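(* Let $N$ be a free $\mathbb Z$-module of finite rank, let $C=(\mathscr C,m)$ be a tropical cycle of pure dimension $n$ in $N_{\mathbb R}=N\otimes_{\mathbb Z}\mathbb R$ with constant weight functions, let $\phi:|\mathscr C|\to\mathbb R$ be a piecewise smooth function on $C$, and let $\delta_{\phi\cdot C}$ be the supercurrent of integration over the corner locus $\phi\cdot C$. Then $$d'd''[\phi]-[d'd''\phi]=\delta_{\phi\cdot C}$$ as supercurrents on $|\mathscr C|$.
   Context: **Polyhedra.** $N$ is free of rank $r$. A polyhedron in $N_{\mathbb R}$ is integral $\mathbb R$-affine if it is a finite intersection of half-spaces $\{\omega:\langle u,\omega\rangle\ge c\}$ with $u\in\mathrm{Hom}(N,\mathbb Z)$, $c\in\mathbb R$. All polyhedral complexes are finite and consist of such polyhedra. For a polyhedron $\sigma$, $\mathbb A_\sigma$ is its affine span, $\mathbb L_\sigma$ the underlying vector space of $\mathbb A_\sigma$, $N_\sigma=N\cap\mathbb L_\sigma$. $\mathscr C_k$ is the set of $k$-dimensional polyhedra of $\mathscr C$, $|\mathscr C|$ the union of all polyhedra of $\mathscr C$. A function on $\sigma$ is smooth if it is the restriction of a smooth function on an open neighbourhood of $\sigma$ in $\mathbb A_\sigma$. **Tropical cycles.** A tropical cycle $C=(\mathscr C,m)$ of dimension $n$ is a polyhedral complex of pure dimension $n$ with smooth weight functions $m_\sigma:\sigma\to\mathbb R$ ($\sigma\in\mathscr C_n$) such that for all $\tau\in\mathscr C_{n-1}$, $\omega\in\tau$ one has $\sum_{\sigma\in\mathscr C_n,\,\sigma\succ\tau}m_\sigma(\omega)\,\omega_{\sigma,\tau}\in\mathbb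 L_\tau$, where $\omega_{\sigma,\tau}\in N_\sigma$ represents the generator of $N_\sigma/N_\tau$ pointing in the direction of $\sigma$. Here the weights of $C$ are constants. Cycles may be replaced by subdivisions with induced weights. **Piecewise smooth functions, corner locus.** $\phi:|\mathscr C|\to\mathbb R$ is piecewise smooth if, after replacing $\mathscr C$ by a subdivision, $\phi|_\sigma=:\phi_\sigma$ is smooth for every $\sigma\in\mathscr C$. Then $\phi\cdot C$ is the tropical cycle of dimension $n-1$ with underlying complex generated by $\mathscr C_{n-1}$ and weights, for $\tau\in\mathscr C_{n-1}$, $\omega\in\tau$, $$m_\tau(\omega)=\Big(\sum_{\sigma\in\mathscr C_n,\sigma\succ\tau}m_\sigma(\omega)\tfrac{\partial\phi_\sigma}{\partial\omega_{\sigma,\tau}}(\omega)\Big)-\tfrac{\partial\phi_\tau}{\partial\omega_\tau}(\omega),\qquad \omega_\tau:=\sum_{\sigma\succ\tau}m_\sigma(\omega)\omega_{\sigma,\tau}\in\mathbb L_\tau .$$ **Superforms and supercurrents.** On an open $\widetilde\Omega\subseteq N_{\mathbb R}$ with linear coordinates $x_1,\dots,x_r$, $A^{p,q}(\widetilde\Omega)=C^\infty(\widetilde\Omega)\otimes\Lambda^pN_{\mathbb R}^*\otimes\Lambda^qN_{\mathbb R}^*$ consists of $\alpha=\sum\alpha_{IJ}\,d'x_I\wedge d''x_J$ (all $d'x_i,d''x_j$ anticommute), with $d'\alpha=\sum\frac{\partial\alpha_{IJ}}{\partial x_i}d'x_i\wedge d'x_I\wedge d''x_J$ and $d''\alpha=\sum\frac{\partial\alpha_{IJ}}{\partial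 x_i}d''x_i\wedge d'x_I\wedge d''x_J$. For a $k$-dimensional polyhedron $\Delta$ and coordinates $x_1,\dots,x_k$ on $\mathbb A_\Delta$ coming from a $\mathbb Z$-basis of $N_\Delta$, $\int_\Delta f\,d'x_1\wedge d''x_1\wedge\dots\wedge d'x_k\wedge d''x_k:=\int_\Delta f\,dx_1\cdots dx_k$. $A^{p,q}(|\mathscr C|)$ is the quotient of $A^{p,q}(N_{\mathbb R})$ identifying superforms with the same restriction to every maximal polyhedron of $\mathscr C$; $A_c^{p,q}$ denotes compact support. Supercurrents in $D_{p,q}(|\mathscr C|)=D^{n-p,n-q}(|\mathscr C|)$ are the linear forms on $A_c^{p,q}(|\mathscr C|)$ whose pull-back to $A_c^{p,q}(N_{\mathbb R})$ is continuous. For $T\in D^{p,q}$, $\langle d'T,\alpha\rangle=(-1)^{p+q+1}\langle T,d'\alpha\rangle$, and likewise for $d''$. **The terms of the formula.** With $\mathscr C$ subdivided so that all $\phi_\sigma$ are smooth: $[\phi](\alpha)=\sum_{\sigma\in\mathscr C_n}m_\sigma\int_\sigma\phi_\sigma\alpha$ for $\alpha\in A_c^{n,n}(|\mathscr C|)$; $[d'd''\phi](\alpha)=\sum_{\sigma\in\mathscr C_n}m_\sigma\int_\sigma d'd''\phi_\sigma\wedge\alpha$ and $\delta_{\phi\cdot C}(\alpha)=\sum_{\tau\in\mathscr C_{n-1}}\int_\tau m_\tau\alpha$ for $\alpha\in A_c^{n-1,n-1}(|\mathscr C|)$ (so $d'd''\phi$ is taken piecewise). *)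

theory Defs
  imports "HOL-Analysis.Analysis"
begin

text \<open>
  A free \<open>\<int>\<close>-module of finite rank is represented as the integral span \<open>N\<close> of an
  \<open>\<real>\<close>-linearly independent list in a Euclidean space, so that \<open>N\<^sub>\<real> = span N\<close>.  The lattice is not
  required to span the ambient type; in this way every rank, including rank 0, is covered.
\<close>

definition lattice_basis :: "'a::euclidean_space set \<Rightarrow> 'a list \<Rightarrow> bool" where
  "lattice_basis M es \<longleftrightarrow> distinct es \<and> independent (set es) \<and>
     M = {(\<Sum>i<length es. of_int (c i) *\<^sub>R es ! i) | c :: nat \<Rightarrow> int. True}"

definition is_lattice :: "'a::euclidean_space set \<Rightarrow> bool" where
  "is_lattice N \<longleftrightarrow> (\<exists>es. lattice_basis N es)"

text \<open>The elements of \<open>Hom(N, \<int>)\<close>, extended linearly.\<close>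

definition dual_lattice :: "'a::euclidean_space set \<Rightarrow> ('a \<Rightarrow> real) set" where
  "dual_lattice N = {u. linear u \<and> (\<forall>x\<in>N. u x \<in> \<int>)}"

text \<open>The vector space \<open>\<bbbL>\<^sub>S\<close> underlying the affine span of \<open>S\<close>, and \<open>N\<^sub>S = N \<inter> \<bbbL>\<^sub>S\<close>.\<close>

definition dirs :: "'a::euclidean_space set \<Rightarrow> 'a set" where
  "dirs S = {x - y | x y. x \<in> affine hull S \<and> y \<in> affine hull S}"

definition lattice_of :: "'a::euclidean_space set \<Rightarrow> 'a set \<Rightarrow> 'a set" where
  "lattice_of N S = N \<inter> dirs S"


text \<open>
  Derivatives are taken within \<open>S\<close>.  When \<open>S\<close> is convex, or relatively open in its affine hull,
  all Frechet derivatives within \<open>S\<close> agree on \<open>dirs S\<close>; only directions \<open>v \<in> dirs S\<close> are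
  ever used.  If \<open>f\<close> is a smooth function on a polyhedron \<open>S\<close>, then at every point of \<open>S\<close> (also on the
  relative boundary) this is the directional derivative of any smooth extension of \<open>f\<close>.
\<close>

definition dirderiv :: "'a::euclidean_space set \<Rightarrow> 'a \<Rightarrow> ('a \<Rightarrow> real) \<Rightarrow> 'a \<Rightarrow> real" where
  "dirderiv S v f = (\<lambda>x. frechet_derivative f (at x within S) v)"

definition iter_dirderiv :: "'a::euclidean_space set \<Rightarrow> 'a list \<Rightarrow> ('a \<Rightarrow> real) \<Rightarrow> 'a \<Rightarrow> real" where
  "iter_dirderiv S vs f = foldr (dirderiv S) vs f"

text \<open>Smoothness on a set \<open>U\<close> that is relatively open in its affine hull.\<close>

definition smooth_open :: "'a::euclidean_space set \<Rightarrow> ('a \<Rightarrow> real) \<Rightarrow> bool" where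
  "smooth_open U f \<longleftrightarrow> (\<forall>vs \<in> lists (dirs U). iter_dirderiv U vs f differentiable_on U)"

definition smooth_on_poly :: "'a::euclidean_space set \<Rightarrow> ('a \<Rightarrow> real) \<Rightarrow> bool" where
  "smooth_on_poly \<sigma> f \<longleftrightarrow>
     (\<exists>U g. openin (top_of_set (affine hull \<sigma>)) U \<and> \<sigma> \<subseteq> U \<and> smooth_open U g \<and> (\<forall>x\<in>\<sigma>. g x = f x))"


definition integral_polyhedron :: "'a::euclidean_space set \<Rightarrow> 'a set \<Rightarrow> bool" where
  "integral_polyhedron N \<sigma> \<longleftrightarrow>
     (\<exists>F :: (('a \<Rightarrow> real) \<times> real) set. finite F \<and> (\<forall>(u, c) \<in> F. u \<in> dual_lattice N) \<and>
        \<sigma> = {\<omega> \<in> span N. \<forall>(u, c) \<in> F. u \<omega> \<ge> c})"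

text \<open>
  The members of a complex are non-empty; since the library counts the empty set as a face,
  it is excluded explicitly.
\<close>

definition polyhedral_complex :: "'a::euclidean_space set \<Rightarrow> 'a set set \<Rightarrow> bool" where
  "polyhedral_complex N \<C> \<longleftrightarrow> finite \<C> \<and>
     (\<forall>\<sigma>\<in>\<C>. \<sigma> \<noteq> {} \<and> integral_polyhedron N \<sigma>) \<and>
     (\<forall>\<sigma>\<in>\<C>. \<forall>\<tau>. \<tau> face_of \<sigma> \<and> \<tau> \<noteq> {} \<longrightarrow> \<tau> \<in> \<C>) \<and>
     (\<forall>\<sigma>\<in>\<C>. \<forall>\<rho>\<in>\<C>. \<sigma> \<inter> \<rho> = {} \<or> (\<sigma> \<inter> \<rho>) face_of \<sigma> \<and> (\<sigma> \<inter> \<rho>) face_of \<rho>)"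

definition cells :: "int \<Rightarrow> 'a::euclidean_space set set \<Rightarrow> 'a set set" where
  "cells k \<C> = {\<sigma>\<in>\<C>. aff_dim \<sigma> = k}"

definition maximal_cells :: "'a set set \<Rightarrow> 'a set set" where
  "maximal_cells \<C> = {\<sigma>\<in>\<C>. \<forall>\<rho>\<in>\<C>. \<sigma> \<subseteq> \<rho> \<longrightarrow> \<rho> = \<sigma>}"

definition pure_dim :: "int \<Rightarrow> 'a::euclidean_space set set \<Rightarrow> bool" where
  "pure_dim n \<C> \<longleftrightarrow> (\<forall>\<sigma>\<in>maximal_cells \<C>. aff_dim \<sigma> = n)"

text \<open>The \<open>\<sigma> \<in> \<C>\<^sub>n\<close> with \<open>\<sigma> \<succ> \<tau>\<close>.\<close>

definition star_cells :: "int \<Rightarrow> 'a::euclidean_space set set \<Rightarrow> 'a set \<Rightarrow> 'a set set" where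
  "star_cells n \<C> \<tau> = {\<sigma>\<in>cells n \<C>. \<tau> face_of \<sigma>}"

text \<open>
  The vector \<open>\<omega>\<^bsub>\<sigma>,\<tau>\<^esub>\<close> for a facet \<open>\<tau>\<close> of \<open>\<sigma>\<close>: a representative in \<open>N\<^sub>\<sigma>\<close> of the generator of
  \<open>N\<^sub>\<sigma> / N\<^sub>\<tau>\<close> that points from \<open>\<tau>\<close> into \<open>\<sigma>\<close>.  It is unique up to adding an element of \<open>N\<^sub>\<tau>\<close>.
\<close>

definition normal_vector :: "'a::euclidean_space set \<Rightarrow> 'a set \<Rightarrow> 'a set \<Rightarrow> 'a" where
  "normal_vector N \<sigma> \<tau> = (SOME w. w \<in> lattice_of N \<sigma> \<and>
     lattice_of N \<sigma> = {u + of_int k *\<^sub>R w | (u :: 'a) (k :: int). u \<in> lattice_of N \<tau>} \<and>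
     (\<exists>a\<in>\<tau>. \<exists>t>0. a + t *\<^sub>R w \<in> \<sigma>))"

definition tropical_cycle ::
    "'a::euclidean_space set \<Rightarrow> int \<Rightarrow> 'a set set \<Rightarrow> ('a set \<Rightarrow> 'a \<Rightarrow> real) \<Rightarrow> bool" where
  "tropical_cycle N n \<C> m \<longleftrightarrow> polyhedral_complex N \<C> \<and> pure_dim n \<C> \<and>
     (\<forall>\<sigma>\<in>cells n \<C>. smooth_on_poly \<sigma> (m \<sigma>)) \<and>
     (\<forall>\<tau>\<in>cells (n - 1) \<C>. \<forall>\<omega>\<in>\<tau>.
        (\<Sum>\<sigma>\<in>star_cells n \<C> \<tau>. m \<sigma> \<omega> *\<^sub>R normal_vector N \<sigma> \<tau>) \<in> dirs \<tau>)"

definition subdivision :: "'a::euclidean_space set \<Rightarrow> 'a set set \<Rightarrow> 'a set set \<Rightarrow> bool" where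
  "subdivision N \<C>' \<C> \<longleftrightarrow> polyhedral_complex N \<C>' \<and> \<Union>\<C>' = \<Union>\<C> \<and> (\<forall>\<sigma>'\<in>\<C>'. \<exists>\<sigma>\<in>\<C>. \<sigma>' \<subseteq> \<sigma>)"

definition induced_weights ::
    "int \<Rightarrow> 'a::euclidean_space set set \<Rightarrow> ('a set \<Rightarrow> 'w) \<Rightarrow> 'a set \<Rightarrow> 'w" where
  "induced_weights n \<C> m \<sigma>' = m (THE \<sigma>. \<sigma> \<in> cells n \<C> \<and> \<sigma>' \<subseteq> \<sigma>)"

definition smooth_on_cells :: "'a::euclidean_space set set \<Rightarrow> ('a \<Rightarrow> real) \<Rightarrow> bool" where
  "smooth_on_cells \<C> \<phi> \<longleftrightarrow> (\<forall>\<sigma>\<in>\<C>. smooth_on_poly \<sigma> \<phi>)"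

definition piecewise_smooth :: "'a::euclidean_space set \<Rightarrow> 'a set set \<Rightarrow> ('a \<Rightarrow> real) \<Rightarrow> bool" where
  "piecewise_smooth N \<C> \<phi> \<longleftrightarrow> (\<exists>\<C>'. subdivision N \<C>' \<C> \<and> smooth_on_cells \<C>' \<phi>)"

text \<open>
  The corner locus \<open>\<phi> \<cdot> C\<close> of a function that is smooth on all polyhedra of \<open>\<C>\<close>: the complex generated
  by \<open>\<C>\<^bsub>n-1\<^esub>\<close> and its weight functions.
\<close>

definition corner_complex :: "int \<Rightarrow> 'a::euclidean_space set set \<Rightarrow> 'a set set" where
  "corner_complex n \<C> = {\<rho>\<in>\<C>. \<exists>\<tau>\<in>cells (n - 1) \<C>. \<rho> face_of \<tau>}"

definition corner_weight ::
    "'a::euclidean_space set \<Rightarrow> int \<Rightarrow> 'a set set \<Rightarrow> ('a set \<Rightarrow> 'a \<Rightarrow> real) \<Rightarrow> ('a \<Rightarrow> real) \<Rightarrow>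
     'a set \<Rightarrow> 'a \<Rightarrow> real" where
  "corner_weight N n \<C> m \<phi> \<tau> \<omega> =
     (\<Sum>\<sigma>\<in>star_cells n \<C> \<tau>. m \<sigma> \<omega> * dirderiv \<sigma> (normal_vector N \<sigma> \<tau>) \<phi> \<omega>)
     - dirderiv \<tau> (\<Sum>\<sigma>\<in>star_cells n \<C> \<tau>. m \<sigma> \<omega> *\<^sub>R normal_vector N \<sigma> \<tau>) \<phi> \<omega>"


text \<open>
  An element of \<open>\<Lambda>\<^sup>pV\<^sup>* \<otimes> \<Lambda>\<^sup>qV\<^sup>*\<close> is identified with a function of two lists of vectors, of lengths
  \<open>p\<close> and \<open>q\<close>, that is alternating multilinear in each of them; the normalisation is
  \<open>(d'x\<^sub>I \<and> d''x\<^sub>J)(v; w) = det (x\<^sub>i(v\<^sub>k)) det (x\<^sub>j(w\<^sub>l))\<close>.  On lists of any other lengths the form is zero.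
  Bidegrees are integers, so the space of superforms is zero in negative bidegrees.
\<close>

type_synonym 'a superform = "'a \<Rightarrow> 'a list \<Rightarrow> 'a list \<Rightarrow> real"

definition alt_multilinear :: "'a::euclidean_space set \<Rightarrow> ('a list \<Rightarrow> real) \<Rightarrow> bool" where
  "alt_multilinear V f \<longleftrightarrow> (\<forall>v\<in>lists V. \<forall>i<length v.
     (\<forall>a\<in>V. \<forall>b\<in>V. \<forall>s t. f (v[i := s *\<^sub>R a + t *\<^sub>R b]) = s * f (v[i := a]) + t * f (v[i := b])) \<and>
     (\<forall>j<i. v ! i = v ! j \<longrightarrow> f v = 0))"

text \<open>The space \<open>A\<^sup>p\<^sup>,\<^sup>q(N\<^sub>\<real>)\<close>; values off \<open>N\<^sub>\<real> = span N\<close> are irrelevant.\<close>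

definition superforms :: "'a::euclidean_space set \<Rightarrow> int \<Rightarrow> int \<Rightarrow> 'a superform set" where
  "superforms N p q = {\<alpha>.
     (\<forall>x\<in>span N. \<forall>v\<in>lists (span N). \<forall>w\<in>lists (span N).
        alt_multilinear (span N) (\<lambda>v. \<alpha> x v w) \<and> alt_multilinear (span N) (\<lambda>w. \<alpha> x v w) \<and>
        (\<not> (int (length v) = p \<and> int (length w) = q) \<longrightarrow> \<alpha> x v w = 0)) \<and>
     (\<forall>v\<in>lists (span N). \<forall>w\<in>lists (span N). smooth_open (span N) (\<lambda>x. \<alpha> x v w))}"

text \<open>
  The differentials on \<open>S\<close>, where \<open>S\<close> is \<open>N\<^sub>\<real>\<close> or a polyhedron.  The sign \<open>(-1) ^ length v\<close> in \<open>d''\<close>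
  comes from moving \<open>d''x\<^sub>i\<close> past \<open>d'x\<^sub>I\<close>.
\<close>

definition omit :: "nat \<Rightarrow> 'b list \<Rightarrow> 'b list" where
  "omit i v = take i v @ drop (Suc i) v"

definition d' :: "'a::euclidean_space set \<Rightarrow> 'a superform \<Rightarrow> 'a superform" where
  "d' S \<alpha> = (\<lambda>x v w. \<Sum>i<length v. (-1) ^ i * dirderiv S (v ! i) (\<lambda>y. \<alpha> y (omit i v) w) x)"

definition d'' :: "'a::euclidean_space set \<Rightarrow> 'a superform \<Rightarrow> 'a superform" where
  "d'' S \<alpha> = (\<lambda>x v w. (-1) ^ length v *
     (\<Sum>j<length w. (-1) ^ j * dirderiv S (w ! j) (\<lambda>y. \<alpha> y v (omit j w)) x))"

definition form0 :: "('a \<Rightarrow> real) \<Rightarrow> 'a superform" where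
  "form0 f = (\<lambda>x v w. if v = [] \<and> w = [] then f x else 0)"

text \<open>
  The wedge product as a sum over shuffles: \<open>I\<close> and \<open>J\<close> are the positions of the vectors that are fed
  to \<open>\<alpha>\<close>.  Only \<open>I\<close>, \<open>J\<close> of the sizes given by the bidegree of \<open>\<alpha>\<close> contribute.  The last sign comes
  from moving the \<open>d'\<close>-part of \<open>\<beta>\<close> past the \<open>d''\<close>-part of \<open>\<alpha>\<close>.
\<close>

definition shuffle_sign :: "nat \<Rightarrow> nat set \<Rightarrow> real" where
  "shuffle_sign k I = (-1) ^ card {(i, j). i < j \<and> j < k \<and> j \<in> I \<and> i \<notin> I}"

definition wedge :: "'a superform \<Rightarrow> 'a superform \<Rightarrow> 'a superform" where
  "wedge \<alpha> \<beta> = (\<lambda>x v w. \<Sum>I\<in>Pow {..<length v}. \<Sum>J\<in>Pow {..<length w}.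
     shuffle_sign (length v) I * shuffle_sign (length w) J * (-1) ^ (card J * (length v - card I)) *
     \<alpha> x (nths v I) (nths w J) * \<beta> x (nths v (- I)) (nths w (- J)))"

definition scale_form :: "('a \<Rightarrow> real) \<Rightarrow> 'a superform \<Rightarrow> 'a superform" where
  "scale_form f \<alpha> = (\<lambda>x v w. f x * \<alpha> x v w)"

text \<open>
  The integral of a \<open>(k,k)\<close>-superform over a \<open>k\<close>-dimensional polyhedron, computed in the coordinates
  of a \<open>\<int>\<close>-basis \<open>es\<close> of \<open>N\<^sub>\<sigma>\<close> and an origin \<open>a\<close> of the affine span; it depends on neither choice.
  The sign is that of \<open>d'x\<^sub>1 \<and> d''x\<^sub>1 \<and> \<dots> \<and> d'x\<^sub>k \<and> d''x\<^sub>k\<close> relative to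
  \<open>d'x\<^sub>1 \<and> \<dots> \<and> d'x\<^sub>k \<and> d''x\<^sub>1 \<and> \<dots> \<and> d''x\<^sub>k\<close>.
\<close>

definition integral_form :: "'a::euclidean_space set \<Rightarrow> 'a set \<Rightarrow> 'a superform \<Rightarrow> real" where
  "integral_form N \<sigma> \<alpha> =
     (let es = (SOME es. lattice_basis (lattice_of N \<sigma>) es);
          a = (SOME a. a \<in> affine hull \<sigma>);
          k = length es;
          P = (\<lambda>y. a + (\<Sum>i<k. y i *\<^sub>R es ! i))
      in (-1) ^ (k * (k - 1) div 2) *
         (LINT y : {y. P y \<in> \<sigma>} | Pi\<^sub>M {..<k} (\<lambda>_. lborel). \<alpha> (P y) es es))"


text \<open>
  Superforms on \<open>|\<C>|\<close> are represented by superforms on \<open>N\<^sub>\<real>\<close>, two of which represent the same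
  element iff they have the same restriction to all maximal polyhedra.  Compactness of the support
  is required only for the restriction, so that \<open>test_forms\<close> contains all representatives of
  elements of \<open>A\<^sub>c\<^sup>p\<^sup>,\<^sup>q(|\<C>|)\<close>.
\<close>

definition same_restriction :: "'a::euclidean_space set set \<Rightarrow> 'a superform \<Rightarrow> 'a superform \<Rightarrow> bool" where
  "same_restriction \<C> \<alpha> \<beta> \<longleftrightarrow> (\<forall>\<sigma>\<in>maximal_cells \<C>. \<forall>x\<in>\<sigma>.
     \<forall>v\<in>lists (dirs \<sigma>). \<forall>w\<in>lists (dirs \<sigma>). \<alpha> x v w = \<beta> x v w)"

definition test_forms :: "'a::euclidean_space set \<Rightarrow> 'a set set \<Rightarrow> int \<Rightarrow> int \<Rightarrow> 'a superform set" where
  "test_forms N \<C> p q = {\<alpha>\<in>superforms N p q.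
     \<exists>K. compact K \<and> (\<forall>\<sigma>\<in>maximal_cells \<C>. \<forall>x\<in>\<sigma> - K.
       \<forall>v\<in>lists (dirs \<sigma>). \<forall>w\<in>lists (dirs \<sigma>). \<alpha> x v w = 0)}"

text \<open>
  Convergence to 0 in the space \<open>A\<^sub>c\<^sup>p\<^sup>,\<^sup>q(N\<^sub>\<real>)\<close>: the supports lie in a common compact set and all
  derivatives of all coefficients converge uniformly.  For linear forms on this (LF-)space continuity and
  sequential continuity at 0 coincide.
\<close>

definition forms_tend_to_0 ::
    "'a::euclidean_space set \<Rightarrow> int \<Rightarrow> int \<Rightarrow> (nat \<Rightarrow> 'a superform) \<Rightarrow> bool" where
  "forms_tend_to_0 N p q A \<longleftrightarrow> (\<forall>j. A j \<in> superforms N p q) \<and>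
     (\<exists>K. compact K \<and> (\<forall>j. \<forall>x\<in>span N - K. \<forall>v\<in>lists (span N). \<forall>w\<in>lists (span N). A j x v w = 0)) \<and>
     (\<forall>us\<in>lists (span N). \<forall>v\<in>lists (span N). \<forall>w\<in>lists (span N).
        uniform_limit (span N) (\<lambda>j. iter_dirderiv (span N) us (\<lambda>x. A j x v w)) (\<lambda>_. 0) sequentially)"

text \<open>
  \<open>D\<^bsub>p,q\<^esub>(|\<C>|)\<close>: a linear form on the quotient \<open>A\<^sub>c\<^sup>p\<^sup>,\<^sup>q(|\<C>|)\<close> is a linear form on representatives
  that is constant on equivalence classes.
\<close>

definition supercurrents ::
    "'a::euclidean_space set \<Rightarrow> 'a set set \<Rightarrow> int \<Rightarrow> int \<Rightarrow> ('a superform \<Rightarrow> real) set" where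
  "supercurrents N \<C> p q = {T.
     (\<forall>\<alpha>\<in>test_forms N \<C> p q. \<forall>\<beta>\<in>test_forms N \<C> p q.
        (\<forall>s t. T (\<lambda>x v w. s * \<alpha> x v w + t * \<beta> x v w) = s * T \<alpha> + t * T \<beta>) \<and>
        (same_restriction \<C> \<alpha> \<beta> \<longrightarrow> T \<alpha> = T \<beta>)) \<and>
     (\<forall>A. forms_tend_to_0 N p q A \<longrightarrow> (\<lambda>j. T (A j)) \<longlonglongrightarrow> 0)}"

text \<open>The sign depends on the upper bidegree: here \<open>T \<in> D\<^sup>p\<^sup>,\<^sup>q(|\<C>|) = D\<^bsub>n-p,n-q\<^esub>(|\<C>|)\<close>.\<close>

definition current_d' ::
    "'a::euclidean_space set \<Rightarrow> nat \<Rightarrow> nat \<Rightarrow> ('a superform \<Rightarrow> real) \<Rightarrow> 'a superform \<Rightarrow> real" where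
  "current_d' N p q T \<alpha> = (-1) ^ (p + q + 1) * T (d' (span N) \<alpha>)"

definition current_d'' ::
    "'a::euclidean_space set \<Rightarrow> nat \<Rightarrow> nat \<Rightarrow> ('a superform \<Rightarrow> real) \<Rightarrow> 'a superform \<Rightarrow> real" where
  "current_d'' N p q T \<alpha> = (-1) ^ (p + q + 1) * T (d'' (span N) \<alpha>)"

definition current_fun ::
    "'a::euclidean_space set \<Rightarrow> int \<Rightarrow> 'a set set \<Rightarrow> ('a set \<Rightarrow> real) \<Rightarrow> ('a \<Rightarrow> real) \<Rightarrow>
     'a superform \<Rightarrow> real" where
  "current_fun N n \<C> m \<phi> \<alpha> = (\<Sum>\<sigma>\<in>cells n \<C>. m \<sigma> * integral_form N \<sigma> (scale_form \<phi> \<alpha>))"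

definition current_piecewise_d'd'' ::
    "'a::euclidean_space set \<Rightarrow> int \<Rightarrow> 'a set set \<Rightarrow> ('a set \<Rightarrow> real) \<Rightarrow> ('a \<Rightarrow> real) \<Rightarrow>
     'a superform \<Rightarrow> real" where
  "current_piecewise_d'd'' N n \<C> m \<phi> \<alpha> =
     (\<Sum>\<sigma>\<in>cells n \<C>. m \<sigma> * integral_form N \<sigma> (wedge (d' \<sigma> (d'' \<sigma> (form0 \<phi>))) \<alpha>))"

definition current_delta ::
    "'a::euclidean_space set \<Rightarrow> int \<Rightarrow> 'a set set \<Rightarrow> ('a set \<Rightarrow> 'a \<Rightarrow> real) \<Rightarrow>
     'a superform \<Rightarrow> real" where
  "current_delta N k \<D> m \<alpha> = (\<Sum>\<tau>\<in>cells k \<D>. integral_form N \<tau> (scale_form (m \<tau>) \<alpha>))"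

end

theory Submission
  imports Defs
begin

text \<open>
  On each \<open>n\<close>-dimensional polyhedron \<open>\<sigma>\<close> of the subdivision
  \<open>\<phi> d'd''\<alpha> - d'd''\<phi> \<and> \<alpha> = - d''(\<phi> d'\<alpha>) - d'(d''\<phi> \<and> \<alpha>)\<close>, so the left-hand side is a sum of
  boundary integrals over the facets \<open>\<tau>\<close>.  Stokes' theorem for superforms reduces to
  \<open>\<integral>\<^sub>\<sigma> \<partial>\<^sub>vf = - \<Sum>\<^sub>\<tau> \<lambda>\<^sub>\<tau>(v) \<integral>\<^sub>\<tau> f\<close> for constant \<open>v \<in> \<bbbL>\<^sub>\<sigma>\<close>, where \<open>\<lambda>\<^sub>\<tau>\<close> is the linear form on \<open>\<bbbL>\<^sub>\<sigma>\<close> that vanishes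
  on \<open>\<bbbL>\<^sub>\<tau>\<close> and is 1 on the lattice normal vector; this follows from Fubini and the fundamental
  theorem of calculus on the lines in direction \<open>v\<close>.  In the sum over all \<open>\<sigma> \<succ> \<tau>\<close> the normal vectors
  combine to \<open>\<omega>\<^sub>\<tau> \<in> \<bbbL>\<^sub>\<tau>\<close>, since balancing passes to the subdivision.  An alternating \<open>n\<close>-form
  vanishes on \<open>\<bbbL>\<^sub>\<tau>\<close>, so the first boundary term cancels, and the second one leaves the weight of the
  corner locus times \<open>\<alpha>\<close>.
\<close>

subsection \<open>Volumes in linear coordinates\<close>

text \<open>The lattice need not span the ambient type, and polyhedra of several dimensions
  interact, so volumes cannot be read off from Lebesgue measure of the type. They are push-forwards
  of product measures along a basis. Two bases are compared by elementary operations, not by a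
  determinant formula: one chain of operations gives the factor d for alternating forms together
  with |d| for volumes. For two bases of the same lattice |d| = 1. A superform of bidegree (n,n) is
  evaluated on the same basis in both slots, so d enters as d * d = 1 and its sign, the orientation,
  disappears. This is what lets boundary terms pass from the chosen basis of \<sigma> to a basis of
  \<tau> extended by the normal vector. The factor \<lambda>(v) in the divergence theorem has the
  same origin: projection along v onto the hyperplane of \<tau> rescales the volume transversal to v
  by |\<lambda>(v)|, because v and \<lambda>(v) w differ by a vector parallel to \<tau>. Lines that
  meet a face of codimension at least 2, or a proper face parallel to v, would spoil the count of
  end points; they form a null set.\<close>

abbreviation lebn :: "nat set \<Rightarrow> (nat \<Rightarrow> real) measure" where
  "lebn I \<equiv> Pi\<^sub>M I (\<lambda>_. lborel)"

definition param :: "'a::euclidean_space list \<Rightarrow> 'a \<Rightarrow> (nat \<Rightarrow> real) \<Rightarrow> 'a" where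
  "param bs a y = a + (\<Sum>i<length bs. y i *\<^sub>R bs ! i)"

text \<open>Lebesgue measure on the affine space through \<open>a\<close> in the coordinates of
  \<open>bs\<close>, pushed to the ambient type. Different bases, origins and dimensions thus give
  measures on one sigma-algebra, which can be compared by equations.\<close>

definition vol :: "'a::euclidean_space list \<Rightarrow> 'a \<Rightarrow> 'a measure" where
  "vol bs a = distr (lebn {..<length bs}) borel (param bs a)"

lemma param_measurable [measurable]:
  "length bs = n \<Longrightarrow> param bs a \<in> borel_measurable (lebn {..<n})"
  unfolding param_def by measurable

lemma sets_vol [simp, measurable_cong]: "sets (vol bs a) = sets borel"
  by (simp add: vol_def)

lemma space_vol [simp]: "space (vol bs a) = UNIV"
  by (simp add: vol_def)

lemma nn_integral_vol:
  assumes [measurable]: "h \<in> borel_measurable borel"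
  shows "nn_integral (vol bs a) h = (\<integral>\<^sup>+y. h (param bs a y) \<partial>lebn {..<length bs})"
  unfolding vol_def by (rule nn_integral_distr) auto

lemma param_upd:
  assumes "i < length bs"
  shows "param bs a (y(i := t)) = a + (\<Sum>j\<in>{..<length bs} - {i}. y j *\<^sub>R bs ! j) + t *\<^sub>R bs ! i"
proof -
  have "param bs a (y(i := t)) = a + (t *\<^sub>R bs ! i + (\<Sum>j\<in>{..<length bs} - {i}. (y(i := t)) j *\<^sub>R bs ! j))"
    using assms unfolding param_def by (subst sum.remove[of _ i]) (auto simp del: fun_upd_apply simp: fun_upd_same)
  also have "(\<Sum>j\<in>{..<length bs} - {i}. (y(i := t)) j *\<^sub>R bs ! j) = (\<Sum>j\<in>{..<length bs} - {i}. y j *\<^sub>R bs ! j)"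
    by (rule sum.cong) auto
  finally show ?thesis by (simp add: algebra_simps del: fun_upd_apply)
qed

text \<open>Tonelli with the i-th coordinate innermost. Every change of basis below is reduced by it
  to a substitution in one real variable.\<close>

lemma nn_integral_vol_coord:
  assumes i: "i < length bs" and [measurable]: "h \<in> borel_measurable borel"
  shows "nn_integral (vol bs a) h =
    (\<integral>\<^sup>+y. (\<integral>\<^sup>+t. h (a + (\<Sum>j\<in>{..<length bs} - {i}. y j *\<^sub>R bs ! j) + t *\<^sub>R bs ! i) \<partial>lborel)
      \<partial>lebn ({..<length bs} - {i}))"
proof -
  interpret product_sigma_finite "\<lambda>_::nat. lborel :: real measure"
    by standard
  have I: "{..<length bs} = insert i ({..<length bs} - {i})" using i by auto
  have m: "(\<lambda>y. h (param bs a y)) \<in> borel_measurable (lebn {..<length bs})"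
    by measurable
  have "nn_integral (vol bs a) h = (\<integral>\<^sup>+y. h (param bs a y) \<partial>lebn {..<length bs})"
    by (rule nn_integral_vol) simp
  also have "\<dots> = (\<integral>\<^sup>+y. h (param bs a y) \<partial>lebn (insert i ({..<length bs} - {i})))"
    using I by simp
  also have "\<dots> = (\<integral>\<^sup>+y. (\<integral>\<^sup>+t. h (param bs a (y(i := t))) \<partial>lborel) \<partial>lebn ({..<length bs} - {i}))"
    by (rule product_nn_integral_insert) (use m I in auto)
  finally show ?thesis by (simp only: param_upd[OF i])
qed

lemma measure_eqI_nn:
  fixes M M' :: "'a::euclidean_space measure"
  assumes "sets M = sets borel" "sets M' = sets borel"
    and "\<And>h :: 'a \<Rightarrow> ennreal. h \<in> borel_measurable borel \<Longrightarrow> nn_integral M h = nn_integral M' h"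
  shows "M = M'"
proof (rule measure_eqI)
  fix A assume A: "A \<in> sets M"
  hence "nn_integral M (indicator A) = nn_integral M' (indicator A)"
    using assms(1) by (intro assms(3)) simp
  moreover have "A \<in> sets M'" using A assms by simp
  ultimately show "emeasure M A = emeasure M' A" using A by simp
qed (use assms in simp)

section \<open>Change of basis by elementary operations\<close>

lemma nn_integral_lborel_scale:
  assumes "c \<noteq> 0" and [measurable]: "f \<in> borel_measurable borel"
  shows "(\<integral>\<^sup>+t. f t \<partial>lborel) = ennreal \<bar>c\<bar> * (\<integral>\<^sup>+t. f (t * c + s) \<partial>lborel)"
  using nn_integral_real_affine[of f c s] assms by (simp add: algebra_simps)

text \<open>For bases of \<open>L\<close>, \<open>d\<close> is the determinant of \<open>cs\<close> with respect to \<open>bs\<close>.\<close>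

definition rescale :: "'a::euclidean_space set \<Rightarrow> 'a list \<Rightarrow> 'a list \<Rightarrow> real \<Rightarrow> bool" where
  "rescale L bs cs d \<longleftrightarrow> d \<noteq> 0 \<and> length cs = length bs \<and> set bs \<subseteq> L \<and> set cs \<subseteq> L \<and>
     span (set cs) = span (set bs) \<and> (\<forall>\<eta>. alt_multilinear L \<eta> \<longrightarrow> \<eta> cs = d * \<eta> bs) \<and>
     (\<forall>a. vol bs a = scale_measure (ennreal \<bar>d\<bar>) (vol cs a))"

lemma rescale_refl: "set bs \<subseteq> L \<Longrightarrow> rescale L bs bs 1"
  by (simp add: rescale_def)

lemma rescale_trans:
  assumes "rescale L bs cs d" "rescale L cs ds e"
  shows "rescale L bs ds (d * e)"
  using assms unfolding rescale_def
  by (auto simp: abs_mult ennreal_mult'' mult.commute mult.left_commute)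

lemma alt_lin:
  assumes "alt_multilinear L \<eta>" "set v \<subseteq> L" "i < length v" "a \<in> L" "b \<in> L"
  shows "\<eta> (v[i := s *\<^sub>R a + t *\<^sub>R b]) = s * \<eta> (v[i := a]) + t * \<eta> (v[i := b])"
  using assms unfolding alt_multilinear_def lists_eq_set by blast

lemma alt_eq:
  assumes "alt_multilinear L \<eta>" "set v \<subseteq> L" "i < length v" "j < length v" "i \<noteq> j" "v ! i = v ! j"
  shows "\<eta> v = 0"
  using assms unfolding alt_multilinear_def lists_eq_set
  by (metis (mono_tags, lifting) linorder_neqE_nat mem_Collect_eq)

lemma span_update:
  assumes "i < length bs" "x \<in> span (set bs)" "bs ! i \<in> span (set (bs[i := x]))"
  shows "span (set (bs[i := x])) = span (set bs)"
proof -
  have "set (bs[i := x]) \<subseteq> span (set bs)"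
    using set_update_subset_insert[of bs i x] assms(2) span_superset[of "set bs"] by blast
  moreover have "bs ! k \<in> span (set (bs[i := x]))" if "k < length bs" for k
  proof (cases "k = i")
    case False
    hence "bs ! k = bs[i := x] ! k" by simp
    also have "\<dots> \<in> set (bs[i := x])" using that by (intro nth_mem) simp
    finally show ?thesis by (rule span_base)
  qed (use assms in simp)
  hence "set bs \<subseteq> span (set (bs[i := x]))" by (metis in_set_conv_nth subsetI)
  ultimately show ?thesis by (simp add: span_eq)
qed

lemma rescale_scale:
  assumes L: "subspace L" "set bs \<subseteq> L" and i: "i < length bs" and c: "c \<noteq> 0"
  shows "rescale L bs (bs[i := c *\<^sub>R bs ! i]) c"
  unfolding rescale_def
proof (intro conjI allI impI)
  let ?cs = "bs[i := c *\<^sub>R bs ! i]"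
  have bi: "bs ! i \<in> L" using L i nth_mem by blast
  show "set ?cs \<subseteq> L"
    using L bi i by (meson insert_subset order_trans set_update_subset_insert subspace_scale)
  show "span (set ?cs) = span (set bs)"
  proof (rule span_update)
    have "c *\<^sub>R bs ! i \<in> set ?cs" using i by (simp add: set_update_memI)
    hence "(1/c) *\<^sub>R c *\<^sub>R bs ! i \<in> span (set ?cs)" by (intro span_scale span_base)
    thus "bs ! i \<in> span (set ?cs)" using c by simp
  qed (use i in \<open>simp_all add: span_scale span_base\<close>)
  show "\<eta> ?cs = c * \<eta> bs" if "alt_multilinear L \<eta>" for \<eta>
    using alt_lin[OF that L(2) i bi bi, of c 0] by simp
  fix a
  show "vol bs a = scale_measure (ennreal \<bar>c\<bar>) (vol ?cs a)"
  proof (rule measure_eqI_nn)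
    fix h :: "'a \<Rightarrow> ennreal" assume [measurable]: "h \<in> borel_measurable borel"
    let ?S = "\<lambda>y. a + (\<Sum>j\<in>{..<length bs} - {i}. y j *\<^sub>R bs ! j)"
    have S: "a + (\<Sum>j\<in>{..<length bs} - {i}. y j *\<^sub>R ?cs ! j) = ?S y" for y
      by (auto intro!: sum.cong)
    have "nn_integral (scale_measure (ennreal \<bar>c\<bar>) (vol ?cs a)) h = ennreal \<bar>c\<bar> * nn_integral (vol ?cs a) h"
      by (rule nn_integral_scale_measure) simp
    also have "\<dots> = ennreal \<bar>c\<bar> * (\<integral>\<^sup>+y. (\<integral>\<^sup>+t. h (?S y + t *\<^sub>R c *\<^sub>R bs ! i) \<partial>lborel) \<partial>lebn ({..<length bs} - {i}))"
      using i by (subst nn_integral_vol_coord[where i=i]) (simp_all add: S)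
    also have "\<dots> = (\<integral>\<^sup>+y. ennreal \<bar>c\<bar> * (\<integral>\<^sup>+t. h (?S y + t *\<^sub>R c *\<^sub>R bs ! i) \<partial>lborel) \<partial>lebn ({..<length bs} - {i}))"
    proof (rule nn_integral_cmult[symmetric])
      have "(\<lambda>y. \<integral>\<^sup>+t. h (?S y + t *\<^sub>R c *\<^sub>R bs ! i) \<partial>lborel) \<in> borel_measurable (lebn ({..<length bs} - {i}))"
        by measurable
      thus "(\<lambda>y. \<integral>\<^sup>+t. h (?S y + t *\<^sub>R c *\<^sub>R bs ! i) \<partial>lborel) \<in> borel_measurable (lebn ({..<length bs} - {i}))" .
    qed
    also have "\<dots> = (\<integral>\<^sup>+y. (\<integral>\<^sup>+t. h (?S y + t *\<^sub>R bs ! i) \<partial>lborel) \<partial>lebn ({..<length bs} - {i}))"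
      by (intro nn_integral_cong, subst nn_integral_lborel_scale[where c=c and s=0, OF c]) simp_all
    also have "\<dots> = nn_integral (vol bs a) h"
      using i by (subst nn_integral_vol_coord[where i=i]) simp_all
    finally show "nn_integral (vol bs a) h = nn_integral (scale_measure (ennreal \<bar>c\<bar>) (vol ?cs a)) h" ..
  qed simp_all
qed (use assms in simp_all)

text \<open>With the j-th coordinate integrated first, the shear only shifts the line in direction
  \<open>bs ! j\<close> by \<open>y i * s\<close>, which Lebesgue measure does not see. For an
  alternating form, the added term has a repeated entry.\<close>

lemma rescale_shear:
  assumes L: "subspace L" "set bs \<subseteq> L" and ij: "i < length bs" "j < length bs" "i \<noteq> j"
  shows "rescale L bs (bs[i := bs ! i + s *\<^sub>R bs ! j]) 1"
  unfolding rescale_def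
proof (intro conjI allI impI)
  let ?cs = "bs[i := bs ! i + s *\<^sub>R bs ! j]"
  have bi: "bs ! i \<in> L" "bs ! j \<in> L" using L ij nth_mem by blast+
  show "set ?cs \<subseteq> L"
    using L bi by (meson insert_subset order_trans set_update_subset_insert subspace_scale subspace_add)
  show "span (set ?cs) = span (set bs)"
  proof (rule span_update)
    have "bs ! i + s *\<^sub>R bs ! j \<in> set ?cs" using ij by (simp add: set_update_memI)
    moreover have "?cs ! j \<in> set ?cs" using ij by (intro nth_mem) simp
    hence "bs ! j \<in> set ?cs" using ij by simp
    ultimately have "(bs ! i + s *\<^sub>R bs ! j) - s *\<^sub>R bs ! j \<in> span (set ?cs)"
      by (intro span_diff span_scale span_base)
    thus "bs ! i \<in> span (set ?cs)" by simp
  qed (use ij in \<open>simp_all add: span_add span_scale span_base\<close>)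
  show "\<eta> ?cs = 1 * \<eta> bs" if "alt_multilinear L \<eta>" for \<eta>
  proof -
    have "set (bs[i := bs ! j]) \<subseteq> L"
      using L bi by (meson insert_subset order_trans set_update_subset_insert)
    hence "\<eta> (bs[i := bs ! j]) = 0"
      by (intro alt_eq[OF that, of _ i j]) (use ij in auto)
    thus ?thesis using alt_lin[OF that L(2) ij(1) bi, of 1 s] by simp
  qed
  fix a
  have "vol bs a = vol ?cs a"
  proof (rule measure_eqI_nn)
    fix h :: "'a \<Rightarrow> ennreal" assume [measurable]: "h \<in> borel_measurable borel"
    let ?S = "\<lambda>y. a + (\<Sum>k\<in>{..<length bs} - {j}. y k *\<^sub>R bs ! k)"
    have S: "a + (\<Sum>k\<in>{..<length bs} - {j}. y k *\<^sub>R ?cs ! k) = ?S y + (y i * s) *\<^sub>R bs ! j" for y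
    proof -
      have i: "i \<in> {..<length bs} - {j}" using ij by auto
      have "(\<Sum>k\<in>{..<length bs} - {j} - {i}. y k *\<^sub>R ?cs ! k) = (\<Sum>k\<in>{..<length bs} - {j} - {i}. y k *\<^sub>R bs ! k)"
        by (auto intro!: sum.cong)
      thus ?thesis
        using ij by (simp add: sum.remove[OF _ i] algebra_simps)
    qed
    have "nn_integral (vol ?cs a) h =
       (\<integral>\<^sup>+y. (\<integral>\<^sup>+t. h (?S y + (y i * s) *\<^sub>R bs ! j + t *\<^sub>R bs ! j) \<partial>lborel) \<partial>lebn ({..<length bs} - {j}))"
      using ij by (subst nn_integral_vol_coord[where i=j]) (simp_all only: S length_list_update, simp_all)
    also have "\<dots> = (\<integral>\<^sup>+y. (\<integral>\<^sup>+t. h (?S y + t *\<^sub>R bs ! j) \<partial>lborel) \<partial>lebn ({..<length bs} - {j}))"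
    proof (rule nn_integral_cong)
      fix y :: "nat \<Rightarrow> real"
      show "(\<integral>\<^sup>+t. h (?S y + (y i * s) *\<^sub>R bs ! j + t *\<^sub>R bs ! j) \<partial>lborel) = (\<integral>\<^sup>+t. h (?S y + t *\<^sub>R bs ! j) \<partial>lborel)"
        by (subst (2) nn_integral_lborel_scale[where c=1 and s="y i * s"]) (simp_all add: algebra_simps)
    qed
    also have "\<dots> = nn_integral (vol bs a) h"
      using ij by (subst nn_integral_vol_coord[where i=j]) simp_all
    finally show "nn_integral (vol bs a) h = nn_integral (vol ?cs a) h" ..
  qed simp_all
  thus "vol bs a = scale_measure (ennreal \<bar>1\<bar>) (vol ?cs a)" by simp
qed (use assms in simp_all)

lemma rescale_replace:
  assumes L: "subspace L" "set bs \<subseteq> L" and i: "i < length bs" and c: "c \<noteq> 0"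
    and J: "finite J" "J \<subseteq> {..<length bs} - {i}"
  shows "rescale L bs (bs[i := c *\<^sub>R bs ! i + (\<Sum>j\<in>J. s j *\<^sub>R bs ! j)]) c"
  using J
proof (induction J rule: finite_induct)
  case empty
  then show ?case using rescale_scale[OF L i c] by simp
next
  case (insert k J)
  let ?x = "c *\<^sub>R bs ! i + (\<Sum>j\<in>J. s j *\<^sub>R bs ! j)"
  let ?cs = "bs[i := ?x]"
  have r: "rescale L bs ?cs c" using insert by simp
  hence "set ?cs \<subseteq> L" by (simp add: rescale_def)
  from rescale_shear[OF L(1) this, of i k "s k"] insert.prems i
  have "rescale L ?cs (?cs[i := ?x + s k *\<^sub>R bs ! k]) 1" by auto
  from rescale_trans[OF r this] show ?case
    using insert.hyps by (simp add: algebra_simps)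
qed

text \<open>A swap is composed of shears and one sign change: (a, b), (a+b, b), (a+b, -a), (b, -a),
  (b, a). The sign change accounts for the factor -1.\<close>

lemma rescale_swap:
  assumes L: "subspace L" "set bs \<subseteq> L" and ij: "i < length bs" "j < length bs" "i \<noteq> j"
  shows "rescale L bs (bs[i := bs ! j, j := bs ! i]) (-1)"
proof -
  let ?a = "bs ! i" and ?b = "bs ! j"
  define c1 where "c1 = bs[i := ?a + ?b]"
  define c2 where "c2 = c1[j := - ?a]"
  define c3 where "c3 = c2[i := ?b]"
  define c4 where "c4 = c3[j := ?a]"
  have len: "length c1 = length bs" "length c2 = length bs" "length c3 = length bs"
    by (simp_all add: c1_def c2_def c3_def)
  have v1: "c1 ! i = ?a + ?b" "c1 ! j = ?b" using ij by (simp_all add: c1_def)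
  have v2: "c2 ! i = ?a + ?b" "c2 ! j = - ?a" using ij v1 len by (simp_all add: c2_def)
  have v3: "c3 ! j = - ?a" using ij v2 len by (simp add: c3_def)
  have 1: "rescale L bs c1 1" using rescale_shear[OF L ij, of 1] by (simp add: c1_def)
  hence s1: "set c1 \<subseteq> L" by (simp add: rescale_def)
  have "c1 ! j + (-1) *\<^sub>R c1 ! i = - ?a" by (simp add: v1)
  hence 2: "rescale L c1 c2 1"
    using rescale_shear[OF L(1) s1, of j i "-1"] ij len unfolding c2_def by metis
  hence s2: "set c2 \<subseteq> L" by (simp add: rescale_def)
  have "c2 ! i + 1 *\<^sub>R c2 ! j = ?b" by (simp add: v2)
  hence 3: "rescale L c2 c3 1"
    using rescale_shear[OF L(1) s2, of i j 1] ij len unfolding c3_def by metis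
  hence s3: "set c3 \<subseteq> L" by (simp add: rescale_def)
  have "(-1) *\<^sub>R c3 ! j = ?a" by (simp add: v3)
  hence 4: "rescale L c3 c4 (-1)"
    using rescale_scale[OF L(1) s3, of j "-1"] ij len unfolding c4_def by simp
  have "c4 = bs[i := ?b, j := ?a]"
    using ij unfolding c4_def c3_def c2_def c1_def
    by (intro nth_equalityI) (auto simp: nth_list_update)
  with rescale_trans[OF rescale_trans[OF rescale_trans[OF 1 2] 3] 4] show ?thesis by simp
qed

section \<open>Bases of subspaces and their coordinates\<close>

definition is_basis :: "'a::euclidean_space list \<Rightarrow> 'a set \<Rightarrow> bool" where
  "is_basis bs L \<longleftrightarrow> distinct bs \<and> independent (set bs) \<and> span (set bs) = L"

lemma is_basis_subspace: "is_basis bs L \<Longrightarrow> subspace L"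
  unfolding is_basis_def by auto

lemma is_basis_subset: "is_basis bs L \<Longrightarrow> set bs \<subseteq> L"
  unfolding is_basis_def using span_superset by auto

lemma is_basis_length: "is_basis bs L \<Longrightarrow> length bs = dim L"
  unfolding is_basis_def by (metis dim_span_eq_card_independent distinct_card)

lemma span_list_sum: "(\<Sum>i<length bs. c i *\<^sub>R bs ! i) \<in> span (set bs)"
  by (intro span_sum span_scale span_base nth_mem) simp

lemma span_list:
  assumes "distinct bs"
  shows "span (set bs) = {(\<Sum>i<length bs. c i *\<^sub>R bs ! i) | c. True}"
proof -
  have b: "bij_betw ((!) bs) {..<length bs} (set bs)"
    using bij_betw_nth[OF assms refl] by simp
  have "x \<in> span (set bs) \<longleftrightarrow> (\<exists>c. x = (\<Sum>i<length bs. c i *\<^sub>R bs ! i))" for x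
  proof
    assume "x \<in> span (set bs)"
    then obtain u where "x = (\<Sum>v\<in>set bs. u v *\<^sub>R v)"
      by (auto simp: span_finite)
    also have "\<dots> = (\<Sum>i<length bs. u (bs ! i) *\<^sub>R bs ! i)"
      using b by (subst sum.reindex_bij_betw[OF b, symmetric]) simp
    finally show "\<exists>c. x = (\<Sum>i<length bs. c i *\<^sub>R bs ! i)" by (intro exI[of _ "\<lambda>i. u (bs ! i)"])
  next
    assume "\<exists>c. x = (\<Sum>i<length bs. c i *\<^sub>R bs ! i)"
    thus "x \<in> span (set bs)" using span_list_sum by auto
  qed
  thus ?thesis by auto
qed

lemma is_basis_span: "is_basis bs L \<Longrightarrow> span (set bs) = L"
  unfolding is_basis_def by blast

lemma is_basis_mem:
  assumes "is_basis bs L"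
  shows "x \<in> L \<longleftrightarrow> (\<exists>c. x = (\<Sum>i<length bs. c i *\<^sub>R bs ! i))"
proof -
  have "distinct bs" using assms unfolding is_basis_def by blast
  from span_list[OF this] show ?thesis unfolding is_basis_span[OF assms] by blast
qed

lemma is_basis_dual:
  assumes "is_basis bs L" "i < length bs"
  obtains l :: "'a::euclidean_space \<Rightarrow> real" where "linear l" "l (bs ! i) = 1"
    "\<And>j. j < length bs \<Longrightarrow> j \<noteq> i \<Longrightarrow> l (bs ! j) = 0"
proof -
  from assms obtain l :: "'a \<Rightarrow> real" where l: "linear l" "\<forall>x\<in>set bs. l x = (if x = bs ! i then 1 else 0)"
    using linear_independent_extend[of "set bs" "\<lambda>x. if x = bs ! i then 1 else 0"]
    unfolding is_basis_def by blast
  show ?thesis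
    using assms l by (intro that[of l]) (auto simp: is_basis_def nth_eq_iff_index_eq)
qed

lemma linear_list_sum:
  assumes "linear l"
  shows "l (\<Sum>i\<in>A. c i *\<^sub>R bs ! i) = (\<Sum>i\<in>A. c i *\<^sub>R l (bs ! i))"
  using assms by (simp add: linear_sum linear_scale)

lemma dual_coord:
  assumes "linear l" "l (bs ! i) = (1::real)" "\<And>j. j < length bs \<Longrightarrow> j \<noteq> i \<Longrightarrow> l (bs ! j) = 0" "i < length bs"
  shows "l (\<Sum>i<length bs. c i *\<^sub>R bs ! i) = c i"
proof -
  have "l (\<Sum>i<length bs. c i *\<^sub>R bs ! i) = (\<Sum>j<length bs. c j * l (bs ! j))"
    by (simp add: linear_list_sum[OF assms(1)])
  also have "\<dots> = (\<Sum>j<length bs. if j = i then c j else 0)"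
    by (rule sum.cong) (use assms in auto)
  finally show ?thesis using assms(4) by simp
qed

lemma is_basis_coord_eq:
  assumes "is_basis bs L" "(\<Sum>i<length bs. c i *\<^sub>R bs ! i) = (\<Sum>i<length bs. d i *\<^sub>R bs ! i)" "i < length bs"
  shows "c i = d i"
proof -
  from is_basis_dual[OF assms(1,3)] obtain l :: "'a \<Rightarrow> real" where
    l: "linear l" "l (bs ! i) = 1" "\<And>j. j < length bs \<Longrightarrow> j \<noteq> i \<Longrightarrow> l (bs ! j) = 0" by blast
  have "c i = l (\<Sum>i<length bs. c i *\<^sub>R bs ! i)" using dual_coord[OF l assms(3), of c] by simp
  also have "\<dots> = d i" unfolding assms(2) using dual_coord[OF l assms(3), of d] by simp
  finally show ?thesis .
qed

lemma is_basisI_span: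
  assumes "is_basis bs L" "length cs = length bs" "span (set cs) = L"
  shows "is_basis cs L"
proof -
  have d: "dim L = length cs" using is_basis_length[OF assms(1)] assms(2) by linarith
  have "dim L = dim (set cs)" unfolding assms(3)[symmetric] by (rule dim_span)
  hence c: "card (set cs) = length cs"
    using d card_length[of cs] dim_le_card'[OF finite_set, of cs] by linarith
  have "distinct cs" using c by (rule card_distinct)
  moreover have "independent (set cs)"
  proof (rule card_le_dim_spanning)
    show "set cs \<subseteq> L" unfolding assms(3)[symmetric] by (rule span_superset)
    show "L \<subseteq> span (set cs)" unfolding assms(3) by (rule order_refl)
    show "card (set cs) \<le> dim L" using c d by linarith
  qed (rule finite_set)
  ultimately show ?thesis unfolding is_basis_def using assms(3) by blast
qed

lemma rescale_is_basis:
  assumes "rescale L bs cs d" "is_basis bs L"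
  shows "is_basis cs L"
proof (rule is_basisI_span)
  show "is_basis bs L" by fact
  show "length cs = length bs" using assms(1) by (simp add: rescale_def)
  have "span (set cs) = span (set bs)" using assms(1) unfolding rescale_def by blast
  also have "\<dots> = L" using assms(2) unfolding is_basis_def by blast
  finally show "span (set cs) = L" .
qed

text \<open>Gaussian elimination: the vectors of \<open>cs\<close> are brought into place one after
  another, each by replacing a pivot vector and then swapping it to its position.\<close>

lemma rescale_exists:
  assumes bs: "is_basis bs L" and cs: "is_basis cs L"
  obtains d where "rescale L bs cs d"
proof -
  have len: "length bs = length cs" using assms is_basis_length by metis
  have L: "subspace L" using bs by (rule is_basis_subspace)
  have "\<exists>ds d. rescale L bs ds d \<and> is_basis ds L \<and> take k ds = take k cs" if "k \<le> length cs" for k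
    using that
  proof (induction k)
    case 0
    then show ?case using rescale_refl[OF is_basis_subset[OF bs]] bs by auto
  next
    case (Suc k)
    then obtain ds d where ds: "rescale L bs ds d" "is_basis ds L" "take k ds = take k cs" by auto
    have lds: "length ds = length cs" using ds(1) len by (simp add: rescale_def)
    let ?x = "cs ! k"
    have "?x \<in> L" using Suc.prems is_basis_subset[OF cs] by (auto simp: Suc_le_eq)
    then obtain c where c: "?x = (\<Sum>i<length ds. c i *\<^sub>R ds ! i)"
      using is_basis_mem[OF ds(2)] by blast
    \<comment> \<open>A pivot exists: otherwise \<open>cs ! k\<close> would be a combination of the
      first k entries, which already agree with those of the independent list
      \<open>cs\<close>.\<close>
    have "\<exists>j<length ds. k \<le> j \<and> c j \<noteq> 0"
    proof (rule ccontr)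
      assume "\<not> ?thesis"
      hence z: "c j = 0" if "j < length ds" "k \<le> j" for j using that by auto
      have e: "ds ! j = cs ! j" if "j < k" for j using ds(3) that by (metis nth_take)
      have "(\<Sum>i<length cs. (if i < k then c i else 0) *\<^sub>R cs ! i) = (\<Sum>i<length ds. c i *\<^sub>R ds ! i)"
        by (rule sum.cong) (use z e lds in auto)
      also have "\<dots> = (\<Sum>i<length cs. (if i = k then 1 else 0) *\<^sub>R cs ! i)"
        using Suc.prems by (simp add: c[symmetric] if_distrib[of "\<lambda>t. t *\<^sub>R _"] cong: if_cong)
      finally have "(if k < k then c k else 0) = (if k = k then 1 else (0::real))"
        by (rule is_basis_coord_eq[OF cs]) (use Suc.prems in simp)
      thus False by simp
    qed
    then obtain j where j: "j < length ds" "k \<le> j" "c j \<noteq> 0" by blast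
    have x: "?x = c j *\<^sub>R ds ! j + (\<Sum>i\<in>{..<length ds} - {j}. c i *\<^sub>R ds ! i)"
      unfolding c using j by (subst sum.remove[of _ j]) auto
    let ?d1 = "ds[j := ?x]"
    have r1: "rescale L ds ?d1 (c j)"
      using rescale_replace[OF L is_basis_subset[OF ds(2)] j(1,3), of "{..<length ds} - {j}" c] x by simp
    have b1: "is_basis ?d1 L" using rescale_is_basis[OF r1 ds(2)] .
    have t1: "take k ?d1 = take k cs" using ds(3) j by simp
    obtain e ds' where *: "rescale L ?d1 ds' e" "take (Suc k) ds' = take (Suc k) cs"
    proof (cases "j = k")
      case True
      hence "take (Suc k) ?d1 = take (Suc k) cs"
        using t1 Suc.prems lds by (simp add: take_Suc_conv_app_nth)
      thus ?thesis using that rescale_refl[OF is_basis_subset[OF b1]] by blast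
    next
      case False
      let ?d2 = "?d1[j := ?d1 ! k, k := ?d1 ! j]"
      have "rescale L ?d1 ?d2 (-1)"
        by (rule rescale_swap[OF L is_basis_subset[OF b1]]) (use j Suc.prems lds False in auto)
      moreover have "take (Suc k) ?d2 = take (Suc k) cs"
        using t1 Suc.prems lds j False
        by (simp add: take_Suc_conv_app_nth nth_list_update)
      ultimately show ?thesis using that by blast
    qed
    show ?case
      using rescale_trans[OF rescale_trans[OF ds(1) r1] *(1)] rescale_is_basis[OF *(1) b1] *(2) by blast
  qed
  from this[of "length cs"] obtain ds d where ds: "rescale L bs ds d" "take (length cs) ds = cs" by auto
  hence "length ds = length cs" using len by (simp add: rescale_def)
  with ds have "ds = cs" by simp
  thus ?thesis using ds that by blast
qed

section \<open>Translations, null sets and finiteness\<close>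

lemma vol_translate:
  assumes "u \<in> span (set bs)"
  shows "vol bs (a + u) = vol bs a"
  using assms
proof (induction arbitrary: a rule: span_induct_alt)
  case base
  then show ?case by simp
next
  case (step c x y)
  then obtain i where i: "i < length bs" "x = bs ! i" by (metis in_set_conv_nth)
  have "vol bs (a + c *\<^sub>R x) = vol bs a" for a
  proof (rule measure_eqI_nn)
    fix h :: "'a \<Rightarrow> ennreal" assume [measurable]: "h \<in> borel_measurable borel"
    let ?S = "\<lambda>y. a + (\<Sum>j\<in>{..<length bs} - {i}. y j *\<^sub>R bs ! j)"
    have S: "a + c *\<^sub>R bs ! i + (\<Sum>j\<in>{..<length bs} - {i}. y j *\<^sub>R bs ! j) + t *\<^sub>R bs ! i
        = ?S y + (t + c) *\<^sub>R bs ! i" for y t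
      by (simp add: algebra_simps)
    have "nn_integral (vol bs (a + c *\<^sub>R x)) h =
      (\<integral>\<^sup>+y. (\<integral>\<^sup>+t. h (?S y + (t + c) *\<^sub>R bs ! i) \<partial>lborel) \<partial>lebn ({..<length bs} - {i}))"
      using i by (subst nn_integral_vol_coord[where i=i]) (simp_all add: S)
    also have "\<dots> = (\<integral>\<^sup>+y. (\<integral>\<^sup>+t. h (?S y + t *\<^sub>R bs ! i) \<partial>lborel) \<partial>lebn ({..<length bs} - {i}))"
    proof (rule nn_integral_cong)
      fix y :: "nat \<Rightarrow> real"
      show "(\<integral>\<^sup>+t. h (?S y + (t + c) *\<^sub>R bs ! i) \<partial>lborel) = (\<integral>\<^sup>+t. h (?S y + t *\<^sub>R bs ! i) \<partial>lborel)"
        using nn_integral_lborel_scale[of 1 "\<lambda>t. h (?S y + t *\<^sub>R bs ! i)" c] by simp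
    qed
    also have "\<dots> = nn_integral (vol bs a) h"
      using i by (subst nn_integral_vol_coord[where i=i]) simp_all
    finally show "nn_integral (vol bs (a + c *\<^sub>R x)) h = nn_integral (vol bs a) h" .
  qed simp_all
  from this[of "a + y"] step.IH show ?case by (simp add: algebra_simps)
qed

lemma nn_integral_vol_shift:
  assumes [measurable]: "h \<in> borel_measurable borel"
  shows "(\<integral>\<^sup>+x. h (x + u) \<partial>vol bs a) = nn_integral (vol bs (a + u)) h"
proof -
  have "param bs (a + u) y = param bs a y + u" for y by (simp add: param_def algebra_simps)
  thus ?thesis by (simp add: nn_integral_vol)
qed

text \<open>Every line in direction \<open>bs ! i\<close> meets the hyperplane in exactly one
  point.\<close>

lemma vol_null_hyperplane:
  fixes u :: "'a::euclidean_space \<Rightarrow> real"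
  assumes u: "linear u" and i: "i < length bs" "u (bs ! i) \<noteq> 0"
  shows "emeasure (vol bs a) {x. u x = c} = 0"
proof -
  have [measurable]: "u \<in> borel_measurable borel"
    by (intro borel_measurable_continuous_onI linear_continuous_on linear_conv_bounded_linear[THEN iffD1] u)
  have m: "{x. u x = c} \<in> sets borel" by measurable
  let ?S = "\<lambda>y. a + (\<Sum>j\<in>{..<length bs} - {i}. y j *\<^sub>R bs ! j)"
  have "emeasure (vol bs a) {x. u x = c} = nn_integral (vol bs a) (indicator {x. u x = c})"
    using m by simp
  also have "\<dots> = (\<integral>\<^sup>+y. (\<integral>\<^sup>+t. indicator {x. u x = c} (?S y + t *\<^sub>R bs ! i) \<partial>lborel) \<partial>lebn ({..<length bs} - {i}))"
    using i m by (subst nn_integral_vol_coord[where i=i]) simp_all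
  also have "\<dots> = (\<integral>\<^sup>+y. 0 \<partial>lebn ({..<length bs} - {i}))"
  proof (rule nn_integral_cong)
    fix y :: "nat \<Rightarrow> real"
    have "indicator {x. u x = c} (?S y + t *\<^sub>R bs ! i) = (indicator {(c - u (?S y)) / u (bs ! i)} t :: ennreal)" for t
      using i u by (auto simp: indicator_def linear_add[OF u] linear_scale[OF u] field_simps)
    thus "(\<integral>\<^sup>+t. indicator {x. u x = c} (?S y + t *\<^sub>R bs ! i) \<partial>lborel) = 0" by simp
  qed
  finally show ?thesis by simp
qed

text \<open>Dual linear forms recover the coordinates, so a bounded set has its coordinates in a
  box.\<close>

lemma vol_finite_bounded:
  assumes bs: "is_basis bs L" and K: "bounded K" "K \<in> sets borel"
  shows "emeasure (vol bs a) K < \<infinity>"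
proof -
  have "\<exists>B. \<forall>y. param bs a y \<in> K \<longrightarrow> \<bar>y i\<bar> \<le> B" if i: "i < length bs" for i
  proof -
    from is_basis_dual[OF bs i] obtain l :: "'a \<Rightarrow> real" where
      l: "linear l" "l (bs ! i) = 1" "\<And>j. j < length bs \<Longrightarrow> j \<noteq> i \<Longrightarrow> l (bs ! j) = 0" by blast
    have "bounded (l ` K)" using K(1) l(1) by (simp add: bounded_linear_image linear_conv_bounded_linear)
    then obtain C where C: "\<And>x. x \<in> K \<Longrightarrow> \<bar>l x\<bar> \<le> C" by (auto simp: bounded_iff)
    have "\<bar>y i\<bar> \<le> C + \<bar>l a\<bar>" if "param bs a y \<in> K" for y
    proof -
      have "l (param bs a y) = l a + y i"
        unfolding param_def using dual_coord[OF l i] by (simp add: linear_add[OF l(1)])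
      thus ?thesis using C[OF that] by linarith
    qed
    thus ?thesis by blast
  qed
  then obtain B where B: "\<And>i y. i < length bs \<Longrightarrow> param bs a y \<in> K \<Longrightarrow> \<bar>y i\<bar> \<le> B i" by metis
  interpret product_sigma_finite "\<lambda>_::nat. lborel :: real measure" by standard
  have "emeasure (vol bs a) K = emeasure (lebn {..<length bs}) (param bs a -` K \<inter> space (lebn {..<length bs}))"
    unfolding vol_def by (rule emeasure_distr) (use K in auto)
  also have "\<dots> \<le> emeasure (lebn {..<length bs}) (Pi\<^sub>E {..<length bs} (\<lambda>i. {- B i .. B i}))"
    by (rule emeasure_mono) (use B in \<open>auto simp: space_PiM PiE_iff abs_le_iff minus_le_iff intro!: sets_PiM_I_finite\<close>)
  also have "\<dots> = (\<Prod>i<length bs. emeasure lborel {- B i .. B i})"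
    by (rule emeasure_PiM) auto
  \<comment> \<open>A bound \<open>B i\<close> may be negative if no parameter leads into
    \<open>K\<close>; then the interval is empty, hence the maximum with 0.\<close>
  also have "\<dots> = (\<Prod>i<length bs. ennreal (max 0 (2 * B i)))"
    by (intro prod.cong refl) (auto simp: emeasure_lborel_Icc_eq max_def)
  also have "\<dots> < \<infinity>" by (simp add: prod_ennreal)
  finally show ?thesis .
qed

section \<open>Fundamental parallelotopes\<close>

text \<open>The cube is half-open so that its lattice translates cover the space without
  overlap.\<close>

definition fund :: "'a::euclidean_space list \<Rightarrow> 'a set" where
  "fund es = {(\<Sum>i<length es. c i *\<^sub>R es ! i) | c. \<forall>i<length es. 0 \<le> c i \<and> c i < 1}"

lemma fund_coord:
  assumes "is_basis es L"
  shows "(\<Sum>i<length es. c i *\<^sub>R es ! i) \<in> fund es \<longleftrightarrow> (\<forall>i<length es. 0 \<le> c i \<and> c i < 1)"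
proof
  assume "(\<Sum>i<length es. c i *\<^sub>R es ! i) \<in> fund es"
  then obtain d where d: "(\<Sum>i<length es. c i *\<^sub>R es ! i) = (\<Sum>i<length es. d i *\<^sub>R es ! i)"
    "\<forall>i<length es. 0 \<le> d i \<and> d i < 1" unfolding fund_def by blast
  with is_basis_coord_eq[OF assms d(1)] show "\<forall>i<length es. 0 \<le> c i \<and> c i < 1" by simp
qed (auto simp: fund_def)

lemma fund_borel:
  assumes es: "is_basis es L"
  shows "fund es \<in> sets borel"
proof -
  have "\<forall>i. \<exists>l :: 'a \<Rightarrow> real. i < length es \<longrightarrow> linear l \<and> l (es ! i) = 1 \<and> (\<forall>j<length es. j \<noteq> i \<longrightarrow> l (es ! j) = 0)"
    using is_basis_dual[OF es] by metis
  then obtain l :: "nat \<Rightarrow> 'a \<Rightarrow> real" where l: "\<And>i. i < length es \<Longrightarrow> linear (l i)" "\<And>i. i < length es \<Longrightarrow> l i (es ! i) = 1"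
    "\<And>i j. i < length es \<Longrightarrow> j < length es \<Longrightarrow> j \<noteq> i \<Longrightarrow> l i (es ! j) = 0" by metis
  have lb: "l i \<in> borel_measurable borel" if "i < length es" for i
    by (intro borel_measurable_continuous_onI linear_continuous_on linear_conv_bounded_linear[THEN iffD1] l(1) that)
  have c: "l i (\<Sum>i<length es. c i *\<^sub>R es ! i) = c i" if "i < length es" for i c
    by (rule dual_coord) (use l that in auto)
  have "fund es = L \<inter> (\<Inter>i\<in>{..<length es}. {x. 0 \<le> l i x \<and> l i x < 1})"
  proof -
    note L = is_basis_mem[OF es]
    show ?thesis
    proof (intro set_eqI iffI)
      fix x assume x: "x \<in> fund es"
      then obtain d where d: "x = (\<Sum>i<length es. d i *\<^sub>R es ! i)" unfolding fund_def by blast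
      with x have "\<forall>i<length es. 0 \<le> d i \<and> d i < 1" using fund_coord[OF es] by simp
      thus "x \<in> L \<inter> (\<Inter>i\<in>{..<length es}. {x. 0 \<le> l i x \<and> l i x < 1})"
        using c d L by auto
    next
      fix x assume x: "x \<in> L \<inter> (\<Inter>i\<in>{..<length es}. {x. 0 \<le> l i x \<and> l i x < 1})"
      then obtain d where d: "x = (\<Sum>i<length es. d i *\<^sub>R es ! i)" using L by blast
      with x have "\<forall>i<length es. 0 \<le> d i \<and> d i < 1" by (simp add: c)
      thus "x \<in> fund es" unfolding d fund_coord[OF es] .
    qed
  qed
  moreover have "closed L" using is_basis_subspace[OF es] by (simp add: closed_subspace)
  hence "L \<in> sets borel" by simp
  moreover have "{x. 0 \<le> l i x \<and> l i x < 1} \<in> sets borel" if "i < length es" for i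
    using lb[OF that] by measurable
  ultimately show ?thesis
    by (cases "length es = 0") (auto intro!: sets.Int sets.finite_INT)
qed

lemma vol_fund:
  assumes es: "is_basis es L"
  shows "emeasure (vol es 0) (fund es) = 1"
proof -
  interpret product_sigma_finite "\<lambda>_::nat. lborel :: real measure" by standard
  have "emeasure (vol es 0) (fund es) = emeasure (lebn {..<length es}) (param es 0 -` fund es \<inter> space (lebn {..<length es}))"
    unfolding vol_def by (rule emeasure_distr) (use fund_borel[OF es] in auto)
  also have "param es 0 -` fund es \<inter> space (lebn {..<length es}) = Pi\<^sub>E {..<length es} (\<lambda>i. {0..<1})"
  proof (intro set_eqI)
    fix y
    have "param es 0 y \<in> fund es \<longleftrightarrow> (\<forall>i<length es. 0 \<le> y i \<and> y i < 1)"
      unfolding param_def add_0 by (rule fund_coord[OF es])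
    thus "y \<in> param es 0 -` fund es \<inter> space (lebn {..<length es}) \<longleftrightarrow> y \<in> Pi\<^sub>E {..<length es} (\<lambda>i. {0..<1})"
      by (auto simp: space_PiM PiE_iff)
  qed
  also have "emeasure (lebn {..<length es}) \<dots> = (\<Prod>i<length es. emeasure lborel {0..<1::real})"
    by (rule emeasure_PiM) auto
  also have "\<dots> = 1" by simp
  finally show ?thesis .
qed

lemma lattice_basis_is_basis:
  "lattice_basis M es \<Longrightarrow> is_basis es (span M)"
proof -
  assume lb: "lattice_basis M es"
  have "set es \<subseteq> M"
  proof
    fix x assume "x \<in> set es"
    then obtain k where k: "k < length es" "x = es ! k" by (metis in_set_conv_nth)
    hence "x = (\<Sum>i<length es. of_int (if i = k then 1 else 0) *\<^sub>R es ! i)"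
      by (simp add: if_distrib[of "\<lambda>t. of_int t *\<^sub>R _"] cong: if_cong)
    thus "x \<in> M" using lb unfolding lattice_basis_def by (auto intro: exI[of _ "\<lambda>i. if i = k then 1 else 0"])
  qed
  moreover have "M \<subseteq> span (set es)"
    using lb by (auto simp: lattice_basis_def span_list_sum)
  ultimately have "span (set es) = span M" by (intro subset_antisym span_mono span_minimal subspace_span)
  moreover have "distinct es" "independent (set es)" using lb unfolding lattice_basis_def by blast+
  ultimately show ?thesis unfolding is_basis_def by blast
qed

lemma lattice_mem:
  "lattice_basis M es \<Longrightarrow> x \<in> M \<longleftrightarrow> (\<exists>c :: nat \<Rightarrow> int. x = (\<Sum>i<length es. of_int (c i) *\<^sub>R es ! i))"
  by (simp add: lattice_basis_def)

lemma fund_tile: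
  assumes lb: "lattice_basis M es" and x: "x \<in> span M"
  shows "\<exists>!l. l \<in> M \<and> x - l \<in> fund es"
proof -
  note b = lattice_basis_is_basis[OF lb]
  obtain c where c: "x = (\<Sum>i<length es. c i *\<^sub>R es ! i)"
    using x is_basis_mem[OF b] by blast
  have d: "x - (\<Sum>i<length es. of_int (k i) *\<^sub>R es ! i) = (\<Sum>i<length es. (c i - of_int (k i)) *\<^sub>R es ! i)" for k :: "nat \<Rightarrow> int"
    by (simp add: c sum_subtractf algebra_simps)
  have mem: "x - (\<Sum>i<length es. of_int (k i) *\<^sub>R es ! i) \<in> fund es \<longleftrightarrow> (\<forall>i<length es. k i = \<lfloor>c i\<rfloor>)" for k :: "nat \<Rightarrow> int"
  proof -
    have fl: "0 \<le> r - of_int z \<and> r - of_int z < 1 \<longleftrightarrow> z = \<lfloor>r\<rfloor>" for r :: real and z :: int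
    proof
      assume "0 \<le> r - of_int z \<and> r - of_int z < 1"
      thus "z = \<lfloor>r\<rfloor>" by (intro floor_unique[symmetric]) auto
    next
      assume "z = \<lfloor>r\<rfloor>"
      thus "0 \<le> r - of_int z \<and> r - of_int z < 1"
        using of_int_floor_le[of r] real_of_int_floor_add_one_gt[of r] by (simp add: diff_less_eq add.commute)
    qed
    have "x - (\<Sum>i<length es. of_int (k i) *\<^sub>R es ! i) \<in> fund es \<longleftrightarrow>
        (\<forall>i<length es. 0 \<le> c i - of_int (k i) \<and> c i - of_int (k i) < 1)"
      unfolding d[of k] by (rule fund_coord[OF b])
    thus ?thesis using fl by presburger
  qed
  let ?l = "\<Sum>i<length es. of_int \<lfloor>c i\<rfloor> *\<^sub>R es ! i"
  have l1: "?l \<in> M"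
    using lattice_mem[OF lb, THEN iffD2, OF exI[of _ "\<lambda>i. \<lfloor>c i\<rfloor>"], OF refl] by simp
  have l2: "x - ?l \<in> fund es" using mem[of "\<lambda>i. \<lfloor>c i\<rfloor>", THEN iffD2] by simp
  have "l = ?l" if l: "l \<in> M" "x - l \<in> fund es" for l
  proof -
    obtain k :: "nat \<Rightarrow> int" where k: "l = (\<Sum>i<length es. of_int (k i) *\<^sub>R es ! i)"
      using l(1) lattice_mem[OF lb] by blast
    have "\<forall>i<length es. k i = \<lfloor>c i\<rfloor>" by (rule mem[THEN iffD1]) (use l(2) k in simp)
    thus ?thesis unfolding k by (intro sum.cong) auto
  qed
  with l1 l2 show ?thesis by blast
qed

lemma lattice_countable:
  assumes "lattice_basis M es"
  shows "countable M"
proof -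
  have "M \<subseteq> (\<lambda>ks. \<Sum>i<length es. of_int (ks ! i) *\<^sub>R es ! i) ` (UNIV :: int list set)"
  proof
    fix x assume "x \<in> M"
    then obtain k :: "nat \<Rightarrow> int" where "x = (\<Sum>i<length es. of_int (k i) *\<^sub>R es ! i)"
      using lattice_mem[OF assms] by blast
    hence "x = (\<Sum>i<length es. of_int (map k [0..<length es] ! i) *\<^sub>R es ! i)" by simp
    thus "x \<in> (\<lambda>ks. \<Sum>i<length es. of_int (ks ! i) *\<^sub>R es ! i) ` UNIV" by (rule image_eqI) (rule UNIV_I)
  qed
  thus ?thesis by (rule countable_subset) auto
qed

lemma lattice_uminus: "lattice_basis M es \<Longrightarrow> x \<in> M \<Longrightarrow> - x \<in> M"
proof -
  assume lb: "lattice_basis M es" "x \<in> M"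
  then obtain c :: "nat \<Rightarrow> int" where "x = (\<Sum>i<length es. of_int (c i) *\<^sub>R es ! i)"
    using lattice_mem[OF lb(1)] by blast
  hence "- x = (\<Sum>i<length es. of_int (- c i) *\<^sub>R es ! i)" by (simp add: sum_negf)
  thus "- x \<in> M" by (intro lattice_mem[OF lb(1), THEN iffD2] exI)
qed

text \<open>The sum over the lattice is written as an integral for the counting measure, so that it
  can be exchanged with the volume integral.\<close>

lemma nn_integral_count_one:
  assumes "\<exists>!l. l \<in> M \<and> P l"
  shows "(\<integral>\<^sup>+l. (if P l then 1 else 0) \<partial>count_space M) = (1::ennreal)"
proof -
  from assms obtain l where l: "l \<in> M" "P l" "\<And>k. k \<in> M \<Longrightarrow> P k \<Longrightarrow> k = l" by blast
  have "(\<integral>\<^sup>+l. (if P l then 1 else 0) \<partial>count_space M) = (\<integral>\<^sup>+k. indicator {l} k \<partial>count_space M)"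
    by (rule nn_integral_cong) (auto simp: indicator_def l(1,2) dest: l(3))
  also have "\<dots> = 1" using l(1) by simp
  finally show ?thesis .
qed

text \<open>Both parallelotopes are fundamental domains of the lattice, so they have the same volume.\<close>

lemma lattice_basis_rescale:
  assumes es: "lattice_basis M es" and fs: "lattice_basis M fs" and r: "rescale L es fs d"
  shows "\<bar>d\<bar> = 1"
proof -
  note be = lattice_basis_is_basis[OF es] and bf = lattice_basis_is_basis[OF fs]
  note [measurable] = fund_borel[OF be] fund_borel[OF bf]
  let ?m = "vol es 0"
  have cM: "countable M" using lattice_countable[OF es] .
  have sp: "span (set es) = span M" using is_basis_span[OF be] .
  have inL: "param es 0 y \<in> span M" for y
    unfolding param_def sp[symmetric] using span_list_sum[of y es] by simp
  have t1: "\<exists>!l. l \<in> M \<and> x - l \<in> fund es" if "x \<in> span M" for x using fund_tile[OF es that] .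
  have neg: "- k \<in> M" if "k \<in> M" for k using lattice_uminus[OF es that] .
  have t2: "\<exists>!l. l \<in> M \<and> x + l \<in> fund fs" if "x \<in> span M" for x
  proof -
    from fund_tile[OF fs that] obtain l where l: "l \<in> M" "x - l \<in> fund fs" "\<And>k. k \<in> M \<Longrightarrow> x - k \<in> fund fs \<Longrightarrow> k = l"
      by blast
    have "- l \<in> M \<and> x + - l \<in> fund fs" using l(1,2) neg[OF l(1)] by simp
    moreover have "k = - l" if "k \<in> M \<and> x + k \<in> fund fs" for k
    proof -
      have "- k = l" using that neg[of k] by (intro l(3)) simp_all
      thus ?thesis by (metis minus_minus)
    qed
    ultimately show ?thesis by (rule ex1I)
  qed
  \<comment> \<open>\<open>?h l\<close> is the piece of the second parallelotope inside the
    translate by l of the first; \<open>?g l\<close> is the same piece moved back by l. Summed over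
    the lattice, the pieces fill the second and the first parallelotope respectively.\<close>
  let ?h = "\<lambda>l x. indicator (fund fs) x * indicator (fund es) (x - l) :: ennreal"
  let ?g = "\<lambda>l x. indicator (fund fs) (x + l) * indicator (fund es) x :: ennreal"
  have "emeasure ?m (fund fs) = nn_integral ?m (indicator (fund fs))" by simp
  also have "\<dots> = (\<integral>\<^sup>+y. (\<integral>\<^sup>+l. ?h l (param es 0 y) \<partial>count_space M) \<partial>lebn {..<length es})"
  proof (subst nn_integral_vol, simp, rule nn_integral_cong)
    fix y :: "nat \<Rightarrow> real"
    let ?x = "param es 0 y"
    have "(\<integral>\<^sup>+l. ?h l ?x \<partial>count_space M) = indicator (fund fs) ?x * (\<integral>\<^sup>+l. (if ?x - l \<in> fund es then 1 else 0) \<partial>count_space M)"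
      by (subst nn_integral_cmult[symmetric]) (auto intro!: nn_integral_cong simp: indicator_def)
    thus "indicator (fund fs) ?x = (\<integral>\<^sup>+l. ?h l ?x \<partial>count_space M)"
      using nn_integral_count_one[OF t1[OF inL[of y]]] by simp
  qed
  also have "\<dots> = (\<integral>\<^sup>+l. (\<integral>\<^sup>+y. ?h l (param es 0 y) \<partial>lebn {..<length es}) \<partial>count_space M)"
    by (rule nn_integral_count_space_nn_integral) (use cM in measurable)
  also have "\<dots> = (\<integral>\<^sup>+l. (\<integral>\<^sup>+x. ?h l x \<partial>?m) \<partial>count_space M)"
    by (intro nn_integral_cong, subst nn_integral_vol) simp_all
  also have "\<dots> = (\<integral>\<^sup>+l. (\<integral>\<^sup>+x. ?g l x \<partial>?m) \<partial>count_space M)"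
  proof (rule nn_integral_cong)
    fix l assume "l \<in> space (count_space M)"
    hence "l \<in> span (set es)" using sp by (simp add: span_base)
    hence v: "vol es (0 + l) = ?m" by (rule vol_translate)
    have "(\<integral>\<^sup>+x. ?g l x \<partial>?m) = (\<integral>\<^sup>+x. ?h l (x + l) \<partial>?m)" by simp
    also have "\<dots> = (\<integral>\<^sup>+x. ?h l x \<partial>?m)"
      by (subst nn_integral_vol_shift) (simp_all add: v[simplified])
    finally show "(\<integral>\<^sup>+x. ?h l x \<partial>?m) = (\<integral>\<^sup>+x. ?g l x \<partial>?m)" ..
  qed
  also have "\<dots> = (\<integral>\<^sup>+l. (\<integral>\<^sup>+y. ?g l (param es 0 y) \<partial>lebn {..<length es}) \<partial>count_space M)"
    by (intro nn_integral_cong, subst nn_integral_vol) simp_all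
  also have "\<dots> = (\<integral>\<^sup>+y. (\<integral>\<^sup>+l. ?g l (param es 0 y) \<partial>count_space M) \<partial>lebn {..<length es})"
    by (rule nn_integral_count_space_nn_integral[symmetric]) (use cM in measurable)
  also have "\<dots> = nn_integral ?m (indicator (fund es))"
  proof (subst nn_integral_vol, simp, rule nn_integral_cong)
    fix y :: "nat \<Rightarrow> real"
    let ?x = "param es 0 y"
    have "(\<integral>\<^sup>+l. ?g l ?x \<partial>count_space M) = indicator (fund es) ?x * (\<integral>\<^sup>+l. (if ?x + l \<in> fund fs then 1 else 0) \<partial>count_space M)"
      by (subst nn_integral_cmult[symmetric]) (auto intro!: nn_integral_cong simp: indicator_def)
    thus "(\<integral>\<^sup>+l. ?g l ?x \<partial>count_space M) = indicator (fund es) ?x"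
      using nn_integral_count_one[OF t2[OF inL[of y]]] by simp
  qed
  also have "\<dots> = 1" using vol_fund[OF be] by simp
  finally have "emeasure ?m (fund fs) = 1" .
  moreover have "?m = scale_measure (ennreal \<bar>d\<bar>) (vol fs 0)" using r by (simp add: rescale_def)
  ultimately have "ennreal \<bar>d\<bar> = 1" using vol_fund[OF bf] by simp
  thus ?thesis by (metis abs_ge_zero ennreal_1 ennreal_inj zero_le_one)
qed

subsection \<open>Lattices and rational subspaces\<close>

text \<open>Sets of generators replace lists here, since the reduction below exchanges generators
  without regard to their order.\<close>

definition zspan :: "'a::euclidean_space set \<Rightarrow> 'a set" where
  "zspan B = {(\<Sum>v\<in>B. of_int (c v) *\<^sub>R v) | c :: 'a \<Rightarrow> int. True}"

definition zbasis :: "'a::euclidean_space set \<Rightarrow> 'a set \<Rightarrow> bool" where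
  "zbasis M B \<longleftrightarrow> finite B \<and> independent B \<and> M = zspan B"

lemma zspanI: "(\<Sum>v\<in>B. of_int (c v) *\<^sub>R v) \<in> zspan B"
  unfolding zspan_def by blast

lemma zspanE:
  assumes "x \<in> zspan B"
  obtains c :: "'a::euclidean_space \<Rightarrow> int" where "x = (\<Sum>v\<in>B. of_int (c v) *\<^sub>R v)"
  using assms unfolding zspan_def by blast

lemma zspan_list:
  assumes "distinct es"
  shows "zspan (set es) = {(\<Sum>i<length es. of_int (c i) *\<^sub>R es ! i) | c :: nat \<Rightarrow> int. True}"
proof (intro set_eqI iffI)
  have b: "bij_betw ((!) es) {..<length es} (set es)"
    using bij_betw_nth[OF assms refl] by simp
  {
    fix x assume "x \<in> zspan (set es)"
    then obtain c :: "'a \<Rightarrow> int" where "x = (\<Sum>v\<in>set es. of_int (c v) *\<^sub>R v)" by (rule zspanE)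
    also have "\<dots> = (\<Sum>i<length es. of_int (c (es ! i)) *\<^sub>R es ! i)"
      using sum.reindex_bij_betw[OF b, of "\<lambda>v. of_int (c v) *\<^sub>R v"] by simp
    finally have "x = (\<Sum>i<length es. of_int ((\<lambda>i. c (es ! i)) i) *\<^sub>R es ! i)" .
    thus "x \<in> {(\<Sum>i<length es. of_int (c i) *\<^sub>R es ! i) | c :: nat \<Rightarrow> int. True}"
      by (intro CollectI exI conjI TrueI)
  next
    fix x assume "x \<in> {(\<Sum>i<length es. of_int (c i) *\<^sub>R es ! i) | c :: nat \<Rightarrow> int. True}"
    then obtain c :: "nat \<Rightarrow> int" where "x = (\<Sum>i<length es. of_int (c i) *\<^sub>R es ! i)" by auto
    also have "\<dots> = (\<Sum>i<length es. of_int (c (the_inv_into {..<length es} ((!) es) (es ! i))) *\<^sub>R es ! i)"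
      using b by (intro sum.cong refl) (simp add: bij_betw_def the_inv_into_f_f)
    also have "\<dots> = (\<Sum>v\<in>set es. of_int (c (the_inv_into {..<length es} ((!) es) v)) *\<^sub>R v)"
      using sum.reindex_bij_betw[OF b, of "\<lambda>v. of_int (c (the_inv_into {..<length es} ((!) es) v)) *\<^sub>R v"] by simp
    finally show "x \<in> zspan (set es)"
      using zspanI[of "\<lambda>v. c (the_inv_into {..<length es} ((!) es) v)" "set es"] by simp
  }
qed

lemma lattice_basis_zbasis:
  "lattice_basis M es \<longleftrightarrow> distinct es \<and> zbasis M (set es)"
  unfolding lattice_basis_def zbasis_def by (auto simp: zspan_list)

lemma zbasis_imp_lattice_basis:
  assumes "zbasis M B"
  obtains es where "lattice_basis M es" "set es = B"
proof -
  have "finite B" using assms by (simp add: zbasis_def)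
  then obtain es where "set es = B" "distinct es" using finite_distinct_list by blast
  thus ?thesis using assms that by (simp add: lattice_basis_zbasis)
qed

lemma zspan_zero: "0 \<in> zspan B"
  using zspanI[of "\<lambda>_. 0" B] by simp

lemma zspan_add:
  assumes "x \<in> zspan B" "y \<in> zspan B"
  shows "x + y \<in> zspan B"
proof -
  obtain c :: "'a \<Rightarrow> int" where c: "x = (\<Sum>v\<in>B. of_int (c v) *\<^sub>R v)" using assms(1) by (rule zspanE)
  obtain d :: "'a \<Rightarrow> int" where d: "y = (\<Sum>v\<in>B. of_int (d v) *\<^sub>R v)" using assms(2) by (rule zspanE)
  show ?thesis
    using zspanI[of "\<lambda>v. c v + d v" B] unfolding c d by (simp add: sum.distrib scaleR_add_left)
qed

lemma zspan_scale:
  assumes "x \<in> zspan B"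
  shows "of_int k *\<^sub>R x \<in> zspan B"
proof -
  obtain c :: "'a \<Rightarrow> int" where c: "x = (\<Sum>v\<in>B. of_int (c v) *\<^sub>R v)" using assms by (rule zspanE)
  show ?thesis
    using zspanI[of "\<lambda>v. k * c v" B] unfolding c by (simp add: scaleR_sum_right)
qed

lemma zspan_base:
  assumes "finite B" "b \<in> B"
  shows "b \<in> zspan B"
proof -
  have "(\<Sum>v\<in>B. of_int (if v = b then 1 else 0) *\<^sub>R v) = (\<Sum>v\<in>B. if v = b then v else 0)"
    by (rule sum.cong) auto
  also have "\<dots> = b" using assms by simp
  finally show ?thesis using zspanI[of "\<lambda>v. if v = b then 1 else 0" B] by simp
qed

lemma zspan_minimal:
  assumes "finite B" "B \<subseteq> zspan C"
  shows "zspan B \<subseteq> zspan C"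
proof
  fix x assume "x \<in> zspan B"
  then obtain c :: "'a \<Rightarrow> int" where c: "x = (\<Sum>v\<in>B. of_int (c v) *\<^sub>R v)" by (rule zspanE)
  have "(\<Sum>v\<in>A. of_int (c v) *\<^sub>R v) \<in> zspan C" if "A \<subseteq> B" for A
    using finite_subset[OF that assms(1)] that
    by (induction A rule: finite_induct) (use assms(2) in \<open>auto intro!: zspan_zero zspan_add zspan_scale\<close>)
  thus "x \<in> zspan C" unfolding c by blast
qed

lemma zspan_subset_span: "zspan B \<subseteq> span B"
proof
  fix x assume "x \<in> zspan B"
  then obtain c :: "'a \<Rightarrow> int" where "x = (\<Sum>v\<in>B. of_int (c v) *\<^sub>R v)" by (rule zspanE)
  thus "x \<in> span B" by (auto intro: span_sum span_scale span_base)
qed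

lemma span_zspan: "finite B \<Longrightarrow> span (zspan B) = span B"
  by (intro subset_antisym span_minimal zspan_subset_span subspace_span span_mono)
     (auto intro: zspan_base)

lemma zbasis_shear:
  fixes q :: int
  assumes M: "zbasis M B" and b: "b \<in> B" "b' \<in> B" "b \<noteq> b'"
  defines "x \<equiv> b + of_int q *\<^sub>R b'"
  shows "zbasis M (insert x (B - {b}))" "x \<notin> B - {b}"
proof -
  from M have fin: "finite B" and ind: "independent B" and MB: "M = zspan B" by (auto simp: zbasis_def)
  let ?C = "insert x (B - {b})"
  have b': "b' \<in> span (B - {b})" "b' \<in> B - {b}" using b by (auto intro: span_base)
  have bn: "b \<notin> span (B - {b})" using ind b(1) unfolding dependent_def by blast
  have xn: "x \<notin> span (B - {b})"
  proof
    assume "x \<in> span (B - {b})"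
    hence "x - of_int q *\<^sub>R b' \<in> span (B - {b})" using b' by (intro span_diff span_scale)
    thus False using bn by (simp add: x_def)
  qed
  thus "x \<notin> B - {b}" using span_base[of x "B - {b}"] by blast
  have indC: "independent ?C"
    by (rule independent_insertI[OF xn independent_mono[OF ind]]) blast
  have "zspan ?C \<subseteq> zspan B"
  proof (rule zspan_minimal)
    have "x \<in> zspan B" unfolding x_def using fin b by (intro zspan_add zspan_scale zspan_base)
    thus "?C \<subseteq> zspan B" using zspan_base[OF fin] by blast
  qed (use fin in simp)
  moreover have "b \<in> zspan ?C"
  proof -
    have "x + of_int (- q) *\<^sub>R b' \<in> zspan ?C"
      using fin b' by (intro zspan_add zspan_scale zspan_base) simp_all
    thus ?thesis by (simp add: x_def)
  qed
  hence "B \<subseteq> zspan ?C" using zspan_base[of ?C] fin by blast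
  hence "zspan B \<subseteq> zspan ?C" using fin by (intro zspan_minimal)
  ultimately show "zbasis M ?C" using fin indC MB by (simp add: zbasis_def)
qed

text \<open>Euclid's algorithm on the values of \<open>u\<close>.\<close>

lemma zbasis_reduce:
  assumes M: "zbasis M B" and u: "linear u" "\<And>x. x \<in> M \<Longrightarrow> u x \<in> \<int>"
  shows "\<exists>C b. zbasis M C \<and> (\<forall>v\<in>C - {b}. u v = (0::real))"
  using M
proof (induction "\<Sum>v\<in>B. nat \<lfloor>\<bar>u v\<bar>\<rfloor>" arbitrary: B rule: less_induct)
  case less
  from less.prems have fin: "finite B" and MB: "M = zspan B" by (auto simp: zbasis_def)
  have int: "\<exists>k. u v = of_int k" if "v \<in> B" for v
    using u(2)[of v] zspan_base[OF fin that] MB by (auto elim: Ints_cases)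
  show ?case
  proof (cases "\<exists>b\<in>B. \<exists>b'\<in>B. b \<noteq> b' \<and> u b' \<noteq> 0 \<and> \<bar>u b'\<bar> \<le> \<bar>u b\<bar>")
    case True
    then obtain b b' where b: "b \<in> B" "b' \<in> B" "b \<noteq> b'" "u b' \<noteq> 0" "\<bar>u b'\<bar> \<le> \<bar>u b\<bar>" by blast
    obtain k k' where k: "u b = of_int k" "u b' = of_int k'" using int b by metis
    have "k' \<noteq> 0" "\<bar>k'\<bar> \<le> \<bar>k\<bar>" using b k by auto
    \<comment> \<open>A single subtraction is enough: as k' is non-zero and |k'| is at most |k|,
      adding k' or -k', according to the sign of k * k', lowers |k|. The induction measure is the
      sum of these absolute values.\<close>
    have "\<exists>q. \<bar>k + q * k'\<bar> < \<bar>k\<bar>"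
    proof (cases "k * k' > 0")
      case True
      thus ?thesis using \<open>k' \<noteq> 0\<close> \<open>\<bar>k'\<bar> \<le> \<bar>k\<bar>\<close> by (intro exI[of _ "-1"]) (auto simp: zero_less_mult_iff)
    next
      case False
      thus ?thesis using \<open>k' \<noteq> 0\<close> \<open>\<bar>k'\<bar> \<le> \<bar>k\<bar>\<close> by (intro exI[of _ "1"]) (auto simp: zero_less_mult_iff)
    qed
    then obtain q where q: "\<bar>k + q * k'\<bar> < \<bar>k\<bar>" by blast
    let ?x = "b + of_int q *\<^sub>R b'"
    let ?C = "insert ?x (B - {b})"
    note C = zbasis_shear[OF less.prems b(1-3), of q]
    have ux: "u ?x = of_int (k + q * k')" using k by (simp add: linear_add[OF u(1)] linear_scale[OF u(1)])
    let ?f = "\<lambda>v. nat \<lfloor>\<bar>u v\<bar>\<rfloor>"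
    have fx: "?f ?x = nat \<bar>k + q * k'\<bar>" unfolding ux by (simp only: of_int_abs[symmetric] floor_of_int)
    have fb: "?f b = nat \<bar>k\<bar>" unfolding k(1) by (simp only: of_int_abs[symmetric] floor_of_int)
    have "sum ?f ?C = ?f ?x + sum ?f (B - {b})" using C(2) fin by simp
    moreover have "sum ?f B = ?f b + sum ?f (B - {b})" using fin b(1) by (simp add: sum.remove)
    moreover have "?f ?x < ?f b" unfolding fx fb using q by linarith
    ultimately have "sum ?f ?C < sum ?f B" by linarith
    from less.hyps[OF this C(1)] show ?thesis .
  next
    case False
    \<comment> \<open>Two distinct generators with non-zero values would each have the strictly
      smaller absolute value, so at most one such generator is left.\<close>
    hence *: "u b' = 0 \<or> \<bar>u b\<bar> < \<bar>u b'\<bar>" if "b \<in> B" "b' \<in> B" "b \<noteq> b'" for b b' using that by force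
    have "\<exists>b. \<forall>v\<in>B - {b}. u v = 0"
    proof (rule ccontr)
      assume n: "\<not> ?thesis"
      then obtain v where v: "v \<in> B" "u v \<noteq> 0" by blast
      obtain v' where v': "v' \<in> B" "v' \<noteq> v" "u v' \<noteq> 0" using n by blast
      show False using *[of v v'] *[of v' v] v v' by force
    qed
    thus ?thesis using less.prems by blast
  qed
qed

text \<open>After reduction a single generator \<open>w\<close> carries a non-zero value. A
  combination lies in the kernel exactly if its coefficient at \<open>w\<close> is zero, both over
  the integers and over the reals, so the other generators are a basis of the kernel in both
  senses.\<close>

lemma zbasis_kernel:
  assumes M: "zbasis M B" and u: "linear u" "\<And>x. x \<in> M \<Longrightarrow> u x \<in> \<int>" and nz: "x0 \<in> M" "u x0 \<noteq> (0::real)"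
  obtains C w where "w \<notin> C" "zbasis M (insert w C)" "u w \<noteq> 0" "zbasis (M \<inter> {x. u x = 0}) C"
    "span C = span M \<inter> {x. u x = 0}"
proof -
  obtain D w where D: "zbasis M D" "\<forall>v\<in>D - {w}. u v = 0" using zbasis_reduce[OF M u] by blast
  let ?C = "D - {w}"
  have fin: "finite D" and ind: "independent D" and MD: "M = zspan D" using D(1) by (auto simp: zbasis_def)
  have u0: "u x = 0" if "x \<in> span ?C" for x
    using linear_eq_0_on_span[OF u(1) _ that] D(2) by blast
  have MsD: "M \<subseteq> span D" unfolding MD by (rule zspan_subset_span)
  have w: "w \<in> D"
  proof (rule ccontr)
    assume "w \<notin> D"
    hence "?C = D" by blast
    hence "x0 \<in> span ?C" using nz(1) MsD by auto
    thus False using u0[of x0] nz by simp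
  qed
  hence ins: "insert w ?C = D" by blast
  have sp: "span M = span D" unfolding MD by (rule span_zspan[OF fin])
  have uw: "u w \<noteq> 0"
  proof
    assume "u w = 0"
    hence "u x = 0" if "x \<in> D" for x using D(2) that by blast
    hence "u x0 = 0" using linear_eq_0_on_span[OF u(1), of D x0] nz(1) MsD by blast
    thus False using nz by simp
  qed
  have k1: "M \<inter> {x. u x = 0} = zspan ?C"
  proof (intro set_eqI iffI)
    fix x assume x: "x \<in> M \<inter> {x. u x = 0}"
    then obtain c :: "'a \<Rightarrow> int" where "x = (\<Sum>v\<in>D. of_int (c v) *\<^sub>R v)" unfolding MD by (auto elim: zspanE)
    hence c: "x = of_int (c w) *\<^sub>R w + (\<Sum>v\<in>?C. of_int (c v) *\<^sub>R v)" using fin w by (simp add: sum.remove)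
    have y: "(\<Sum>v\<in>?C. of_int (c v) *\<^sub>R v) \<in> zspan ?C" by (rule zspanI)
    hence "u (\<Sum>v\<in>?C. of_int (c v) *\<^sub>R v) = 0" by (intro u0 subsetD[OF zspan_subset_span])
    hence "u x = of_int (c w) * u w" unfolding c by (simp add: linear_add[OF u(1)] linear_scale[OF u(1)])
    hence "c w = 0" using x uw by simp
    thus "x \<in> zspan ?C" using y c by simp
  next
    fix x assume x: "x \<in> zspan ?C"
    moreover have "zspan ?C \<subseteq> zspan D" using fin zspan_base[OF fin] by (intro zspan_minimal) auto
    moreover have "u x = 0" using x by (intro u0 subsetD[OF zspan_subset_span])
    ultimately show "x \<in> M \<inter> {x. u x = 0}" using MD by auto
  qed
  have k2: "span ?C = span M \<inter> {x. u x = 0}"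
  proof (intro set_eqI iffI)
    fix x assume "x \<in> span ?C"
    thus "x \<in> span M \<inter> {x. u x = 0}" using u0[of x] span_mono[of ?C D] sp by auto
  next
    fix x assume x: "x \<in> span M \<inter> {x. u x = 0}"
    hence "x \<in> span (insert w ?C)" using sp ins by auto
    then obtain k where k: "x - k *\<^sub>R w \<in> span ?C" unfolding span_insert by blast
    have "u x - k * u w = 0" using u0[OF k] by (simp add: linear_diff[OF u(1)] linear_scale[OF u(1)])
    hence "k = 0" using x uw by auto
    thus "x \<in> span ?C" using k by simp
  qed
  have "zbasis (M \<inter> {x. u x = 0}) ?C"
    unfolding zbasis_def using fin independent_mono[OF ind, of ?C] k1 by auto
  thus ?thesis using that[of w ?C] D(1) ins uw k2 by auto
qed

text \<open>The forms are imposed one at a time. The equation of real spans records that the lattice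
  points have full rank in the subspace cut out by integral forms.\<close>

lemma zbasis_kernels:
  assumes M: "zbasis M B" and F: "finite F" "\<And>u. u \<in> F \<Longrightarrow> linear u \<and> (\<forall>x\<in>M. u x \<in> \<int>)"
  shows "\<exists>C. zbasis (M \<inter> {x. \<forall>u\<in>F. u x = (0::real)}) C \<and> span C = span M \<inter> {x. \<forall>u\<in>F. u x = 0}"
  using F
proof (induction F rule: finite_induct)
  case empty
  have "span B = span M" using M span_zspan[of B] by (simp add: zbasis_def)
  then show ?case using M by auto
next
  case (insert u F)
  let ?M = "M \<inter> {x. \<forall>u\<in>F. u x = 0}"
  obtain C where C: "zbasis ?M C" "span C = span M \<inter> {x. \<forall>u\<in>F. u x = 0}"
    using insert by blast
  have u: "linear u" "\<And>x. x \<in> ?M \<Longrightarrow> u x \<in> \<int>" using insert.prems by auto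
  have sM: "span ?M = span C" using C(1) span_zspan[of C] by (simp add: zbasis_def)
  have e: "?M \<inter> {x. u x = 0} = M \<inter> {x. \<forall>u\<in>insert u F. u x = 0}"
    "span M \<inter> {x. \<forall>u\<in>F. u x = 0} \<inter> {x. u x = 0} = span M \<inter> {x. \<forall>u\<in>insert u F. u x = 0}" by auto
  show ?case
  proof (cases "\<forall>x\<in>?M. u x = 0")
    case True
    hence "?M \<inter> {x. u x = 0} = ?M" by blast
    hence h1: "zbasis (?M \<inter> {x. u x = 0}) C" using C(1) by simp
    have "u x = 0" if "x \<in> span C" for x
      using linear_eq_0_on_span[OF u(1), of ?M x] True that unfolding sM by blast
    hence "span C \<inter> {x. u x = 0} = span C" by blast
    hence "span C = span M \<inter> {x. \<forall>u\<in>F. u x = 0} \<inter> {x. u x = 0}" unfolding C(2) ..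
    with h1 show ?thesis unfolding e by (intro exI conjI)
  next
    case False
    then obtain x0 where x0: "x0 \<in> ?M" "u x0 \<noteq> 0" by blast
    obtain D where D: "zbasis (?M \<inter> {x. u x = 0}) D" "span D = span ?M \<inter> {x. u x = 0}"
      by (rule zbasis_kernel[OF C(1) u x0], assumption, rule that)
    from D(2) have "span D = span M \<inter> {x. \<forall>u\<in>F. u x = 0} \<inter> {x. u x = 0}" unfolding sM C(2) .
    with D(1) show ?thesis unfolding e by (intro exI conjI)
  qed
qed

section \<open>Direction spaces of integral polyhedra\<close>

lemma dirs_shift:
  assumes "a \<in> affine hull S"
  shows "dirs S = (\<lambda>x. x - a) ` (affine hull S)"
proof (intro set_eqI iffI)
  fix v assume "v \<in> dirs S"
  then obtain x y where xy: "v = x - y" "x \<in> affine hull S" "y \<in> affine hull S" unfolding dirs_def by blast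
  have "a + 1 *\<^sub>R (x - y) \<in> affine hull S"
    using mem_affine_3_minus[OF affine_affine_hull assms xy(2,3), of 1] by simp
  moreover have "v = (a + 1 *\<^sub>R (x - y)) - a" using xy by simp
  ultimately show "v \<in> (\<lambda>x. x - a) ` (affine hull S)" by blast
next
  fix v assume "v \<in> (\<lambda>x. x - a) ` (affine hull S)"
  thus "v \<in> dirs S" unfolding dirs_def using assms by blast
qed

lemma dirs_iff: "a \<in> affine hull S \<Longrightarrow> a + v \<in> affine hull S \<longleftrightarrow> v \<in> dirs S"
  by (subst dirs_shift, assumption) (force simp: image_iff algebra_simps)

lemma dirs_diff: "x \<in> affine hull S \<Longrightarrow> y \<in> affine hull S \<Longrightarrow> x - y \<in> dirs S"
  unfolding dirs_def by blast

lemma subspace_dirs: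
  assumes "S \<noteq> {}"
  shows "subspace (dirs S)"
proof -
  obtain a where a: "a \<in> affine hull S" using assms by (meson ex_in_conv hull_inc)
  have "dirs S = (\<lambda>x. - a + x) ` (affine hull S)" unfolding dirs_shift[OF a] by simp
  thus ?thesis using affine_diffs_subspace[OF affine_affine_hull a] by simp
qed

lemma dim_dirs:
  assumes "S \<noteq> {}"
  shows "int (dim (dirs S)) = aff_dim S"
proof -
  obtain a where a: "a \<in> affine hull S" using assms by (meson ex_in_conv hull_inc)
  have "dirs S = (\<lambda>x. - a + x) ` (affine hull S)" unfolding dirs_shift[OF a] by simp
  moreover have "a \<in> affine hull (affine hull S)" using a by (simp add: hull_hull)
  ultimately show ?thesis using aff_dim_eq_dim[of a "affine hull S"] by (simp add: aff_dim_affine_hull)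
qed

lemma dirs_mono: "S \<subseteq> T \<Longrightarrow> dirs S \<subseteq> dirs T"
  unfolding dirs_def using hull_mono[of S T affine] by blast

lemma dirs_subset_subspace:
  assumes "S \<subseteq> V" "subspace V"
  shows "dirs S \<subseteq> V"
proof -
  have "affine hull S \<subseteq> V" using assms by (intro hull_minimal subspace_imp_affine)
  thus ?thesis unfolding dirs_def using assms(2) by (auto intro: subspace_diff)
qed

lemma dirs_span [simp]: "dirs (span N) = span N"
proof -
  have "affine hull (span N) = span N" by (intro hull_same subspace_imp_affine subspace_span)
  moreover have "0 \<in> span N" by (rule span_zero)
  ultimately have "dirs (span N) = (\<lambda>x. x - 0) ` (span N)" using dirs_shift[of 0 "span N"] by metis
  thus ?thesis by simp
qed

text \<open>This is used for one-sided limits along rays: a short segment that starts at a relative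
  interior point and stays in the affine hull stays in the set.\<close>

lemma rel_interior_tendsto:
  fixes p :: "'a::euclidean_space"
  assumes p: "p \<in> rel_interior S" and q: "(q \<longlongrightarrow> p) F" and e: "\<forall>\<^sub>F s in F. q s \<in> affine hull S"
  shows "\<forall>\<^sub>F s in F. q s \<in> S"
proof -
  obtain r where r: "r > 0" "ball p r \<inter> affine hull S \<subseteq> S" using p by (auto simp: mem_rel_interior_ball)
  have "\<forall>\<^sub>F s in F. q s \<in> ball p r"
    using tendstoD[OF q r(1)] by eventually_elim (simp add: dist_commute)
  with e show ?thesis by eventually_elim (use r in blast)
qed

lemma linear_inner_rep:
  assumes "linear (u :: 'a::euclidean_space \<Rightarrow> real)"
  shows "u x = adjoint u 1 \<bullet> x"
  using adjoint_works[OF assms, of x 1] by (simp add: inner_commute)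

lemma integral_polyhedron_polyhedron:
  assumes "integral_polyhedron N \<sigma>"
  shows "polyhedron \<sigma>"
proof -
  obtain F where F: "finite F" "\<forall>(u, c) \<in> F. u \<in> dual_lattice N"
    "\<sigma> = {\<omega> \<in> span N. \<forall>(u, c) \<in> F. u \<omega> \<ge> c}" using assms unfolding integral_polyhedron_def by blast
  have "\<sigma> = span N \<inter> \<Inter>((\<lambda>(u, c). {x. u x \<ge> c}) ` F)" unfolding F(3) by auto
  moreover have "polyhedron (span N)" by (simp add: affine_imp_polyhedron subspace_imp_affine)
  moreover have "polyhedron {x. u x \<ge> c}" if "(u, c) \<in> F" for u c
  proof -
    have "linear u" using F(2) that by (auto simp: dual_lattice_def)
    hence "{x. u x \<ge> c} = {x. adjoint u 1 \<bullet> x \<ge> c}" using linear_inner_rep[of u] by simp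
    thus ?thesis using polyhedron_halfspace_ge[where a="adjoint u 1" and b=c] by simp
  qed
  hence "polyhedron (\<Inter>((\<lambda>(u, c). {x. u x \<ge> c}) ` F))"
    using F(1) by (intro polyhedron_Inter) auto
  ultimately show ?thesis by simp
qed

lemma integral_polyhedron_subset: "integral_polyhedron N \<sigma> \<Longrightarrow> \<sigma> \<subseteq> span N"
  unfolding integral_polyhedron_def by blast

text \<open>\<open>E\<close> collects the inequalities that are equalities on all of \<sigma>. At a
  point where all the others are strict, small moves along the kernel of the forms in
  \<open>E\<close> remain in \<sigma>, so this kernel is the whole direction space. Hence that space
  is rational.\<close>

lemma integral_polyhedron_dirs:
  assumes "integral_polyhedron N \<sigma>" "\<sigma> \<noteq> {}"
  obtains I where "finite I" "\<And>u. u \<in> I \<Longrightarrow> u \<in> dual_lattice N" "dirs \<sigma> = span N \<inter> {x. \<forall>u\<in>I. u x = 0}"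
proof -
  obtain F where F: "finite F" "\<forall>(u, c) \<in> F. u \<in> dual_lattice N"
    and \<sigma>: "\<sigma> = {\<omega> \<in> span N. \<forall>(u, c) \<in> F. u \<omega> \<ge> c}" using assms unfolding integral_polyhedron_def by blast
  have lin: "linear u" if "(u, c) \<in> F" for u c using F(2) that by (auto simp: dual_lattice_def)
  define E where "E = {(u, c) \<in> F. \<forall>x\<in>\<sigma>. u x = c}"
  have cvx: "convex \<sigma>" using integral_polyhedron_polyhedron[OF assms(1)] polyhedron_imp_convex by blast
  \<comment> \<open>An inequality outside \<open>E\<close> is strict somewhere on \<sigma>. Passing
    to midpoints makes finitely many of them strict at one point.\<close>
  have "\<exists>p\<in>\<sigma>. \<forall>(u, c)\<in>G. u p > c" if "finite G" "G \<subseteq> F - E" for G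
    using that
  proof (induction G rule: finite_induct)
    case empty
    then show ?case using assms(2) by auto
  next
    case (insert g G)
    obtain u c where g: "g = (u, c)" by (cases g)
    obtain p where p: "p \<in> \<sigma>" "\<forall>(u, c)\<in>G. u p > c" using insert by blast
    have uc: "(u, c) \<in> F" using insert.prems g by blast
    have "(u, c) \<notin> E" using insert.prems g by blast
    then obtain x where x: "x \<in> \<sigma>" "u x \<noteq> c" using uc unfolding E_def by blast
    hence ux: "u x > c" using uc \<sigma> by force
    let ?q = "(1/2) *\<^sub>R p + (1/2) *\<^sub>R x"
    have q: "?q \<in> \<sigma>" using convexD[OF cvx p(1) x(1), of "1/2" "1/2"] by simp
    have qv: "u' ?q = (u' p + u' x) / 2" if "(u', c') \<in> F" for u' c'
      using lin[OF that] by (simp add: linear_add linear_scale)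
    have ge: "u' y \<ge> c'" if "(u', c') \<in> F" "y \<in> \<sigma>" for u' c' y using that \<sigma> by blast
    have "u' ?q > c'" if "(u', c') \<in> insert g G" for u' c'
    proof -
      have F': "(u', c') \<in> F" using that insert.prems by blast
      show ?thesis
      proof (cases "(u', c') = g")
        case True
        thus ?thesis using qv[OF F'] ux ge[OF F' p(1)] g by simp
      next
        case False
        hence "u' p > c'" using p(2) that by blast
        thus ?thesis using qv[OF F'] ge[OF F' x(1)] by simp
      qed
    qed
    thus ?case using q by blast
  qed
  from this[of "F - E"] obtain p where p: "p \<in> \<sigma>" "\<And>u c. (u, c) \<in> F - E \<Longrightarrow> u p > c"
    using F(1) by fastforce
  let ?I = "fst ` E"
  have "dirs \<sigma> = span N \<inter> {x. \<forall>u\<in>?I. u x = 0}"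
  proof (intro set_eqI iffI)
    fix v assume "v \<in> dirs \<sigma>"
    then obtain x y where xy: "v = x - y" "x \<in> affine hull \<sigma>" "y \<in> affine hull \<sigma>" unfolding dirs_def by blast
    have s: "affine hull \<sigma> \<subseteq> span N" using \<sigma> by (intro hull_minimal) (auto simp: subspace_imp_affine)
    have "u v = 0" if "(u, c) \<in> E" for u c
    proof -
      have lu: "linear u" using that lin unfolding E_def by blast
      have "affine {x. u x = c}"
        using affine_hyperplane[of "adjoint u 1" c] linear_inner_rep[OF lu] by simp
      hence "affine hull \<sigma> \<subseteq> {x. u x = c}" using that unfolding E_def by (intro hull_minimal) auto
      hence "u x = c" "u y = c" using xy by auto
      thus ?thesis using xy(1) lu by (simp add: linear_diff)
    qed
    moreover have "v \<in> span N" using s xy by (auto intro: span_diff)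
    ultimately show "v \<in> span N \<inter> {x. \<forall>u\<in>?I. u x = 0}" by auto
  next
    fix v assume v: "v \<in> span N \<inter> {x. \<forall>u\<in>?I. u x = 0}"
    have "\<forall>\<^sub>F e in at_right 0. u (p + e *\<^sub>R v) \<ge> c" if uc: "(u, c) \<in> F" for u c
    proof (cases "(u, c) \<in> E")
      case True
      hence "u v = 0" using v by force
      moreover have "u p \<ge> c" using p(1) uc \<sigma> by blast
      ultimately show ?thesis using lin[OF uc] by (simp add: linear_add linear_scale)
    next
      case False
      hence "u p > c" using p(2) uc by blast
      moreover have "((\<lambda>e. u p + e * u v) \<longlongrightarrow> u p + 0 * u v) (at_right 0)" by (intro tendsto_intros)
      ultimately have "\<forall>\<^sub>F e in at_right 0. u p + e * u v > c" by (intro order_tendstoD(1)) auto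
      thus ?thesis
        by eventually_elim (simp add: linear_add[OF lin[OF uc]] linear_scale[OF lin[OF uc]])
    qed
    hence "\<forall>\<^sub>F e in at_right 0. \<forall>(u, c)\<in>F. u (p + e *\<^sub>R v) \<ge> c"
      using F(1) by (intro eventually_ball_finite) auto
    hence "\<forall>\<^sub>F e in at_right (0::real). e > 0 \<and> (\<forall>(u, c)\<in>F. u (p + e *\<^sub>R v) \<ge> c)"
      using eventually_at_right_less by (rule eventually_conj[rotated])
    then obtain e where e: "e > 0" "\<forall>(u, c)\<in>F. u (p + e *\<^sub>R v) \<ge> c"
      using eventually_happens trivial_limit_at_right_real by blast
    have "p + e *\<^sub>R v \<in> \<sigma>"
      using e(2) p(1) v unfolding \<sigma> by (auto intro: span_add span_scale)
    hence "(p + e *\<^sub>R v) - p \<in> dirs \<sigma>" using p(1) by (intro dirs_diff hull_inc)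
    hence "e *\<^sub>R v \<in> dirs \<sigma>" by simp
    from subspace_scale[OF subspace_dirs[OF assms(2)] this, of "1/e"]
    show "v \<in> dirs \<sigma>" using e(1) by simp
  qed
  moreover have "finite ?I"
    using F(1) by (intro finite_imageI finite_subset[of E F]) (auto simp: E_def)
  moreover have "u \<in> dual_lattice N" if "u \<in> ?I" for u using that F(2) unfolding E_def by auto
  ultimately show ?thesis using that by blast
qed

text \<open>Since the direction space is cut out by integral forms, its lattice points span it; the
  volume on \<sigma> can therefore be normalised by the lattice.\<close>

lemma lattice_of_zbasis:
  assumes N: "is_lattice N" and \<sigma>: "integral_polyhedron N \<sigma>" "\<sigma> \<noteq> {}"
  obtains C where "zbasis (lattice_of N \<sigma>) C" "span C = dirs \<sigma>"
proof -
  obtain B where B: "zbasis N B" using N unfolding is_lattice_def lattice_basis_zbasis by blast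
  obtain I where I: "finite I" "\<And>u. u \<in> I \<Longrightarrow> u \<in> dual_lattice N" "dirs \<sigma> = span N \<inter> {x. \<forall>u\<in>I. u x = 0}"
    using integral_polyhedron_dirs[OF \<sigma>] by blast
  have "linear u \<and> (\<forall>x\<in>N. u x \<in> \<int>)" if "u \<in> I" for u using I(2)[OF that] unfolding dual_lattice_def by blast
  from zbasis_kernels[OF B I(1) this] obtain C where
    C: "zbasis (N \<inter> {x. \<forall>u\<in>I. u x = 0}) C" "span C = span N \<inter> {x. \<forall>u\<in>I. u x = 0}" by blast
  have "lattice_of N \<sigma> = N \<inter> {x. \<forall>u\<in>I. u x = 0}"
    unfolding lattice_of_def I(3) using span_superset[of N] by blast
  thus ?thesis using C I(3) that by auto
qed

lemma lattice_of_basis: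
  assumes "is_lattice N" "integral_polyhedron N \<sigma>" "\<sigma> \<noteq> {}" "lattice_basis (lattice_of N \<sigma>) es"
  shows "is_basis es (dirs \<sigma>)"
proof -
  obtain C where C: "zbasis (lattice_of N \<sigma>) C" "span C = dirs \<sigma>" using lattice_of_zbasis[OF assms(1-3)] by blast
  hence "span (lattice_of N \<sigma>) = dirs \<sigma>" using span_zspan[of C] by (simp add: zbasis_def)
  thus ?thesis using lattice_basis_is_basis[OF assms(4)] by simp
qed

lemma lattice_of_basis_exists:
  assumes "is_lattice N" "integral_polyhedron N \<sigma>" "\<sigma> \<noteq> {}"
  shows "\<exists>es. lattice_basis (lattice_of N \<sigma>) es"
  using lattice_of_zbasis[OF assms] zbasis_imp_lattice_basis by metis

lemma zspan_insert:
  assumes "finite D" "w \<notin> D"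
  shows "zspan (insert w D) = {y + of_int k *\<^sub>R w | (y :: 'a::euclidean_space) (k :: int). y \<in> zspan D}"
proof (intro set_eqI iffI)
  fix x assume "x \<in> zspan (insert w D)"
  then obtain c :: "'a \<Rightarrow> int" where "x = (\<Sum>v\<in>insert w D. of_int (c v) *\<^sub>R v)" by (rule zspanE)
  hence "x = (\<Sum>v\<in>D. of_int (c v) *\<^sub>R v) + of_int (c w) *\<^sub>R w" using assms by simp
  moreover have "(\<Sum>v\<in>D. of_int (c v) *\<^sub>R v) \<in> zspan D" by (rule zspanI)
  ultimately show "x \<in> {y + of_int k *\<^sub>R w | y (k :: int). y \<in> zspan D}" by blast
next
  fix x assume "x \<in> {y + of_int k *\<^sub>R w | y (k :: int). y \<in> zspan D}"
  then obtain y k where x: "x = y + of_int k *\<^sub>R w" "y \<in> zspan D" by blast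
  have fin: "finite (insert w D)" using assms by simp
  have "zspan D \<subseteq> zspan (insert w D)"
    using zspan_base[OF fin] by (intro zspan_minimal assms(1)) blast
  thus "x \<in> zspan (insert w D)" unfolding x(1)
    using x(2) zspan_base[OF fin, of w] by (intro zspan_add zspan_scale) auto
qed

lemma linear_separating:
  assumes "subspace L" "v \<notin> L"
  obtains u :: "'a::euclidean_space \<Rightarrow> real" where "linear u" "\<And>x. x \<in> L \<Longrightarrow> u x = 0" "u v = 1"
proof -
  obtain B where B: "independent B" "B \<subseteq> L" "L \<subseteq> span B"
    by (rule maximal_independent_subset[of L], rule that)
  have s: "span B = L" by (rule subset_antisym[OF span_minimal[OF B(2) assms(1)] B(3)])
  have vB: "v \<notin> B" using assms(2) B(2) by blast
  have "v \<notin> span B" unfolding s by (rule assms(2))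
  hence "independent (insert v B)" using B(1) by (rule independent_insertI)
  then obtain l :: "'a \<Rightarrow> real" where l: "linear l" "\<forall>x\<in>insert v B. l x = (if x = v then 1 else 0)"
    using linear_independent_extend[of "insert v B" "\<lambda>x. if x = v then 1 else 0"] by blast
  have l0: "l x = 0" if "x \<in> B" for x using l(2) that vB by auto
  have "l x = 0" if "x \<in> L" for x
    by (rule linear_eq_0_on_span[OF l(1) l0, of B x]) (use that s in simp_all)
  moreover have "l v = 1" using l(2) by simp
  ultimately show ?thesis using l(1) that by blast
qed

section \<open>Facets, lattice normal vectors and conormals\<close>

locale facet =
  fixes N \<sigma> \<tau> :: "'a::euclidean_space set"
  assumes N: "is_lattice N"
    and \<sigma>: "integral_polyhedron N \<sigma>"
    and \<tau>: "integral_polyhedron N \<tau>"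
    and face: "\<tau> face_of \<sigma>"
    and ne: "\<tau> \<noteq> {}"
    and dim: "aff_dim \<sigma> = aff_dim \<tau> + 1"
begin

abbreviation "w \<equiv> normal_vector N \<sigma> \<tau>"

lemma subset: "\<tau> \<subseteq> \<sigma>"
  using face by (rule face_of_imp_subset)

lemma \<sigma>_ne: "\<sigma> \<noteq> {}"
  using subset ne by blast

lemma convex_\<sigma>: "convex \<sigma>" and convex_\<tau>: "convex \<tau>"
  using integral_polyhedron_polyhedron[OF \<sigma>] integral_polyhedron_polyhedron[OF \<tau>] polyhedron_imp_convex by blast+

lemma closed_\<sigma>: "closed \<sigma>" and closed_\<tau>: "closed \<tau>"
  using integral_polyhedron_polyhedron[OF \<sigma>] integral_polyhedron_polyhedron[OF \<tau>] polyhedron_imp_closed by blast+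

lemma dirs_sub: "dirs \<tau> \<subseteq> dirs \<sigma>"
  using subset by (rule dirs_mono)

lemma sub\<sigma>: "subspace (dirs \<sigma>)" and sub\<tau>: "subspace (dirs \<tau>)"
  using subspace_dirs \<sigma>_ne ne by blast+

lemma dim_dirs_eq: "dim (dirs \<sigma>) = dim (dirs \<tau>) + 1"
  using dim_dirs[OF \<sigma>_ne] dim_dirs[OF ne] dim by linarith

text \<open>Among the integral forms cutting out the directions of \<tau>, one is non-zero on those
  of \<sigma>. By comparison of dimensions its kernel there is exactly the direction space of
  \<tau>, so reducing the lattice of \<sigma> by this form splits off the generator
  \<open>w\<close>.\<close>

lemma exists_complement:
  obtains w where "w \<in> lattice_of N \<sigma>" "w \<notin> dirs \<tau>"
    "lattice_of N \<sigma> = {u + of_int k *\<^sub>R w | (u :: 'a) (k :: int). u \<in> lattice_of N \<tau>}"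
    "\<And>v. v \<in> dirs \<sigma> \<Longrightarrow> \<exists>r. v - r *\<^sub>R w \<in> dirs \<tau>"
proof -
  obtain I where I: "finite I" "\<And>u. u \<in> I \<Longrightarrow> u \<in> dual_lattice N" "dirs \<tau> = span N \<inter> {x. \<forall>u\<in>I. u x = 0}"
    using integral_polyhedron_dirs[OF \<tau> ne] by blast
  have sN: "dirs \<sigma> \<subseteq> span N"
    by (intro dirs_subset_subspace integral_polyhedron_subset[OF \<sigma>] subspace_span)
  have "\<exists>u\<in>I. \<exists>v\<in>dirs \<sigma>. u v \<noteq> 0"
  proof (rule ccontr)
    assume "\<not> ?thesis"
    hence "dirs \<sigma> \<subseteq> dirs \<tau>" unfolding I(3) using sN by blast
    thus False using dim_subset[of "dirs \<sigma>" "dirs \<tau>"] dim_dirs_eq by linarith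
  qed
  then obtain u v where uv: "u \<in> I" "v \<in> dirs \<sigma>" "u v \<noteq> 0" by blast
  have lin: "linear u" and uint: "\<And>x. x \<in> N \<Longrightarrow> u x \<in> \<int>"
    using I(2)[OF uv(1)] unfolding dual_lattice_def by blast+
  let ?M = "lattice_of N \<sigma>"
  obtain C where C: "zbasis ?M C" "span C = dirs \<sigma>" by (rule lattice_of_zbasis[OF N \<sigma> \<sigma>_ne])
  have spM: "span ?M = dirs \<sigma>" using C span_zspan[of C] unfolding zbasis_def by simp
  have "\<exists>x\<in>?M. u x \<noteq> 0"
  proof (rule ccontr)
    assume "\<not> ?thesis"
    hence "u v = 0" using linear_eq_0_on_span[OF lin, of ?M v] uv(2) unfolding spM by blast
    thus False using uv(3) by simp
  qed
  then obtain x0 where x0: "x0 \<in> ?M" "u x0 \<noteq> 0" by blast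
  have uM: "u x \<in> \<int>" if "x \<in> ?M" for x using that uint unfolding lattice_of_def by blast
  obtain D w where D: "w \<notin> D" "zbasis ?M (insert w D)" "u w \<noteq> 0" "zbasis (?M \<inter> {x. u x = 0}) D"
    "span D = span ?M \<inter> {x. u x = 0}"
    by (rule zbasis_kernel[OF C(1) lin uM x0], assumption, rule that)
  have finD: "finite D" using D(4) unfolding zbasis_def by blast
  have spw: "span (insert w D) = dirs \<sigma>"
    using D(2) span_zspan[of "insert w D"] spM unfolding zbasis_def by simp
  have d1: "dim (dirs \<sigma>) = card (insert w D)"
    using D(2) dim_span_eq_card_independent[of "insert w D"] unfolding zbasis_def spw by blast
  have d2: "dim (span D) = card D"
    using D(4) dim_span_eq_card_independent[of D] unfolding zbasis_def by blast
  have sub: "dirs \<tau> \<subseteq> span D"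
    unfolding D(5) spM using dirs_sub uv(1) I(3) by blast
  have eq: "dirs \<tau> = span D"
    by (rule subspace_dim_equal[OF sub\<tau> subspace_span sub]) (use d1 d2 finD D(1) dim_dirs_eq in simp)
  have "dirs \<tau> = dirs \<sigma> \<inter> {x. u x = 0}" using eq unfolding D(5) spM .
  hence "lattice_of N \<tau> = ?M \<inter> {x. u x = 0}" unfolding lattice_of_def by blast
  moreover have "?M \<inter> {x. u x = 0} = zspan D" using D(4) unfolding zbasis_def by (elim conjE)
  ultimately have l\<tau>: "lattice_of N \<tau> = zspan D" by (rule trans)
  have "?M = zspan (insert w D)" using D(2) unfolding zbasis_def by blast
  hence M: "?M = {y + of_int k *\<^sub>R w | y (k :: int). y \<in> lattice_of N \<tau>}"
    unfolding l\<tau> zspan_insert[OF finD D(1)] .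
  have "w \<in> ?M" using D(2) zspan_base[of "insert w D" w] unfolding zbasis_def by simp
  moreover have "w \<notin> dirs \<tau>" unfolding eq D(5) using D(3) by blast
  moreover have "\<exists>r. v - r *\<^sub>R w \<in> dirs \<tau>" if "v \<in> dirs \<sigma>" for v
    using that unfolding spw[symmetric] eq span_insert by blast
  ultimately show ?thesis using that M by blast
qed

text \<open>The complement is determined only up to sign. A point y of \<sigma> outside the affine
  hull of \<tau> decides: y - a has a non-zero component r along the complement, and the sign of r
  says whether w or -w points into \<sigma>.\<close>

lemma normal_exists: "\<exists>w. w \<in> lattice_of N \<sigma> \<and>
     lattice_of N \<sigma> = {u + of_int k *\<^sub>R w | (u :: 'a) (k :: int). u \<in> lattice_of N \<tau>} \<and>
     (\<exists>a\<in>\<tau>. \<exists>t>0. a + t *\<^sub>R w \<in> \<sigma>)"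
proof -
  obtain w where w: "w \<in> lattice_of N \<sigma>" "w \<notin> dirs \<tau>"
    "lattice_of N \<sigma> = {u + of_int k *\<^sub>R w | (u :: 'a) (k :: int). u \<in> lattice_of N \<tau>}"
    "\<And>v. v \<in> dirs \<sigma> \<Longrightarrow> \<exists>r. v - r *\<^sub>R w \<in> dirs \<tau>" by (rule exists_complement) (rule that)
  obtain a where a: "a \<in> rel_interior \<tau>" using rel_interior_eq_empty[OF convex_\<tau>] ne by blast
  have at: "a \<in> \<tau>" using a rel_interior_subset by blast
  have "\<not> \<sigma> \<subseteq> affine hull \<tau>"
  proof
    assume "\<sigma> \<subseteq> affine hull \<tau>"
    hence "aff_dim \<sigma> \<le> aff_dim \<tau>" using aff_dim_subset[of \<sigma> "affine hull \<tau>"] by (simp add: aff_dim_affine_hull)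
    thus False using dim by linarith
  qed
  then obtain y where y: "y \<in> \<sigma>" "y \<notin> affine hull \<tau>" by blast
  have aa: "a \<in> affine hull \<tau>" using at by (rule hull_inc)
  have "y - a \<in> dirs \<sigma>" using y(1) at subset by (intro dirs_diff hull_inc) auto
  then obtain r where r: "y - a - r *\<^sub>R w \<in> dirs \<tau>" using w(4) by blast
  define v where "v = y - a - r *\<^sub>R w"
  have v: "v \<in> dirs \<tau>" using r by (simp add: v_def)
  have "r \<noteq> 0"
  proof
    assume "r = 0"
    hence "a + (y - a) \<in> affine hull \<tau>" using dirs_iff[OF aa, of "y - a"] r by simp
    thus False using y by simp
  qed
  have "\<forall>\<^sub>F s in at_right 0. a + s *\<^sub>R v \<in> \<tau>"
  proof (rule rel_interior_tendsto[OF a])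
    have "((\<lambda>s. a + s *\<^sub>R v) \<longlongrightarrow> a + 0 *\<^sub>R v) (at_right 0)" by (intro tendsto_intros)
    thus "((\<lambda>s. a + s *\<^sub>R v) \<longlongrightarrow> a) (at_right 0)" by simp
    show "\<forall>\<^sub>F s in at_right 0. a + s *\<^sub>R v \<in> affine hull \<tau>"
      using dirs_iff[OF aa] v subspace_scale[OF sub\<tau>] by (intro always_eventually) blast
  qed
  moreover have "\<forall>\<^sub>F s in at_right 0. (s::real) < 1" by (rule eventually_at_right_real[THEN eventually_mono, of 0 1]) auto
  moreover have "\<forall>\<^sub>F s in at_right 0. (s::real) > 0" by (rule eventually_at_right_less)
  ultimately have "\<forall>\<^sub>F s in at_right 0. a + s *\<^sub>R v \<in> \<tau> \<and> s < 1 \<and> s > 0" by eventually_elim blast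
  then obtain s where s: "a + s *\<^sub>R v \<in> \<tau>" "s < 1" "s > 0"
    using eventually_happens trivial_limit_at_right_real by blast
  \<comment> \<open>The point lies on the segment from a to y. It is reached from a + s v, still in
    \<tau> for small s, by moving only along w.\<close>
  have "(1 - s) *\<^sub>R a + s *\<^sub>R y \<in> \<sigma>" using s y(1) at subset convexD[OF convex_\<sigma>, of a y "1 - s" s] by auto
  also have "(1 - s) *\<^sub>R a + s *\<^sub>R y = a + s *\<^sub>R v + (s * r) *\<^sub>R w" by (simp add: v_def algebra_simps)
  finally have q: "a + s *\<^sub>R v + (s * r) *\<^sub>R w \<in> \<sigma>" .
  show ?thesis
  proof (cases "r > 0")
    case True
    hence "s * r > 0" using s by simp
    with q s w(1,3) show ?thesis by blast
  next
    case False
    hence neg: "s * (- r) > 0" using s \<open>r \<noteq> 0\<close> by (simp add: mult_pos_neg)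
    have m: "of_int k *\<^sub>R (- w) = of_int (- k) *\<^sub>R w" for k :: int by simp
    have "lattice_of N \<sigma> = {u + of_int k *\<^sub>R (- w) | (u :: 'a) (k :: int). u \<in> lattice_of N \<tau>}" (is "_ = ?R")
    proof (intro set_eqI iffI)
      fix x assume "x \<in> lattice_of N \<sigma>"
      then obtain u k where uk: "x = u + of_int k *\<^sub>R w" "u \<in> lattice_of N \<tau>" using w(3) by blast
      hence "x = u + of_int (- k) *\<^sub>R (- w)" by simp
      thus "x \<in> ?R" using uk(2) by blast
    next
      fix x assume "x \<in> ?R"
      then obtain u k where uk: "x = u + of_int k *\<^sub>R (- w)" "u \<in> lattice_of N \<tau>" by blast
      hence "x = u + of_int (- k) *\<^sub>R w" by simp
      thus "x \<in> lattice_of N \<sigma>" using uk(2) w(3) by blast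
    qed
    moreover have "- w \<in> lattice_of N \<sigma>"
    proof -
      have "0 \<in> lattice_of N \<tau>"
      proof -
        obtain D where "zbasis (lattice_of N \<tau>) D" by (rule lattice_of_zbasis[OF N \<tau> ne])
        thus ?thesis using zspan_zero unfolding zbasis_def by simp
      qed
      hence "0 + of_int (-1) *\<^sub>R w \<in> lattice_of N \<sigma>" unfolding w(3) by blast
      thus ?thesis by simp
    qed
    moreover have "a + s *\<^sub>R v + (s * (- r)) *\<^sub>R (- w) \<in> \<sigma>" using q by simp
    ultimately show ?thesis using s(1) neg by blast
  qed
qed

lemma normal_lattice: "w \<in> lattice_of N \<sigma>"
  and normal_decomp: "lattice_of N \<sigma> = {u + of_int k *\<^sub>R w | (u :: 'a) (k :: int). u \<in> lattice_of N \<tau>}"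
  and normal_inward: "\<exists>a\<in>\<tau>. \<exists>t>0. a + t *\<^sub>R w \<in> \<sigma>"
  using someI_ex[OF normal_exists] unfolding normal_vector_def by blast+

lemma normal_dirs: "w \<in> dirs \<sigma>"
  using normal_lattice unfolding lattice_of_def by blast

lemma normal_complement:
  assumes "v \<in> dirs \<sigma>"
  shows "\<exists>r. v - r *\<^sub>R w \<in> dirs \<tau>"
proof -
  obtain C where C: "zbasis (lattice_of N \<sigma>) C" "span C = dirs \<sigma>" by (rule lattice_of_zbasis[OF N \<sigma> \<sigma>_ne])
  have sp: "span (lattice_of N \<sigma>) = dirs \<sigma>" using C span_zspan[of C] unfolding zbasis_def by simp
  have "lattice_of N \<sigma> \<subseteq> span (insert w (dirs \<tau>))"
  proof
    fix x assume "x \<in> lattice_of N \<sigma>"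
    then obtain u k where uk: "x = u + of_int k *\<^sub>R w" "u \<in> lattice_of N \<tau>" using normal_decomp by blast
    hence "u \<in> dirs \<tau>" unfolding lattice_of_def by blast
    thus "x \<in> span (insert w (dirs \<tau>))" unfolding uk(1) by (intro span_add span_scale span_base) auto
  qed
  hence "dirs \<sigma> \<subseteq> span (insert w (dirs \<tau>))" unfolding sp[symmetric] by (intro span_minimal subspace_span)
  hence "v \<in> span (insert w (dirs \<tau>))" using assms by blast
  then obtain r where "v - r *\<^sub>R w \<in> span (dirs \<tau>)" unfolding span_insert by blast
  moreover have "span (dirs \<tau>) = dirs \<tau>" using sub\<tau> by (simp add: span_eq_iff)
  ultimately show ?thesis by auto
qed

lemma normal_notin: "w \<notin> dirs \<tau>"
proof
  assume w: "w \<in> dirs \<tau>"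
  have "dirs \<sigma> \<subseteq> dirs \<tau>"
  proof
    fix v assume "v \<in> dirs \<sigma>"
    then obtain r where "v - r *\<^sub>R w \<in> dirs \<tau>" using normal_complement by blast
    hence "v - r *\<^sub>R w + r *\<^sub>R w \<in> dirs \<tau>" using w by (intro subspace_add subspace_scale sub\<tau>)
    thus "v \<in> dirs \<tau>" by simp
  qed
  thus False using dim_subset[of "dirs \<sigma>" "dirs \<tau>"] dim_dirs_eq by linarith
qed

lemma conormal_exists: "\<exists>l :: 'a \<Rightarrow> real. linear l \<and> (\<forall>x\<in>dirs \<tau>. l x = 0) \<and> l w = 1"
  by (rule linear_separating[OF sub\<tau> normal_notin]) blast

text \<open>The form \<lambda> of the facet. It is determined on the directions of \<sigma>; its
  extension to the ambient space is a choice.\<close>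

definition conormal :: "'a \<Rightarrow> real" where
  "conormal = (SOME l. linear l \<and> (\<forall>x\<in>dirs \<tau>. l x = 0) \<and> l w = 1)"

lemma conormal_linear: "linear conormal"
  and conormal_zero: "x \<in> dirs \<tau> \<Longrightarrow> conormal x = 0"
  and conormal_normal: "conormal w = 1"
  using someI_ex[OF conormal_exists] unfolding conormal_def by blast+

lemma conormal_decomp:
  assumes "v \<in> dirs \<sigma>"
  shows "v - conormal v *\<^sub>R w \<in> dirs \<tau>"
proof -
  obtain r where r: "v - r *\<^sub>R w \<in> dirs \<tau>" using normal_complement[OF assms] by blast
  hence "conormal v = r"
    using conormal_zero[OF r] conormal_normal
    by (simp add: linear_diff[OF conormal_linear] linear_scale[OF conormal_linear])
  thus ?thesis using r by simp
qed

lemma conormal_ker: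
  assumes "v \<in> dirs \<sigma>" "conormal v = 0"
  shows "v \<in> dirs \<tau>"
  using conormal_decomp[OF assms(1)] assms(2) by simp

lemma conormal_affine:
  assumes "a \<in> \<tau>" "y \<in> \<sigma>" "conormal y = conormal a"
  shows "y \<in> \<tau>"
proof -
  have "y - a \<in> dirs \<sigma>" using assms subset by (intro dirs_diff hull_inc) auto
  hence "y - a \<in> dirs \<tau>" by (rule conormal_ker) (simp add: assms(3) linear_diff[OF conormal_linear])
  hence "a + (y - a) \<in> affine hull \<tau>" using dirs_iff[OF hull_inc[OF assms(1)]] by blast
  hence "y \<in> affine hull \<tau> \<inter> \<sigma>" using assms(2) by simp
  thus ?thesis using face_of_imp_eq_affine_Int[OF convex_\<sigma> face] by blast
qed

lemma conormal_const:
  assumes "a \<in> \<tau>" "b \<in> \<tau>"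
  shows "conormal a = conormal b"
  using conormal_zero[OF dirs_diff[OF hull_inc[OF assms(1)] hull_inc[OF assms(2)]]]
  by (simp add: linear_diff[OF conormal_linear])

text \<open>The normal vector is known to point inward at one point only. A point y of \<sigma>
  beyond the level of \<tau> could be joined to a point z of \<sigma> on the inner side; the segment
  would cross that level inside \<tau>, and the face property would put z into \<tau>.\<close>

lemma conormal_ge:
  assumes "a \<in> \<tau>" "y \<in> \<sigma>"
  shows "conormal a \<le> conormal y"
proof (rule ccontr)
  assume c: "\<not> ?thesis"
  obtain b t where b: "b \<in> \<tau>" "t > 0" "b + t *\<^sub>R w \<in> \<sigma>" using normal_inward by blast
  let ?z = "b + t *\<^sub>R w"
  define r where "r = conormal a - conormal y"
  have r: "r > 0" using c by (simp add: r_def)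
  have cz: "conormal ?z = conormal a + t"
    using conormal_const[OF b(1) assms(1)] conormal_normal
    by (simp add: linear_add[OF conormal_linear] linear_scale[OF conormal_linear])
  \<comment> \<open>The weights are chosen so that the conormal of \<open>?q\<close> equals its
    value on \<tau>: y lies r below that level and \<open>?z\<close> lies t above.\<close>
  let ?q = "(t / (t + r)) *\<^sub>R y + (r / (t + r)) *\<^sub>R ?z"
  have tr: "t / (t + r) > 0" "r / (t + r) > 0" "t / (t + r) + r / (t + r) = 1"
    using b(2) r by (simp_all add: add_divide_distrib[symmetric])
  have q: "?q \<in> \<sigma>" using convexD[OF convex_\<sigma> assms(2) b(3)] tr by simp
  have "conormal ?q = (t / (t + r)) * (conormal a - r) + (r / (t + r)) * (conormal a + t)"
    unfolding linear_add[OF conormal_linear] linear_scale[OF conormal_linear]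
    using cz by (simp add: r_def linear_add[OF conormal_linear] linear_scale[OF conormal_linear])
  also have "\<dots> = (t / (t + r) + r / (t + r)) * conormal a"
    by (simp add: algebra_simps add_divide_distrib diff_divide_distrib)
  also have "\<dots> = conormal a" using tr(3) by simp
  finally have "?q \<in> \<tau>" using conormal_affine[OF assms(1) q] by simp
  moreover have "?q \<in> open_segment y ?z"
  proof -
    have "y \<noteq> ?z" using cz r b(2) by (auto simp: r_def)
    thus ?thesis unfolding in_segment(2)
      using tr by (intro conjI exI[of _ "r / (t + r)"]) (auto simp: eq_diff_eq[symmetric])
  qed
  ultimately have "?z \<in> \<tau>" using face_ofD[OF face] assms(2) b(3) by blast
  hence "conormal ?z = conormal a" using conormal_const assms(1) by blast
  thus False using cz b(2) by simp
qed

text \<open>For small s the point p + s v is a convex combination of the fixed point b + t w of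
  \<sigma> and a point of \<tau> near p, which exists because p is relatively interior to
  \<tau>.\<close>

lemma inward_point:
  assumes p: "p \<in> rel_interior \<tau>" and v: "v \<in> dirs \<sigma>" "conormal v > 0"
  shows "\<forall>\<^sub>F s in at_right 0. p + s *\<^sub>R v \<in> \<sigma>"
proof -
  obtain b t where b: "b \<in> \<tau>" "t > 0" "b + t *\<^sub>R w \<in> \<sigma>" using normal_inward by blast
  have pt: "p \<in> \<tau>" using p rel_interior_subset by blast
  define v0 where "v0 = v - conormal v *\<^sub>R w"
  have v0: "v0 \<in> dirs \<tau>" unfolding v0_def by (rule conormal_decomp[OF v(1)])
  \<comment> \<open>Solution of (1 - th) q + th (b + t w) = p + s v with th = s
    \<open>conormal v\<close> / t; this th makes the w-components agree, so q stays in the affine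
    hull of \<tau>.\<close>
  define q where "q s = p + (s / (1 - s * conormal v / t)) *\<^sub>R (v0 + (conormal v / t) *\<^sub>R (p - b))" for s
  have "((\<lambda>s. q s) \<longlongrightarrow> p + (0 / (1 - 0 * conormal v / t)) *\<^sub>R (v0 + (conormal v / t) *\<^sub>R (p - b))) (at_right 0)"
    unfolding q_def using b(2) by (intro tendsto_intros) auto
  hence "(q \<longlongrightarrow> p) (at_right 0)" by simp
  moreover have "\<forall>\<^sub>F s in at_right 0. q s \<in> affine hull \<tau>"
  proof (intro always_eventually allI)
    fix s
    have "p - b \<in> dirs \<tau>" using pt b(1) by (intro dirs_diff hull_inc)
    hence "(s / (1 - s * conormal v / t)) *\<^sub>R (v0 + (conormal v / t) *\<^sub>R (p - b)) \<in> dirs \<tau>"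
      using v0 by (intro subspace_scale subspace_add sub\<tau>)
    thus "q s \<in> affine hull \<tau>" unfolding q_def using dirs_iff[OF hull_inc[OF pt]] by blast
  qed
  ultimately have 1: "\<forall>\<^sub>F s in at_right 0. q s \<in> \<tau>" by (rule rel_interior_tendsto[OF p])
  have "((\<lambda>s. s * conormal v / t) \<longlongrightarrow> 0 * conormal v / t) (at_right 0)" by (intro tendsto_intros) (use b(2) in simp)
  hence 2: "\<forall>\<^sub>F s in at_right 0. s * conormal v / t < 1" by (intro order_tendstoD(2)) auto
  have 3: "\<forall>\<^sub>F s in at_right 0. (s::real) > 0" by (rule eventually_at_right_less)
  show ?thesis using 1 2 3
  proof eventually_elim
    case (elim s)
    define th where "th = s * conormal v / t"
    define X where "X = v0 + (conormal v / t) *\<^sub>R (p - b)"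
    have th: "th \<ge> 0" "th < 1" using elim b(2) v(2) by (simp_all add: th_def)
    have tt: "th * t = s * conormal v" "s * (conormal v / t) = th" using b(2) by (simp_all add: th_def)
    have q: "q s = p + (s / (1 - th)) *\<^sub>R X" unfolding q_def th_def X_def ..
    have "(1 - th) *\<^sub>R q s + th *\<^sub>R (b + t *\<^sub>R w) \<in> \<sigma>"
      using convexD[OF convex_\<sigma> _ b(3), of "q s" "1 - th" th] elim subset th by auto
    also have "(1 - th) *\<^sub>R q s = (1 - th) *\<^sub>R p + s *\<^sub>R X"
      using th unfolding q by (simp add: scaleR_add_right)
    also have "s *\<^sub>R X = s *\<^sub>R v0 + th *\<^sub>R (p - b)"
      unfolding X_def scaleR_add_right scaleR_scaleR tt ..
    also have "(1 - th) *\<^sub>R p + (s *\<^sub>R v0 + th *\<^sub>R (p - b)) + th *\<^sub>R (b + t *\<^sub>R w) = p + s *\<^sub>R v0 + (th * t) *\<^sub>R w"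
      by (simp add: algebra_simps)
    also have "\<dots> = p + s *\<^sub>R v" unfolding tt v0_def by (simp add: algebra_simps)
    finally show ?case .
  qed
qed

text \<open>In this adapted basis, lattice volumes and forms on \<sigma> can be compared with those
  on \<tau>.\<close>

lemma lattice_basis_facet:
  assumes ts: "lattice_basis (lattice_of N \<tau>) ts"
  shows "lattice_basis (lattice_of N \<sigma>) (ts @ [w])"
proof -
  have z: "zbasis (lattice_of N \<tau>) (set ts)" "distinct ts" using ts by (simp_all add: lattice_basis_zbasis)
  have sp: "span (set ts) = dirs \<tau>" by (rule is_basis_span[OF lattice_of_basis[OF N \<tau> ne ts]])
  have wt: "w \<notin> set ts" using normal_notin sp span_superset[of "set ts"] by blast
  have "independent (insert w (set ts))"
    using normal_notin z(1) unfolding zbasis_def sp[symmetric] by (intro independent_insertI) auto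
  moreover have "lattice_of N \<sigma> = zspan (insert w (set ts))"
    using normal_decomp z(1) zspan_insert[OF finite_set wt] unfolding zbasis_def by simp
  ultimately have "zbasis (lattice_of N \<sigma>) (set (ts @ [w]))" unfolding zbasis_def by simp
  thus ?thesis using z(2) wt by (simp add: lattice_basis_zbasis)
qed

end

subsection \<open>Integration over polyhedra\<close>

lemma scale_measure_density:
  "scale_measure (ennreal c) M = density M (\<lambda>_. ennreal c)"
proof (rule measure_eqI)
  fix A assume "A \<in> sets (scale_measure (ennreal c) M)"
  thus "emeasure (scale_measure (ennreal c) M) A = emeasure (density M (\<lambda>_. ennreal c)) A"
    by (simp add: emeasure_density nn_integral_cmult_indicator)
qed simp

lemma integral_scale_measure:
  fixes f :: "_ \<Rightarrow> real"
  assumes "c \<ge> 0" "f \<in> borel_measurable M"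
  shows "integral\<^sup>L (scale_measure (ennreal c) M) f = c * integral\<^sup>L M f"
  unfolding scale_measure_density using assms by (subst integral_density) auto

text \<open>The basis and the origin are the same choices as in \<open>integral_form\<close>, so the
  two agree by unfolding.\<close>

definition cellvol :: "'a::euclidean_space set \<Rightarrow> 'a set \<Rightarrow> 'a measure" where
  "cellvol N \<sigma> = vol (SOME es. lattice_basis (lattice_of N \<sigma>) es) (SOME a. a \<in> affine hull \<sigma>)"

definition cint :: "'a::euclidean_space set \<Rightarrow> 'a set \<Rightarrow> ('a \<Rightarrow> real) \<Rightarrow> real" where
  "cint N \<sigma> f = (\<integral>x. indicator \<sigma> x * f x \<partial>cellvol N \<sigma>)"

text \<open>Another lattice basis changes the volume by a factor of absolute value 1, another origin
  by a translation along the direction space.\<close>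

lemma cellvol_eq:
  assumes N: "is_lattice N" "integral_polyhedron N \<sigma>" "\<sigma> \<noteq> {}"
    and es: "lattice_basis (lattice_of N \<sigma>) es" and a: "a \<in> affine hull \<sigma>"
  shows "cellvol N \<sigma> = vol es a"
proof -
  define fs where "fs = (SOME es. lattice_basis (lattice_of N \<sigma>) es)"
  define b where "b = (SOME a. a \<in> affine hull \<sigma>)"
  have fs: "lattice_basis (lattice_of N \<sigma>) fs" unfolding fs_def using es by (rule someI)
  have b: "b \<in> affine hull \<sigma>" unfolding b_def using a by (rule someI)
  note bes = lattice_of_basis[OF N es] and bfs = lattice_of_basis[OF N fs]
  obtain d where d: "rescale (dirs \<sigma>) fs es d" by (rule rescale_exists[OF bfs bes])
  hence "rescale (span (lattice_of N \<sigma>)) fs es d" 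
    using is_basis_span[OF bes] is_basis_span[OF lattice_basis_is_basis[OF es]] by simp
  have "\<bar>d\<bar> = 1" by (rule lattice_basis_rescale[OF fs es d])
  hence "vol fs b = vol es b" using d unfolding rescale_def by simp
  also have "\<dots> = vol es (a + (b - a))" by simp
  also have "\<dots> = vol es a"
    by (rule vol_translate) (use is_basis_span[OF bes] dirs_diff[OF b a] in simp)
  finally show ?thesis unfolding cellvol_def fs_def b_def .
qed

lemma cell_integrable:
  fixes f :: "'a::euclidean_space \<Rightarrow> real"
  assumes bs: "is_basis bs L" and \<sigma>: "closed \<sigma>" and f: "continuous_on \<sigma> f"
    and K: "compact K" "\<And>x. x \<in> \<sigma> - K \<Longrightarrow> f x = 0"
  shows "integrable (vol bs a) (\<lambda>x. indicator \<sigma> x * f x)"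
proof -
  have cK: "compact (\<sigma> \<inter> K)" using \<sigma> K(1) by (intro closed_Int_compact)
  have "compact (f ` (\<sigma> \<inter> K))"
    using f cK by (intro compact_continuous_image) (auto intro: continuous_on_subset)
  then obtain B where B: "\<And>x. x \<in> \<sigma> \<inter> K \<Longrightarrow> norm (f x) \<le> B"
    using compact_imp_bounded bounded_iff by (metis imageI)
  have m: "(\<lambda>x. indicator \<sigma> x *\<^sub>R f x) \<in> borel_measurable borel"
    using \<sigma> f by (intro borel_measurable_continuous_on_indicator) auto
  have sK: "\<sigma> \<inter> K \<in> sets (vol bs a)" using borel_compact[OF cK] by simp
  show ?thesis
  proof (rule Bochner_Integration.integrable_bound)
    have "emeasure (vol bs a) (\<sigma> \<inter> K) < \<infinity>"
      using cK by (intro vol_finite_bounded[OF bs] compact_imp_bounded borel_compact)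
    thus "integrable (vol bs a) (\<lambda>x. B * indicator (\<sigma> \<inter> K) x)"
      using sK by (intro integrable_mult_right integrable_real_indicator)
    show "(\<lambda>x. indicator \<sigma> x * f x) \<in> borel_measurable (vol bs a)" using m by simp
    show "AE x in vol bs a. norm (indicator \<sigma> x * f x) \<le> norm (B * indicator (\<sigma> \<inter> K) x)"
    proof (intro AE_I2)
      fix x
      consider "x \<in> \<sigma> \<inter> K" | "x \<notin> \<sigma>" | "x \<in> \<sigma> - K" by blast
      thus "norm (indicator \<sigma> x * f x) \<le> norm (B * indicator (\<sigma> \<inter> K) x)"
      proof cases
        case 1
        thus ?thesis using order_trans[OF B[OF 1] abs_ge_self] by simp
      qed (simp_all add: K(2))
    qed
  qed
qed

text \<open>The direction of the lines is put last in the basis, so that it is the variable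
  integrated first.\<close>

lemma nn_integral_vol_snoc:
  assumes [measurable]: "h \<in> borel_measurable borel"
  shows "nn_integral (vol (bs @ [v]) a) h = (\<integral>\<^sup>+x. (\<integral>\<^sup>+t. h (x + t *\<^sub>R v) \<partial>lborel) \<partial>vol bs a)"
proof -
  have I: "{..<length (bs @ [v])} - {length bs} = {..<length bs}" by auto
  have S: "a + (\<Sum>j\<in>{..<length bs}. y j *\<^sub>R (bs @ [v]) ! j) = param bs a y" for y
    unfolding param_def by (simp add: nth_append)
  have "nn_integral (vol (bs @ [v]) a) h =
    (\<integral>\<^sup>+y. (\<integral>\<^sup>+t. h (param bs a y + t *\<^sub>R v) \<partial>lborel) \<partial>lebn {..<length bs})"
    using nn_integral_vol_coord[of "length bs" "bs @ [v]" h a] unfolding I S nth_append_length by simp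
  also have "\<dots> = (\<integral>\<^sup>+x. (\<integral>\<^sup>+t. h (x + t *\<^sub>R v) \<partial>lborel) \<partial>vol bs a)"
    by (subst nn_integral_vol) simp_all
  finally show ?thesis .
qed

lemma integral_vol_snoc:
  fixes f :: "'a::euclidean_space \<Rightarrow> real"
  assumes f: "integrable (vol (bs @ [v]) a) f"
  shows "integral\<^sup>L (vol (bs @ [v]) a) f = (\<integral>x. (\<integral>t. f (x + t *\<^sub>R v) \<partial>lborel) \<partial>vol bs a)"
proof -
  interpret product_sigma_finite "\<lambda>_::nat. lborel :: real measure" by standard
  have [measurable]: "f \<in> borel_measurable borel" using borel_measurable_integrable[OF f] by simp
  have I: "{..<length (bs @ [v])} = insert (length bs) {..<length bs}" by auto
  have p [measurable]: "param (bs @ [v]) a \<in> lebn {..<length (bs @ [v])} \<rightarrow>\<^sub>M borel" by (rule param_measurable) simp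
  have S: "param (bs @ [v]) a (y(length bs := t)) = param bs a y + t *\<^sub>R v" for y t
  proof -
    have "(\<Sum>j\<in>{..<length (bs @ [v])} - {length bs}. y j *\<^sub>R (bs @ [v]) ! j) = (\<Sum>j<length bs. y j *\<^sub>R bs ! j)"
      by (rule sum.cong) (auto simp: nth_append)
    thus ?thesis by (subst param_upd) (simp_all add: param_def)
  qed
  have i: "integrable (lebn (insert (length bs) {..<length bs})) (\<lambda>y. f (param (bs @ [v]) a y))"
    using f integrable_distr[OF p, of f] unfolding vol_def I by simp
  have "integral\<^sup>L (vol (bs @ [v]) a) f = (\<integral>y. f (param (bs @ [v]) a y) \<partial>lebn (insert (length bs) {..<length bs}))"
    unfolding vol_def I[symmetric] by (rule integral_distr) auto
  also have "\<dots> = (\<integral>y. (\<integral>t. f (param (bs @ [v]) a (y(length bs := t))) \<partial>lborel) \<partial>lebn {..<length bs})"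
    by (rule product_integral_insert[OF _ _ i]) auto
  also have "\<dots> = (\<integral>y. (\<integral>t. f (param bs a y + t *\<^sub>R v) \<partial>lborel) \<partial>lebn {..<length bs})"
    by (simp only: S)
  also have "\<dots> = (\<integral>x. (\<integral>t. f (x + t *\<^sub>R v) \<partial>lborel) \<partial>vol bs a)"
    unfolding vol_def by (rule integral_distr[symmetric]) auto
  finally show ?thesis .
qed

lemma distr_vol:
  assumes [measurable]: "p \<in> borel_measurable borel" and len: "length cs = length bs"
    and p: "\<And>y. p (param bs a y) = param cs b y"
  shows "distr (vol bs a) borel p = vol cs b"
proof -
  have "distr (vol bs a) borel p = distr (lebn {..<length bs}) borel (p \<circ> param bs a)"
    unfolding vol_def by (rule distr_distr) auto
  also have "p \<circ> param bs a = param cs b" using p by (intro ext) simp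
  finally show ?thesis unfolding vol_def len .
qed

text \<open>A linear form that vanishes on \<open>W\<close> but not on \<open>L\<close> is constant
  on \<open>S\<close>, so \<open>S\<close> lies in a hyperplane transversal to some basis
  vector.\<close>

lemma vol_null_lower:
  assumes bs: "is_basis bs L" and S: "\<And>x. x \<in> S \<Longrightarrow> x - k \<in> W" and W: "subspace W" "\<not> L \<subseteq> W"
  shows "AE x in vol bs a. x \<notin> S"
proof -
  obtain z where z: "z \<in> L" "z \<notin> W" using W(2) by blast
  obtain u :: "'a \<Rightarrow> real" where u: "linear u" "\<And>x. x \<in> W \<Longrightarrow> u x = 0" "u z = 1"
    by (rule linear_separating[OF W(1) z(2)], rule that)
  have "\<exists>i<length bs. u (bs ! i) \<noteq> 0"
  proof (rule ccontr)
    assume "\<not> ?thesis"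
    hence "u x = 0" if "x \<in> set bs" for x using that by (auto simp: in_set_conv_nth)
    hence "u z = 0" using linear_eq_0_on_span[OF u(1), of "set bs" z] z(1) is_basis_span[OF bs] by simp
    thus False using u(3) by simp
  qed
  then obtain i where i: "i < length bs" "u (bs ! i) \<noteq> 0" by blast
  have [measurable]: "u \<in> borel_measurable borel"
    by (intro borel_measurable_continuous_onI linear_continuous_on linear_conv_bounded_linear[THEN iffD1] u(1))
  have "{x. u x = u k} \<in> null_sets (vol bs a)"
    using vol_null_hyperplane[OF u(1) i, of a "u k"] by (auto simp: null_sets_def)
  hence "AE x in vol bs a. x \<notin> {x. u x = u k}" by (rule AE_not_in)
  moreover have "x \<in> {x. u x = u k}" if "x \<in> S" for x
    using u(2)[OF S[OF that]] by (simp add: linear_diff[OF u(1)])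
  ultimately show ?thesis by (auto elim!: eventually_mono)
qed

text \<open>The translated fundamental parallelotope has measure 1, so scalar factors can be
  cancelled. This is how the constant in \<open>distr_hit\<close> is identified.\<close>

lemma vol_normalized:
  assumes es: "is_basis es L" and eq: "scale_measure (ennreal c) (vol es a) = scale_measure (ennreal d) (vol es a)"
    and "c \<ge> 0" "d \<ge> 0"
  shows "c = d"
proof -
  note [measurable] = fund_borel[OF es]
  define A where "A = {x. x - a \<in> fund es}"
  have [measurable]: "A \<in> sets borel" unfolding A_def by measurable
  have "emeasure (vol es a) A = (\<integral>\<^sup>+x. indicator A (x + a) \<partial>vol es 0)"
    by (subst nn_integral_vol_shift) simp_all
  also have "\<dots> = (\<integral>\<^sup>+x. indicator (fund es) x \<partial>vol es 0)"
    by (rule nn_integral_cong) (simp add: A_def indicator_def)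
  also have "\<dots> = 1" using vol_fund[OF es] by simp
  finally have "emeasure (vol es a) A = 1" .
  moreover have "emeasure (scale_measure (ennreal c) (vol es a)) A = emeasure (scale_measure (ennreal d) (vol es a)) A"
    using eq by simp
  ultimately show ?thesis using assms(3,4) by simp
qed

subsection \<open>The divergence theorem on a polyhedron\<close>

text \<open>The boundary terms vanish at the ends where \<open>I\<close> is unbounded.\<close>

lemma line_integral:
  fixes F G :: "real \<Rightarrow> real"
  assumes I: "closed I" "convex I"
    and deriv: "\<And>t. t \<in> I \<Longrightarrow> (F has_vector_derivative G t) (at t within I)"
    and G: "continuous_on I G"
    and B: "\<And>t. t \<in> I \<Longrightarrow> \<bar>t\<bar> \<ge> B \<Longrightarrow> F t = 0 \<and> G t = 0"
  obtains L R where "(\<integral>t. indicator I t * G t \<partial>lborel) = R - L"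
    "\<forall>t\<in>I. (\<forall>s\<in>I. t \<le> s) \<longrightarrow> L = F t"
    "\<not> (\<exists>t\<in>I. \<forall>s\<in>I. t \<le> s) \<Longrightarrow> L = 0"
    "\<forall>t\<in>I. (\<forall>s\<in>I. s \<le> t) \<longrightarrow> R = F t"
    "\<not> (\<exists>t\<in>I. \<forall>s\<in>I. s \<le> t) \<Longrightarrow> R = 0"
proof -
  \<comment> \<open>The fundamental theorem needs a compact interval, and outside [-B, B] both
    functions vanish on \<open>I\<close>.\<close>
  define J where "J = I \<inter> {- B..B}"
  have IJ: "indicator I t * G t = indicator J t * G t" for t
    using B[of t] by (cases "t \<in> I"; cases "\<bar>t\<bar> \<le> B") (auto simp: J_def indicator_def abs_le_iff)
  have F0: "F t = 0" if "t \<in> I" "t \<notin> J" for t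
    using B[OF that(1)] that by (auto simp: J_def abs_le_iff)
  have mid: "y \<in> I" if "x \<in> I" "z \<in> I" "x \<le> y" "y \<le> z" for x y z
    using that mem_is_interval_1_I[of I x z y] I(2) is_interval_convex_1[of I] by blast
  show ?thesis
  proof (cases "J = {}")
    case True
    have "(\<integral>t. indicator I t * G t \<partial>lborel) = 0 - 0" unfolding IJ True by simp
    thus ?thesis using F0 True by (intro that[of 0 0]) auto
  next
    case False
    have "compact J" unfolding J_def using I(1) by (intro closed_Int_compact) auto
    moreover have "connected J" unfolding J_def using I(2) by (intro convex_connected convex_Int) auto
    ultimately obtain l u where J: "J = {l..u}" using connected_compact_interval_1 by blast
    hence lu: "l \<le> u" "l \<in> J" "u \<in> J" using False by auto
    have sub: "{l..u} \<subseteq> I" using J by (auto simp: J_def)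
    have "(\<integral>t. indicator {l..u} t *\<^sub>R G t \<partial>lborel) = F u - F l"
    proof (rule integral_FTC_atLeastAtMost[OF lu(1)])
      show "(F has_vector_derivative G t) (at t within {l..u})" if "l \<le> t" "t \<le> u" for t
        using deriv[of t] sub that by (intro has_vector_derivative_within_subset[OF _ sub]) auto
      show "continuous_on {l..u} G" using G sub by (rule continuous_on_subset)
    qed
    hence int: "(\<integral>t. indicator I t * G t \<partial>lborel) = F u - F l" unfolding IJ J by simp
    have lI: "l \<in> I" "- B \<le> l" "l \<le> B" and uI: "u \<in> I" "- B \<le> u" "u \<le> B" using lu by (auto simp: J_def)
    \<comment> \<open>If \<open>I\<close> goes on below l, then l is not an end of \<open>I\<close>
      but the cut-off -B, where F vanishes already.\<close>
    have Bl: "l = - B" if "s \<in> I" "s < l" for s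
    proof -
      have "s \<notin> J" using that J by auto
      hence "s < - B" using that lI by (auto simp: J_def)
      hence "- B \<in> J" using mid[OF that(1) lI(1), of "- B"] lI by (auto simp: J_def)
      thus ?thesis using J lI by auto
    qed
    have Bu: "u = B" if "s \<in> I" "u < s" for s
    proof -
      have "s \<notin> J" using that J by auto
      hence "B < s" using that uI by (auto simp: J_def)
      hence "B \<in> J" using mid[OF uI(1) that(1), of B] uI by (auto simp: J_def)
      thus ?thesis using J uI by auto
    qed
    have Fl: "F l = 0" if "s \<in> I" "s < l" for s using Bl[OF that] B[OF lI(1)] by simp
    have Fu: "F u = 0" if "s \<in> I" "u < s" for s using Bu[OF that] B[OF uI(1)] by simp
    show ?thesis
    proof (rule that[OF int])
      have "F l = F t" if t: "t \<in> I" "\<And>s. s \<in> I \<Longrightarrow> t \<le> s" for t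
      proof (cases "t < l")
        case True
        hence "t \<notin> J" using J by auto
        thus ?thesis using F0[OF t(1)] Fl[OF t(1) True] by simp
      next
        case False
        hence "t = l" using t(2)[OF lI(1)] by simp
        thus ?thesis by simp
      qed
      thus "\<forall>t\<in>I. (\<forall>s\<in>I. t \<le> s) \<longrightarrow> F l = F t" by blast
    next
      assume n: "\<not> (\<exists>t\<in>I. \<forall>s\<in>I. t \<le> s)"
      then obtain s where "s \<in> I" "s < l" using lI(1) not_le by blast
      thus "F l = 0" by (rule Fl)
    next
      have "F u = F t" if t: "t \<in> I" "\<And>s. s \<in> I \<Longrightarrow> s \<le> t" for t
      proof (cases "u < t")
        case True
        hence "t \<notin> J" using J by auto
        thus ?thesis using F0[OF t(1)] Fu[OF t(1) True] by simp
      next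
        case False
        hence "t = u" using t(2)[OF uI(1)] by simp
        thus ?thesis by simp
      qed
      thus "\<forall>t\<in>I. (\<forall>s\<in>I. s \<le> t) \<longrightarrow> F u = F t" by blast
    next
      assume n: "\<not> (\<exists>t\<in>I. \<forall>s\<in>I. s \<le> t)"
      then obtain s where "s \<in> I" "u < s" using uI(1) not_le by blast
      thus "F u = 0" by (rule Fu)
    qed
  qed
qed

section \<open>Lines through a polyhedron and its facets\<close>

locale cell =
  fixes N \<sigma> :: "'a::euclidean_space set"
  assumes N: "is_lattice N"
    and \<sigma>: "integral_polyhedron N \<sigma>"
    and ne: "\<sigma> \<noteq> {}"
    and facets: "\<And>\<tau>. \<tau> facet_of \<sigma> \<Longrightarrow> integral_polyhedron N \<tau>"
begin

lemma polyhedron_\<sigma>: "polyhedron \<sigma>" using integral_polyhedron_polyhedron[OF \<sigma>] .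
lemma convex_\<sigma>: "convex \<sigma>" using polyhedron_imp_convex[OF polyhedron_\<sigma>] .
lemma closed_\<sigma>: "closed \<sigma>" using polyhedron_imp_closed[OF polyhedron_\<sigma>] .
lemma sub\<sigma>: "subspace (dirs \<sigma>)" using subspace_dirs[OF ne] .

lemma facetI:
  assumes "\<tau> facet_of \<sigma>"
  shows "facet N \<sigma> \<tau>"
  using assms N \<sigma> facets[OF assms] by unfold_locales (auto simp: facet_of_def)

definition lam :: "'a set \<Rightarrow> 'a \<Rightarrow> real" where
  "lam \<tau> = facet.conormal N \<sigma> \<tau>"

lemma lam_linear: "\<tau> facet_of \<sigma> \<Longrightarrow> linear (lam \<tau>)"
  unfolding lam_def by (rule facet.conormal_linear[OF facetI])

text \<open>Projection along \<open>v\<close> onto the level set of the conormal that contains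
  \<tau>. The conormal is constant on \<tau>, so any point of \<tau> fixes the level.\<close>

definition hit :: "'a set \<Rightarrow> 'a \<Rightarrow> 'a \<Rightarrow> 'a" where
  "hit \<tau> v x = x + ((lam \<tau> (SOME a. a \<in> \<tau>) - lam \<tau> x) / lam \<tau> v) *\<^sub>R v"

lemma lam_const:
  assumes "\<tau> facet_of \<sigma>" "y \<in> \<tau>"
  shows "lam \<tau> (SOME a. a \<in> \<tau>) = lam \<tau> y"
  unfolding lam_def
  by (rule facet.conormal_const[OF facetI[OF assms(1)] someI[of "\<lambda>a. a \<in> \<tau>", OF assms(2)] assms(2)])

lemma hit_eq:
  assumes "\<tau> facet_of \<sigma>" "lam \<tau> v \<noteq> 0" "x + t *\<^sub>R v \<in> \<tau>"
  shows "hit \<tau> v x = x + t *\<^sub>R v"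
proof -
  note l = lam_linear[OF assms(1)]
  have "lam \<tau> (SOME a. a \<in> \<tau>) = lam \<tau> x + t * lam \<tau> v"
    unfolding lam_const[OF assms(1,3)] by (simp add: linear_add[OF l] linear_scale[OF l])
  thus ?thesis unfolding hit_def using assms(2) by simp
qed

lemma hit_uminus:
  assumes "\<tau> facet_of \<sigma>"
  shows "hit \<tau> (- v) x = hit \<tau> v x"
  unfolding hit_def by (simp add: linear_neg[OF lam_linear[OF assms]])

text \<open>The proper faces whose shadow in direction \<open>v\<close> is too small to be seen by
  almost every line: those of codimension at least 2, and those containing the direction
  \<open>v\<close>.\<close>

definition bad :: "'a \<Rightarrow> 'a set set" where
  "bad v = {\<kappa>. \<kappa> face_of \<sigma> \<and> \<kappa> \<noteq> {} \<and> (aff_dim \<kappa> \<le> aff_dim \<sigma> - 2 \<or> aff_dim \<kappa> \<le> aff_dim \<sigma> - 1 \<and> v \<in> dirs \<kappa>)}"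

definition good :: "'a \<Rightarrow> 'a \<Rightarrow> bool" where
  "good v x \<longleftrightarrow> (\<forall>t. x + t *\<^sub>R v \<notin> \<Union>(bad v))"

lemma bad_uminus: "bad (- v) = bad v"
proof -
  have "- v \<in> dirs \<kappa> \<longleftrightarrow> v \<in> dirs \<kappa>" if "\<kappa> \<noteq> {}" for \<kappa> :: "'a set"
    using subspace_neg[OF subspace_dirs[OF that], of v] subspace_neg[OF subspace_dirs[OF that], of "- v"] by auto
  thus ?thesis unfolding bad_def by blast
qed

lemma good_uminus: "good v x \<Longrightarrow> good (- v) x"
  unfolding good_def bad_uminus by (metis scaleR_minus_left scaleR_minus_right minus_minus)

text \<open>The union of the lines in direction \<open>v\<close> through a bad face lies in a
  translate of the span of \<open>v\<close> and the directions of that face, whose dimension is less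
  than that of \<sigma>. It cannot contain the span of \<open>bs\<close>, so its trace there is
  null; there are finitely many faces.\<close>

lemma good_AE:
  assumes bs: "is_basis (bs @ [v]) (dirs \<sigma>)"
  shows "AE x in vol bs a. good v x"
proof -
  have dis: "distinct (bs @ [v])" "independent (set (bs @ [v]))" using bs unfolding is_basis_def by blast+
  have b: "is_basis bs (span (set bs))"
    unfolding is_basis_def using dis(1) independent_mono[OF dis(2), of "set bs"] by auto
  have vn: "v \<notin> span (set bs)"
  proof -
    have "set (bs @ [v]) - {v} = set bs" using dis(1) by auto
    thus ?thesis using dis(2) unfolding dependent_def by auto
  qed
  have dim: "dim (dirs \<sigma>) = Suc (length bs)" using is_basis_length[OF bs] by simp
  have "finite (bad v)"
    by (rule finite_subset[OF _ finite_polyhedron_faces[OF polyhedron_\<sigma>]]) (auto simp: bad_def)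
  moreover have "AE x in vol bs a. x \<notin> {x. \<exists>t. x + t *\<^sub>R v \<in> \<kappa>}" if \<kappa>: "\<kappa> \<in> bad v" for \<kappa>
  proof -
    have k: "\<kappa> face_of \<sigma>" "\<kappa> \<noteq> {}" using \<kappa> unfolding bad_def by blast+
    obtain k0 where k0: "k0 \<in> \<kappa>" using k(2) by blast
    let ?W = "span (insert v (dirs \<kappa>))"
    show ?thesis
    proof (rule vol_null_lower[OF b, of _ k0 ?W])
      fix x assume "x \<in> {x. \<exists>t. x + t *\<^sub>R v \<in> \<kappa>}"
      then obtain t where t: "x + t *\<^sub>R v \<in> \<kappa>" by blast
      have "x + t *\<^sub>R v - k0 \<in> dirs \<kappa>" using t k0 by (intro dirs_diff hull_inc)
      hence "(x + t *\<^sub>R v - k0) - t *\<^sub>R v \<in> ?W" by (intro span_diff span_scale span_base) auto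
      thus "x - k0 \<in> ?W" by simp
    next
      show "subspace ?W" by (rule subspace_span)
      show "\<not> span (set bs) \<subseteq> ?W"
      proof
        assume s: "span (set bs) \<subseteq> ?W"
        have "set (bs @ [v]) \<subseteq> ?W" using s span_superset[of "set bs"] span_base[of v "insert v (dirs \<kappa>)"] by auto
        hence "dirs \<sigma> \<subseteq> ?W" unfolding is_basis_span[OF bs, symmetric] by (intro span_minimal subspace_span)
        hence le: "dim (dirs \<sigma>) \<le> dim (insert v (dirs \<kappa>))" using dim_subset[of "dirs \<sigma>" ?W] by simp
        have ds: "int (dim (dirs \<sigma>)) = aff_dim \<sigma>" "int (dim (dirs \<kappa>)) = aff_dim \<kappa>"
          using dim_dirs[OF ne] dim_dirs[OF k(2)] by auto
        have sp: "span (dirs \<kappa>) = dirs \<kappa>" using subspace_dirs[OF k(2)] by (simp add: span_eq_iff)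
        have "dim (insert v (dirs \<kappa>)) = (if v \<in> dirs \<kappa> then dim (dirs \<kappa>) else dim (dirs \<kappa>) + 1)"
          using dim_insert[of v "dirs \<kappa>"] sp by simp
        thus False using le ds \<kappa> unfolding bad_def by (auto split: if_splits)
      qed
    qed
  qed
  ultimately have "AE x in vol bs a. \<forall>\<kappa>\<in>bad v. x \<notin> {x. \<exists>t. x + t *\<^sub>R v \<in> \<kappa>}"
    by (intro AE_finite_allI)
  thus ?thesis by (rule eventually_mono) (auto simp: good_def)
qed

text \<open>A relative boundary point lies on a facet. If that facet were parallel to
  \<open>v\<close>, or the point lay on a facet of it, a bad face would be met.\<close>

lemma good_boundary:
  assumes g: "good v x" and y: "x + t *\<^sub>R v \<in> \<sigma>" "x + t *\<^sub>R v \<notin> rel_interior \<sigma>"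
  obtains \<tau> where "\<tau> facet_of \<sigma>" "x + t *\<^sub>R v \<in> rel_interior \<tau>" "v \<notin> dirs \<tau>"
proof -
  let ?y = "x + t *\<^sub>R v"
  obtain \<tau> where t: "\<tau> facet_of \<sigma>" "?y \<in> \<tau>"
    using rel_boundary_of_polyhedron[OF polyhedron_\<sigma>] y by blast
  interpret facet N \<sigma> \<tau> by (rule facetI[OF t(1)])
  have nb: "?y \<notin> \<kappa>" if "\<kappa> \<in> bad v" for \<kappa> using g that unfolding good_def by blast
  have "v \<notin> dirs \<tau>"
  proof
    assume "v \<in> dirs \<tau>"
    hence "\<tau> \<in> bad v" unfolding bad_def using face dim t(2) by auto
    thus False using nb t(2) by blast
  qed
  moreover have "?y \<in> rel_interior \<tau>"
  proof (rule ccontr)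
    assume "?y \<notin> rel_interior \<tau>"
    then obtain \<kappa> where \<kappa>: "\<kappa> facet_of \<tau>" "?y \<in> \<kappa>"
      using rel_boundary_of_polyhedron[OF integral_polyhedron_polyhedron[OF \<tau>]] t(2) by blast
    have "\<kappa> face_of \<sigma>" using \<kappa>(1) face face_of_trans unfolding facet_of_def by blast
    moreover have "aff_dim \<kappa> = aff_dim \<sigma> - 2" using \<kappa>(1) dim unfolding facet_of_def by linarith
    ultimately have "\<kappa> \<in> bad v" unfolding bad_def using \<kappa>(2) by auto
    thus False using nb \<kappa>(2) by blast
  qed
  ultimately show ?thesis using that t(1) by blast
qed

lemma good_unique:
  assumes g: "good v x" and "\<tau> facet_of \<sigma>" "\<tau>' facet_of \<sigma>" "x + t *\<^sub>R v \<in> \<tau>" "x + t *\<^sub>R v \<in> \<tau>'"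
  shows "\<tau> = \<tau>'"
proof (rule ccontr)
  assume ne: "\<tau> \<noteq> \<tau>'"
  have f: "\<tau> face_of \<sigma>" "\<tau>' face_of \<sigma>" and d: "aff_dim \<tau> = aff_dim \<sigma> - 1" "aff_dim \<tau>' = aff_dim \<sigma> - 1"
    using assms(2,3) unfolding facet_of_def by auto
  let ?k = "\<tau> \<inter> \<tau>'"
  have k: "?k face_of \<sigma>" using f by (rule face_of_Int)
  have c: "convex \<tau>" "convex \<tau>'" using f face_of_imp_convex by blast+
  have "aff_dim ?k < aff_dim \<sigma> - 1"
  proof (cases "?k = \<tau>")
    case True
    hence "?k face_of \<tau>'" using face_of_subset[OF k, of \<tau>'] f(2) face_of_imp_subset by blast
    moreover have "?k \<noteq> \<tau>'" using True ne by blast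
    ultimately show ?thesis using face_of_aff_dim_lt[OF c(2)] d by metis
  next
    case False
    have "?k face_of \<tau>" using face_of_subset[OF k, of \<tau>] f(1) face_of_imp_subset by blast
    thus ?thesis using face_of_aff_dim_lt[OF c(1)] d False by metis
  qed
  hence "?k \<in> bad v" unfolding bad_def using k assms(4,5) by auto
  thus False using g assms(4,5) unfolding good_def by blast
qed

lemma facets_finite: "finite {\<tau>. \<tau> facet_of \<sigma>}"
  using finite_polyhedron_facets[OF polyhedron_\<sigma>] .

text \<open>A line enters \<sigma> through a facet with positive conormal value on \<open>v\<close>.
  On a good line at most one facet has its projected point inside it, namely the facet at the lower
  end of the segment, so the sum collapses to the value there. If the segment has no lower end, no
  summand survives.\<close>

lemma hit_sum:
  fixes f :: "'a \<Rightarrow> real"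
  assumes v: "v \<in> dirs \<sigma>" and g: "good v x"
  defines "S \<equiv> (\<Sum>\<tau> | \<tau> facet_of \<sigma> \<and> lam \<tau> v > 0. indicator \<tau> (hit \<tau> v x) * f (hit \<tau> v x))"
  shows "x + t *\<^sub>R v \<in> \<sigma> \<Longrightarrow> (\<And>s. x + s *\<^sub>R v \<in> \<sigma> \<Longrightarrow> t \<le> s) \<Longrightarrow> S = (f (x + t *\<^sub>R v) :: real)"
    and "\<not> (\<exists>t. x + t *\<^sub>R v \<in> \<sigma> \<and> (\<forall>s. x + s *\<^sub>R v \<in> \<sigma> \<longrightarrow> t \<le> s)) \<Longrightarrow> S = 0"
proof -
  let ?P = "{\<tau>. \<tau> facet_of \<sigma> \<and> lam \<tau> v > 0}"
  have finP: "finite ?P" by (rule finite_subset[OF _ facets_finite]) auto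
  \<comment> \<open>The conormal is minimal on \<tau> among the points of \<sigma> and increases
    along \<open>v\<close>, so a point of \<tau> is the lower end of the segment.\<close>
  have min: "t \<le> s" if "\<tau> \<in> ?P" "x + t *\<^sub>R v \<in> \<tau>" "x + s *\<^sub>R v \<in> \<sigma>" for \<tau> t s
  proof -
    have \<tau>: "\<tau> facet_of \<sigma>" "lam \<tau> v > 0" using that by auto
    have "lam \<tau> (x + t *\<^sub>R v) \<le> lam \<tau> (x + s *\<^sub>R v)"
      unfolding lam_def by (rule facet.conormal_ge[OF facetI[OF \<tau>(1)] that(2,3)])
    hence "t * lam \<tau> v \<le> s * lam \<tau> v"
      by (simp add: linear_add[OF lam_linear[OF \<tau>(1)]] linear_scale[OF lam_linear[OF \<tau>(1)]])
    thus ?thesis using \<tau>(2) by simp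
  qed
  have hit: "hit \<tau> v x = x + ((lam \<tau> (SOME a. a \<in> \<tau>) - lam \<tau> x) / lam \<tau> v) *\<^sub>R v" for \<tau> by (simp add: hit_def)
  have Sf: "S = f (x + t *\<^sub>R v)" if \<tau>: "\<tau> \<in> ?P" "x + t *\<^sub>R v \<in> \<tau>" for \<tau> t
  proof -
    have h: "hit \<tau> v x = x + t *\<^sub>R v" using \<tau> by (intro hit_eq) auto
    have "indicator \<tau>' (hit \<tau>' v x) * f (hit \<tau>' v x) = 0" if \<tau>': "\<tau>' \<in> ?P - {\<tau>}" for \<tau>'
    proof (rule ccontr)
      assume "\<not> ?thesis"
      hence h': "hit \<tau>' v x \<in> \<tau>'" by (auto simp: indicator_def split: if_splits)
      then obtain s where s: "x + s *\<^sub>R v \<in> \<tau>'" unfolding hit by blast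
      have "x + s *\<^sub>R v \<in> \<sigma>" "x + t *\<^sub>R v \<in> \<sigma>"
        using s \<tau> \<tau>' facet_of_imp_subset by blast+
      hence "s = t" using min[OF \<tau>] min[of \<tau>' s] s \<tau>' by (intro order_antisym) auto
      hence "\<tau> = \<tau>'" using good_unique[OF g, of \<tau> \<tau>' t] \<tau> \<tau>' s by auto
      thus False using \<tau>' by blast
    qed
    hence n: "\<forall>\<tau>'\<in>?P - {\<tau>}. indicator \<tau>' (hit \<tau>' v x) * f (hit \<tau>' v x) = 0" by blast
    have "S = indicator \<tau> (hit \<tau> v x) * f (hit \<tau> v x)"
      unfolding S_def sum.remove[OF finP \<tau>(1)] sum.neutral[OF n] by (rule add_0_right)
    thus ?thesis unfolding h using \<tau>(2) by simp
  qed
  have ex: "\<exists>\<tau>\<in>?P. x + t *\<^sub>R v \<in> \<tau>" if t: "x + t *\<^sub>R v \<in> \<sigma>" "\<And>s. x + s *\<^sub>R v \<in> \<sigma> \<Longrightarrow> t \<le> s" for t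
  proof -
    \<comment> \<open>At the lower end no step in direction -v stays in \<sigma>. This excludes a
      relative interior point of \<sigma> and a facet with negative conormal value.\<close>
    have retreat: "False" if ev: "\<forall>\<^sub>F s in at_right 0. x + t *\<^sub>R v + s *\<^sub>R (- v) \<in> \<sigma>"
    proof -
      have "\<forall>\<^sub>F s in at_right (0::real). s > 0 \<and> x + t *\<^sub>R v + s *\<^sub>R (- v) \<in> \<sigma>"
        using eventually_at_right_less ev by (rule eventually_conj)
      then obtain s where s: "s > 0" "x + t *\<^sub>R v + s *\<^sub>R (- v) \<in> \<sigma>"
        using eventually_happens trivial_limit_at_right_real by blast
      have "x + t *\<^sub>R v + s *\<^sub>R (- v) = x + (t - s) *\<^sub>R v" by (simp add: algebra_simps)
      with s(2) have "x + (t - s) *\<^sub>R v \<in> \<sigma>" by metis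
      thus False using t(2) s(1) by fastforce
    qed
    have ri: "x + t *\<^sub>R v \<notin> rel_interior \<sigma>"
    proof
      assume r: "x + t *\<^sub>R v \<in> rel_interior \<sigma>"
      have "\<forall>\<^sub>F s in at_right 0. x + t *\<^sub>R v + s *\<^sub>R (- v) \<in> \<sigma>"
      proof (rule rel_interior_tendsto[OF r])
        have "((\<lambda>s. x + t *\<^sub>R v + s *\<^sub>R (- v)) \<longlongrightarrow> x + t *\<^sub>R v + 0 *\<^sub>R (- v)) (at_right 0)" by (intro tendsto_intros)
        thus "((\<lambda>s. x + t *\<^sub>R v + s *\<^sub>R (- v)) \<longlongrightarrow> x + t *\<^sub>R v) (at_right 0)" by simp
        show "\<forall>\<^sub>F s in at_right 0. x + t *\<^sub>R v + s *\<^sub>R (- v) \<in> affine hull \<sigma>"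
          using dirs_iff[OF hull_inc[OF t(1)]] v by (intro always_eventually allI) (blast intro: subspace_scale[OF sub\<sigma>] subspace_neg[OF sub\<sigma>])
      qed
      thus False by (rule retreat)
    qed
    obtain \<tau> where \<tau>: "\<tau> facet_of \<sigma>" "x + t *\<^sub>R v \<in> rel_interior \<tau>" "v \<notin> dirs \<tau>"
      by (rule good_boundary[OF g t(1) ri])
    have "lam \<tau> v > 0"
    proof (rule ccontr)
      assume "\<not> ?thesis"
      moreover have "lam \<tau> v \<noteq> 0" using facet.conormal_ker[OF facetI[OF \<tau>(1)] v] \<tau>(3) unfolding lam_def by blast
      ultimately have "lam \<tau> (- v) > 0" by (simp add: linear_neg[OF lam_linear[OF \<tau>(1)]])
      from facet.inward_point[OF facetI[OF \<tau>(1)] \<tau>(2) subspace_neg[OF sub\<sigma> v] this[unfolded lam_def]]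
      show False by (rule retreat)
    qed
    moreover have "x + t *\<^sub>R v \<in> \<tau>" using \<tau>(2) rel_interior_subset by blast
    ultimately show ?thesis using \<tau>(1) by blast
  qed
  {
    assume "x + t *\<^sub>R v \<in> \<sigma>" "\<And>s. x + s *\<^sub>R v \<in> \<sigma> \<Longrightarrow> t \<le> s"
    then obtain \<tau> where "\<tau> \<in> ?P" "x + t *\<^sub>R v \<in> \<tau>" using ex by blast
    thus "S = f (x + t *\<^sub>R v)" by (rule Sf)
  next
    assume no: "\<not> (\<exists>t. x + t *\<^sub>R v \<in> \<sigma> \<and> (\<forall>s. x + s *\<^sub>R v \<in> \<sigma> \<longrightarrow> t \<le> s))"
    show "S = 0" unfolding S_def
    proof (rule sum.neutral, rule ballI, rule ccontr)
      fix \<tau> assume \<tau>: "\<tau> \<in> ?P" and "indicator \<tau> (hit \<tau> v x) * f (hit \<tau> v x) \<noteq> 0"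
      hence "hit \<tau> v x \<in> \<tau>" by (auto simp: indicator_def split: if_splits)
      then obtain s where s: "x + s *\<^sub>R v \<in> \<tau>" unfolding hit by blast
      have "x + s *\<^sub>R v \<in> \<sigma>" using s \<tau> facet_of_imp_subset by blast
      thus False using no min[OF \<tau> s] by blast
    qed
  }
qed

end

section \<open>Projection along a direction onto a facet, and the divergence theorem\<close>

lemma extend_basis:
  assumes "subspace L" "v \<in> L" "v \<noteq> (0::'a::euclidean_space)"
  obtains bs where "is_basis (bs @ [v]) L"
proof -
  have "independent {v}" "{v} \<subseteq> L" using assms by auto
  then obtain B where B: "{v} \<subseteq> B" "B \<subseteq> L" "independent B" "L \<subseteq> span B"
    using maximal_independent_subset_extend[of "{v}" L] by blast
  have "finite (B - {v})" using B(3) independent_imp_finite by blast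
  then obtain bs where bs: "set bs = B - {v}" "distinct bs" using finite_distinct_list by blast
  have "set (bs @ [v]) = B" using bs B(1) by auto
  moreover have "span B = L" by (rule subset_antisym[OF span_minimal[OF B(2) assms(1)] B(4)])
  ultimately have "is_basis (bs @ [v]) L" unfolding is_basis_def using bs B(3) by simp
  thus ?thesis by (rule that)
qed

text \<open>\<open>p\<close> projects along \<open>v\<close> to the level \<open>l = k\<close>. It
  moves points only along \<open>v\<close>, so the volume with \<open>v\<close> as last coordinate
  is unchanged, while the remaining basis vectors are replaced by their projections to the kernel of
  \<open>l\<close>.\<close>

lemma vol_shear_snoc:
  fixes k :: real
  assumes l: "linear l" and v: "l v \<noteq> (0::real)"
  defines "p \<equiv> \<lambda>x. x + ((k - l x) / l v) *\<^sub>R v"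
  shows "vol (map (\<lambda>b. b - (l b / l v) *\<^sub>R v) bs @ [v]) (p a) = vol (bs @ [v]) a"
    and "distr (vol bs a) borel p = vol (map (\<lambda>b. b - (l b / l v) *\<^sub>R v) bs) (p a)"
    and "p \<in> borel_measurable borel"
proof -
  let ?cs = "map (\<lambda>b. b - (l b / l v) *\<^sub>R v) bs"
  have [measurable]: "l \<in> borel_measurable borel"
    by (intro borel_measurable_continuous_onI linear_continuous_on linear_conv_bounded_linear[THEN iffD1] l)
  show pm [measurable]: "p \<in> borel_measurable borel" unfolding p_def by measurable
  have pp: "p (param bs a y) = param ?cs (p a) y" for y
  proof -
    have "param ?cs (p a) y = p a + (\<Sum>i<length bs. y i *\<^sub>R (bs ! i - (l (bs ! i) / l v) *\<^sub>R v))"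
      unfolding param_def by simp
    also have "(\<Sum>i<length bs. y i *\<^sub>R (bs ! i - (l (bs ! i) / l v) *\<^sub>R v)) =
        (\<Sum>i<length bs. y i *\<^sub>R bs ! i) - (\<Sum>i<length bs. y i * l (bs ! i) / l v) *\<^sub>R v"
      by (simp add: scaleR_diff_right sum_subtractf scaleR_sum_left)
    also have "(\<Sum>i<length bs. y i * l (bs ! i) / l v) = l (\<Sum>i<length bs. y i *\<^sub>R bs ! i) / l v"
      by (simp add: linear_list_sum[OF l] sum_divide_distrib)
    finally show ?thesis
      unfolding p_def param_def linear_add[OF l] by (simp add: diff_divide_distrib add_divide_distrib algebra_simps)
  qed
  show d: "distr (vol bs a) borel p = vol ?cs (p a)"
    by (rule distr_vol) (simp_all add: pp)
  show "vol (?cs @ [v]) (p a) = vol (bs @ [v]) a"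
  proof (rule measure_eqI_nn)
    fix h :: "'a \<Rightarrow> ennreal" assume [measurable]: "h \<in> borel_measurable borel"
    have "nn_integral (vol (?cs @ [v]) (p a)) h = (\<integral>\<^sup>+x. (\<integral>\<^sup>+t. h (x + t *\<^sub>R v) \<partial>lborel) \<partial>vol ?cs (p a))"
      by (rule nn_integral_vol_snoc) simp
    also have "\<dots> = (\<integral>\<^sup>+x. (\<integral>\<^sup>+t. h (p x + t *\<^sub>R v) \<partial>lborel) \<partial>vol bs a)"
      unfolding d[symmetric] by (rule nn_integral_distr) simp_all
    also have "\<dots> = (\<integral>\<^sup>+x. (\<integral>\<^sup>+t. h (x + t *\<^sub>R v) \<partial>lborel) \<partial>vol bs a)"
    proof (rule nn_integral_cong)
      fix x
      have e: "p x + t *\<^sub>R v = x + (t * 1 + (k - l x) / l v) *\<^sub>R v" for t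
        by (simp add: p_def algebra_simps)
      show "(\<integral>\<^sup>+t. h (p x + t *\<^sub>R v) \<partial>lborel) = (\<integral>\<^sup>+t. h (x + t *\<^sub>R v) \<partial>lborel)"
        unfolding e using nn_integral_lborel_scale[of 1 "\<lambda>t. h (x + t *\<^sub>R v)" "(k - l x) / l v"] by simp
    qed
    also have "\<dots> = nn_integral (vol (bs @ [v]) a) h" by (rule nn_integral_vol_snoc[symmetric]) simp
    finally show "nn_integral (vol (?cs @ [v]) (p a)) h = nn_integral (vol (bs @ [v]) a) h" .
  qed simp_all
qed

lemma vol_snoc_scale:
  assumes "vol bs a = scale_measure (ennreal c) (vol cs a)" "c \<ge> 0"
  shows "vol (bs @ [v]) a = scale_measure (ennreal c) (vol (cs @ [v]) a)"
proof (rule measure_eqI_nn)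
  fix h :: "'a \<Rightarrow> ennreal" assume [measurable]: "h \<in> borel_measurable borel"
  show "nn_integral (vol (bs @ [v]) a) h = nn_integral (scale_measure (ennreal c) (vol (cs @ [v]) a)) h"
    by (simp add: nn_integral_vol_snoc nn_integral_scale_measure assms(1))
qed simp_all

context cell
begin

text \<open>\<open>bs\<close> parametrises the lines in direction \<open>v\<close>, and \<kappa>
  compares the volume of this basis with the lattice volume of \<sigma>; it cancels at the end of
  \<open>stokes\<close>.\<close>

context
  fixes bs v es a \<kappa>
  assumes bs: "is_basis (bs @ [v]) (dirs \<sigma>)" and es: "lattice_basis (lattice_of N \<sigma>) es"
    and a: "a \<in> affine hull \<sigma>"
    and \<kappa>: "\<kappa> > 0" "vol (bs @ [v]) a = scale_measure (ennreal \<kappa>) (vol es a)"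
begin

lemma v_dirs: "v \<in> dirs \<sigma>" using is_basis_subset[OF bs] by simp

text \<open>The projection carries \<open>bs\<close> to a basis \<open>cs\<close> of the directions
  of \<tau>, so the image measure is a multiple |d| of the lattice volume of \<tau>. To find d,
  append \<open>v\<close> to \<open>cs\<close> and to a lattice basis \<open>ts\<close> of \<tau>,
  and compare with the lattice basis \<open>ts @ [w]\<close> of \<sigma>.\<close>

lemma distr_hit:
  assumes \<tau>: "\<tau> facet_of \<sigma>" and v: "lam \<tau> v \<noteq> 0"
  shows "distr (vol bs a) borel (hit \<tau> v) = scale_measure (ennreal (\<kappa> * \<bar>lam \<tau> v\<bar>)) (cellvol N \<tau>)"
proof -
  interpret F: facet N \<sigma> \<tau> by (rule facetI[OF \<tau>])
  define k where "k = lam \<tau> (SOME a. a \<in> \<tau>)"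
  have hit: "hit \<tau> v = (\<lambda>x. x + ((k - lam \<tau> x) / lam \<tau> v) *\<^sub>R v)" by (intro ext) (simp add: hit_def k_def)
  define cs where "cs = map (\<lambda>b. b - (lam \<tau> b / lam \<tau> v) *\<^sub>R v) bs"
  note l = lam_linear[OF \<tau>]
  let ?b = "hit \<tau> v a"
  have sh: "vol (cs @ [v]) ?b = vol (bs @ [v]) a" "distr (vol bs a) borel (hit \<tau> v) = vol cs ?b"
    unfolding hit cs_def by (rule vol_shear_snoc[OF l v])+
  obtain ts where ts: "lattice_basis (lattice_of N \<tau>) ts"
    using lattice_of_basis_exists[OF N F.\<tau> F.ne] by blast
  note bts = lattice_of_basis[OF N F.\<tau> F.ne ts]
  note lts = F.lattice_basis_facet[OF ts]
  note btw = lattice_of_basis[OF N \<sigma> ne lts]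
  have len: "length cs = length ts"
    using is_basis_length[OF bs] is_basis_length[OF bts] F.dim_dirs_eq by (simp add: cs_def)
  have lam0: "lam \<tau> x = 0" if "x \<in> dirs \<tau>" for x
    unfolding lam_def by (rule F.conormal_zero[OF that])
  have ker: "x \<in> dirs \<tau>" if "x \<in> dirs \<sigma>" "lam \<tau> x = 0" for x
    using that unfolding lam_def by (rule F.conormal_ker)
  have csd: "set cs \<subseteq> dirs \<tau>"
  proof
    fix x assume "x \<in> set cs"
    then obtain b where b: "b \<in> set bs" "x = b - (lam \<tau> b / lam \<tau> v) *\<^sub>R v" by (auto simp: cs_def)
    have "b \<in> dirs \<sigma>" using b(1) is_basis_subset[OF bs] by auto
    hence "x \<in> dirs \<sigma>" unfolding b(2) using v_dirs by (intro subspace_diff subspace_scale sub\<sigma>)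
    moreover have "lam \<tau> x = 0" unfolding b(2) using v by (simp add: linear_diff[OF l] linear_scale[OF l])
    ultimately show "x \<in> dirs \<tau>" by (rule ker)
  qed
  have "dirs \<tau> \<subseteq> span (set cs)"
  proof
    fix z assume z: "z \<in> dirs \<tau>"
    hence "z \<in> dirs \<sigma>" using F.dirs_sub by blast
    hence zs: "z \<in> span (set (bs @ [v]))" unfolding is_basis_span[OF bs] .
    have "set (bs @ [v]) \<subseteq> span (insert v (set cs))"
    proof
      fix b assume "b \<in> set (bs @ [v])"
      then consider "b = v" | "b \<in> set bs" by auto
      thus "b \<in> span (insert v (set cs))"
      proof cases
        case 2
        hence "b - (lam \<tau> b / lam \<tau> v) *\<^sub>R v \<in> set cs" by (auto simp: cs_def)
        hence "(b - (lam \<tau> b / lam \<tau> v) *\<^sub>R v) + (lam \<tau> b / lam \<tau> v) *\<^sub>R v \<in> span (insert v (set cs))"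
          by (intro span_add span_scale span_base) auto
        thus ?thesis by simp
      qed (auto intro: span_base)
    qed
    hence "z \<in> span (insert v (set cs))" using zs span_minimal[OF _ subspace_span] by blast
    then obtain r where r: "z - r *\<^sub>R v \<in> span (set cs)" unfolding span_insert by blast
    have "span (set cs) \<subseteq> dirs \<tau>" using csd F.sub\<tau> by (intro span_minimal)
    hence "lam \<tau> (z - r *\<^sub>R v) = 0" using r lam0 by blast
    hence "r = 0" using lam0[OF z] v by (simp add: linear_diff[OF l] linear_scale[OF l])
    thus "z \<in> span (set cs)" using r by simp
  qed
  hence "span (set cs) = dirs \<tau>" using span_minimal[OF csd F.sub\<tau>] by blast
  hence bcs: "is_basis cs (dirs \<tau>)" using is_basisI_span[OF bts len] by blast
  obtain d where d: "rescale (dirs \<tau>) cs ts d" by (rule rescale_exists[OF bcs bts])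
  hence d0: "\<bar>d\<bar> > 0" and vd: "\<And>a. vol cs a = scale_measure (ennreal \<bar>d\<bar>) (vol ts a)" unfolding rescale_def by auto
  \<comment> \<open>Modulo the directions of \<tau>, \<open>v\<close> is \<lambda>(v) times the
    normal vector; replacing w by \<open>v\<close> therefore rescales by \<lambda>(v).\<close>
  obtain s where s: "v - lam \<tau> v *\<^sub>R F.w = (\<Sum>i<length ts. s i *\<^sub>R ts ! i)"
    using F.conormal_decomp[OF v_dirs] is_basis_mem[OF bts] unfolding lam_def by blast
  have "rescale (dirs \<sigma>) (ts @ [F.w]) ((ts @ [F.w])[length ts := lam \<tau> v *\<^sub>R (ts @ [F.w]) ! length ts +
      (\<Sum>j\<in>{..<length ts}. s j *\<^sub>R (ts @ [F.w]) ! j)]) (lam \<tau> v)"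
    by (rule rescale_replace[OF sub\<sigma> is_basis_subset[OF btw]]) (use v in auto)
  moreover have "(\<Sum>j\<in>{..<length ts}. s j *\<^sub>R (ts @ [F.w]) ! j) = (\<Sum>i<length ts. s i *\<^sub>R ts ! i)"
    by (rule sum.cong) (auto simp: nth_append)
  ultimately have "rescale (dirs \<sigma>) (ts @ [F.w]) (ts @ [v]) (lam \<tau> v)"
    by (simp add: s[symmetric])
  hence vw: "vol (ts @ [F.w]) x = scale_measure (ennreal \<bar>lam \<tau> v\<bar>) (vol (ts @ [v]) x)" for x unfolding rescale_def by blast
  have ba: "?b - a \<in> dirs \<sigma>" unfolding hit using v_dirs by (simp add: subspace_scale[OF sub\<sigma>])
  have b\<sigma>: "?b \<in> affine hull \<sigma>" using dirs_iff[OF a, of "?b - a"] ba by simp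
  have bt: "?b \<in> affine hull \<tau>"
  proof -
    define t0 where "t0 = (SOME a. a \<in> \<tau>)"
    have t0: "t0 \<in> \<tau>" unfolding t0_def using F.ne by (simp add: some_in_eq)
    have "?b - t0 \<in> dirs \<sigma>" using t0 F.subset by (intro dirs_diff[OF b\<sigma>] hull_inc) auto
    moreover have "lam \<tau> (?b - t0) = 0"
      using v unfolding hit k_def t0_def by (simp add: linear_diff[OF l] linear_add[OF l] linear_scale[OF l])
    ultimately have "?b - t0 \<in> dirs \<tau>" by (rule ker)
    thus ?thesis using dirs_iff[OF hull_inc[OF t0], of "?b - t0"] by simp
  qed
  have c\<tau>: "cellvol N \<tau> = vol ts ?b" by (rule cellvol_eq[OF N F.\<tau> F.ne ts bt])
  have c\<sigma>: "cellvol N \<sigma> = vol (ts @ [F.w]) ?b" "cellvol N \<sigma> = vol es a"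
    by (rule cellvol_eq[OF N \<sigma> ne lts b\<sigma>], rule cellvol_eq[OF N \<sigma> ne es a])
  \<comment> \<open>The volume in the basis \<open>bs @ [v]\<close> is computed twice, through the
    lattice of \<sigma> and through \<open>cs\<close>; cancelling gives \<kappa> |\<lambda>(v)| =
    |d|.\<close>
  have "scale_measure (ennreal (\<kappa> * \<bar>lam \<tau> v\<bar>)) (vol (ts @ [v]) ?b) = scale_measure (ennreal \<kappa>) (vol (ts @ [F.w]) ?b)"
    using \<kappa>(1) by (simp add: vw ennreal_mult)
  also have "\<dots> = vol (bs @ [v]) a" using c\<sigma> \<kappa>(2) by simp
  also have "\<dots> = vol (cs @ [v]) ?b" by (rule sh(1)[symmetric])
  also have "\<dots> = scale_measure (ennreal \<bar>d\<bar>) (vol (ts @ [v]) ?b)" by (rule vol_snoc_scale[OF vd]) simp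
  finally have eq: "scale_measure (ennreal (\<kappa> * \<bar>lam \<tau> v\<bar>)) (vol (ts @ [v]) ?b) = scale_measure (ennreal \<bar>d\<bar>) (vol (ts @ [v]) ?b)" .
  have btv: "is_basis (ts @ [v]) (dirs \<sigma>)"
    using rescale_is_basis[OF \<open>rescale (dirs \<sigma>) (ts @ [F.w]) (ts @ [v]) (lam \<tau> v)\<close> btw] .
  have "\<kappa> * \<bar>lam \<tau> v\<bar> = \<bar>d\<bar>" by (rule vol_normalized[OF btv eq]) (use \<kappa>(1) in simp_all)
  thus ?thesis unfolding sh(2) vd c\<tau> by simp
qed

lemma hit_integral:
  assumes \<tau>: "\<tau> facet_of \<sigma>" and v: "lam \<tau> v \<noteq> 0"
    and f: "continuous_on \<tau> f" and K: "compact K" "\<And>x. x \<in> \<tau> - K \<Longrightarrow> f x = (0::real)"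
  shows "integrable (vol bs a) (\<lambda>x. indicator \<tau> (hit \<tau> v x) * f (hit \<tau> v x))"
    and "(\<integral>x. indicator \<tau> (hit \<tau> v x) * f (hit \<tau> v x) \<partial>vol bs a) = \<kappa> * \<bar>lam \<tau> v\<bar> * cint N \<tau> f"
proof -
  interpret F: facet N \<sigma> \<tau> by (rule facetI[OF \<tau>])
  let ?h = "\<lambda>y. indicator \<tau> y * f y"
  have "(\<lambda>x. indicator \<tau> x *\<^sub>R f x) \<in> borel_measurable borel"
    using F.closed_\<tau> f by (intro borel_measurable_continuous_on_indicator) auto
  hence [measurable]: "?h \<in> borel_measurable borel" by simp
  have hm [measurable]: "hit \<tau> v \<in> borel_measurable borel"
    using vol_shear_snoc(3)[OF lam_linear[OF \<tau>] v, of "lam \<tau> (SOME a. a \<in> \<tau>)"] unfolding hit_def[abs_def] .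
  obtain ts where ts: "lattice_basis (lattice_of N \<tau>) ts"
    using lattice_of_basis_exists[OF N F.\<tau> F.ne] by blast
  obtain b where b: "b \<in> affine hull \<tau>" using F.ne by (meson ex_in_conv hull_inc)
  have c: "cellvol N \<tau> = vol ts b" by (rule cellvol_eq[OF N F.\<tau> F.ne ts b])
  have i: "integrable (cellvol N \<tau>) ?h"
    unfolding c by (rule cell_integrable[OF lattice_of_basis[OF N F.\<tau> F.ne ts] F.closed_\<tau> f K])
  have k: "\<kappa> * \<bar>lam \<tau> v\<bar> \<ge> 0" using \<kappa>(1) by simp
  have "integrable (scale_measure (ennreal (\<kappa> * \<bar>lam \<tau> v\<bar>)) (cellvol N \<tau>)) ?h"
    unfolding scale_measure_density using i k
    by (subst integrable_density) (auto dest: borel_measurable_integrable)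
  hence "integrable (distr (vol bs a) borel (hit \<tau> v)) ?h" unfolding distr_hit[OF \<tau> v] .
  thus "integrable (vol bs a) (\<lambda>x. ?h (hit \<tau> v x))" by (rule integrable_distr[rotated]) simp
  have "(\<integral>x. ?h (hit \<tau> v x) \<partial>vol bs a) = (\<integral>y. ?h y \<partial>distr (vol bs a) borel (hit \<tau> v))"
    by (rule integral_distr[symmetric]) simp_all
  also have "\<dots> = \<kappa> * \<bar>lam \<tau> v\<bar> * cint N \<tau> f"
    unfolding distr_hit[OF \<tau> v] cint_def using borel_measurable_integrable[OF i] k by (intro integral_scale_measure)
  finally show "(\<integral>x. ?h (hit \<tau> v x) \<partial>vol bs a) = \<kappa> * \<bar>lam \<tau> v\<bar> * cint N \<tau> f" .
qed

end

text \<open>Entry points carry a minus sign and positive \<lambda>(v), exit points a plus sign and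
  negative \<lambda>(v). Both therefore contribute -\<lambda>(v) times the integral over the
  facet.\<close>

theorem stokes:
  assumes v: "v \<in> dirs \<sigma>"
    and f: "continuous_on \<sigma> f" and g: "continuous_on \<sigma> g"
    and K: "compact K" "\<And>x. x \<in> \<sigma> - K \<Longrightarrow> f x = (0::real)" "\<And>x. x \<in> \<sigma> - K \<Longrightarrow> g x = 0"
    and deriv: "\<And>x t. x + t *\<^sub>R v \<in> \<sigma> \<Longrightarrow>
      ((\<lambda>s. f (x + s *\<^sub>R v)) has_vector_derivative g (x + t *\<^sub>R v)) (at t within {s. x + s *\<^sub>R v \<in> \<sigma>})"
  shows "cint N \<sigma> g = - (\<Sum>\<tau> | \<tau> facet_of \<sigma>. lam \<tau> v * cint N \<tau> f)"
\<comment> \<open>The zero vector cannot be part of a basis, so it is treated apart; both sides are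
  then 0.\<close>
proof (cases "v = 0")
  case True
  have "g x = 0" if "x \<in> \<sigma>" for x
  proof -
    have "((\<lambda>s. f x) has_vector_derivative g x) (at 0)" using deriv[of x 0] that True by simp
    moreover have "((\<lambda>s. f x) has_vector_derivative 0) (at (0::real))" by simp
    ultimately show ?thesis by (rule vector_derivative_unique_at)
  qed
  hence z: "(\<lambda>x. indicator \<sigma> x * g x) = (\<lambda>_. 0)" by (intro ext) (simp add: indicator_def)
  have "cint N \<sigma> g = 0" unfolding cint_def z by simp
  moreover have "lam \<tau> v = 0" if "\<tau> facet_of \<sigma>" for \<tau> using linear_0[OF lam_linear[OF that]] True by simp
  ultimately show ?thesis by simp
next
  case False
  obtain bs where bs: "is_basis (bs @ [v]) (dirs \<sigma>)" by (rule extend_basis[OF sub\<sigma> v False])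
  obtain es where es: "lattice_basis (lattice_of N \<sigma>) es" using lattice_of_basis_exists[OF N \<sigma> ne] by blast
  obtain a where a: "a \<in> affine hull \<sigma>" using ne by (meson ex_in_conv hull_inc)
  note bes = lattice_of_basis[OF N \<sigma> ne es]
  obtain \<kappa>' where "rescale (dirs \<sigma>) (bs @ [v]) es \<kappa>'" by (rule rescale_exists[OF bs bes])
  then obtain \<kappa> where \<kappa>: "\<kappa> > 0" "vol (bs @ [v]) a = scale_measure (ennreal \<kappa>) (vol es a)"
    unfolding rescale_def by (metis zero_less_abs_iff)
  have c: "cellvol N \<sigma> = vol es a" by (rule cellvol_eq[OF N \<sigma> ne es a])
  let ?G = "\<lambda>x. indicator \<sigma> x * g x"
  let ?H = "\<lambda>\<tau> x. indicator \<tau> (hit \<tau> v x) * f (hit \<tau> v x)"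
  let ?P = "{\<tau>. \<tau> facet_of \<sigma> \<and> lam \<tau> v > 0}" and ?Q = "{\<tau>. \<tau> facet_of \<sigma> \<and> lam \<tau> (- v) > 0}"
  have finP: "finite ?P" "finite ?Q" by (rule finite_subset[OF _ facets_finite], auto)+
  obtain B where B: "\<And>x. x \<in> K \<Longrightarrow> norm x \<le> B" using compact_imp_bounded[OF K(1)] bounded_iff by blast
  have line: "(\<integral>t. ?G (x + t *\<^sub>R v) \<partial>lborel) = (\<Sum>\<tau>\<in>?Q. ?H \<tau> x) - (\<Sum>\<tau>\<in>?P. ?H \<tau> x)" if gd: "good v x" for x
  proof -
    define I where "I = {s. x + s *\<^sub>R v \<in> \<sigma>}"
    have cont: "continuous_on A (\<lambda>s. x + s *\<^sub>R v)" for A by (intro continuous_intros)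
    have cI: "closed I"
    proof -
      have "closed ((\<lambda>s. x + s *\<^sub>R v) -` \<sigma>)" using closed_\<sigma> cont by (intro closed_vimage) auto
      thus ?thesis unfolding I_def vimage_def .
    qed
    have vI: "convex I"
    proof (rule convexI)
      fix s t u w :: real assume *: "s \<in> I" "t \<in> I" "0 \<le> u" "0 \<le> w" "u + w = 1"
      have "u *\<^sub>R (x + s *\<^sub>R v) + w *\<^sub>R (x + t *\<^sub>R v) \<in> \<sigma>"
        using * convexD[OF convex_\<sigma>] unfolding I_def by blast
      also have "u *\<^sub>R (x + s *\<^sub>R v) + w *\<^sub>R (x + t *\<^sub>R v) = (u + w) *\<^sub>R x + (u *\<^sub>R s + w *\<^sub>R t) *\<^sub>R v"
        by (simp add: algebra_simps)
      finally show "u *\<^sub>R s + w *\<^sub>R t \<in> I" using * unfolding I_def by simp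
    qed
    have Gc: "continuous_on I (\<lambda>t. g (x + t *\<^sub>R v))"
      by (rule continuous_on_compose2[OF g cont]) (auto simp: I_def)
    \<comment> \<open>For parameters this large the triangle inequality puts x + t v outside the
      ball around \<open>K\<close>.\<close>
    have B0: "f (x + t *\<^sub>R v) = 0 \<and> g (x + t *\<^sub>R v) = 0"
      if t: "t \<in> I" "(\<bar>B\<bar> + norm x + 1) / norm v \<le> \<bar>t\<bar>" for t
    proof -
      have "\<bar>B\<bar> + norm x + 1 \<le> \<bar>t\<bar> * norm v" using t(2) False by (simp add: field_simps)
      moreover have "\<bar>t\<bar> * norm v - norm x \<le> norm (x + t *\<^sub>R v)"
        using norm_triangle_ineq4[of "x + t *\<^sub>R v" x] by simp
      ultimately have "x + t *\<^sub>R v \<notin> K" using B[of "x + t *\<^sub>R v"] by fastforce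
      thus ?thesis using K t(1) unfolding I_def by blast
    qed
    have dI: "((\<lambda>s. f (x + s *\<^sub>R v)) has_vector_derivative g (x + t *\<^sub>R v)) (at t within I)" if "t \<in> I" for t
      using deriv[of x t] that unfolding I_def by simp
    obtain L R where LR: "(\<integral>t. indicator I t * g (x + t *\<^sub>R v) \<partial>lborel) = R - L"
      "\<forall>t\<in>I. (\<forall>s\<in>I. t \<le> s) \<longrightarrow> L = f (x + t *\<^sub>R v)"
      "\<not> (\<exists>t\<in>I. \<forall>s\<in>I. t \<le> s) \<Longrightarrow> L = 0"
      "\<forall>t\<in>I. (\<forall>s\<in>I. s \<le> t) \<longrightarrow> R = f (x + t *\<^sub>R v)"
      "\<not> (\<exists>t\<in>I. \<forall>s\<in>I. s \<le> t) \<Longrightarrow> R = 0"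
      by (rule line_integral[OF cI vI dI Gc B0], assumption+) (rule that)
    have P: "(\<Sum>\<tau>\<in>?P. ?H \<tau> x) = L"
    proof (cases "\<exists>t\<in>I. \<forall>s\<in>I. t \<le> s")
      case True
      then obtain t where t: "t \<in> I" "\<And>s. s \<in> I \<Longrightarrow> t \<le> s" by blast
      show ?thesis using hit_sum(1)[OF v gd, of t f] LR(2)[rule_format, OF t] t unfolding I_def by simp
    next
      case n: False
      show ?thesis using hit_sum(2)[OF v gd, of f] LR(3)[OF n] n unfolding I_def by simp
    qed
    have I': "x + s *\<^sub>R (- v) \<in> \<sigma> \<longleftrightarrow> - s \<in> I" for s unfolding I_def by simp
    \<comment> \<open>The upper end of the segment is its lower end when the line is run in
      direction -v, and the projection along -v equals that along v.\<close>
    have Q: "(\<Sum>\<tau>\<in>?Q. ?H \<tau> x) = R"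
    proof -
      note v' = subspace_neg[OF sub\<sigma> v] and g' = good_uminus[OF gd]
      have e: "(\<Sum>\<tau>\<in>?Q. ?H \<tau> x) = (\<Sum>\<tau>\<in>?Q. indicator \<tau> (hit \<tau> (- v) x) * f (hit \<tau> (- v) x))"
        by (rule sum.cong) (auto simp: hit_uminus)
      show ?thesis
      proof (cases "\<exists>t\<in>I. \<forall>s\<in>I. s \<le> t")
        case True
        then obtain t where t: "t \<in> I" "\<And>s. s \<in> I \<Longrightarrow> s \<le> t" by blast
        have "(\<Sum>\<tau>\<in>?Q. indicator \<tau> (hit \<tau> (- v) x) * f (hit \<tau> (- v) x)) = f (x + (- t) *\<^sub>R (- v))"
        proof (rule hit_sum(1)[OF v' g'])
          show "x + (- t) *\<^sub>R (- v) \<in> \<sigma>" unfolding I' using t(1) by simp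
          show "- t \<le> s" if "x + s *\<^sub>R (- v) \<in> \<sigma>" for s using that t(2)[of "- s"] unfolding I' by simp
        qed
        moreover have "R = f (x + t *\<^sub>R v)" using LR(4) t by blast
        ultimately show ?thesis unfolding e by simp
      next
        case n: False
        have "\<not> (\<exists>t. x + t *\<^sub>R (- v) \<in> \<sigma> \<and> (\<forall>s. x + s *\<^sub>R (- v) \<in> \<sigma> \<longrightarrow> t \<le> s))"
        proof
          assume "\<exists>t. x + t *\<^sub>R (- v) \<in> \<sigma> \<and> (\<forall>s. x + s *\<^sub>R (- v) \<in> \<sigma> \<longrightarrow> t \<le> s)"
          then obtain t where t: "- t \<in> I" "\<And>s. - s \<in> I \<Longrightarrow> t \<le> s" unfolding I' by blast
          have "s \<le> - t" if "s \<in> I" for s using t(2)[of "- s"] that by simp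
          thus False using n t(1) by blast
        qed
        thus ?thesis unfolding e LR(5)[OF n] by (rule hit_sum(2)[OF v' g'])
      qed
    qed
    have "(\<integral>t. ?G (x + t *\<^sub>R v) \<partial>lborel) = (\<integral>t. indicator I t * g (x + t *\<^sub>R v) \<partial>lborel)"
      by (rule Bochner_Integration.integral_cong) (auto simp: I_def indicator_def)
    thus ?thesis unfolding LR(1) P Q .
  qed
  have iG: "integrable (vol (bs @ [v]) a) ?G" by (rule cell_integrable[OF bs closed_\<sigma> g K(1,3)])
  have mG [measurable]: "?G \<in> borel_measurable borel" using borel_measurable_integrable[OF iG] by simp
  have iH: "integrable (vol bs a) (?H \<tau>)" "(\<integral>x. ?H \<tau> x \<partial>vol bs a) = \<kappa> * \<bar>lam \<tau> v\<bar> * cint N \<tau> f"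
    if "\<tau> facet_of \<sigma>" "lam \<tau> v \<noteq> 0" for \<tau>
    using that facet_of_imp_subset[OF that(1)] K(2) continuous_on_subset[OF f]
    by (intro hit_integral[OF bs es a \<kappa> that _ K(1)]; blast)+
  have Q0: "lam \<tau> (- v) = - lam \<tau> v" if "\<tau> facet_of \<sigma>" for \<tau> using linear_neg[OF lam_linear[OF that]] .
  have iP: "integrable (vol bs a) (?H \<tau>)" if "\<tau> \<in> ?P" for \<tau> using that by (intro iH) auto
  have iQ: "integrable (vol bs a) (?H \<tau>)" if "\<tau> \<in> ?Q" for \<tau> using that by (intro iH) (auto simp: Q0)
  have "\<kappa> * cint N \<sigma> g = (\<integral>x. ?G x \<partial>vol (bs @ [v]) a)"
    unfolding cint_def c \<kappa>(2) using \<kappa>(1) mG by (subst integral_scale_measure) simp_all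
  also have "\<dots> = (\<integral>x. (\<integral>t. ?G (x + t *\<^sub>R v) \<partial>lborel) \<partial>vol bs a)" by (rule integral_vol_snoc[OF iG])
  also have "\<dots> = (\<integral>x. (\<Sum>\<tau>\<in>?Q. ?H \<tau> x) - (\<Sum>\<tau>\<in>?P. ?H \<tau> x) \<partial>vol bs a)"
  proof (rule integral_cong_AE)
    show "(\<lambda>x. \<integral>t. ?G (x + t *\<^sub>R v) \<partial>lborel) \<in> borel_measurable (vol bs a)"
    proof -
      have "(\<lambda>(x, t). ?G (x + t *\<^sub>R v)) \<in> borel_measurable (vol bs a \<Otimes>\<^sub>M lborel)"
      proof -
        have "(\<lambda>p. fst p + snd p *\<^sub>R v) \<in> borel_measurable (vol bs a \<Otimes>\<^sub>M lborel)" by measurable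
        from measurable_compose[OF this mG] show ?thesis by (simp add: case_prod_beta)
      qed
      thus ?thesis by (intro sigma_finite_measure.borel_measurable_lebesgue_integral lborel.sigma_finite_measure_axioms)
    qed
    show "(\<lambda>x. (\<Sum>\<tau>\<in>?Q. ?H \<tau> x) - (\<Sum>\<tau>\<in>?P. ?H \<tau> x)) \<in> borel_measurable (vol bs a)"
      using iP iQ by (intro borel_measurable_integrable Bochner_Integration.integrable_diff Bochner_Integration.integrable_sum)
    show "AE x in vol bs a. (\<integral>t. ?G (x + t *\<^sub>R v) \<partial>lborel) = (\<Sum>\<tau>\<in>?Q. ?H \<tau> x) - (\<Sum>\<tau>\<in>?P. ?H \<tau> x)"
      using good_AE[OF bs] by (rule eventually_mono) (rule line)
  qed
  also have "\<dots> = (\<integral>x. (\<Sum>\<tau>\<in>?Q. ?H \<tau> x) \<partial>vol bs a) - (\<integral>x. (\<Sum>\<tau>\<in>?P. ?H \<tau> x) \<partial>vol bs a)"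
    using iP iQ by (intro Bochner_Integration.integral_diff Bochner_Integration.integrable_sum)
  also have "(\<integral>x. (\<Sum>\<tau>\<in>?Q. ?H \<tau> x) \<partial>vol bs a) = (\<Sum>\<tau>\<in>?Q. - \<kappa> * (lam \<tau> v * cint N \<tau> f))"
    using iQ iH by (subst Bochner_Integration.integral_sum) (auto intro!: sum.cong simp: Q0)
  also have "(\<integral>x. (\<Sum>\<tau>\<in>?P. ?H \<tau> x) \<partial>vol bs a) = (\<Sum>\<tau>\<in>?P. \<kappa> * (lam \<tau> v * cint N \<tau> f))"
    using iP iH by (subst Bochner_Integration.integral_sum) (auto intro!: sum.cong)
  also have "(\<Sum>\<tau>\<in>?Q. - \<kappa> * (lam \<tau> v * cint N \<tau> f)) - (\<Sum>\<tau>\<in>?P. \<kappa> * (lam \<tau> v * cint N \<tau> f)) =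
      - \<kappa> * (\<Sum>\<tau>\<in>?P \<union> ?Q. lam \<tau> v * cint N \<tau> f)"
    using finP by (subst sum.union_disjoint) (auto simp: Q0 sum_distrib_left sum_negf distrib_left)
  \<comment> \<open>The facets left out of both sets are parallel to \<open>v\<close>, with
    \<lambda>(v) = 0.\<close>
  also have "(\<Sum>\<tau>\<in>?P \<union> ?Q. lam \<tau> v * cint N \<tau> f) = (\<Sum>\<tau> | \<tau> facet_of \<sigma>. lam \<tau> v * cint N \<tau> f)"
    using facets_finite by (rule sum.mono_neutral_left) (auto simp: Q0)
  finally have "\<kappa> * cint N \<sigma> g = \<kappa> * - (\<Sum>\<tau> | \<tau> facet_of \<sigma>. lam \<tau> v * cint N \<tau> f)" by simp
  thus ?thesis using \<kappa>(1) mult_left_cancel[of \<kappa>] by blast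
qed

end

subsection \<open>Derivatives within convex sets and alternating forms\<close>

lemma line_deriv:
  assumes f: "(f has_derivative D) (at (x + t *\<^sub>R v) within S)"
  shows "((\<lambda>s. f (x + s *\<^sub>R v)) has_vector_derivative D v) (at t within {s. x + s *\<^sub>R v \<in> S})"
proof -
  have "((\<lambda>s. x + s *\<^sub>R v) has_derivative (\<lambda>s. s *\<^sub>R v)) (at t within {s. x + s *\<^sub>R v \<in> S})"
    by (auto intro!: derivative_eq_intros)
  moreover have "(\<lambda>s. x + s *\<^sub>R v) ` {s. x + s *\<^sub>R v \<in> S} \<subseteq> S" by auto
  hence "(f has_derivative D) (at (x + t *\<^sub>R v) within (\<lambda>s. x + s *\<^sub>R v) ` {s. x + s *\<^sub>R v \<in> S})"
    by (rule has_derivative_subset[OF f])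
  ultimately have "((\<lambda>s. f (x + s *\<^sub>R v)) has_derivative (\<lambda>s. D (s *\<^sub>R v))) (at t within {s. x + s *\<^sub>R v \<in> S})"
    by (rule has_derivative_in_compose)
  moreover have "linear D" using has_derivative_linear[OF f] .
  ultimately show ?thesis by (simp add: has_vector_derivative_def linear_scale)
qed

text \<open>Segments from x to other points of the convex set determine the derivative on their
  differences, and these differences span the direction space. This makes \<open>dirderiv\<close>
  independent of the derivative picked by \<open>frechet_derivative\<close>.\<close>

lemma derivative_dirs_unique:
  fixes f :: "'a::euclidean_space \<Rightarrow> real"
  assumes S: "convex S" "x \<in> S" and D: "(f has_derivative D) (at x within S)" "(f has_derivative D') (at x within S)"
    and v: "v \<in> dirs S"
  shows "D v = D' v"
proof -
  have eq: "D (z - x) = D' (z - x)" if "z \<in> S" for z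
  proof -
    let ?I = "{s. x + s *\<^sub>R (z - x) \<in> S}"
    have sub: "{0..1} \<subseteq> ?I"
    proof
      fix s :: real assume "s \<in> {0..1}"
      hence "(1 - s) *\<^sub>R x + s *\<^sub>R z \<in> S" using S that by (intro convexD) auto
      thus "s \<in> ?I" by (simp add: algebra_simps)
    qed
    have "((\<lambda>s. f (x + s *\<^sub>R (z - x))) has_vector_derivative E (z - x)) (at 0 within {0..1})"
      if "(f has_derivative E) (at x within S)" for E
      using line_deriv[of f E x 0 "z - x" S] that by (intro has_vector_derivative_within_subset[OF _ sub]) simp
    from vector_derivative_unique_within[OF _ this[OF D(1)] this[OF D(2)]] show ?thesis
      by (simp add: at_within_Icc_at_right)
  qed
  have lin: "linear D" "linear D'" using D has_derivative_linear by blast+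
  have "x + v \<in> affine hull S" using v dirs_iff[OF hull_inc[OF S(2)]] by blast
  then obtain u where u: "x + v = x + u" "u \<in> span ((\<lambda>z. - x + z) ` (S - {x}))"
    unfolding affine_hull_span2[OF S(2)] by auto
  have "D u - D' u = 0"
  proof (rule linear_eq_0_on_span[of "\<lambda>u. D u - D' u", OF linear_compose_sub[OF lin] _ u(2)])
    fix z assume "z \<in> (\<lambda>z. - x + z) ` (S - {x})"
    then obtain y where "y \<in> S" "z = y - x" by auto
    thus "D z - D' z = 0" using eq by simp
  qed
  thus ?thesis using u(1) by simp
qed

lemma dirderiv_eq:
  assumes "convex S" "x \<in> S" "(f has_derivative D) (at x within S)" "v \<in> dirs S"
  shows "dirderiv S v f x = D v"
proof -
  have "f differentiable (at x within S)" using assms(3) unfolding differentiable_def by blast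
  hence "(f has_derivative frechet_derivative f (at x within S)) (at x within S)"
    by (simp only: frechet_derivative_works)
  from derivative_dirs_unique[OF assms(1,2) this assms(3,4)] show ?thesis unfolding dirderiv_def .
qed

text \<open>This links the derivatives taken in the full space, on a cell and on a facet: along
  common directions they have the same values.\<close>

lemma dirderiv_restrict:
  assumes S: "convex S" "x \<in> S" "S \<subseteq> U" and v: "v \<in> dirs S" and f: "f differentiable (at x within U)"
    and g: "\<And>y. y \<in> S \<Longrightarrow> g y = f y"
  shows "dirderiv S v g x = dirderiv U v f x" "g differentiable (at x within S)"
proof -
  let ?D = "frechet_derivative f (at x within U)"
  have "(f has_derivative ?D) (at x within U)" using f by (simp only: frechet_derivative_works)
  hence "(f has_derivative ?D) (at x within S)" using S(3) by (rule has_derivative_subset)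
  hence d: "(g has_derivative ?D) (at x within S)"
    by (rule has_derivative_transform[OF S(2), rotated]) (rule g)
  show "dirderiv S v g x = dirderiv U v f x" using dirderiv_eq[OF S(1,2) d v] unfolding dirderiv_def .
  show "g differentiable (at x within S)" using d unfolding differentiable_def by blast
qed

lemma iter_dirderiv_Nil [simp]: "iter_dirderiv S [] f = f"
  by (simp add: iter_dirderiv_def)

lemma iter_dirderiv_Cons [simp]: "iter_dirderiv S (v # vs) f = dirderiv S v (iter_dirderiv S vs f)"
  by (simp add: iter_dirderiv_def)

lemma smooth_openD:
  "smooth_open U f \<Longrightarrow> set vs \<subseteq> dirs U \<Longrightarrow> iter_dirderiv U vs f differentiable_on U"
  unfolding smooth_open_def by blast

lemma smooth_restrict:
  assumes f: "smooth_open U f" and S: "convex S" "S \<subseteq> U" and g: "\<And>y. y \<in> S \<Longrightarrow> g y = f y"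
  shows "set vs \<subseteq> dirs S \<Longrightarrow> x \<in> S \<Longrightarrow> iter_dirderiv S vs g x = iter_dirderiv U vs f x"
    and "smooth_open S g"
proof -
  have sub: "dirs S \<subseteq> dirs U" using S(2) by (rule dirs_mono)
  have diff: "iter_dirderiv U vs f differentiable (at x within U)" if "set vs \<subseteq> dirs S" "x \<in> S" for vs x
    using smooth_openD[OF f, of vs] that sub S(2) unfolding differentiable_on_def by blast
  have eq: "iter_dirderiv S vs g x = iter_dirderiv U vs f x" if "set vs \<subseteq> dirs S" "x \<in> S" for vs x
    using that
  proof (induction vs arbitrary: x)
    case Nil
    then show ?case using g by simp
  next
    case (Cons v vs)
    have vs: "set vs \<subseteq> dirs S" and v: "v \<in> dirs S" using Cons.prems by auto
    show ?case unfolding iter_dirderiv_Cons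
      by (rule dirderiv_restrict[OF S(1) Cons.prems(2) S(2) v diff[OF vs Cons.prems(2)] Cons.IH[OF vs]])
  qed
  show "set vs \<subseteq> dirs S \<Longrightarrow> x \<in> S \<Longrightarrow> iter_dirderiv S vs g x = iter_dirderiv U vs f x" by (rule eq)
  show "smooth_open S g" unfolding smooth_open_def
  proof (intro ballI)
    fix vs assume "vs \<in> lists (dirs S)"
    hence vs: "set vs \<subseteq> dirs S" by auto
    show "iter_dirderiv S vs g differentiable_on S" unfolding differentiable_on_def
    proof (intro ballI)
      fix x assume x: "x \<in> S"
      have "(iter_dirderiv U vs f has_derivative frechet_derivative (iter_dirderiv U vs f) (at x within U)) (at x within U)"
        using diff[OF vs x] by (simp only: frechet_derivative_works)
      from has_derivative_transform[OF x eq[OF vs] has_derivative_subset[OF this S(2)]]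
      show "iter_dirderiv S vs g differentiable (at x within S)" unfolding differentiable_def by blast
    qed
  qed
qed

lemma smooth_on_poly_imp:
  assumes "convex \<sigma>" "smooth_on_poly \<sigma> f"
  shows "smooth_open \<sigma> f"
proof -
  obtain U g where "\<sigma> \<subseteq> U" "smooth_open U g" "\<forall>x\<in>\<sigma>. g x = f x"
    using assms(2) unfolding smooth_on_poly_def by blast
  thus ?thesis using smooth_restrict(2)[OF _ assms(1), of U g f] by simp
qed

lemma smooth_dirderiv:
  assumes "smooth_open S f" "v \<in> dirs S"
  shows "smooth_open S (dirderiv S v f)"
  unfolding smooth_open_def
proof (intro ballI)
  fix vs assume "vs \<in> lists (dirs S)"
  hence "set (vs @ [v]) \<subseteq> dirs S" using assms(2) by auto
  from smooth_openD[OF assms(1) this] show "iter_dirderiv S vs (dirderiv S v f) differentiable_on S"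
    by (simp add: iter_dirderiv_def)
qed

lemma smooth_diff: "smooth_open S f \<Longrightarrow> f differentiable_on S"
  using smooth_openD[of S f "[]"] by simp

lemma smooth_diff_at: "smooth_open S f \<Longrightarrow> x \<in> S \<Longrightarrow> f differentiable (at x within S)"
  using smooth_diff unfolding differentiable_on_def by blast

lemma smooth_cont: "smooth_open S f \<Longrightarrow> continuous_on S f"
  by (intro differentiable_imp_continuous_on smooth_diff)

lemma frechet_works:
  "f differentiable (at x within S) \<Longrightarrow> (f has_derivative frechet_derivative f (at x within S)) (at x within S)"
  by (simp only: frechet_derivative_works)

lemma dirderiv_lincomb:
  assumes S: "convex S" "x \<in> S" "v \<in> dirs S" and f: "f differentiable (at x within S)" "g differentiable (at x within S)"
  shows "dirderiv S v (\<lambda>y. s * f y + t * g y) x = s * dirderiv S v f x + t * dirderiv S v g x"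
proof -
  have "((\<lambda>y. s * f y + t * g y) has_derivative (\<lambda>h. s * frechet_derivative f (at x within S) h + t * frechet_derivative g (at x within S) h)) (at x within S)"
    using frechet_works[OF f(1)] frechet_works[OF f(2)] by (intro derivative_intros)
  from dirderiv_eq[OF S(1,2) this S(3)] show ?thesis by (simp add: dirderiv_def)
qed

lemma dirderiv_sum:
  assumes S: "convex S" "x \<in> S" "v \<in> dirs S" and f: "\<And>i. i \<in> A \<Longrightarrow> f i differentiable (at x within S)"
  shows "dirderiv S v (\<lambda>y. \<Sum>i\<in>A. c i * f i y) x = (\<Sum>i\<in>A. c i * dirderiv S v (f i) x)"
proof -
  have "((\<lambda>y. \<Sum>i\<in>A. c i * f i y) has_derivative (\<lambda>h. \<Sum>i\<in>A. c i * frechet_derivative (f i) (at x within S) h)) (at x within S)"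
    using frechet_works[OF f] by (intro has_derivative_sum has_derivative_mult_right)
  from dirderiv_eq[OF S(1,2) this S(3)] show ?thesis by (simp add: dirderiv_def)
qed

lemma dirderiv_linear:
  assumes "f differentiable (at x within S)"
  shows "dirderiv S (s *\<^sub>R a + t *\<^sub>R b) f x = s * dirderiv S a f x + t * dirderiv S b f x"
  unfolding dirderiv_def using linear_frechet_derivative[OF assms] by (simp add: linear_add linear_scale)

lemma dirderiv_zero_off:
  fixes f :: "'a::euclidean_space \<Rightarrow> real"
  assumes S: "convex S" "x \<in> S" "v \<in> dirs S" and K: "closed K" "x \<notin> K" and f: "\<And>y. y \<in> S - K \<Longrightarrow> f y = 0"
  shows "dirderiv S v f x = 0"
proof -
  obtain d where d: "d > 0" "ball x d \<subseteq> - K" using K openE[of "- K" x] by auto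
  have "(f has_derivative (\<lambda>_. 0)) (at x within S)"
  proof (rule has_derivative_transform_within[OF _ d(1) S(2)])
    show "((\<lambda>_. 0::real) has_derivative (\<lambda>_. 0)) (at x within S)" by (rule has_derivative_const)
    show "0 = f y" if "y \<in> S" "dist y x < d" for y using that d(2) f[of y] by (auto simp: dist_commute)
  qed
  from dirderiv_eq[OF S(1,2) this S(3)] show ?thesis .
qed

lemma dirderiv_zero:
  fixes f :: "'a::euclidean_space \<Rightarrow> real"
  assumes S: "convex S" "x \<in> S" "v \<in> dirs S" and f: "\<And>y. y \<in> S \<Longrightarrow> f y = 0"
  shows "dirderiv S v f x = 0"
  by (rule dirderiv_zero_off[OF S, of "{}"]) (use f in auto)

section \<open>Alternating forms\<close>

lemma omit_nth: "i < length v \<Longrightarrow> j < length v - 1 \<Longrightarrow> omit i v ! j = (if j < i then v ! j else v ! Suc j)"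
  by (auto simp: omit_def nth_append)

lemma omit_length: "i < length v \<Longrightarrow> length (omit i v) = length v - 1"
  by (simp add: omit_def)

lemma omit_set: "set (omit i v) \<subseteq> set v"
  by (auto simp: omit_def dest: in_set_takeD in_set_dropD)

lemma omit_update_same: "i < length v \<Longrightarrow> omit i (v[i := x]) = omit i v"
  by (simp add: omit_def)

lemma omit_update:
  assumes "i < length v" "k < length v" "i \<noteq> k"
  shows "omit i (v[k := x]) = (omit i v)[(if k < i then k else k - 1) := x]"
  using assms by (intro nth_equalityI) (auto simp: omit_nth omit_length nth_list_update)

lemma omit_append:
  "omit (length P) (P @ c # R) = P @ R"
  by (simp add: omit_def)

lemma alt_lin_append:
  assumes "alt_multilinear L \<eta>" "set (P @ S) \<subseteq> L" "a \<in> L" "b \<in> L"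
  shows "\<eta> (P @ (s *\<^sub>R a + t *\<^sub>R b) # S) = s * \<eta> (P @ a # S) + t * \<eta> (P @ b # S)"
  using alt_lin[OF assms(1), of "P @ a # S" "length P" a b s t] assms by (simp add: list_update_append)

lemma alt_swap_adj:
  assumes "alt_multilinear L \<eta>" "subspace L" "set (P @ S) \<subseteq> L" "a \<in> L" "b \<in> L"
  shows "\<eta> (P @ a # b # S) = - \<eta> (P @ b # a # S)"
proof -
  have z: "\<eta> (P @ c # c # S) = 0" if "c \<in> L" for c
    by (rule alt_eq[OF assms(1), of _ "length P" "Suc (length P)"]) (use that assms in \<open>auto simp: nth_append\<close>)
  have ab: "a + b \<in> L" using assms by (intro subspace_add)
  have 1: "\<eta> (P @ (a + b) # (a + b) # S) = \<eta> (P @ a # (a + b) # S) + \<eta> (P @ b # (a + b) # S)"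
    using alt_lin_append[OF assms(1), of P "(a + b) # S" a b 1 1] assms ab by auto
  have 2: "\<eta> (P @ c # (a + b) # S) = \<eta> (P @ c # a # S) + \<eta> (P @ c # b # S)" if "c \<in> L" for c
    using alt_lin_append[OF assms(1), of "P @ [c]" S a b 1 1] assms that by auto
  show ?thesis using 1 2 z assms(4,5) ab by simp
qed

lemma alt_move:
  assumes "alt_multilinear L \<eta>" "subspace L" "set (P @ Q @ c # R) \<subseteq> L"
  shows "\<eta> (P @ Q @ c # R) = (-1) ^ length Q * \<eta> (P @ c # Q @ R)"
  using assms(3)
proof (induction Q arbitrary: P)
  case (Cons q Q)
  have "\<eta> ((P @ [q]) @ Q @ c # R) = (-1) ^ length Q * \<eta> ((P @ [q]) @ c # Q @ R)"
    by (rule Cons.IH) (use Cons.prems in auto)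
  moreover have "\<eta> (P @ q # c # Q @ R) = - \<eta> (P @ c # q # Q @ R)"
    by (rule alt_swap_adj[OF assms(1,2)]) (use Cons.prems in auto)
  ultimately show ?case by simp
qed simp

text \<open>With \<open>B a l\<close> the product of a linear form at \<open>a\<close> and an
  alternating form at \<open>l\<close>, this is their wedge product; with \<open>B a\<close> a
  derivative in direction \<open>a\<close>, it is an exterior derivative at one point.\<close>

definition ext1 :: "('a \<Rightarrow> 'a list \<Rightarrow> real) \<Rightarrow> 'a list \<Rightarrow> real" where
  "ext1 B v = (\<Sum>i<length v. (-1) ^ i * B (v ! i) (omit i v))"

text \<open>If the entries at l < k coincide, every term that omits neither of them vanishes. In one
  of the other two terms the repeated vector is moved past the list \<open>Q\<close> between both
  places; as k = l + length Q + 1, the two terms cancel.\<close>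

lemma ext1_alt:
  fixes B :: "'a::euclidean_space \<Rightarrow> 'a list \<Rightarrow> real"
  assumes L: "subspace L" and alt: "\<And>a. a \<in> L \<Longrightarrow> alt_multilinear L (B a)"
    and lin: "\<And>a b s t l. a \<in> L \<Longrightarrow> b \<in> L \<Longrightarrow> set l \<subseteq> L \<Longrightarrow> B (s *\<^sub>R a + t *\<^sub>R b) l = s * B a l + t * B b l"
  shows "alt_multilinear L (ext1 B)"
  unfolding alt_multilinear_def
proof (intro ballI allI impI conjI)
  fix v :: "'a list" and k assume "v \<in> lists L" and k: "k < length v"
  hence v: "set v \<subseteq> L" by auto
  have vi: "v ! i \<in> L" if "i < length v" for i using v that nth_mem by blast
  have om: "set (omit i v) \<subseteq> L" for i using v omit_set[of i v] by blast
  {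
    fix a b s t assume ab: "a \<in> L" "b \<in> L"
    let ?k = "\<lambda>i. if k < i then k else k - 1"
    have e: "(-1) ^ i * B (v[k := x] ! i) (omit i (v[k := x])) =
        (-1) ^ i * (if i = k then B x (omit k v) else B (v ! i) ((omit i v)[?k i := x]))" if "i < length v" for i x
      using that k by (cases "i = k") (simp_all add: omit_update_same omit_update)
    have E: "ext1 B (v[k := x]) = (\<Sum>i<length v. (-1) ^ i * (if i = k then B x (omit k v) else B (v ! i) ((omit i v)[?k i := x])))" for x
      unfolding ext1_def by (rule sum.cong) (use e in simp_all)
    have "(-1) ^ i * (if i = k then B (s *\<^sub>R a + t *\<^sub>R b) (omit k v) else B (v ! i) ((omit i v)[?k i := s *\<^sub>R a + t *\<^sub>R b])) =
       s * ((-1) ^ i * (if i = k then B a (omit k v) else B (v ! i) ((omit i v)[?k i := a]))) +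
       t * ((-1) ^ i * (if i = k then B b (omit k v) else B (v ! i) ((omit i v)[?k i := b])))" if i: "i < length v" for i
    proof (cases "i = k")
      case True
      thus ?thesis using lin[OF ab om[of k]] by (simp add: algebra_simps)
    next
      case False
      have "?k i < length (omit i v)" using i k False by (auto simp: omit_length)
      from alt_lin[OF alt[OF vi[OF i]] om this ab] False show ?thesis by (simp add: algebra_simps)
    qed
    thus "ext1 B (v[k := s *\<^sub>R a + t *\<^sub>R b]) = s * ext1 B (v[k := a]) + t * ext1 B (v[k := b])"
      unfolding E by (simp add: sum_distrib_left sum.distrib[symmetric])
  next
    fix l assume l: "l < k" and eq: "v ! k = v ! l"
    define c where "c = v ! k"
    define P where "P = take l v"
    define Q where "Q = drop (Suc l) (take k v)"
    define R where "R = drop (Suc k) v"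
    have v1: "v = take k v @ c # R" unfolding c_def R_def using k by (rule id_take_nth_drop)
    have "take k v = take l (take k v) @ take k v ! l # drop (Suc l) (take k v)"
      by (rule id_take_nth_drop) (use l k in simp)
    also have "\<dots> = P @ c # Q" using l k eq by (simp add: P_def Q_def c_def min_def)
    finally have v2: "v = P @ c # Q @ c # R" using v1 by simp
    have lP: "length P = l" and lPQ: "length (P @ c # Q) = k" using l k by (auto simp: P_def Q_def)
    have ok: "omit k v = P @ c # Q @ R" using omit_append[of "P @ c # Q" c R] lPQ v2 by simp
    have ol: "omit l v = P @ Q @ c # R" using omit_append[of P c "Q @ c # R"] lP v2 by simp
    have z: "(-1) ^ i * B (v ! i) (omit i v) = 0" if i: "i \<in> {..<length v} - {k, l}" for i
    proof -
      have i': "i < length v" using i by simp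
      let ?p = "if k < i then k else k - 1" and ?q = "if l < i then l else l - 1"
      have "?p < length (omit i v)" "?q < length (omit i v)" "?p \<noteq> ?q" "omit i v ! ?p = omit i v ! ?q"
        using i k l eq by (auto simp: omit_length omit_nth)
      from alt_eq[OF alt[OF vi[OF i']] om this] have "B (v ! i) (omit i v) = 0" .
      thus ?thesis by simp
    qed
    have mv: "B c (P @ Q @ c # R) = (-1) ^ length Q * B c (P @ c # Q @ R)"
      by (rule alt_move[OF alt L]) (use v v2 in auto)
    have "ext1 B v = (\<Sum>i\<in>{k, l}. (-1) ^ i * B (v ! i) (omit i v))"
      unfolding ext1_def using z k l by (intro sum.mono_neutral_right) auto
    also have "\<dots> = (-1) ^ k * B c (P @ c # Q @ R) + (-1) ^ l * B c (P @ Q @ c # R)"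
      using l eq ok ol by (simp add: c_def)
    also have "\<dots> = 0"
    proof -
      have "k = Suc (l + length Q)" using lP lPQ by simp
      thus ?thesis unfolding mv by (simp add: power_add)
    qed
    finally show "ext1 B v = 0" .
  }
qed

lemma ext1_snoc:
  "ext1 B (ts @ [w]) = (-1) ^ length ts * B w ts + (\<Sum>k<length ts. (-1) ^ k * B (ts ! k) (omit k ts @ [w]))"
proof -
  have "(-1) ^ k * B ((ts @ [w]) ! k) (omit k (ts @ [w])) = (-1) ^ k * B (ts ! k) (omit k ts @ [w])" if "k < length ts" for k
    using that by (simp add: nth_append omit_def)
  thus ?thesis unfolding ext1_def by (simp add: omit_def)
qed

lemma alt_sum_last:
  assumes "alt_multilinear L \<eta>" "subspace L" "set ts \<subseteq> L" "finite A" "\<And>i. i \<in> A \<Longrightarrow> x i \<in> L"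
  shows "\<eta> (ts @ [\<Sum>i\<in>A. c i *\<^sub>R x i]) = (\<Sum>i\<in>A. c i * \<eta> (ts @ [x i]))"
  using assms(4,5)
proof (induction A rule: finite_induct)
  case empty
  have "\<eta> (ts @ [0 *\<^sub>R 0 + 0 *\<^sub>R 0]) = 0 * \<eta> (ts @ [0]) + 0 * \<eta> (ts @ [0])"
    by (rule alt_lin_append[OF assms(1)]) (use assms subspace_0 in auto)
  then show ?case by simp
next
  case (insert i A)
  have "\<eta> (ts @ [c i *\<^sub>R x i + 1 *\<^sub>R (\<Sum>i\<in>A. c i *\<^sub>R x i)]) = c i * \<eta> (ts @ [x i]) + 1 * \<eta> (ts @ [\<Sum>i\<in>A. c i *\<^sub>R x i])"
    using insert.prems assms(3) by (intro alt_lin_append[OF assms(1)] subspace_sum[OF assms(2)] subspace_scale[OF assms(2)]) auto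
  then show ?case using insert by simp
qed

lemma alt_dependent:
  assumes "alt_multilinear L \<eta>" "subspace L" "set ts \<subseteq> L" "distinct ts" "w \<in> span (set ts)"
  shows "\<eta> (ts @ [w]) = 0"
proof -
  obtain c where c: "w = (\<Sum>i<length ts. c i *\<^sub>R ts ! i)" using assms(5) span_list[OF assms(4)] by auto
  have "\<eta> (ts @ [w]) = (\<Sum>i<length ts. c i * \<eta> (ts @ [ts ! i]))"
    unfolding c using assms(3) nth_mem by (intro alt_sum_last[OF assms(1-3)]) auto
  also have "\<dots> = 0"
  proof (rule sum.neutral, rule ballI)
    fix i assume i: "i \<in> {..<length ts}"
    have "set (ts @ [ts ! i]) \<subseteq> L" using i assms(3) nth_mem by auto
    hence "\<eta> (ts @ [ts ! i]) = 0" by (rule alt_eq[OF assms(1), of _ i "length ts"]) (use i in \<open>auto simp: nth_append\<close>)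
    thus "c i * \<eta> (ts @ [ts ! i]) = 0" by simp
  qed
  finally show ?thesis .
qed

subsection \<open>Subdivisions of tropical cycles\<close>

lemma face_same_dim:
  "T face_of S \<Longrightarrow> convex S \<Longrightarrow> aff_dim T \<ge> aff_dim S \<Longrightarrow> T = S"
  using face_of_aff_dim_lt[of S T] by force

lemma dirs_eq_dim:
  assumes "S \<subseteq> T" "S \<noteq> {}" "aff_dim S = aff_dim T"
  shows "dirs S = dirs T"
proof (rule subspace_dim_equal)
  have "T \<noteq> {}" using assms by blast
  thus "subspace (dirs S)" "subspace (dirs T)" using subspace_dirs assms(2) by blast+
  show "dim (dirs T) \<le> dim (dirs S)" using dim_dirs[OF assms(2)] dim_dirs[OF \<open>T \<noteq> {}\<close>] assms(3) by linarith
qed (rule dirs_mono[OF assms(1)])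

text \<open>Modulo the directions of \<tau> each normal vector is an integral multiple of the other,
  so the two factors are both 1 or both -1; the conormal tells which.\<close>

lemma normal_vectors_parallel:
  assumes F: "facet N \<sigma> \<tau>" "facet N \<sigma>' \<tau>'" and eq: "dirs \<sigma> = dirs \<sigma>'" "dirs \<tau> = dirs \<tau>'"
  shows "(facet.conormal N \<sigma> \<tau> (normal_vector N \<sigma>' \<tau>') > 0 \<longrightarrow> normal_vector N \<sigma>' \<tau>' - normal_vector N \<sigma> \<tau> \<in> dirs \<tau>)"
    "(facet.conormal N \<sigma> \<tau> (normal_vector N \<sigma>' \<tau>') < 0 \<longrightarrow> normal_vector N \<sigma>' \<tau>' + normal_vector N \<sigma> \<tau> \<in> dirs \<tau>)"
proof -
  interpret A: facet N \<sigma> \<tau> by (rule F(1))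
  interpret B: facet N \<sigma>' \<tau>' by (rule F(2))
  have l: "lattice_of N \<sigma>' = lattice_of N \<sigma>" "lattice_of N \<tau>' = lattice_of N \<tau>"
    unfolding lattice_of_def eq by blast+
  obtain u k where k: "B.w = u + of_int k *\<^sub>R A.w" "u \<in> dirs \<tau>"
    using B.normal_lattice unfolding l A.normal_decomp unfolding lattice_of_def by blast
  obtain u' k' where k': "A.w = u' + of_int k' *\<^sub>R B.w" "u' \<in> dirs \<tau>"
    using A.normal_lattice unfolding l[symmetric] B.normal_decomp unfolding lattice_of_def eq by blast
  have c: "A.conormal B.w = of_int k"
    unfolding k(1) using k(2) A.conormal_zero A.conormal_normal
    by (simp add: linear_add[OF A.conormal_linear] linear_scale[OF A.conormal_linear])
  have "A.conormal A.w = of_int k' * of_int k"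
    by (subst k'(1)) (use k'(2) A.conormal_zero c in \<open>simp add: linear_add[OF A.conormal_linear] linear_scale[OF A.conormal_linear]\<close>)
  hence "of_int (k' * k) = (1::real)" using A.conormal_normal by simp
  hence "k' * k = 1" by (simp only: of_int_eq_1_iff)
  hence "k = 1 \<or> k = -1" using zmult_eq_1_iff by blast
  thus "A.conormal B.w > 0 \<longrightarrow> B.w - A.w \<in> dirs \<tau>" "A.conormal B.w < 0 \<longrightarrow> B.w + A.w \<in> dirs \<tau>"
    using k unfolding c by auto
qed

locale complex =
  fixes N :: "'a::euclidean_space set" and \<C>
  assumes N: "is_lattice N" and complex: "polyhedral_complex N \<C>"
begin

lemma finite_\<C>: "finite \<C>" using complex unfolding polyhedral_complex_def by blast

lemma cell_ne: "\<sigma> \<in> \<C> \<Longrightarrow> \<sigma> \<noteq> {}" and cell_int: "\<sigma> \<in> \<C> \<Longrightarrow> integral_polyhedron N \<sigma>"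
  using complex unfolding polyhedral_complex_def by blast+

lemma face_mem: "\<sigma> \<in> \<C> \<Longrightarrow> \<tau> face_of \<sigma> \<Longrightarrow> \<tau> \<noteq> {} \<Longrightarrow> \<tau> \<in> \<C>"
  using complex unfolding polyhedral_complex_def by blast

lemma inter_face: "\<sigma> \<in> \<C> \<Longrightarrow> \<rho> \<in> \<C> \<Longrightarrow> \<sigma> \<inter> \<rho> \<noteq> {} \<Longrightarrow> (\<sigma> \<inter> \<rho>) face_of \<sigma> \<and> (\<sigma> \<inter> \<rho>) face_of \<rho>"
  using complex unfolding polyhedral_complex_def by blast

lemma cell_poly: "\<sigma> \<in> \<C> \<Longrightarrow> polyhedron \<sigma>" using cell_int integral_polyhedron_polyhedron by blast
lemma cell_convex: "\<sigma> \<in> \<C> \<Longrightarrow> convex \<sigma>" using cell_poly polyhedron_imp_convex by blast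
lemma cell_closed: "\<sigma> \<in> \<C> \<Longrightarrow> closed \<sigma>" using cell_poly polyhedron_imp_closed by blast

lemma facet_mem: "\<sigma> \<in> \<C> \<Longrightarrow> \<tau> facet_of \<sigma> \<Longrightarrow> \<tau> \<in> \<C>"
  using face_mem unfolding facet_of_def by blast

lemma cellI: "\<sigma> \<in> \<C> \<Longrightarrow> cell N \<sigma>"
  by unfold_locales (use N cell_int cell_ne facet_mem in blast)+

lemma facetI:
  assumes "\<tau> \<in> cells (k - 1) \<C>" "\<sigma> \<in> star_cells k \<C> \<tau>"
  shows "facet N \<sigma> \<tau>"
  using assms cell_int cell_ne N unfolding cells_def star_cells_def by unfold_locales auto

text \<open>A face of \<tau> that contains a relative interior point of \<tau> is all of \<tau>;
  this is applied to the intersection with \<sigma>.\<close>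

lemma relint_face:
  assumes "\<tau> \<in> \<C>" "\<sigma> \<in> \<C>" "p \<in> rel_interior \<tau>" "p \<in> \<sigma>"
  shows "\<tau> face_of \<sigma>"
proof -
  have pt: "p \<in> \<tau>" using assms(3) rel_interior_subset by blast
  hence f: "(\<tau> \<inter> \<sigma>) face_of \<tau>" "(\<tau> \<inter> \<sigma>) face_of \<sigma>" using inter_face[OF assms(1,2)] assms(4) by blast+
  have "\<tau> \<subseteq> \<tau> \<inter> \<sigma>"
    using assms(3,4) pt by (intro subset_of_face_of[OF f(1)]) (auto simp: disjnt_def)
  hence "\<tau> \<inter> \<sigma> = \<tau>" by blast
  thus ?thesis using f(2) by simp
qed

text \<open>Take a cell of least dimension containing the point: on its relative boundary the point
  would lie on a facet, which is a smaller cell of the complex.\<close>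

lemma carrier:
  assumes "p \<in> \<Union>\<C>"
  obtains \<rho> where "\<rho> \<in> \<C>" "p \<in> rel_interior \<rho>"
proof -
  have "\<exists>\<sigma>. \<sigma> \<in> \<C> \<and> p \<in> \<sigma>" using assms by blast
  then obtain \<rho> where \<rho>: "\<rho> \<in> \<C>" "p \<in> \<rho>" and min: "\<And>\<sigma>. \<sigma> \<in> \<C> \<and> p \<in> \<sigma> \<Longrightarrow> nat (aff_dim \<rho>) \<le> nat (aff_dim \<sigma>)"
    using ex_has_least_nat[of "\<lambda>\<sigma>. \<sigma> \<in> \<C> \<and> p \<in> \<sigma>" _ "\<lambda>\<sigma>. nat (aff_dim \<sigma>)"] by metis
  have "p \<in> rel_interior \<rho>"
  proof (rule ccontr)
    assume "p \<notin> rel_interior \<rho>"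
    then obtain \<tau> where \<tau>: "\<tau> facet_of \<rho>" "p \<in> \<tau>" using rel_boundary_of_polyhedron[OF cell_poly[OF \<rho>(1)]] \<rho>(2) by blast
    have "nat (aff_dim \<rho>) \<le> nat (aff_dim \<tau>)" using min[of \<tau>] facet_mem[OF \<rho>(1) \<tau>(1)] \<tau>(2) by blast
    moreover have "aff_dim \<tau> = aff_dim \<rho> - 1" using \<tau>(1) unfolding facet_of_def by blast
    moreover have "aff_dim \<tau> \<ge> 0" using \<tau>(2) aff_dim_negative_iff[of \<tau>] by (metis empty_iff not_le)
    ultimately show False by linarith
  qed
  thus ?thesis using \<rho>(1) that by blast
qed

end

locale subdiv = C: complex N \<C> + D: complex N \<D>
  for N :: "'a::euclidean_space set" and \<C> \<D> and n :: int +
  assumes sub: "subdivision N \<D> \<C>" and pure: "pure_dim n \<C>"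
begin

lemma in_maximal:
  assumes "\<sigma>' \<in> \<D>"
  obtains \<sigma> where "\<sigma> \<in> cells n \<C>" "\<sigma> \<in> maximal_cells \<C>" "\<sigma>' \<subseteq> \<sigma>"
proof -
  obtain \<rho> where \<rho>: "\<rho> \<in> \<C>" "\<sigma>' \<subseteq> \<rho>" using sub assms unfolding subdivision_def by blast
  let ?A = "{\<sigma> \<in> \<C>. \<rho> \<subseteq> \<sigma>}"
  obtain \<sigma> where \<sigma>: "\<sigma> \<in> ?A" "\<And>\<sigma>'. \<sigma>' \<in> ?A \<Longrightarrow> \<sigma> \<subseteq> \<sigma>' \<Longrightarrow> \<sigma> = \<sigma>'"
    using finite_has_maximal[of ?A] C.finite_\<C> \<rho>(1) by auto
  have "\<sigma> \<in> maximal_cells \<C>" unfolding maximal_cells_def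
    using \<sigma> by (auto dest: order_trans)
  moreover have "aff_dim \<sigma> = n" using calculation pure unfolding pure_dim_def by blast
  ultimately show ?thesis using that \<sigma>(1) \<rho>(2) unfolding cells_def by blast
qed

lemma aff_dim_le: "\<sigma>' \<in> \<D> \<Longrightarrow> aff_dim \<sigma>' \<le> n"
  by (erule in_maximal) (use aff_dim_subset in \<open>auto simp: cells_def\<close>)

lemma cells_inter:
  assumes "\<sigma>1 \<in> cells n \<C>" "\<sigma>2 \<in> cells n \<C>" "S \<subseteq> \<sigma>1" "S \<subseteq> \<sigma>2" "S \<noteq> {}" "aff_dim S \<ge> n"
  shows "\<sigma>1 = \<sigma>2"
proof -
  have c: "\<sigma>1 \<in> \<C>" "\<sigma>2 \<in> \<C>" "aff_dim \<sigma>1 = n" "aff_dim \<sigma>2 = n" using assms unfolding cells_def by auto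
  have "aff_dim (\<sigma>1 \<inter> \<sigma>2) \<ge> n" using aff_dim_subset[of S "\<sigma>1 \<inter> \<sigma>2"] assms by auto
  moreover have "(\<sigma>1 \<inter> \<sigma>2) face_of \<sigma>1" "(\<sigma>1 \<inter> \<sigma>2) face_of \<sigma>2" using C.inter_face[OF c(1,2)] assms by blast+
  ultimately have "\<sigma>1 \<inter> \<sigma>2 = \<sigma>1" "\<sigma>1 \<inter> \<sigma>2 = \<sigma>2" using face_same_dim C.cell_convex c by metis+
  thus ?thesis by simp
qed

lemma weight_eq:
  assumes "\<sigma>' \<in> cells n \<D>" "\<sigma> \<in> cells n \<C>" "\<sigma>' \<subseteq> \<sigma>"
  shows "induced_weights n \<C> m \<sigma>' = m \<sigma>"
proof -
  have s: "\<sigma>' \<noteq> {}" "aff_dim \<sigma>' \<ge> n" using assms(1) D.cell_ne unfolding cells_def by auto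
  have "(THE \<sigma>. \<sigma> \<in> cells n \<C> \<and> \<sigma>' \<subseteq> \<sigma>) = \<sigma>"
    using assms(2,3) cells_inter[OF _ assms(2) _ assms(3) s] by (intro the_equality) blast+
  thus ?thesis unfolding induced_weights_def by simp
qed

section \<open>Cells of the subdivision around a cell of codimension one\<close>

context
  fixes \<tau> p
  assumes \<tau>: "\<tau> \<in> cells (n - 1) \<D>" and p: "p \<in> rel_interior \<tau>"
begin

lemma \<tau>D: "\<tau> \<in> \<D>" "aff_dim \<tau> = n - 1" "p \<in> \<tau>" "\<tau> \<noteq> {}" "p \<in> affine hull \<tau>"
proof -
  show "\<tau> \<in> \<D>" "aff_dim \<tau> = n - 1" using \<tau> unfolding cells_def by auto
  show "p \<in> \<tau>" using p rel_interior_subset by blast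
  thus "\<tau> \<noteq> {}" "p \<in> affine hull \<tau>" by (auto intro: hull_inc)
qed

lemma star_dirs:
  assumes "\<sigma> \<in> cells n \<C>" "\<kappa> \<in> star_cells n \<D> \<tau>" "\<kappa> \<subseteq> \<sigma>"
  shows "dirs \<kappa> = dirs \<sigma>"
  using assms D.cell_ne by (intro dirs_eq_dim) (auto simp: star_cells_def cells_def)

lemma not_dirs_dim:
  assumes "p + s *\<^sub>R u \<in> S" "\<tau> \<subseteq> S" "u \<notin> dirs \<tau>" "s > 0"
  shows "aff_dim S \<ge> n"
proof (rule ccontr)
  assume "\<not> ?thesis"
  hence "aff_dim \<tau> = aff_dim S" using aff_dim_subset[OF assms(2)] \<tau>D(2) by linarith
  hence "dirs \<tau> = dirs S" by (intro dirs_eq_dim assms(2) \<tau>D)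
  moreover have "(p + s *\<^sub>R u) - p \<in> dirs S" using assms \<tau>D by (intro dirs_diff hull_inc) auto
  ultimately have "s *\<^sub>R u \<in> dirs \<tau>" by simp
  from subspace_scale[OF subspace_dirs[OF \<tau>D(4)] this, of "1/s"] show False using assms by simp
qed

text \<open>Finitely many cells cover the start of the ray from p in direction u, so one of them
  contains points of the ray arbitrarily close to p. It is closed, so it contains p and hence \<tau>
  as a face; as u leaves the directions of \<tau>, it has full dimension.\<close>

lemma star_exists:
  assumes \<sigma>: "\<sigma> \<in> cells n \<C>" "\<tau> \<subseteq> \<sigma>" and u: "u \<in> dirs \<sigma>" "u \<notin> dirs \<tau>" "\<forall>\<^sub>F s in at_right 0. p + s *\<^sub>R u \<in> \<sigma>"
  obtains \<kappa> where "\<kappa> \<in> star_cells n \<D> \<tau>" "\<kappa> \<subseteq> \<sigma>" "facet.conormal N \<kappa> \<tau> u > 0"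
proof -
  have \<sigma>C: "\<sigma> \<in> \<C>" using \<sigma> unfolding cells_def by blast
  have U: "\<Union>\<D> = \<Union>\<C>" using sub unfolding subdivision_def by blast
  \<comment> \<open>The pigeonhole argument yields a cell met infinitely often near p, which is
    expressed by \<open>frequently\<close>.\<close>
  have "\<exists>\<kappa>\<in>\<D>. \<exists>\<^sub>F s in at_right 0. p + s *\<^sub>R u \<in> \<kappa>"
  proof (rule ccontr)
    assume "\<not> ?thesis"
    hence "\<forall>\<^sub>F s in at_right 0. \<forall>\<kappa>\<in>\<D>. p + s *\<^sub>R u \<notin> \<kappa>"
      using D.finite_\<C> by (intro eventually_ball_finite) (auto simp: not_frequently)
    with u(3) have "\<forall>\<^sub>F s in at_right (0::real). False"
      by eventually_elim (use U \<sigma>C in blast)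
    thus False by simp
  qed
  then obtain \<kappa> where \<kappa>: "\<kappa> \<in> \<D>" and fr: "\<exists>\<^sub>F s in at_right 0. p + s *\<^sub>R u \<in> \<kappa>" by blast
  have "p \<in> \<kappa>"
  proof (rule ccontr)
    assume pn: "p \<notin> \<kappa>"
    have "((\<lambda>s. p + s *\<^sub>R u) \<longlongrightarrow> p + 0 *\<^sub>R u) (at_right 0)" by (intro tendsto_intros)
    hence "\<forall>\<^sub>F s in at_right 0. p + s *\<^sub>R u \<in> - \<kappa>"
      using D.cell_closed[OF \<kappa>] pn by (intro topological_tendstoD) auto
    thus False using fr unfolding frequently_def by simp
  qed
  hence f: "\<tau> face_of \<kappa>" by (rule D.relint_face[OF \<tau>D(1) \<kappa> p])
  hence t\<kappa>: "\<tau> \<subseteq> \<kappa>" by (rule face_of_imp_subset)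
  have "\<exists>\<^sub>F s in at_right 0. p + s *\<^sub>R u \<in> \<kappa> \<and> p + s *\<^sub>R u \<in> \<sigma> \<and> s > 0"
    using frequently_eventually_conj[OF fr eventually_conj[OF u(3) eventually_at_right_less[of 0]]]
    by (rule frequently_elim1) blast
  then obtain s where s: "p + s *\<^sub>R u \<in> \<kappa>" "p + s *\<^sub>R u \<in> \<sigma>" "s > 0" by (metis (mono_tags, lifting) frequently_ex)
  have "aff_dim \<kappa> \<ge> n" by (rule not_dirs_dim[OF s(1) t\<kappa> u(2) s(3)])
  hence star: "\<kappa> \<in> star_cells n \<D> \<tau>" using aff_dim_le[OF \<kappa>] \<kappa> f unfolding star_cells_def cells_def by auto
  obtain \<sigma>2 where \<sigma>2: "\<sigma>2 \<in> cells n \<C>" "\<kappa> \<subseteq> \<sigma>2" by (rule in_maximal[OF \<kappa>])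
  \<comment> \<open>The point of the ray together with \<tau> already spans dimension n and lies in
    \<sigma> as well as in the n-cell around \<kappa>, so these two cells coincide.\<close>
  have "aff_dim (insert (p + s *\<^sub>R u) \<tau>) \<ge> n" by (rule not_dirs_dim[of s u]) (use u s in auto)
  hence "\<sigma> = \<sigma>2"
    by (intro cells_inter[OF \<sigma>(1) \<sigma>2(1), of "insert (p + s *\<^sub>R u) \<tau>"]) (use s \<sigma> \<sigma>2 t\<kappa> in auto)
  hence \<kappa>\<sigma>: "\<kappa> \<subseteq> \<sigma>" using \<sigma>2 by simp
  interpret F: facet N \<kappa> \<tau> by (rule D.facetI[OF \<tau> star])
  have "F.conormal p \<le> F.conormal (p + s *\<^sub>R u)" by (rule F.conormal_ge[OF \<tau>D(3) s(1)])
  hence "F.conormal u \<ge> 0"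
    using s(3) by (simp add: linear_add[OF F.conormal_linear] linear_scale[OF F.conormal_linear] zero_le_mult_iff)
  moreover have "F.conormal u \<noteq> 0" using F.conormal_ker u star_dirs[OF \<sigma>(1) star \<kappa>\<sigma>] by blast
  ultimately show ?thesis using that star \<kappa>\<sigma> by simp
qed

text \<open>Both conormals vanish on the directions of \<tau>, a hyperplane in the common direction
  space, so they are proportional there.\<close>

lemma star_conormal:
  assumes \<kappa>: "\<kappa>1 \<in> star_cells n \<D> \<tau>" "\<kappa>2 \<in> star_cells n \<D> \<tau>" "dirs \<kappa>1 = dirs \<kappa>2" and u: "u \<in> dirs \<kappa>1"
  shows "facet.conormal N \<kappa>2 \<tau> u = facet.conormal N \<kappa>1 \<tau> u * facet.conormal N \<kappa>2 \<tau> (normal_vector N \<kappa>1 \<tau>)"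
proof -
  interpret A: facet N \<kappa>1 \<tau> by (rule D.facetI[OF \<tau> \<kappa>(1)])
  interpret B: facet N \<kappa>2 \<tau> by (rule D.facetI[OF \<tau> \<kappa>(2)])
  have "B.conormal (u - A.conormal u *\<^sub>R A.w) = 0" by (rule B.conormal_zero[OF A.conormal_decomp[OF u]])
  thus ?thesis by (simp add: linear_diff[OF B.conormal_linear] linear_scale[OF B.conormal_linear])
qed

text \<open>Two cells on the same side of \<tau> share the points p + s w for small s > 0. Their
  intersection then has full dimension and, being a face of both, equals both.\<close>

lemma star_unique:
  assumes \<kappa>: "\<kappa>1 \<in> star_cells n \<D> \<tau>" "\<kappa>2 \<in> star_cells n \<D> \<tau>" "dirs \<kappa>1 = dirs \<kappa>2"
    and pos: "facet.conormal N \<kappa>2 \<tau> (normal_vector N \<kappa>1 \<tau>) > 0"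
  shows "\<kappa>1 = \<kappa>2"
proof -
  interpret A: facet N \<kappa>1 \<tau> by (rule D.facetI[OF \<tau> \<kappa>(1)])
  interpret B: facet N \<kappa>2 \<tau> by (rule D.facetI[OF \<tau> \<kappa>(2)])
  have "\<forall>\<^sub>F s in at_right 0. p + s *\<^sub>R A.w \<in> \<kappa>1"
    by (rule A.inward_point[OF p A.normal_dirs]) (simp add: A.conormal_normal)
  moreover have "\<forall>\<^sub>F s in at_right 0. p + s *\<^sub>R A.w \<in> \<kappa>2"
    using A.normal_dirs \<kappa>(3) by (intro B.inward_point[OF p _ pos]) simp
  ultimately have "\<forall>\<^sub>F s in at_right 0. p + s *\<^sub>R A.w \<in> \<kappa>1 \<and> p + s *\<^sub>R A.w \<in> \<kappa>2 \<and> s > 0"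
    using eventually_at_right_less[of 0] by eventually_elim blast
  then obtain s where s: "p + s *\<^sub>R A.w \<in> \<kappa>1 \<inter> \<kappa>2" "s > 0"
    using eventually_happens trivial_limit_at_right_real by blast
  have "aff_dim (\<kappa>1 \<inter> \<kappa>2) \<ge> n"
    by (rule not_dirs_dim[OF s(1) _ A.normal_notin s(2)]) (use A.subset B.subset in blast)
  moreover have k: "\<kappa>1 \<in> \<D>" "\<kappa>2 \<in> \<D>" "aff_dim \<kappa>1 = n" "aff_dim \<kappa>2 = n" using \<kappa> unfolding star_cells_def cells_def by auto
  moreover have "(\<kappa>1 \<inter> \<kappa>2) face_of \<kappa>1" "(\<kappa>1 \<inter> \<kappa>2) face_of \<kappa>2" using D.inter_face[OF k(1,2)] s(1) by blast+
  ultimately have "\<kappa>1 \<inter> \<kappa>2 = \<kappa>1" "\<kappa>1 \<inter> \<kappa>2 = \<kappa>2" using face_same_dim D.cell_convex by metis+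
  thus ?thesis by simp
qed

text \<open>Near \<open>p\<close> the cells of \<open>\<D>\<close> inside \<open>\<sigma>\<close> are two half-spaces if \<open>p\<close> is interior to \<open>\<sigma>\<close>,
  and a single one if \<open>p\<close> is interior to a facet of \<open>\<sigma>\<close>.\<close>

lemma star_sum_interior:
  assumes \<sigma>: "\<sigma> \<in> cells n \<C>" "\<tau> \<subseteq> \<sigma>" "p \<in> rel_interior \<sigma>"
  shows "(\<Sum>\<kappa>\<in>{\<kappa>\<in>star_cells n \<D> \<tau>. \<kappa> \<subseteq> \<sigma>}. normal_vector N \<kappa> \<tau>) \<in> dirs \<tau>"
proof -
  have \<sigma>C: "\<sigma> \<in> \<C>" "aff_dim \<sigma> = n" using \<sigma> unfolding cells_def by auto
  note s\<sigma> = subspace_dirs[OF C.cell_ne[OF \<sigma>C(1)]] and s\<tau> = subspace_dirs[OF \<tau>D(4)]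
  have "\<not> dirs \<sigma> \<subseteq> dirs \<tau>"
    using dim_subset[of "dirs \<sigma>" "dirs \<tau>"] dim_dirs[OF C.cell_ne[OF \<sigma>C(1)]] dim_dirs[OF \<tau>D(4)] \<sigma>C(2) \<tau>D(2) by linarith
  then obtain u where u: "u \<in> dirs \<sigma>" "u \<notin> dirs \<tau>" by blast
  have ev: "\<forall>\<^sub>F s in at_right 0. p + s *\<^sub>R v \<in> \<sigma>" if "v \<in> dirs \<sigma>" for v
  proof (rule rel_interior_tendsto[OF \<sigma>(3)])
    have "((\<lambda>s. p + s *\<^sub>R v) \<longlongrightarrow> p + 0 *\<^sub>R v) (at_right 0)" by (intro tendsto_intros)
    thus "((\<lambda>s. p + s *\<^sub>R v) \<longlongrightarrow> p) (at_right 0)" by simp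
    have "p \<in> \<sigma>" using \<sigma>(3) rel_interior_subset[of \<sigma>] by blast
    hence pa: "p \<in> affine hull \<sigma>" by (rule hull_inc)
    show "\<forall>\<^sub>F s in at_right 0. p + s *\<^sub>R v \<in> affine hull \<sigma>"
      by (intro always_eventually allI) (simp add: dirs_iff[OF pa] subspace_scale[OF s\<sigma> that])
  qed
  \<comment> \<open>As p is interior to \<sigma>, the rays in both directions u and -u stay in
    \<sigma>; they pick out the cell on either side of \<tau>.\<close>
  have mu: "- u \<in> dirs \<sigma>" "- u \<notin> dirs \<tau>" using u subspace_neg[OF s\<sigma>] subspace_neg[OF s\<tau>, of "- u"] by auto
  obtain \<kappa>1 where k1: "\<kappa>1 \<in> star_cells n \<D> \<tau>" "\<kappa>1 \<subseteq> \<sigma>" "facet.conormal N \<kappa>1 \<tau> u > 0"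
    by (rule star_exists[OF \<sigma>(1,2) u ev[OF u(1)]])
  obtain \<kappa>2 where k2: "\<kappa>2 \<in> star_cells n \<D> \<tau>" "\<kappa>2 \<subseteq> \<sigma>" "facet.conormal N \<kappa>2 \<tau> (- u) > 0"
    by (rule star_exists[OF \<sigma>(1,2) mu ev[OF mu(1)]])
  have neg: "facet.conormal N \<kappa> \<tau> (- u) = - facet.conormal N \<kappa> \<tau> u" if "\<kappa> \<in> star_cells n \<D> \<tau>" for \<kappa>
    by (rule linear_neg[OF facet.conormal_linear[OF D.facetI[OF \<tau> that]]])
  have d: "dirs \<kappa> = dirs \<sigma>" if "\<kappa> \<in> star_cells n \<D> \<tau>" "\<kappa> \<subseteq> \<sigma>" for \<kappa> by (rule star_dirs[OF \<sigma>(1) that])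
  have all: "\<kappa> = \<kappa>1 \<or> \<kappa> = \<kappa>2" if k: "\<kappa> \<in> star_cells n \<D> \<tau>" "\<kappa> \<subseteq> \<sigma>" for \<kappa>
  proof -
    interpret K: facet N \<kappa> \<tau> by (rule D.facetI[OF \<tau> k(1)])
    have eq: "dirs \<kappa> = dirs \<kappa>1" "dirs \<kappa> = dirs \<kappa>2" using d k k1 k2 by metis+
    have uk: "u \<in> dirs \<kappa>" "- u \<in> dirs \<kappa>" using d[OF k] u mu by auto
    have "K.conormal u \<noteq> 0" using K.conormal_ker[OF uk(1)] u(2) by blast
    moreover have "\<kappa> = \<kappa>1" if "K.conormal u > 0"
      using star_conormal[OF k(1) k1(1) eq(1) uk(1)] k1(3) that
      by (intro star_unique[OF k(1) k1(1) eq(1)]) (simp add: zero_less_mult_iff)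
    moreover have "\<kappa> = \<kappa>2" if "K.conormal (- u) > 0"
      using star_conormal[OF k(1) k2(1) eq(2) uk(2)] k2(3) that
      by (intro star_unique[OF k(1) k2(1) eq(2)]) (simp add: zero_less_mult_iff)
    ultimately show ?thesis using neg[OF k(1)] by linarith
  qed
  have ne: "\<kappa>1 \<noteq> \<kappa>2" using k1(3) k2(3) neg[OF k2(1)] by auto
  have set: "{\<kappa>\<in>star_cells n \<D> \<tau>. \<kappa> \<subseteq> \<sigma>} = {\<kappa>1, \<kappa>2}" using all k1 k2 by blast
  have eq: "dirs \<kappa>2 = dirs \<kappa>1" using d k1 k2 by metis
  have "- u \<in> dirs \<kappa>2" using d[OF k2(1,2)] mu by simp
  from star_conormal[OF k2(1) k1(1) eq this]
  have "- facet.conormal N \<kappa>1 \<tau> u = facet.conormal N \<kappa>2 \<tau> (- u) * facet.conormal N \<kappa>1 \<tau> (normal_vector N \<kappa>2 \<tau>)"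
    by (simp add: neg[OF k1(1)])
  hence "facet.conormal N \<kappa>1 \<tau> (normal_vector N \<kappa>2 \<tau>) < 0"
    using k1(3) k2(3) by (metis mult_less_0_iff neg_less_0_iff_less not_less_iff_gr_or_eq)
  hence "normal_vector N \<kappa>2 \<tau> + normal_vector N \<kappa>1 \<tau> \<in> dirs \<tau>"
    using normal_vectors_parallel(2)[OF D.facetI[OF \<tau> k1(1)] D.facetI[OF \<tau> k2(1)] eq[symmetric] refl] by blast
  thus ?thesis unfolding set using ne by (simp add: add.commute)
qed

lemma star_sum_facet:
  assumes \<sigma>: "\<sigma> \<in> star_cells n \<C> \<rho>" and \<rho>: "\<rho> \<in> cells (n - 1) \<C>" "\<tau> \<subseteq> \<rho>" "p \<in> rel_interior \<rho>"
  shows "(\<Sum>\<kappa>\<in>{\<kappa>\<in>star_cells n \<D> \<tau>. \<kappa> \<subseteq> \<sigma>}. normal_vector N \<kappa> \<tau>) - normal_vector N \<sigma> \<rho> \<in> dirs \<tau>"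
proof -
  interpret F: facet N \<sigma> \<rho> by (rule C.facetI[OF \<rho>(1) \<sigma>])
  have \<sigma>c: "\<sigma> \<in> cells n \<C>" using \<sigma> unfolding star_cells_def by blast
  have dr: "dirs \<tau> = dirs \<rho>" using \<rho> \<tau>D by (intro dirs_eq_dim) (auto simp: cells_def)
  have t\<sigma>: "\<tau> \<subseteq> \<sigma>" using \<rho>(2) F.subset by blast
  have "\<forall>\<^sub>F s in at_right 0. p + s *\<^sub>R F.w \<in> \<sigma>"
    by (rule F.inward_point[OF \<rho>(3) F.normal_dirs]) (simp add: F.conormal_normal)
  moreover have "F.w \<notin> dirs \<tau>" unfolding dr by (rule F.normal_notin)
  ultimately obtain \<kappa>1 where k1: "\<kappa>1 \<in> star_cells n \<D> \<tau>" "\<kappa>1 \<subseteq> \<sigma>" "facet.conormal N \<kappa>1 \<tau> F.w > 0"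
    using star_exists[OF \<sigma>c t\<sigma> F.normal_dirs] by blast
  have d: "dirs \<kappa> = dirs \<sigma>" if "\<kappa> \<in> star_cells n \<D> \<tau>" "\<kappa> \<subseteq> \<sigma>" for \<kappa> by (rule star_dirs[OF \<sigma>c that])
  \<comment> \<open>The cell lies in \<sigma>, hence on the inner side of \<rho>, so its normal
    vector agrees in direction with that of \<sigma>. This leaves only one cell.\<close>
  have pos: "F.conormal (normal_vector N \<kappa> \<tau>) > 0 \<and> facet.conormal N \<kappa> \<tau> F.w > 0" if k: "\<kappa> \<in> star_cells n \<D> \<tau>" "\<kappa> \<subseteq> \<sigma>" for \<kappa>
  proof -
    interpret K: facet N \<kappa> \<tau> by (rule D.facetI[OF \<tau> k(1)])
    obtain b t where b: "b \<in> \<tau>" "t > 0" "b + t *\<^sub>R K.w \<in> \<kappa>" using K.normal_inward by blast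
    have "F.conormal b \<le> F.conormal (b + t *\<^sub>R K.w)" using b \<rho>(2) k(2) by (intro F.conormal_ge) auto
    hence "F.conormal K.w \<ge> 0"
      using b(2) by (simp add: linear_add[OF F.conormal_linear] linear_scale[OF F.conormal_linear] zero_le_mult_iff)
    moreover have "F.conormal K.w \<noteq> 0" using F.conormal_ker K.normal_dirs d[OF k] K.normal_notin dr by blast
    ultimately have 1: "F.conormal K.w > 0" by simp
    have "K.conormal (K.w - F.conormal K.w *\<^sub>R F.w) = 0"
      using F.conormal_decomp K.normal_dirs d[OF k] dr by (intro K.conormal_zero) auto
    hence "1 = F.conormal K.w * K.conormal F.w"
      by (simp add: linear_diff[OF K.conormal_linear] linear_scale[OF K.conormal_linear] K.conormal_normal)
    hence "K.conormal F.w > 0" using 1 by (metis zero_less_mult_pos zero_less_one)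
    thus ?thesis using 1 by blast
  qed
  have "\<kappa> = \<kappa>1" if k: "\<kappa> \<in> star_cells n \<D> \<tau>" "\<kappa> \<subseteq> \<sigma>" for \<kappa>
  proof -
    have eq: "dirs \<kappa> = dirs \<kappa>1" using d k k1 by metis
    have "F.w \<in> dirs \<kappa>" using d[OF k] F.normal_dirs by simp
    from star_conormal[OF k(1) k1(1) eq this] show ?thesis
      using k1(3) pos[OF k] by (intro star_unique[OF k(1) k1(1) eq]) (simp add: zero_less_mult_iff)
  qed
  hence set: "{\<kappa>\<in>star_cells n \<D> \<tau>. \<kappa> \<subseteq> \<sigma>} = {\<kappa>1}" using k1 by blast
  have "normal_vector N \<kappa>1 \<tau> - F.w \<in> dirs \<rho>"
    using normal_vectors_parallel(1)[OF F.facet_axioms D.facetI[OF \<tau> k1(1)]] pos[OF k1(1,2)] d[OF k1(1,2)] dr by blast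
  thus ?thesis unfolding set dr by simp
qed

end

text \<open>The cells around \<tau> are grouped by the n-cells of \<C> containing them. The cell
  \<rho> carrying a relative interior point of \<tau> contains \<tau>, so its dimension is n or n -
  1.\<close>

lemma balanced:
  assumes bal: "\<And>\<rho>. \<rho> \<in> cells (n - 1) \<C> \<Longrightarrow> (\<Sum>\<sigma>\<in>star_cells n \<C> \<rho>. m \<sigma> *\<^sub>R normal_vector N \<sigma> \<rho>) \<in> dirs \<rho>"
    and \<tau>: "\<tau> \<in> cells (n - 1) \<D>"
  shows "(\<Sum>\<kappa>\<in>star_cells n \<D> \<tau>. induced_weights n \<C> m \<kappa> *\<^sub>R normal_vector N \<kappa> \<tau>) \<in> dirs \<tau>"
proof -
  have t: "\<tau> \<in> \<D>" "aff_dim \<tau> = n - 1" using \<tau> unfolding cells_def by auto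
  have tne: "\<tau> \<noteq> {}" and tcv: "convex \<tau>" using D.cell_ne[OF t(1)] D.cell_convex[OF t(1)] .
  obtain p where p: "p \<in> rel_interior \<tau>" using rel_interior_eq_empty[OF tcv] tne by blast
  have pt: "p \<in> \<tau>" using p rel_interior_subset by blast
  have U: "\<Union>\<D> = \<Union>\<C>" using sub unfolding subdivision_def by blast
  have "p \<in> \<Union>\<C>" using pt t(1) U by blast
  then obtain \<rho> where \<rho>: "\<rho> \<in> \<C>" "p \<in> rel_interior \<rho>" by (rule C.carrier)
  have p\<rho>: "p \<in> \<rho>" using \<rho>(2) rel_interior_subset by blast
  obtain \<sigma>0 where \<sigma>0: "\<sigma>0 \<in> cells n \<C>" "\<tau> \<subseteq> \<sigma>0" by (rule in_maximal[OF t(1)])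
  have \<sigma>0C: "\<sigma>0 \<in> \<C>" "aff_dim \<sigma>0 = n" using \<sigma>0 unfolding cells_def by auto
  have f0: "\<rho> face_of \<sigma>0" using C.relint_face[OF \<rho>(1) \<sigma>0C(1) \<rho>(2)] pt \<sigma>0(2) by blast
  have t\<rho>: "\<tau> \<subseteq> \<rho>"
    using p p\<rho> by (intro subset_of_face_of[OF f0 \<sigma>0(2)]) (auto simp: disjnt_def)
  let ?S = "{\<sigma>\<in>cells n \<C>. p \<in> \<sigma>}"
  have finS: "finite ?S" using C.finite_\<C> unfolding cells_def by simp
  have finst: "finite (star_cells n \<D> \<tau>)" using D.finite_\<C> unfolding star_cells_def cells_def by simp
  have ex1: "\<exists>\<sigma>\<in>?S. \<kappa> \<subseteq> \<sigma>" if "\<kappa> \<in> star_cells n \<D> \<tau>" for \<kappa>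
  proof -
    have k: "\<kappa> \<in> \<D>" "\<tau> \<subseteq> \<kappa>" using that face_of_imp_subset unfolding star_cells_def cells_def by auto
    obtain \<sigma> where "\<sigma> \<in> cells n \<C>" "\<kappa> \<subseteq> \<sigma>" by (rule in_maximal[OF k(1)])
    thus ?thesis using k(2) pt by blast
  qed
  have un: "\<sigma>1 = \<sigma>2" if "\<kappa> \<in> star_cells n \<D> \<tau>" "\<sigma>1 \<in> ?S" "\<sigma>2 \<in> ?S" "\<kappa> \<subseteq> \<sigma>1" "\<kappa> \<subseteq> \<sigma>2" for \<kappa> \<sigma>1 \<sigma>2
    using that D.cell_ne by (intro cells_inter[of \<sigma>1 \<sigma>2 \<kappa>]) (auto simp: star_cells_def cells_def)
  have split: "star_cells n \<D> \<tau> = (\<Union>\<sigma>\<in>?S. {\<kappa>\<in>star_cells n \<D> \<tau>. \<kappa> \<subseteq> \<sigma>})" using ex1 by blast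
  have "(\<Sum>\<kappa>\<in>star_cells n \<D> \<tau>. induced_weights n \<C> m \<kappa> *\<^sub>R normal_vector N \<kappa> \<tau>) =
    (\<Sum>\<sigma>\<in>?S. \<Sum>\<kappa>\<in>{\<kappa>\<in>star_cells n \<D> \<tau>. \<kappa> \<subseteq> \<sigma>}. induced_weights n \<C> m \<kappa> *\<^sub>R normal_vector N \<kappa> \<tau>)"
    by (subst split, rule sum.UNION_disjoint) (use finS finst un in auto)
  also have "\<dots> = (\<Sum>\<sigma>\<in>?S. m \<sigma> *\<^sub>R (\<Sum>\<kappa>\<in>{\<kappa>\<in>star_cells n \<D> \<tau>. \<kappa> \<subseteq> \<sigma>}. normal_vector N \<kappa> \<tau>))"
    unfolding scaleR_sum_right by (intro sum.cong refl) (auto simp: weight_eq star_cells_def)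
  also have "\<dots> \<in> dirs \<tau>"
  proof (cases "aff_dim \<rho> = n")
    \<comment> \<open>\<tau> runs through the interior of one n-cell: there is a single group, whose
      two opposite normal vectors cancel modulo the directions of \<tau>.\<close>
    case True
    have \<rho>n: "\<rho> \<in> cells n \<C>" using True \<rho>(1) unfolding cells_def by blast
    have "\<sigma> = \<rho>" if "\<sigma> \<in> ?S" for \<sigma>
    proof -
      have s: "\<sigma> \<in> \<C>" "p \<in> \<sigma>" "aff_dim \<sigma> = n" using that unfolding cells_def by auto
      show ?thesis using face_same_dim[OF C.relint_face[OF \<rho>(1) s(1) \<rho>(2) s(2)] C.cell_convex[OF s(1)]] s(3) True by simp
    qed
    hence "?S = {\<rho>}" using \<rho>n p\<rho> by blast
    thus ?thesis using star_sum_interior[OF \<tau> p \<rho>n t\<rho> \<rho>(2)] by (simp add: subspace_scale[OF subspace_dirs[OF tne]])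
  next
    \<comment> \<open>\<tau> subdivides \<rho>: each group gives the normal vector of its n-cell at
      \<rho>, so the sum is that of \<C> up to directions of \<tau>.\<close>
    case False
    have "aff_dim \<rho> \<le> n" using aff_dim_subset[OF face_of_imp_subset[OF f0]] \<sigma>0C(2) by simp
    moreover have "aff_dim \<rho> \<ge> n - 1" using aff_dim_subset[OF t\<rho>] t(2) by simp
    ultimately have d: "aff_dim \<rho> = n - 1" using False by linarith
    have \<rho>n: "\<rho> \<in> cells (n - 1) \<C>" using d \<rho>(1) unfolding cells_def by blast
    have S: "?S = star_cells n \<C> \<rho>"
      using C.relint_face[OF \<rho>(1) _ \<rho>(2)] p\<rho> face_of_imp_subset unfolding star_cells_def cells_def by blast
    have dr: "dirs \<rho> = dirs \<tau>" using dirs_eq_dim[OF t\<rho> tne] d t(2) by simp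
    let ?W = "\<lambda>\<sigma>. (\<Sum>\<kappa>\<in>{\<kappa>\<in>star_cells n \<D> \<tau>. \<kappa> \<subseteq> \<sigma>}. normal_vector N \<kappa> \<tau>)"
    note s\<tau> = subspace_dirs[OF tne]
    have "(\<Sum>\<sigma>\<in>?S. m \<sigma> *\<^sub>R (?W \<sigma> - normal_vector N \<sigma> \<rho>)) \<in> dirs \<tau>"
      unfolding S using star_sum_facet[OF \<tau> p _ \<rho>n t\<rho> \<rho>(2)] by (intro subspace_sum[OF s\<tau>] subspace_scale[OF s\<tau>])
    moreover have "(\<Sum>\<sigma>\<in>?S. m \<sigma> *\<^sub>R normal_vector N \<sigma> \<rho>) \<in> dirs \<tau>" unfolding S dr[symmetric] by (rule bal[OF \<rho>n])
    ultimately have "(\<Sum>\<sigma>\<in>?S. m \<sigma> *\<^sub>R (?W \<sigma> - normal_vector N \<sigma> \<rho>)) + (\<Sum>\<sigma>\<in>?S. m \<sigma> *\<^sub>R normal_vector N \<sigma> \<rho>) \<in> dirs \<tau>"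
      by (rule subspace_add[OF s\<tau>])
    thus ?thesis by (simp add: scaleR_diff_right sum_subtractf)
  qed
  finally show ?thesis .
qed

end

subsection \<open>Supercurrents\<close>

definition ES :: "'a::euclidean_space set \<Rightarrow> 'a set \<Rightarrow> 'a list" where
  "ES N \<sigma> = (SOME es. lattice_basis (lattice_of N \<sigma>) es)"

lemma cint_cong: "(\<And>x. x \<in> \<sigma> \<Longrightarrow> f x = g x) \<Longrightarrow> cint N \<sigma> f = cint N \<sigma> g"
  unfolding cint_def by (rule Bochner_Integration.integral_cong) (auto simp: indicator_def)

context cell
begin

lemma ES_lattice: "lattice_basis (lattice_of N \<sigma>) (ES N \<sigma>)"
  unfolding ES_def by (rule someI_ex[OF lattice_of_basis_exists[OF N \<sigma> ne]])

lemma ES_basis: "is_basis (ES N \<sigma>) (dirs \<sigma>)"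
  by (rule lattice_of_basis[OF N \<sigma> ne ES_lattice])

lemma ES_dirs: "set (ES N \<sigma>) \<subseteq> dirs \<sigma>"
  by (rule is_basis_subset[OF ES_basis])

lemma ES_length: "int (length (ES N \<sigma>)) = aff_dim \<sigma>"
  using is_basis_length[OF ES_basis] dim_dirs[OF ne] by simp

lemma cint_integrable:
  assumes "continuous_on \<sigma> f" "compact K" "\<And>x. x \<in> \<sigma> - K \<Longrightarrow> f x = (0::real)"
  shows "integrable (cellvol N \<sigma>) (\<lambda>x. indicator \<sigma> x * f x)"
proof -
  obtain a where a: "a \<in> affine hull \<sigma>" using ne by (meson ex_in_conv hull_inc)
  show ?thesis unfolding cellvol_eq[OF N \<sigma> ne ES_lattice a]
    by (rule cell_integrable[OF ES_basis closed_\<sigma> assms])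
qed

lemma cint_sum:
  assumes "\<And>i. i \<in> I \<Longrightarrow> continuous_on \<sigma> (f i)" "compact K" "\<And>i x. i \<in> I \<Longrightarrow> x \<in> \<sigma> - K \<Longrightarrow> f i x = (0::real)"
  shows "cint N \<sigma> (\<lambda>x. \<Sum>i\<in>I. c i * f i x) = (\<Sum>i\<in>I. c i * cint N \<sigma> (f i))"
proof -
  have i: "integrable (cellvol N \<sigma>) (\<lambda>x. indicator \<sigma> x * f i x)" if "i \<in> I" for i
    by (rule cint_integrable[OF assms(1)[OF that] assms(2) assms(3)[OF that]])
  have "cint N \<sigma> (\<lambda>x. \<Sum>i\<in>I. c i * f i x) = (\<integral>x. (\<Sum>i\<in>I. c i * (indicator \<sigma> x * f i x)) \<partial>cellvol N \<sigma>)"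
    unfolding cint_def by (rule Bochner_Integration.integral_cong) (auto simp: sum_distrib_left mult.left_commute)
  also have "\<dots> = (\<Sum>i\<in>I. (\<integral>x. c i * (indicator \<sigma> x * f i x) \<partial>cellvol N \<sigma>))"
    by (rule Bochner_Integration.integral_sum) (use i in simp)
  also have "\<dots> = (\<Sum>i\<in>I. c i * cint N \<sigma> (f i))" unfolding cint_def by simp
  finally show ?thesis .
qed

lemma cint_lincomb:
  assumes "continuous_on \<sigma> f" "continuous_on \<sigma> g" "compact K"
    "\<And>x. x \<in> \<sigma> - K \<Longrightarrow> f x = 0" "\<And>x. x \<in> \<sigma> - K \<Longrightarrow> g x = 0"
  shows "cint N \<sigma> (\<lambda>x. s * f x + t * g x) = s * cint N \<sigma> f + t * cint N \<sigma> g"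
  using cint_sum[of "{True, False}" "\<lambda>b. if b then f else g" K "\<lambda>b. if b then s else t"] assms by simp

lemma integral_form_cint:
  assumes "continuous_on \<sigma> (\<lambda>x. \<alpha> x (ES N \<sigma>) (ES N \<sigma>))"
  shows "integral_form N \<sigma> \<alpha> =
    (-1) ^ (length (ES N \<sigma>) * (length (ES N \<sigma>) - 1) div 2) * cint N \<sigma> (\<lambda>x. \<alpha> x (ES N \<sigma>) (ES N \<sigma>))"
proof -
  let ?h = "\<lambda>x. indicator \<sigma> x * \<alpha> x (ES N \<sigma>) (ES N \<sigma>)"
  have "(\<lambda>x. indicator \<sigma> x *\<^sub>R \<alpha> x (ES N \<sigma>) (ES N \<sigma>)) \<in> borel_measurable borel"
    using closed_\<sigma> assms by (intro borel_measurable_continuous_on_indicator) auto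
  hence m: "?h \<in> borel_measurable borel" by simp
  define a where "a = (SOME a. a \<in> affine hull \<sigma>)"
  have "cint N \<sigma> (\<lambda>x. \<alpha> x (ES N \<sigma>) (ES N \<sigma>)) = (\<integral>y. ?h (param (ES N \<sigma>) a y) \<partial>lebn {..<length (ES N \<sigma>)})"
    unfolding cint_def cellvol_def ES_def[symmetric] a_def[symmetric] vol_def
    by (rule integral_distr[OF _ m]) (simp add: param_measurable)
  also have "\<dots> = (LINT y : {y. param (ES N \<sigma>) a y \<in> \<sigma>} | lebn {..<length (ES N \<sigma>)}. \<alpha> (param (ES N \<sigma>) a y) (ES N \<sigma>) (ES N \<sigma>))"
    unfolding set_lebesgue_integral_def by (rule Bochner_Integration.integral_cong) (auto simp: indicator_def)
  finally show ?thesis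
    unfolding integral_form_def Let_def ES_def[symmetric] a_def[symmetric] param_def by simp
qed

text \<open>Integration by parts in a constant direction; the compact support is carried by
  \<open>g\<close> alone.\<close>

lemma stokes_prod:
  assumes f: "smooth_open \<sigma> f" and g: "smooth_open \<sigma> g" and K: "compact K" "\<And>x. x \<in> \<sigma> - K \<Longrightarrow> g x = 0"
    and v: "v \<in> dirs \<sigma>"
  shows "cint N \<sigma> (\<lambda>x. f x * dirderiv \<sigma> v g x + dirderiv \<sigma> v f x * g x) =
    - (\<Sum>\<tau> | \<tau> facet_of \<sigma>. lam \<tau> v * cint N \<tau> (\<lambda>x. f x * g x))"
proof (rule stokes[OF v _ _ K(1)])
  show "continuous_on \<sigma> (\<lambda>x. f x * g x)" by (intro continuous_on_mult smooth_cont f g)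
  show "continuous_on \<sigma> (\<lambda>x. f x * dirderiv \<sigma> v g x + dirderiv \<sigma> v f x * g x)"
    by (intro continuous_on_add continuous_on_mult smooth_cont smooth_dirderiv f g v)
  fix x assume x: "x \<in> \<sigma> - K"
  show "f x * g x = 0" using K(2)[OF x] by simp
  have "dirderiv \<sigma> v g x = 0"
    using x K(2) by (intro dirderiv_zero_off[OF convex_\<sigma> _ v compact_imp_closed[OF K(1)]]) auto
  thus "f x * dirderiv \<sigma> v g x + dirderiv \<sigma> v f x * g x = 0" using K(2)[OF x] by simp
next
  fix x t assume x: "x + t *\<^sub>R v \<in> \<sigma>"
  from line_deriv[OF has_derivative_mult[OF frechet_works[OF smooth_diff_at[OF f x]] frechet_works[OF smooth_diff_at[OF g x]]]]
  show "((\<lambda>s. f (x + s *\<^sub>R v) * g (x + s *\<^sub>R v)) has_vector_derivative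
      f (x + t *\<^sub>R v) * dirderiv \<sigma> v g (x + t *\<^sub>R v) + dirderiv \<sigma> v f (x + t *\<^sub>R v) * g (x + t *\<^sub>R v))
     (at t within {s. x + s *\<^sub>R v \<in> \<sigma>})" unfolding dirderiv_def .
qed

end

lemma smooth_lincomb:
  assumes S: "convex S" and f: "smooth_open S f" and g: "smooth_open S g"
  shows "smooth_open S (\<lambda>x. s * f x + t * g x)"
proof -
  let ?h = "\<lambda>x. s * f x + t * g x"
  have diff: "(\<lambda>x. s * iter_dirderiv S vs f x + t * iter_dirderiv S vs g x) differentiable (at x within S)"
    if "set vs \<subseteq> dirs S" "x \<in> S" for vs x
    using smooth_openD[OF f that(1)] smooth_openD[OF g that(1)] that(2)
    unfolding differentiable_on_def by (intro differentiable_add differentiable_mult differentiable_const) auto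
  have eq: "iter_dirderiv S vs ?h x = s * iter_dirderiv S vs f x + t * iter_dirderiv S vs g x"
    if "set vs \<subseteq> dirs S" "x \<in> S" for vs x
    using that
  proof (induction vs arbitrary: x)
    case (Cons v vs)
    have vs: "set vs \<subseteq> dirs S" and v: "v \<in> dirs S" using Cons.prems by auto
    have d: "iter_dirderiv S vs f differentiable (at x within S)" "iter_dirderiv S vs g differentiable (at x within S)"
      using smooth_openD[OF f vs] smooth_openD[OF g vs] Cons.prems(2) unfolding differentiable_on_def by blast+
    have "iter_dirderiv S (v # vs) ?h x = dirderiv S v (\<lambda>x. s * iter_dirderiv S vs f x + t * iter_dirderiv S vs g x) x"
      unfolding iter_dirderiv_Cons
      by (rule dirderiv_restrict(1)[OF S Cons.prems(2) order_refl v diff[OF vs Cons.prems(2)] Cons.IH[OF vs]])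
    also have "\<dots> = s * iter_dirderiv S (v # vs) f x + t * iter_dirderiv S (v # vs) g x"
      unfolding iter_dirderiv_Cons by (rule dirderiv_lincomb[OF S Cons.prems(2) v d])
    finally show ?case .
  qed simp
  show ?thesis unfolding smooth_open_def differentiable_on_def
  proof (intro ballI)
    fix vs x assume "vs \<in> lists (dirs S)" and x: "x \<in> S"
    hence vs: "set vs \<subseteq> dirs S" by auto
    have "iter_dirderiv S vs ?h differentiable (at x within S)"
      by (rule differentiable_transform_within[OF diff[OF vs x] zero_less_one x]) (use eq[OF vs] in simp)
    thus "iter_dirderiv S vs ?h differentiable (at x within S)" .
  qed
qed

lemma superforms_alt1:
  "\<alpha> \<in> superforms N p q \<Longrightarrow> x \<in> span N \<Longrightarrow> set w \<subseteq> span N \<Longrightarrow> alt_multilinear (span N) (\<lambda>v. \<alpha> x v w)"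
  unfolding superforms_def lists_eq_set by blast

lemma superforms_alt2:
  "\<alpha> \<in> superforms N p q \<Longrightarrow> x \<in> span N \<Longrightarrow> set v \<subseteq> span N \<Longrightarrow> alt_multilinear (span N) (\<lambda>w. \<alpha> x v w)"
  unfolding superforms_def lists_eq_set by blast

lemma superforms_smooth:
  "\<alpha> \<in> superforms N p q \<Longrightarrow> set v \<subseteq> span N \<Longrightarrow> set w \<subseteq> span N \<Longrightarrow> smooth_open (span N) (\<lambda>x. \<alpha> x v w)"
  unfolding superforms_def lists_eq_set by blast

lemma superforms_zero:
  "\<alpha> \<in> superforms N p q \<Longrightarrow> x \<in> span N \<Longrightarrow> set v \<subseteq> span N \<Longrightarrow> set w \<subseteq> span N \<Longrightarrow>
    \<not> (int (length v) = p \<and> int (length w) = q) \<Longrightarrow> \<alpha> x v w = 0"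
  unfolding superforms_def lists_eq_set by blast

lemma alt_multilinear_lincomb:
  assumes "alt_multilinear V f" "alt_multilinear V g"
  shows "alt_multilinear V (\<lambda>v. s * f v + t * g v)"
  using assms unfolding alt_multilinear_def by (simp add: algebra_simps)

lemma superforms_lincomb:
  assumes "\<alpha> \<in> superforms N p q" "\<beta> \<in> superforms N p q"
  shows "(\<lambda>x v w. s * \<alpha> x v w + t * \<beta> x v w) \<in> superforms N p q"
proof -
  have cv: "convex (span N)" by (simp add: subspace_imp_convex)
  show ?thesis unfolding superforms_def
  proof (intro CollectI conjI ballI impI)
    fix x v w assume x: "x \<in> span N" and "v \<in> lists (span N)" "w \<in> lists (span N)"
    hence vw: "set v \<subseteq> span N" "set w \<subseteq> span N" by auto
    show "alt_multilinear (span N) (\<lambda>v. s * \<alpha> x v w + t * \<beta> x v w)"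
      by (intro alt_multilinear_lincomb superforms_alt1[OF assms(1) x vw(2)] superforms_alt1[OF assms(2) x vw(2)])
    show "alt_multilinear (span N) (\<lambda>w. s * \<alpha> x v w + t * \<beta> x v w)"
      by (intro alt_multilinear_lincomb superforms_alt2[OF assms(1) x vw(1)] superforms_alt2[OF assms(2) x vw(1)])
    assume l: "\<not> (int (length v) = p \<and> int (length w) = q)"
    show "s * \<alpha> x v w + t * \<beta> x v w = 0"
      using superforms_zero[OF assms(1) x vw l] superforms_zero[OF assms(2) x vw l] by simp
  next
    fix v w assume "v \<in> lists (span N)" "w \<in> lists (span N)"
    hence vw: "set v \<subseteq> span N" "set w \<subseteq> span N" by auto
    show "smooth_open (span N) (\<lambda>x. s * \<alpha> x v w + t * \<beta> x v w)"
      by (rule smooth_lincomb[OF cv superforms_smooth[OF assms(1) vw] superforms_smooth[OF assms(2) vw]])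
  qed
qed

lemma test_forms_lincomb:
  assumes "\<alpha> \<in> test_forms N \<C> p q" "\<beta> \<in> test_forms N \<C> p q"
  shows "(\<lambda>x v w. s * \<alpha> x v w + t * \<beta> x v w) \<in> test_forms N \<C> p q"
proof -
  obtain K where K: "compact K" "\<forall>\<sigma>\<in>maximal_cells \<C>. \<forall>x\<in>\<sigma> - K. \<forall>v\<in>lists (dirs \<sigma>). \<forall>w\<in>lists (dirs \<sigma>). \<alpha> x v w = 0"
    using assms(1) unfolding test_forms_def by blast
  obtain L where L: "compact L" "\<forall>\<sigma>\<in>maximal_cells \<C>. \<forall>x\<in>\<sigma> - L. \<forall>v\<in>lists (dirs \<sigma>). \<forall>w\<in>lists (dirs \<sigma>). \<beta> x v w = 0"
    using assms(2) unfolding test_forms_def by blast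
  have "(\<lambda>x v w. s * \<alpha> x v w + t * \<beta> x v w) \<in> superforms N p q"
    using assms unfolding test_forms_def by (intro superforms_lincomb) auto
  moreover have "compact (K \<union> L)" using K(1) L(1) by (rule compact_Un)
  moreover have "\<forall>\<sigma>\<in>maximal_cells \<C>. \<forall>x\<in>\<sigma> - (K \<union> L). \<forall>v\<in>lists (dirs \<sigma>). \<forall>w\<in>lists (dirs \<sigma>).
      s * \<alpha> x v w + t * \<beta> x v w = 0"
    using K(2) L(2) by simp
  ultimately show ?thesis unfolding test_forms_def by blast
qed

lemma supercurrents_tendsto:
  "T \<in> supercurrents N \<C> p q \<Longrightarrow> forms_tend_to_0 N p q A \<Longrightarrow> (\<lambda>j. T (A j)) \<longlonglongrightarrow> 0"
  unfolding supercurrents_def by blast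

context subdiv
begin

lemma cell_span: "\<kappa> \<in> \<D> \<Longrightarrow> \<kappa> \<subseteq> span N"
  using D.cell_int integral_polyhedron_subset by blast

lemma dirs_span_sub: "\<kappa> \<in> \<D> \<Longrightarrow> dirs \<kappa> \<subseteq> span N"
  by (intro dirs_subset_subspace cell_span subspace_span)

lemma form_smooth:
  assumes "\<alpha> \<in> superforms N p q" "\<kappa> \<in> \<D>" "set v \<subseteq> dirs \<kappa>" "set w \<subseteq> dirs \<kappa>"
  shows "smooth_open \<kappa> (\<lambda>x. \<alpha> x v w)"
proof (rule smooth_restrict(2)[OF _ D.cell_convex[OF assms(2)] cell_span[OF assms(2)] refl])
  show "smooth_open (span N) (\<lambda>x. \<alpha> x v w)"
    by (rule superforms_smooth[OF assms(1)]) (rule order_trans[OF _ dirs_span_sub[OF assms(2)]], fact)+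
qed

lemma form_support:
  assumes "\<alpha> \<in> test_forms N \<C> p q"
  obtains K where "compact K" "\<And>\<kappa> x v w. \<kappa> \<in> \<D> \<Longrightarrow> x \<in> \<kappa> - K \<Longrightarrow> set v \<subseteq> dirs \<kappa> \<Longrightarrow> set w \<subseteq> dirs \<kappa> \<Longrightarrow> \<alpha> x v w = 0"
proof -
  obtain K where K: "compact K" "\<forall>\<sigma>\<in>maximal_cells \<C>. \<forall>x\<in>\<sigma> - K. \<forall>v\<in>lists (dirs \<sigma>). \<forall>w\<in>lists (dirs \<sigma>). \<alpha> x v w = 0"
    using assms unfolding test_forms_def by blast
  have "\<alpha> x v w = 0" if k: "\<kappa> \<in> \<D>" "x \<in> \<kappa> - K" "set v \<subseteq> dirs \<kappa>" "set w \<subseteq> dirs \<kappa>" for \<kappa> x v w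
  proof -
    obtain \<sigma> where \<sigma>: "\<sigma> \<in> maximal_cells \<C>" "\<kappa> \<subseteq> \<sigma>" by (rule in_maximal[OF k(1)])
    have "v \<in> lists (dirs \<sigma>)" "w \<in> lists (dirs \<sigma>)" using k dirs_mono[OF \<sigma>(2)] by auto
    thus ?thesis using K(2) \<sigma> k(2) by blast
  qed
  thus ?thesis using that K(1) by blast
qed

text \<open>All three currents of the formula are finite sums of such terms. For continuity, if the
  supports lie in \<open>K\<close>, the value is at most the supremum of the coefficient times the
  integral of |f| over the part of \<kappa> in \<open>K\<close>.\<close>

lemma supercurrent_single:
  assumes \<kappa>: "\<kappa> \<in> \<D>" and f: "continuous_on \<kappa> f" and v: "set v \<subseteq> dirs \<kappa>" and w: "set w \<subseteq> dirs \<kappa>"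
  shows "(\<lambda>\<alpha>. cint N \<kappa> (\<lambda>x. f x * \<alpha> x v w)) \<in> supercurrents N \<C> p q" (is "?T \<in> _")
proof -
  interpret cell N \<kappa> by (rule D.cellI[OF \<kappa>])
  have vw: "set v \<subseteq> span N" "set w \<subseteq> span N" using v w dirs_span_sub[OF \<kappa>] by auto
  have cont: "continuous_on \<kappa> (\<lambda>x. f x * \<alpha> x v w)" if "\<alpha> \<in> superforms N p q" for \<alpha>
    by (intro continuous_on_mult f smooth_cont form_smooth[OF that \<kappa> v w])
  show ?thesis unfolding supercurrents_def
  proof (intro CollectI conjI ballI allI impI)
    fix \<alpha> \<beta> s t assume \<alpha>: "\<alpha> \<in> test_forms N \<C> p q" and \<beta>: "\<beta> \<in> test_forms N \<C> p q"
    obtain K where K: "compact K" "\<And>\<kappa> x v w. \<kappa> \<in> \<D> \<Longrightarrow> x \<in> \<kappa> - K \<Longrightarrow> set v \<subseteq> dirs \<kappa> \<Longrightarrow> set w \<subseteq> dirs \<kappa> \<Longrightarrow> \<alpha> x v w = 0"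
      using form_support[OF \<alpha>] by blast
    obtain L where L: "compact L" "\<And>\<kappa> x v w. \<kappa> \<in> \<D> \<Longrightarrow> x \<in> \<kappa> - L \<Longrightarrow> set v \<subseteq> dirs \<kappa> \<Longrightarrow> set w \<subseteq> dirs \<kappa> \<Longrightarrow> \<beta> x v w = 0"
      using form_support[OF \<beta>] by blast
    have "?T (\<lambda>x v w. s * \<alpha> x v w + t * \<beta> x v w) = cint N \<kappa> (\<lambda>x. s * (f x * \<alpha> x v w) + t * (f x * \<beta> x v w))"
      by (rule cint_cong) (simp add: algebra_simps)
    also have "\<dots> = s * ?T \<alpha> + t * ?T \<beta>"
      using \<alpha> \<beta> K(2)[OF \<kappa> _ v w] L(2)[OF \<kappa> _ v w] unfolding test_forms_def
      by (intro cint_lincomb[where K = "K \<union> L"] cont compact_Un K(1) L(1)) auto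
    finally show "?T (\<lambda>x v w. s * \<alpha> x v w + t * \<beta> x v w) = s * ?T \<alpha> + t * ?T \<beta>" .
  next
    fix \<alpha> \<beta> assume same: "same_restriction \<C> \<alpha> \<beta>"
    obtain \<sigma> where \<sigma>: "\<sigma> \<in> maximal_cells \<C>" "\<kappa> \<subseteq> \<sigma>" by (rule in_maximal[OF \<kappa>])
    have "v \<in> lists (dirs \<sigma>)" "w \<in> lists (dirs \<sigma>)" using v w dirs_mono[OF \<sigma>(2)] by auto
    hence "\<alpha> x v w = \<beta> x v w" if "x \<in> \<kappa>" for x using same \<sigma> that unfolding same_restriction_def by blast
    thus "?T \<alpha> = ?T \<beta>" by (intro cint_cong) simp
  next
    fix A assume A: "forms_tend_to_0 N p q A"
    have As: "A j \<in> superforms N p q" for j using A unfolding forms_tend_to_0_def by blast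
    have vl: "v \<in> lists (span N)" "w \<in> lists (span N)" using vw by auto
    obtain K where cK: "compact K" and K0: "\<forall>j. \<forall>x\<in>span N - K. \<forall>v\<in>lists (span N). \<forall>w\<in>lists (span N). A j x v w = 0"
      using A unfolding forms_tend_to_0_def by blast
    have "A j x v w = 0" if "x \<in> span N - K" for j x using K0 vl that by blast
    note K = cK this
    have "\<forall>us\<in>lists (span N). \<forall>v\<in>lists (span N). \<forall>w\<in>lists (span N).
        uniform_limit (span N) (\<lambda>j. iter_dirderiv (span N) us (\<lambda>x. A j x v w)) (\<lambda>_. 0) sequentially"
      using A unfolding forms_tend_to_0_def by blast
    from this[rule_format, of "[]" v w] have ul: "uniform_limit (span N) (\<lambda>j x. A j x v w) (\<lambda>_. 0) sequentially"
      using vl by simp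
    let ?F = "\<lambda>x. indicator \<kappa> x * (indicator K x * \<bar>f x\<bar>)"
    have ck: "continuous_on (\<kappa> \<inter> K) (\<lambda>x. \<bar>f x\<bar>)" using f by (intro continuous_on_rabs continuous_on_subset[OF f]) auto
    obtain a where a: "a \<in> affine hull \<kappa>" using ne by (meson ex_in_conv hull_inc)
    have "integrable (cellvol N \<kappa>) (\<lambda>x. indicator (\<kappa> \<inter> K) x * \<bar>f x\<bar>)"
      unfolding cellvol_eq[OF N \<sigma> ne ES_lattice a]
      by (rule cell_integrable[OF ES_basis _ ck K(1)]) (use closed_\<sigma> compact_imp_closed[OF K(1)] in auto)
    moreover have "(\<lambda>x. indicator (\<kappa> \<inter> K) x * \<bar>f x\<bar>) = ?F" by (intro ext) (simp add: indicator_def)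
    ultimately have iF: "integrable (cellvol N \<kappa>) ?F" by simp
    define C where "C = integral\<^sup>L (cellvol N \<kappa>) ?F"
    have C0: "C \<ge> 0" unfolding C_def by (rule Bochner_Integration.integral_nonneg) simp
    show "(\<lambda>j. ?T (A j)) \<longlonglongrightarrow> 0"
    proof (rule tendstoI)
      fix e :: real assume e: "e > 0"
      \<comment> \<open>\<open>C\<close> may be 0, hence the denominator
        \<open>C + 1\<close>.\<close>
      define d where "d = e / (C + 1)"
      have d: "d > 0" "d * C < e" using e C0 by (simp_all add: d_def field_simps)
      have "\<forall>\<^sub>F j in sequentially. \<forall>x\<in>span N. dist (A j x v w) 0 < d" by (rule uniform_limitD[OF ul d(1)])
      thus "\<forall>\<^sub>F j in sequentially. dist (?T (A j)) 0 < e"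
      proof eventually_elim
        case (elim j)
        have "norm (?T (A j)) \<le> integral\<^sup>L (cellvol N \<kappa>) (\<lambda>x. d * ?F x)"
          unfolding cint_def
        proof (rule Bochner_Integration.integral_norm_bound_integral)
          show "integrable (cellvol N \<kappa>) (\<lambda>x. indicator \<kappa> x * (f x * A j x v w))"
            using K(2) cell_span[OF \<kappa>] by (intro cint_integrable[OF cont[OF As] K(1)]) auto
          show "integrable (cellvol N \<kappa>) (\<lambda>x. d * ?F x)" using iF by simp
          fix x
          show "norm (indicator \<kappa> x * (f x * A j x v w)) \<le> d * ?F x"
          proof (cases "x \<in> \<kappa> \<inter> K")
            case True
            hence "\<bar>A j x v w\<bar> \<le> d" using elim cell_span[OF \<kappa>] by force
            hence "\<bar>f x\<bar> * \<bar>A j x v w\<bar> \<le> \<bar>f x\<bar> * d" by (intro mult_left_mono) auto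
            thus ?thesis using True by (simp add: abs_mult mult.commute)
          next
            case False
            hence z: "indicator \<kappa> x * (f x * A j x v w) = 0" using K(2)[of x j] cell_span[OF \<kappa>] by (auto simp: indicator_def)
            have "0 \<le> d * ?F x" using d(1) by simp
            thus ?thesis unfolding z by simp
          qed
        qed
        also have "\<dots> = d * C" unfolding C_def by (rule Bochner_Integration.integral_mult_right_zero)
        finally show ?case using d(2) unfolding dist_norm diff_0_right by linarith
      qed
    qed
  qed
qed

text \<open>\<open>T\<close> is described by a formula on test forms only; linear combinations of
  test forms and the terms of a null sequence are again test forms, so the formula covers every
  condition.\<close>

lemma supercurrentI:
  assumes I: "finite I"
    "\<And>i. i \<in> I \<Longrightarrow> \<kappa> i \<in> \<D> \<and> continuous_on (\<kappa> i) (f i) \<and> set (v i) \<subseteq> dirs (\<kappa> i) \<and> set (w i) \<subseteq> dirs (\<kappa> i)"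
    and T: "\<And>\<alpha>. \<alpha> \<in> test_forms N \<C> p q \<Longrightarrow> T \<alpha> = (\<Sum>i\<in>I. c i * cint N (\<kappa> i) (\<lambda>x. f i x * \<alpha> x (v i) (w i)))"
  shows "T \<in> supercurrents N \<C> p q"
proof -
  let ?S = "\<lambda>i \<alpha>. cint N (\<kappa> i) (\<lambda>x. f i x * \<alpha> x (v i) (w i))"
  have S: "?S i \<in> supercurrents N \<C> p q" if "i \<in> I" for i
    using supercurrent_single[of "\<kappa> i" "f i" "v i" "w i" p q] I(2)[OF that] by blast
  show ?thesis unfolding supercurrents_def
  proof (intro CollectI conjI ballI allI impI)
    fix \<alpha> \<beta> s t assume ab: "\<alpha> \<in> test_forms N \<C> p q" "\<beta> \<in> test_forms N \<C> p q"
    have "?S i (\<lambda>x v w. s * \<alpha> x v w + t * \<beta> x v w) = s * ?S i \<alpha> + t * ?S i \<beta>" if "i \<in> I" for i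
      using S[OF that] ab unfolding supercurrents_def by blast
    thus "T (\<lambda>x v w. s * \<alpha> x v w + t * \<beta> x v w) = s * T \<alpha> + t * T \<beta>"
      unfolding T[OF ab(1)] T[OF ab(2)] T[OF test_forms_lincomb[OF ab]]
      by (simp add: sum_distrib_left sum.distrib[symmetric] algebra_simps)
  next
    fix \<alpha> \<beta> assume ab: "\<alpha> \<in> test_forms N \<C> p q" "\<beta> \<in> test_forms N \<C> p q" "same_restriction \<C> \<alpha> \<beta>"
    have "?S i \<alpha> = ?S i \<beta>" if "i \<in> I" for i using S[OF that] ab unfolding supercurrents_def by blast
    thus "T \<alpha> = T \<beta>" unfolding T[OF ab(1)] T[OF ab(2)] by simp
  next
    fix A assume A: "forms_tend_to_0 N p q A"
    have tf: "A j \<in> test_forms N \<C> p q" for j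
    proof -
      obtain K where K: "compact K" "\<forall>j. \<forall>x\<in>span N - K. \<forall>v\<in>lists (span N). \<forall>w\<in>lists (span N). A j x v w = 0"
        using A unfolding forms_tend_to_0_def by blast
      have "A j x v w = 0" if "\<sigma> \<in> maximal_cells \<C>" "x \<in> \<sigma> - K" "v \<in> lists (dirs \<sigma>)" "w \<in> lists (dirs \<sigma>)" for \<sigma> x v w
      proof -
        have "\<sigma> \<in> \<C>" using that(1) unfolding maximal_cells_def by blast
        hence s: "\<sigma> \<subseteq> span N" using C.cell_int integral_polyhedron_subset by blast
        have "dirs \<sigma> \<subseteq> span N" by (rule dirs_subset_subspace[OF s subspace_span])
        hence "v \<in> lists (span N)" "w \<in> lists (span N)" using that lists_mono by blast+
        thus ?thesis using K(2) s that(2) by blast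
      qed
      moreover have "A j \<in> superforms N p q" using A unfolding forms_tend_to_0_def by blast
      ultimately show ?thesis unfolding test_forms_def
        by (intro CollectI conjI exI[of _ K] ballI K(1))
    qed
    have "(\<lambda>j. ?S i (A j)) \<longlonglongrightarrow> 0" if "i \<in> I" for i by (rule supercurrents_tendsto[OF S[OF that] A])
    hence "(\<lambda>j. \<Sum>i\<in>I. c i * ?S i (A j)) \<longlonglongrightarrow> (\<Sum>i\<in>I. c i * 0)"
      by (intro tendsto_sum tendsto_mult tendsto_const)
    thus "(\<lambda>j. T (A j)) \<longlonglongrightarrow> 0" unfolding T[OF tf] by simp
  qed
qed

end

subsection \<open>The corner locus formula\<close>

lemma alt_mono: "alt_multilinear V f \<Longrightarrow> L \<subseteq> V \<Longrightarrow> alt_multilinear L f"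
  unfolding alt_multilinear_def lists_eq_set by blast

lemma alt_scale: "alt_multilinear V f \<Longrightarrow> alt_multilinear V (\<lambda>v. c * f v)"
  using alt_multilinear_lincomb[of V f f c 0] by simp

lemma dirderiv_alt:
  fixes F :: "'a::euclidean_space \<Rightarrow> 'a list \<Rightarrow> real"
  assumes V: "subspace V" and x: "x \<in> V" and a: "a \<in> V" and alt: "\<And>y. y \<in> V \<Longrightarrow> alt_multilinear V (F y)"
    and diff: "\<And>r. set r \<subseteq> V \<Longrightarrow> (\<lambda>y. F y r) differentiable (at x within V)"
  shows "alt_multilinear V (\<lambda>r. dirderiv V a (\<lambda>y. F y r) x)"
proof -
  have cv: "convex V" using V by (rule subspace_imp_convex)
  have aV: "a \<in> dirs V" using a dirs_span[of V] V by (simp add: span_eq_iff[THEN iffD2])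
  show ?thesis unfolding alt_multilinear_def
  proof (intro ballI allI impI conjI)
    fix v i assume "v \<in> lists V" and i: "i < length v"
    hence v: "set v \<subseteq> V" by auto
    {
      fix b c s t assume bc: "b \<in> V" "c \<in> V"
      have u: "set (v[i := z]) \<subseteq> V" if "z \<in> V" for z
        using v that set_update_subset_insert[of v i z] by blast
      have "dirderiv V a (\<lambda>y. F y (v[i := s *\<^sub>R b + t *\<^sub>R c])) x =
          dirderiv V a (\<lambda>y. s * F y (v[i := b]) + t * F y (v[i := c])) x"
      proof (rule dirderiv_restrict(1)[OF cv x order_refl aV])
        show "(\<lambda>y. s * F y (v[i := b]) + t * F y (v[i := c])) differentiable (at x within V)"
          by (intro differentiable_add differentiable_mult differentiable_const diff u bc)
        show "F y (v[i := s *\<^sub>R b + t *\<^sub>R c]) = s * F y (v[i := b]) + t * F y (v[i := c])" if "y \<in> V" for y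
          by (rule alt_lin[OF alt[OF that] v i bc])
      qed
      also have "\<dots> = s * dirderiv V a (\<lambda>y. F y (v[i := b])) x + t * dirderiv V a (\<lambda>y. F y (v[i := c])) x"
        by (rule dirderiv_lincomb[OF cv x aV diff[OF u[OF bc(1)]] diff[OF u[OF bc(2)]]])
      finally show "dirderiv V a (\<lambda>y. F y (v[i := s *\<^sub>R b + t *\<^sub>R c])) x =
        s * dirderiv V a (\<lambda>y. F y (v[i := b])) x + t * dirderiv V a (\<lambda>y. F y (v[i := c])) x" .
    next
      fix j assume j: "j < i" "v ! i = v ! j"
      show "dirderiv V a (\<lambda>y. F y v) x = 0"
        by (rule dirderiv_zero[OF cv x aV]) (rule alt_eq[OF alt v i, of _ j], use i j in auto)
    }
  qed
qed

text \<open>Passing from \<open>es\<close> to \<open>ts @ [w]\<close> changes the alternating form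
  in each of the two slots by the factor d, and d * d = 1. Since \<open>l\<close> vanishes on
  \<open>ts\<close>, only the term that omits w survives in the first slot.\<close>

lemma ext1_double:
  fixes C :: "'a::euclidean_space \<Rightarrow> 'a list \<Rightarrow> 'a list \<Rightarrow> real"
  assumes L: "subspace L" and r: "rescale L (ts @ [w]) es d" "\<bar>d\<bar> = 1"
    and l: "linear l" "\<And>t. t \<in> set ts \<Longrightarrow> l t = 0" "l w = (1::real)"
    and alt1: "\<And>a r. a \<in> L \<Longrightarrow> set r \<subseteq> L \<Longrightarrow> alt_multilinear L (\<lambda>l. C a l r)"
    and alt2: "\<And>a l. a \<in> L \<Longrightarrow> set l \<subseteq> L \<Longrightarrow> alt_multilinear L (\<lambda>r. C a l r)"
    and lin: "\<And>a b s t l r. a \<in> L \<Longrightarrow> b \<in> L \<Longrightarrow> set l \<subseteq> L \<Longrightarrow> set r \<subseteq> L \<Longrightarrow>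
      C (s *\<^sub>R a + t *\<^sub>R b) l r = s * C a l r + t * C b l r"
  shows "(\<Sum>i<length es. \<Sum>j<length es. (-1) ^ (i + j) * (l (es ! i) * C (es ! j) (omit i es) (omit j es))) =
    (-1) ^ length ts * ext1 (\<lambda>a r. C a ts r) (ts @ [w])"
proof -
  have sub: "set (ts @ [w]) \<subseteq> L" "set es \<subseteq> L" and eta: "\<And>\<eta>. alt_multilinear L \<eta> \<Longrightarrow> \<eta> es = d * \<eta> (ts @ [w])"
    using r(1) unfolding rescale_def by blast+
  have om: "set (omit i es) \<subseteq> L" for i using sub(2) omit_set[of i es] by blast
  have esL: "es ! j \<in> L" if "j < length es" for j using sub(2) that nth_mem by blast
  have inner: "(\<Sum>i<length es. (-1) ^ i * (l (es ! i) * C a (omit i es) r)) = d * ((-1) ^ length ts * C a ts r)"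
    if a: "a \<in> L" "set r \<subseteq> L" for a r
  proof -
    let ?B = "\<lambda>b k. l b * C a k r"
    have "alt_multilinear L (ext1 ?B)"
      by (rule ext1_alt[OF L]) (use alt_scale[OF alt1[OF a]] in \<open>simp_all add: linear_add[OF l(1)] linear_scale[OF l(1)] algebra_simps\<close>)
    hence "ext1 ?B es = d * ext1 ?B (ts @ [w])" by (rule eta)
    also have "ext1 ?B (ts @ [w]) = (-1) ^ length ts * C a ts r"
      unfolding ext1_snoc using l(2,3) by simp
    finally show ?thesis unfolding ext1_def .
  qed
  have "(\<Sum>i<length es. \<Sum>j<length es. (-1) ^ (i + j) * (l (es ! i) * C (es ! j) (omit i es) (omit j es))) =
    (\<Sum>j<length es. (-1) ^ j * (\<Sum>i<length es. (-1) ^ i * (l (es ! i) * C (es ! j) (omit i es) (omit j es))))"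
    by (subst sum.swap) (simp add: sum_distrib_left power_add mult_ac)
  also have "\<dots> = (\<Sum>j<length es. (-1) ^ j * (d * ((-1) ^ length ts * C (es ! j) ts (omit j es))))"
    using inner esL om by (intro sum.cong refl) simp
  also have "\<dots> = d * (-1) ^ length ts * ext1 (\<lambda>a r. C a ts r) es"
    unfolding ext1_def sum_distrib_left by (rule sum.cong) (simp_all add: mult_ac)
  also have "ext1 (\<lambda>a r. C a ts r) es = d * ext1 (\<lambda>a r. C a ts r) (ts @ [w])"
    by (intro eta ext1_alt[OF L] alt2 lin) (use sub(1) in simp_all)
  also have "d * (-1) ^ length ts * (d * ext1 (\<lambda>a r. C a ts r) (ts @ [w])) =
      (d * d) * ((-1) ^ length ts * ext1 (\<lambda>a r. C a ts r) (ts @ [w]))" by (simp only: mult_ac)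
  also have "d * d = 1" using r(2) by (metis abs_mult_self_eq mult_1)
  finally show ?thesis by simp
qed

lemma d''_d'_formula:
  assumes \<alpha>: "\<alpha> \<in> superforms N p q" and x: "x \<in> span N" and es: "set es \<subseteq> span N"
  shows "d'' (span N) (d' (span N) \<alpha>) x es es =
    (-1) ^ length es * (\<Sum>i<length es. \<Sum>j<length es. (-1) ^ (i + j) *
      dirderiv (span N) (es ! j) (dirderiv (span N) (es ! i) (\<lambda>y. \<alpha> y (omit i es) (omit j es))) x)"
proof -
  let ?V = "span N"
  have cv: "convex ?V" by (simp add: subspace_imp_convex)
  have e: "es ! j \<in> dirs ?V" if "j < length es" for j using es that nth_mem unfolding dirs_span by blast
  have om: "set (omit i es) \<subseteq> ?V" for i using es omit_set[of i es] by blast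
  have diff: "dirderiv ?V (es ! i) (\<lambda>y. \<alpha> y (omit i es) (omit j es)) differentiable (at x within ?V)" if "i < length es" for i j
    by (rule smooth_diff_at[OF smooth_dirderiv[OF superforms_smooth[OF \<alpha> om om] e[OF that]] x])
  have "d'' ?V (d' ?V \<alpha>) x es es = (-1) ^ length es * (\<Sum>j<length es. (-1) ^ j *
      dirderiv ?V (es ! j) (\<lambda>y. \<Sum>i<length es. (-1) ^ i * dirderiv ?V (es ! i) (\<lambda>y. \<alpha> y (omit i es) (omit j es)) y) x)"
    unfolding d''_def d'_def ..
  also have "\<dots> = (-1) ^ length es * (\<Sum>j<length es. (-1) ^ j * (\<Sum>i<length es. (-1) ^ i *
      dirderiv ?V (es ! j) (dirderiv ?V (es ! i) (\<lambda>y. \<alpha> y (omit i es) (omit j es))) x))"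
    using e diff by (intro arg_cong2[of _ _ _ _ "(*)"] refl sum.cong dirderiv_sum[OF cv x]) auto
  also have "\<dots> = (-1) ^ length es * (\<Sum>j<length es. \<Sum>i<length es. (-1) ^ (i + j) *
      dirderiv ?V (es ! j) (dirderiv ?V (es ! i) (\<lambda>y. \<alpha> y (omit i es) (omit j es))) x)"
    by (simp add: sum_distrib_left power_add mult_ac)
  finally show ?thesis by (subst sum.swap)
qed

section \<open>The piecewise Hessian form and its wedge product\<close>

lemma nths_singleton: "i < length es \<Longrightarrow> nths es {i} = [es ! i]"
proof (induction es arbitrary: i)
  case (Cons e es)
  have "{j. Suc j \<in> {i}} = (case i of 0 \<Rightarrow> {} | Suc k \<Rightarrow> {k})" by (auto split: nat.splits)
  then show ?case using Cons by (cases i) (simp_all add: nths_Cons)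
qed simp

lemma nths_Compl_singleton: "i < length es \<Longrightarrow> nths es (- {i}) = omit i es"
proof (induction es arbitrary: i)
  case (Cons e es)
  show ?case
  proof (cases i)
    case 0
    have "{j. Suc j \<in> - {i}} = UNIV" using 0 by auto
    then show ?thesis using 0 by (simp add: nths_Cons omit_def nths_all)
  next
    case (Suc k)
    have "{j. Suc j \<in> - {i}} = - {k}" using Suc by auto
    then show ?thesis using Suc Cons by (simp add: nths_Cons omit_def)
  qed
qed simp

lemma shuffle_sign_singleton: "i < k \<Longrightarrow> shuffle_sign k {i} = (-1) ^ i"
proof -
  assume i: "i < k"
  have "{(a, b). a < b \<and> b < k \<and> b \<in> {i} \<and> a \<notin> {i}} = (\<lambda>a. (a, i)) ` {..<i}" using i by auto
  hence "card {(a, b). a < b \<and> b < k \<and> b \<in> {i} \<and> a \<notin> {i}} = i"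
    by (simp add: card_image inj_on_def)
  thus ?thesis unfolding shuffle_sign_def by simp
qed

lemma sum_Pow_singletons:
  fixes F :: "nat set \<Rightarrow> real"
  assumes "\<And>I. I \<subseteq> {..<k} \<Longrightarrow> card I \<noteq> 1 \<Longrightarrow> F I = 0"
  shows "(\<Sum>I\<in>Pow {..<k}. F I) = (\<Sum>i<k. F {i})"
proof -
  have "(\<Sum>I\<in>Pow {..<k}. F I) = (\<Sum>I\<in>(\<lambda>i. {i}) ` {..<k}. F I)"
  proof (rule sum.mono_neutral_right)
    show "\<forall>I\<in>Pow {..<k} - (\<lambda>i. {i}) ` {..<k}. F I = 0"
    proof
      fix I assume I: "I \<in> Pow {..<k} - (\<lambda>i. {i}) ` {..<k}"
      have "card I \<noteq> 1" using I by (auto simp: card_1_singleton_iff)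
      thus "F I = 0" using assms I by blast
    qed
  qed auto
  also have "\<dots> = (\<Sum>i<k. F {i})" by (subst sum.reindex) (auto simp: inj_on_def)
  finally show ?thesis .
qed

lemma d'_d''_form0:
  assumes S: "convex S" "x \<in> S"
  shows "d' S (d'' S (form0 f)) x [a] [b] = dirderiv S a (dirderiv S b f) x"
    and "set v \<subseteq> dirs S \<Longrightarrow> set w \<subseteq> dirs S \<Longrightarrow> \<not> (length v = 1 \<and> length w = 1) \<Longrightarrow> d' S (d'' S (form0 f)) x v w = 0"
proof -
  have 1: "d'' S (form0 f) y [] [b] = dirderiv S b f y" for y b
    unfolding d''_def form0_def by (simp add: omit_def)
  show "d' S (d'' S (form0 f)) x [a] [b] = dirderiv S a (dirderiv S b f) x"
    unfolding d'_def by (simp add: omit_def 1)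
  have 2: "d'' S (form0 f) y v w = 0" if "y \<in> S" "set w \<subseteq> dirs S" "v \<noteq> [] \<or> length w \<noteq> 1" for y v w
  proof -
    have "dirderiv S (w ! j) (\<lambda>z. form0 f z v (omit j w)) y = 0" if j: "j < length w" for j
    proof (rule dirderiv_zero[OF S(1) \<open>y \<in> S\<close>])
      show "w ! j \<in> dirs S" using j \<open>set w \<subseteq> dirs S\<close> nth_mem by blast
      have "v \<noteq> [] \<or> omit j w \<noteq> []" using \<open>v \<noteq> [] \<or> length w \<noteq> 1\<close> j omit_length[OF j] by auto
      thus "form0 f z v (omit j w) = 0" for z by (auto simp: form0_def)
    qed
    thus ?thesis unfolding d''_def by simp
  qed
  assume v: "set v \<subseteq> dirs S" and w: "set w \<subseteq> dirs S" and n: "\<not> (length v = 1 \<and> length w = 1)"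
  have "dirderiv S (v ! i) (\<lambda>y. d'' S (form0 f) y (omit i v) w) x = 0" if i: "i < length v" for i
  proof (rule dirderiv_zero[OF S])
    show "v ! i \<in> dirs S" using i v nth_mem by blast
    have "omit i v \<noteq> [] \<or> length w \<noteq> 1" using n i omit_length[OF i] by auto
    thus "d'' S (form0 f) y (omit i v) w = 0" if "y \<in> S" for y using 2[OF that w] by blast
  qed
  thus "d' S (d'' S (form0 f)) x v w = 0" unfolding d'_def by simp
qed

text \<open>The Hessian form has bidegree (1,1), so only pairs of singletons contribute to the
  shuffle sum.\<close>

lemma wedge_formula:
  assumes S: "convex S" "x \<in> S" and es: "set es \<subseteq> dirs S"
  shows "wedge (d' S (d'' S (form0 f))) \<alpha> x es es =
    - ((-1) ^ length es) * (\<Sum>i<length es. \<Sum>j<length es. (-1) ^ (i + j) *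
      (dirderiv S (es ! i) (dirderiv S (es ! j) f) x * \<alpha> x (omit i es) (omit j es)))"
proof -
  let ?b = "d' S (d'' S (form0 f))" and ?k = "length es"
  let ?F = "\<lambda>I J. shuffle_sign ?k I * shuffle_sign ?k J * (-1) ^ (card J * (?k - card I)) *
     ?b x (nths es I) (nths es J) * \<alpha> x (nths es (- I)) (nths es (- J))"
  have len: "length (nths es I) = card I" if "I \<subseteq> {..<?k}" for I
  proof -
    have "{i. i < ?k \<and> i \<in> I} = I" using that by auto
    thus ?thesis by (simp add: length_nths)
  qed
  have st: "set (nths es I) \<subseteq> dirs S" for I using es set_nths_subset[of es I] by blast
  have z: "?F I J = 0" if "I \<subseteq> {..<?k}" "J \<subseteq> {..<?k}" "card I \<noteq> 1 \<or> card J \<noteq> 1" for I J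
  proof -
    have "?b x (nths es I) (nths es J) = 0"
      by (rule d'_d''_form0(2)[OF S st st]) (use that len in auto)
    thus ?thesis by simp
  qed
  have "wedge ?b \<alpha> x es es = (\<Sum>I\<in>Pow {..<?k}. \<Sum>J\<in>Pow {..<?k}. ?F I J)" unfolding wedge_def ..
  also have "\<dots> = (\<Sum>i<?k. \<Sum>J\<in>Pow {..<?k}. ?F {i} J)"
    by (rule sum_Pow_singletons, rule sum.neutral) (use z in blast)
  also have "\<dots> = (\<Sum>i<?k. \<Sum>j<?k. ?F {i} {j})"
  proof (rule sum.cong[OF refl])
    fix i assume "i \<in> {..<?k}"
    thus "(\<Sum>J\<in>Pow {..<?k}. ?F {i} J) = (\<Sum>j<?k. ?F {i} {j})"
      by (intro sum_Pow_singletons z) auto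
  qed
  also have "\<dots> = (\<Sum>i<?k. \<Sum>j<?k. - ((-1) ^ ?k) * ((-1) ^ (i + j) *
      (dirderiv S (es ! i) (dirderiv S (es ! j) f) x * \<alpha> x (omit i es) (omit j es))))"
  proof (intro sum.cong refl)
    fix i j assume ij: "i \<in> {..<?k}" "j \<in> {..<?k}"
    \<comment> \<open>An index below the length shows that the length is positive. The subtraction
      in the exponent is therefore genuine, and its sign is (-1)^(k-1) = -(-1)^k.\<close>
    then obtain k' where "?k = Suc k'" by (cases ?k) auto
    thus "?F {i} {j} = - ((-1) ^ ?k) * ((-1) ^ (i + j) *
      (dirderiv S (es ! i) (dirderiv S (es ! j) f) x * \<alpha> x (omit i es) (omit j es)))"
      using ij by (simp add: shuffle_sign_singleton nths_singleton nths_Compl_singleton d'_d''_form0(1)[OF S] power_add)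
  qed
  finally show ?thesis by (simp only: sum_distrib_left)
qed

section \<open>The boundary terms at a cell of codimension one\<close>

locale corner = subdiv N \<C> \<D> "int k" for N :: "'a::euclidean_space set" and \<C> \<D> and k :: nat +
  fixes \<phi> :: "'a \<Rightarrow> real" and m :: "'a set \<Rightarrow> real"
  assumes smooth: "\<And>\<sigma>. \<sigma> \<in> \<D> \<Longrightarrow> smooth_open \<sigma> \<phi>"
    and balance: "\<And>\<tau>. \<tau> \<in> cells (int k - 1) \<D> \<Longrightarrow>
      (\<Sum>\<sigma>\<in>star_cells (int k) \<D> \<tau>. m \<sigma> *\<^sub>R normal_vector N \<sigma> \<tau>) \<in> dirs \<tau>"
begin

abbreviation "cw \<equiv> corner_weight N (int k) \<D> (\<lambda>\<sigma> \<omega>. m \<sigma>) \<phi>"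

definition coef :: "'a superform \<Rightarrow> 'a set \<Rightarrow> nat \<Rightarrow> nat \<Rightarrow> 'a \<Rightarrow> real" where
  "coef \<alpha> \<sigma> i j = (\<lambda>y. \<alpha> y (omit i (ES N \<sigma>)) (omit j (ES N \<sigma>)))"

text \<open>The integrand on \<tau> that comes from integrating by parts twice on \<sigma>. In the
  first term the conormal meets the i-th vector, omitted from the first slot of \<alpha>; in the
  second it meets the j-th, omitted from the second slot.\<close>

definition flux :: "'a superform \<Rightarrow> 'a set \<Rightarrow> 'a set \<Rightarrow> 'a \<Rightarrow> real" where
  "flux \<alpha> \<sigma> \<tau> x = (\<Sum>i<length (ES N \<sigma>). \<Sum>j<length (ES N \<sigma>). (-1) ^ (i + j) *
     (cell.lam N \<sigma> \<tau> (ES N \<sigma> ! i) * (dirderiv \<sigma> (ES N \<sigma> ! j) \<phi> x * coef \<alpha> \<sigma> i j x) -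
      cell.lam N \<sigma> \<tau> (ES N \<sigma> ! j) * (\<phi> x * dirderiv \<sigma> (ES N \<sigma> ! i) (coef \<alpha> \<sigma> i j) x)))"

lemma cellsD: "\<sigma> \<in> cells d \<D> \<Longrightarrow> \<sigma> \<in> \<D>" "\<sigma> \<in> cells d \<D> \<Longrightarrow> aff_dim \<sigma> = d"
  unfolding cells_def by auto

lemma starD: "\<sigma> \<in> star_cells d \<D> \<tau> \<Longrightarrow> \<sigma> \<in> cells d \<D>" "\<sigma> \<in> star_cells d \<D> \<tau> \<Longrightarrow> \<tau> \<subseteq> \<sigma>"
  unfolding star_cells_def using face_of_imp_subset by auto

lemma subspace_V: "subspace (span N)"
  by (rule subspace_span)

lemma ES_sub: "\<sigma> \<in> \<D> \<Longrightarrow> set (ES N \<sigma>) \<subseteq> dirs \<sigma>"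
  using cell.ES_dirs[OF D.cellI] .

lemma ES_nth: "\<sigma> \<in> \<D> \<Longrightarrow> i < length (ES N \<sigma>) \<Longrightarrow> ES N \<sigma> ! i \<in> dirs \<sigma>"
  using ES_sub nth_mem by blast

lemma omit_sub: "\<sigma> \<in> \<D> \<Longrightarrow> set (omit i (ES N \<sigma>)) \<subseteq> dirs \<sigma>"
  using ES_sub omit_set[of i "ES N \<sigma>"] by blast

lemma coef_smooth:
  "\<alpha> \<in> superforms N p q \<Longrightarrow> \<sigma> \<in> \<D> \<Longrightarrow> smooth_open \<sigma> (coef \<alpha> \<sigma> i j)"
  unfolding coef_def by (rule form_smooth[OF _ _ omit_sub omit_sub])

lemma coef_smooth_V:
  "\<alpha> \<in> superforms N p q \<Longrightarrow> \<sigma> \<in> \<D> \<Longrightarrow> smooth_open (span N) (coef \<alpha> \<sigma> i j)"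
  unfolding coef_def using omit_sub dirs_span_sub by (intro superforms_smooth) blast+

lemma lift_alt:
  assumes \<alpha>: "\<alpha> \<in> superforms N p q" and x: "x \<in> span N" and a: "a \<in> span N" and l: "set l \<subseteq> span N"
  shows "alt_multilinear (span N) (\<lambda>r. dirderiv (span N) a (\<lambda>y. \<alpha> y r l) x)"
    and "alt_multilinear (span N) (\<lambda>r. dirderiv (span N) a (\<lambda>y. \<alpha> y l r) x)"
proof -
  show "alt_multilinear (span N) (\<lambda>r. dirderiv (span N) a (\<lambda>y. \<alpha> y r l) x)"
  proof (rule dirderiv_alt[OF subspace_V x a])
    show "alt_multilinear (span N) (\<lambda>r. \<alpha> y r l)" if "y \<in> span N" for y by (rule superforms_alt1[OF \<alpha> that l])
    show "(\<lambda>y. \<alpha> y r l) differentiable (at x within span N)" if "set r \<subseteq> span N" for r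
      by (rule smooth_diff_at[OF superforms_smooth[OF \<alpha> that l] x])
  qed
  show "alt_multilinear (span N) (\<lambda>r. dirderiv (span N) a (\<lambda>y. \<alpha> y l r) x)"
  proof (rule dirderiv_alt[OF subspace_V x a])
    show "alt_multilinear (span N) (\<lambda>r. \<alpha> y l r)" if "y \<in> span N" for y by (rule superforms_alt2[OF \<alpha> that l])
    show "(\<lambda>y. \<alpha> y l r) differentiable (at x within span N)" if "set r \<subseteq> span N" for r
      by (rule smooth_diff_at[OF superforms_smooth[OF \<alpha> l that] x])
  qed
qed

lemma lift_lin:
  assumes \<alpha>: "\<alpha> \<in> superforms N p q" and x: "x \<in> span N" and l: "set l \<subseteq> span N" "set r \<subseteq> span N"
  shows "dirderiv (span N) (s *\<^sub>R a + t *\<^sub>R b) (\<lambda>y. \<alpha> y l r) x =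
    s * dirderiv (span N) a (\<lambda>y. \<alpha> y l r) x + t * dirderiv (span N) b (\<lambda>y. \<alpha> y l r) x"
  by (rule dirderiv_linear[OF smooth_diff_at[OF superforms_smooth[OF \<alpha> l] x]])

text \<open>The basis of \<sigma> is exchanged for the basis of \<tau> followed by the normal
  vector, so that the fluxes from different \<sigma> become comparable.\<close>

lemma flux_eq:
  assumes \<alpha>: "\<alpha> \<in> superforms N p q" and \<tau>: "\<tau> \<in> cells (int k - 1) \<D>" and \<sigma>: "\<sigma> \<in> star_cells (int k) \<D> \<tau>" and x: "x \<in> \<tau>"
  defines "ts \<equiv> ES N \<tau>"
  shows "flux \<alpha> \<sigma> \<tau> x = (-1) ^ length ts * ext1 (\<lambda>a r. dirderiv \<sigma> a \<phi> x * \<alpha> x ts r) (ts @ [normal_vector N \<sigma> \<tau>])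
    - \<phi> x * ((-1) ^ length ts * ext1 (\<lambda>a l. dirderiv (span N) a (\<lambda>y. \<alpha> y l ts) x) (ts @ [normal_vector N \<sigma> \<tau>]))"
proof -
  interpret F: facet N \<sigma> \<tau> by (rule D.facetI[OF \<tau> \<sigma>])
  have \<tau>D: "\<tau> \<in> \<D>" by (rule cellsD(1)[OF \<tau>])
  have \<sigma>D: "\<sigma> \<in> \<D>" by (rule cellsD(1)[OF starD(1)[OF \<sigma>]])
  interpret S: cell N \<sigma> by (rule D.cellI[OF \<sigma>D])
  interpret T: cell N \<tau> by (rule D.cellI[OF \<tau>D])
  let ?V = "span N" and ?L = "dirs \<sigma>" and ?es = "ES N \<sigma>" and ?w = "F.w"
  have LV: "?L \<subseteq> ?V" by (rule dirs_span_sub[OF \<sigma>D])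
  have x\<sigma>: "x \<in> \<sigma>" using x F.subset by blast
  have xV: "x \<in> ?V" using x\<sigma> cell_span[OF \<sigma>D] by blast
  have ts: "lattice_basis (lattice_of N \<tau>) ts" unfolding ts_def by (rule T.ES_lattice)
  have tsd: "set ts \<subseteq> dirs \<tau>" unfolding ts_def by (rule T.ES_dirs)
  note tw = F.lattice_basis_facet[OF ts]
  note btw = lattice_of_basis[OF F.N F.\<sigma> F.\<sigma>_ne tw]
  obtain d where d: "rescale ?L (ts @ [?w]) ?es d" by (rule rescale_exists[OF btw S.ES_basis])
  have "rescale (span (lattice_of N \<sigma>)) (ts @ [?w]) ?es d"
    using d is_basis_span[OF btw] is_basis_span[OF lattice_basis_is_basis[OF tw]] by simp
  hence d1: "\<bar>d\<bar> = 1" by (rule lattice_basis_rescale[OF tw S.ES_lattice])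
  have lam: "S.lam \<tau> = F.conormal" unfolding S.lam_def ..
  have l: "linear (S.lam \<tau>)" "\<And>t. t \<in> set ts \<Longrightarrow> S.lam \<tau> t = 0" "S.lam \<tau> ?w = 1"
    unfolding lam using F.conormal_linear F.conormal_normal F.conormal_zero tsd by blast+
  have phi: "\<phi> differentiable (at x within \<sigma>)" by (rule smooth_diff_at[OF smooth[OF \<sigma>D] x\<sigma>])
  let ?C1 = "\<lambda>a l r. dirderiv \<sigma> a \<phi> x * \<alpha> x l r"
  have e1: "(\<Sum>i<length ?es. \<Sum>j<length ?es. (-1) ^ (i + j) * (S.lam \<tau> (?es ! i) * ?C1 (?es ! j) (omit i ?es) (omit j ?es))) =
     (-1) ^ length ts * ext1 (\<lambda>a r. ?C1 a ts r) (ts @ [?w])"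
  proof (rule ext1_double[OF S.sub\<sigma> d d1 l])
    show "alt_multilinear ?L (\<lambda>l. ?C1 a l r)" if "set r \<subseteq> ?L" for a r
      by (rule alt_scale[OF alt_mono[OF superforms_alt1[OF \<alpha> xV order_trans[OF that LV]] LV]])
    show "alt_multilinear ?L (\<lambda>r. ?C1 a l r)" if "set l \<subseteq> ?L" for a l
      by (rule alt_scale[OF alt_mono[OF superforms_alt2[OF \<alpha> xV order_trans[OF that LV]] LV]])
    show "?C1 (s *\<^sub>R a + t *\<^sub>R b) l r = s * ?C1 a l r + t * ?C1 b l r" for a b s t l r
      unfolding dirderiv_linear[OF phi] by (simp add: algebra_simps)
  qed
  \<comment> \<open>Here the conormal belongs to the second slot of \<alpha>, so the slots are
    exchanged before \<open>ext1_double\<close> is applied.\<close>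
  let ?C2 = "\<lambda>a l r. dirderiv ?V a (\<lambda>y. \<alpha> y r l) x"
  have e2: "(\<Sum>i<length ?es. \<Sum>j<length ?es. (-1) ^ (i + j) * (S.lam \<tau> (?es ! i) * ?C2 (?es ! j) (omit i ?es) (omit j ?es))) =
     (-1) ^ length ts * ext1 (\<lambda>a r. ?C2 a ts r) (ts @ [?w])"
  proof (rule ext1_double[OF S.sub\<sigma> d d1 l])
    show "alt_multilinear ?L (\<lambda>l. ?C2 a l r)" if "a \<in> ?L" "set r \<subseteq> ?L" for a r
      using that LV by (intro alt_mono[OF lift_alt(2)[OF \<alpha> xV] LV]) auto
    show "alt_multilinear ?L (\<lambda>r. ?C2 a l r)" if "a \<in> ?L" "set l \<subseteq> ?L" for a l
      using that LV by (intro alt_mono[OF lift_alt(1)[OF \<alpha> xV] LV]) auto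
    show "?C2 (s *\<^sub>R a + t *\<^sub>R b) l r = s * ?C2 a l r + t * ?C2 b l r" if "set l \<subseteq> ?L" "set r \<subseteq> ?L" for a b s t l r
      by (rule lift_lin[OF \<alpha> xV order_trans[OF that(2) LV] order_trans[OF that(1) LV]])
  qed
  \<comment> \<open>The coefficients of \<alpha> are smooth on the whole space; differentiating
    there makes the operator independent of \<sigma>, which the summation in \<open>flux_sum\<close>
    requires.\<close>
  have dd: "dirderiv \<sigma> (?es ! i) (coef \<alpha> \<sigma> i j) x = dirderiv ?V (?es ! i) (coef \<alpha> \<sigma> i j) x" if "i < length ?es" for i j
    by (rule dirderiv_restrict(1)[OF S.convex_\<sigma> x\<sigma> cell_span[OF \<sigma>D] ES_nth[OF \<sigma>D that] smooth_diff_at[OF coef_smooth_V[OF \<alpha> \<sigma>D] xV] refl])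
  have "flux \<alpha> \<sigma> \<tau> x =
     (\<Sum>i<length ?es. \<Sum>j<length ?es. (-1) ^ (i + j) * (S.lam \<tau> (?es ! i) * ?C1 (?es ! j) (omit i ?es) (omit j ?es))) -
     \<phi> x * (\<Sum>i<length ?es. \<Sum>j<length ?es. (-1) ^ (i + j) * (S.lam \<tau> (?es ! j) * ?C2 (?es ! i) (omit j ?es) (omit i ?es)))"
    unfolding flux_def sum_distrib_left sum_subtractf[symmetric]
  proof (intro sum.cong refl)
    fix i j assume "i \<in> {..<length ?es}" "j \<in> {..<length ?es}"
    hence "dirderiv \<sigma> (?es ! i) (coef \<alpha> \<sigma> i j) x = ?C2 (?es ! i) (omit j ?es) (omit i ?es)"
      using dd[of i j] by (simp add: coef_def)
    thus "(-1) ^ (i + j) * (S.lam \<tau> (?es ! i) * (dirderiv \<sigma> (?es ! j) \<phi> x * coef \<alpha> \<sigma> i j x) -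
       S.lam \<tau> (?es ! j) * (\<phi> x * dirderiv \<sigma> (?es ! i) (coef \<alpha> \<sigma> i j) x)) =
       (-1) ^ (i + j) * (S.lam \<tau> (?es ! i) * ?C1 (?es ! j) (omit i ?es) (omit j ?es)) -
       \<phi> x * ((-1) ^ (i + j) * (S.lam \<tau> (?es ! j) * ?C2 (?es ! i) (omit j ?es) (omit i ?es)))"
      by (simp add: coef_def algebra_simps)
  qed
  also have "(\<Sum>i<length ?es. \<Sum>j<length ?es. (-1) ^ (i + j) * (S.lam \<tau> (?es ! j) * ?C2 (?es ! i) (omit j ?es) (omit i ?es))) =
      (\<Sum>i<length ?es. \<Sum>j<length ?es. (-1) ^ (i + j) * (S.lam \<tau> (?es ! i) * ?C2 (?es ! j) (omit i ?es) (omit j ?es)))"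
    by (subst sum.swap) (simp add: add.commute)
  finally show ?thesis unfolding e1 e2 .
qed

text \<open>By balancing, the contraction with \<open>\<omega>\<^sub>\<tau> \<in> \<bbbL>\<^sub>\<tau>\<close> of an \<open>n\<close>-form vanishes on \<open>\<bbbL>\<^sub>\<tau>\<close>.\<close>

lemma flux_sum:
  assumes \<alpha>: "\<alpha> \<in> superforms N p q" and \<tau>: "\<tau> \<in> cells (int k - 1) \<D>" and x: "x \<in> \<tau>"
  shows "(\<Sum>\<sigma>\<in>star_cells (int k) \<D> \<tau>. m \<sigma> * flux \<alpha> \<sigma> \<tau> x) = cw \<tau> x * \<alpha> x (ES N \<tau>) (ES N \<tau>)"
proof -
  have \<tau>D: "\<tau> \<in> \<D>" by (rule cellsD(1)[OF \<tau>])
  interpret T: cell N \<tau> by (rule D.cellI[OF \<tau>D])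
  let ?ts = "ES N \<tau>" and ?V = "span N" and ?S = "star_cells (int k) \<D> \<tau>" and ?w = "\<lambda>\<sigma>. normal_vector N \<sigma> \<tau>"
  define \<omega> where "\<omega> = (\<Sum>\<sigma>\<in>?S. m \<sigma> *\<^sub>R ?w \<sigma>)"
  have \<omega>: "\<omega> \<in> dirs \<tau>" unfolding \<omega>_def by (rule balance[OF \<tau>])
  have LV: "dirs \<tau> \<subseteq> ?V" by (rule dirs_span_sub[OF \<tau>D])
  have xV: "x \<in> ?V" using x cell_span[OF \<tau>D] by blast
  have tsd: "set ?ts \<subseteq> dirs \<tau>" by (rule T.ES_dirs)
  have tsV: "set ?ts \<subseteq> ?V" using tsd LV by blast
  have omV: "set (omit q ?ts) \<subseteq> ?V" for q using omit_set[of q ?ts] tsV by blast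
  have dis: "distinct ?ts" using T.ES_basis unfolding is_basis_def by blast
  have \<omega>s: "\<omega> \<in> span (set ?ts)" unfolding is_basis_span[OF T.ES_basis] by (rule \<omega>)
  have finS: "finite ?S" using D.finite_\<C> unfolding star_cells_def cells_def by simp
  have wV: "?w \<sigma> \<in> ?V" if "\<sigma> \<in> ?S" for \<sigma>
    using facet.normal_dirs[OF D.facetI[OF \<tau> that]] dirs_span_sub[OF cellsD(1)[OF starD(1)[OF that]]] by blast
  have phi: "\<phi> differentiable (at x within \<tau>)" by (rule smooth_diff_at[OF smooth[OF \<tau>D] x])
  \<comment> \<open>Along \<tau> the derivatives of all the pieces of \<phi> agree; only the normal
    derivatives depend on \<sigma>.\<close>
  have Dt: "dirderiv \<sigma> (?ts ! q) \<phi> x = dirderiv \<tau> (?ts ! q) \<phi> x" if "\<sigma> \<in> ?S" "q < length ?ts" for \<sigma> q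
  proof (rule dirderiv_restrict(1)[symmetric, OF T.convex_\<sigma> x starD(2)[OF that(1)] ES_nth[OF \<tau>D that(2)] _ refl])
    show "\<phi> differentiable (at x within \<sigma>)"
      using x starD(2)[OF that(1)] by (intro smooth_diff_at[OF smooth] cellsD(1)[OF starD(1)[OF that(1)]]) blast
  qed
  let ?B1 = "\<lambda>a r. dirderiv \<tau> a \<phi> x * \<alpha> x ?ts r"
  have z1: "ext1 ?B1 (?ts @ [\<omega>]) = 0"
  proof (rule alt_dependent[OF ext1_alt[OF T.sub\<sigma>] T.sub\<sigma> tsd dis \<omega>s])
    show "alt_multilinear (dirs \<tau>) (?B1 a)" for a
      by (rule alt_scale[OF alt_mono[OF superforms_alt2[OF \<alpha> xV tsV] LV]])
    show "?B1 (s *\<^sub>R a + t *\<^sub>R b) r = s * ?B1 a r + t * ?B1 b r" for a b s t r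
      unfolding dirderiv_linear[OF phi] by (simp add: algebra_simps)
  qed
  let ?B2 = "\<lambda>a l. dirderiv ?V a (\<lambda>y. \<alpha> y l ?ts) x"
  \<comment> \<open>The normal vectors lie in different direction spaces, so their weighted sum is
    inserted into a form on the full space.\<close>
  have alt2: "alt_multilinear ?V (ext1 ?B2)"
    by (rule ext1_alt[OF subspace_V lift_alt(1)[OF \<alpha> xV _ tsV] lift_lin[OF \<alpha> xV _ tsV]])
  have "(\<Sum>\<sigma>\<in>?S. m \<sigma> * ext1 ?B2 (?ts @ [?w \<sigma>])) = ext1 ?B2 (?ts @ [\<omega>])"
    unfolding \<omega>_def by (rule alt_sum_last[symmetric, OF alt2 subspace_V tsV finS wV])
  also have "\<dots> = 0" by (rule alt_dependent[OF alt2 subspace_V tsV dis \<omega>s])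
  finally have z2: "(\<Sum>\<sigma>\<in>?S. m \<sigma> * ext1 ?B2 (?ts @ [?w \<sigma>])) = 0" .
  let ?A = "\<alpha> x ?ts ?ts"
  let ?R = "\<lambda>v. (\<Sum>q<length ?ts. (-1) ^ q * (dirderiv \<tau> (?ts ! q) \<phi> x * \<alpha> x ?ts (omit q ?ts @ [v])))"
  have f1: "ext1 (\<lambda>a r. dirderiv \<sigma> a \<phi> x * \<alpha> x ?ts r) (?ts @ [?w \<sigma>]) =
      (-1) ^ length ?ts * (dirderiv \<sigma> (?w \<sigma>) \<phi> x * ?A) + ?R (?w \<sigma>)" if "\<sigma> \<in> ?S" for \<sigma>
    unfolding ext1_snoc using Dt[OF that] by simp
  have R: "(\<Sum>\<sigma>\<in>?S. m \<sigma> * ?R (?w \<sigma>)) = ?R \<omega>"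
  proof -
    have q: "\<alpha> x ?ts (omit q ?ts @ [\<omega>]) = (\<Sum>\<sigma>\<in>?S. m \<sigma> * \<alpha> x ?ts (omit q ?ts @ [?w \<sigma>]))" for q
      unfolding \<omega>_def by (rule alt_sum_last[OF superforms_alt2[OF \<alpha> xV tsV] subspace_V omV finS wV])
    show ?thesis unfolding q sum_distrib_left by (subst sum.swap) (simp only: mult_ac)
  qed
  \<comment> \<open>Expanding the vanishing form \<open>z1\<close> at its last vector expresses the
    tangential terms by the derivative of \<phi> along \<omega>, the correction term of the corner
    weight.\<close>
  have "?R \<omega> = - ((-1) ^ length ?ts * (dirderiv \<tau> \<omega> \<phi> x * ?A))"
    using z1 unfolding ext1_snoc by (simp add: eq_neg_iff_add_eq_0 add.commute)
  note R = R[unfolded this]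
  have sq: "(-1) ^ n * ((-1) ^ n * c) = (c::real)" for n c
    by (simp add: mult.assoc[symmetric] power_mult_distrib[symmetric])
  have "(\<Sum>\<sigma>\<in>?S. m \<sigma> * flux \<alpha> \<sigma> \<tau> x) =
    (\<Sum>\<sigma>\<in>?S. (-1) ^ length ?ts * (m \<sigma> * ((-1) ^ length ?ts * (dirderiv \<sigma> (?w \<sigma>) \<phi> x * ?A)) + m \<sigma> * ?R (?w \<sigma>))
      - \<phi> x * (-1) ^ length ?ts * (m \<sigma> * ext1 ?B2 (?ts @ [?w \<sigma>])))"
    by (rule sum.cong[OF refl], subst flux_eq[OF \<alpha> \<tau> _ x], assumption, subst f1, assumption) (simp add: algebra_simps)
  also have "\<dots> = (-1) ^ length ?ts * ((\<Sum>\<sigma>\<in>?S. m \<sigma> * ((-1) ^ length ?ts * (dirderiv \<sigma> (?w \<sigma>) \<phi> x * ?A))) + (\<Sum>\<sigma>\<in>?S. m \<sigma> * ?R (?w \<sigma>)))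
      - \<phi> x * (-1) ^ length ?ts * (\<Sum>\<sigma>\<in>?S. m \<sigma> * ext1 ?B2 (?ts @ [?w \<sigma>]))"
    by (simp only: sum_subtractf sum.distrib[symmetric] sum_distrib_left[symmetric])
  also have "(\<Sum>\<sigma>\<in>?S. m \<sigma> * ((-1) ^ length ?ts * (dirderiv \<sigma> (?w \<sigma>) \<phi> x * ?A))) =
      (-1) ^ length ?ts * ((\<Sum>\<sigma>\<in>?S. m \<sigma> * dirderiv \<sigma> (?w \<sigma>) \<phi> x) * ?A)"
    unfolding sum_distrib_left sum_distrib_right by (rule sum.cong) (simp_all only: mult_ac)
  also have "(-1) ^ length ?ts * ((-1) ^ length ?ts * ((\<Sum>\<sigma>\<in>?S. m \<sigma> * dirderiv \<sigma> (?w \<sigma>) \<phi> x) * ?A) + (\<Sum>\<sigma>\<in>?S. m \<sigma> * ?R (?w \<sigma>)))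
      - \<phi> x * (-1) ^ length ?ts * (\<Sum>\<sigma>\<in>?S. m \<sigma> * ext1 ?B2 (?ts @ [?w \<sigma>])) =
      (\<Sum>\<sigma>\<in>?S. m \<sigma> * dirderiv \<sigma> (?w \<sigma>) \<phi> x) * ?A - dirderiv \<tau> \<omega> \<phi> x * ?A"
    unfolding R z2 distrib_left sq by (simp add: sq)
  also have "\<dots> = cw \<tau> x * ?A" unfolding corner_weight_def \<omega>_def by (simp add: left_diff_distrib)
  finally show ?thesis .
qed

lemma cw_cont:
  assumes \<tau>: "\<tau> \<in> cells (int k - 1) \<D>"
  shows "continuous_on \<tau> (cw \<tau>)"
proof -
  have 1: "continuous_on \<tau> (dirderiv \<sigma> (normal_vector N \<sigma> \<tau>) \<phi>)" if s: "\<sigma> \<in> star_cells (int k) \<D> \<tau>" for \<sigma>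
  proof -
    have "\<sigma> \<in> \<D>" by (rule cellsD(1)[OF starD(1)[OF s]])
    hence "continuous_on \<sigma> (dirderiv \<sigma> (normal_vector N \<sigma> \<tau>) \<phi>)"
      by (intro smooth_cont smooth_dirderiv smooth facet.normal_dirs D.facetI[OF \<tau> s])
    thus ?thesis using starD(2)[OF s] by (rule continuous_on_subset)
  qed
  have 2: "continuous_on \<tau> (dirderiv \<tau> (\<Sum>\<sigma>\<in>star_cells (int k) \<D> \<tau>. m \<sigma> *\<^sub>R normal_vector N \<sigma> \<tau>) \<phi>)"
    by (intro smooth_cont smooth_dirderiv smooth balance \<tau> cellsD(1)[OF \<tau>])
  show ?thesis unfolding corner_weight_def[abs_def]
    by (intro continuous_on_diff continuous_on_sum continuous_on_mult continuous_on_const 1 2)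
qed

end

text \<open>The sign exponents of \<open>integral_form\<close> in dimensions l + 1 and l differ by
  l, and -(-1)^(l+1) = (-1)^l compensates this. That factor is the one produced by
  \<open>cell_identity\<close>.\<close>

lemma corner_sign: "(-1) ^ (Suc l * l div 2) * - ((-1) ^ Suc l) = ((-1) ^ (l * (l - 1) div 2) :: real)"
proof -
  have "Suc l * l = 2 * l + l * (l - 1)" by (cases l) (simp_all add: algebra_simps)
  hence "Suc l * l div 2 = l + l * (l - 1) div 2" by simp
  thus ?thesis by (simp add: power_add mult_ac power_mult_distrib[symmetric])
qed

section \<open>The identity of currents\<close>

context corner
begin

lemma length_ES: "\<sigma> \<in> cells (int k) \<D> \<Longrightarrow> length (ES N \<sigma>) = k"
  using cell.ES_length[OF D.cellI[OF cellsD(1)]] cellsD(2) by force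

definition ddcoef :: "'a superform \<Rightarrow> 'a set \<Rightarrow> 'a \<Rightarrow> real" where
  "ddcoef \<alpha> \<sigma> x = (\<Sum>(i, j)\<in>{..<k} \<times> {..<k}. (-1) ^ (i + j) *
     dirderiv \<sigma> (ES N \<sigma> ! j) (dirderiv \<sigma> (ES N \<sigma> ! i) (coef \<alpha> \<sigma> i j)) x)"

definition hesscoef :: "'a superform \<Rightarrow> 'a set \<Rightarrow> 'a \<Rightarrow> real" where
  "hesscoef \<alpha> \<sigma> x = (\<Sum>(i, j)\<in>{..<k} \<times> {..<k}. (-1) ^ (i + j) *
     (dirderiv \<sigma> (ES N \<sigma> ! i) (dirderiv \<sigma> (ES N \<sigma> ! j) \<phi>) x * coef \<alpha> \<sigma> i j x))"

lemma dd_eq: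
  assumes \<alpha>: "\<alpha> \<in> superforms N p q" and \<sigma>: "\<sigma> \<in> cells (int k) \<D>" and x: "x \<in> \<sigma>"
  shows "d'' (span N) (d' (span N) \<alpha>) x (ES N \<sigma>) (ES N \<sigma>) = (-1) ^ k * ddcoef \<alpha> \<sigma> x"
proof -
  have \<sigma>D: "\<sigma> \<in> \<D>" by (rule cellsD(1)[OF \<sigma>])
  let ?es = "ES N \<sigma>"
  have xV: "x \<in> span N" using x cell_span[OF \<sigma>D] by blast
  have es: "set ?es \<subseteq> span N" using ES_sub[OF \<sigma>D] dirs_span_sub[OF \<sigma>D] by blast
  have "dirderiv (span N) (?es ! j) (dirderiv (span N) (?es ! i) (\<lambda>y. \<alpha> y (omit i ?es) (omit j ?es))) x =
      dirderiv \<sigma> (?es ! j) (dirderiv \<sigma> (?es ! i) (coef \<alpha> \<sigma> i j)) x" if "i < k" "j < k" for i j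
    using smooth_restrict(1)[OF coef_smooth_V[OF \<alpha> \<sigma>D] D.cell_convex[OF \<sigma>D] cell_span[OF \<sigma>D] refl _ x, of "[?es ! j, ?es ! i]" i j]
      ES_nth[OF \<sigma>D] that length_ES[OF \<sigma>] by (simp add: coef_def)
  thus ?thesis
    unfolding d''_d'_formula[OF \<alpha> xV es] length_ES[OF \<sigma>] ddcoef_def sum.cartesian_product[symmetric] by simp
qed

lemma wedge_eq:
  assumes \<sigma>: "\<sigma> \<in> cells (int k) \<D>" and x: "x \<in> \<sigma>"
  shows "wedge (d' \<sigma> (d'' \<sigma> (form0 \<phi>))) \<alpha> x (ES N \<sigma>) (ES N \<sigma>) = - ((-1) ^ k) * hesscoef \<alpha> \<sigma> x"
  unfolding wedge_formula[OF D.cell_convex[OF cellsD(1)[OF \<sigma>]] x ES_sub[OF cellsD(1)[OF \<sigma>]]] length_ES[OF \<sigma>]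
    hesscoef_def sum.cartesian_product[symmetric] coef_def ..

lemma term_cont:
  assumes \<alpha>: "\<alpha> \<in> superforms N p q" and \<sigma>: "\<sigma> \<in> cells (int k) \<D>" and ij: "i < k" "j < k"
  shows "continuous_on \<sigma> (coef \<alpha> \<sigma> i j)" "continuous_on \<sigma> (dirderiv \<sigma> (ES N \<sigma> ! i) (coef \<alpha> \<sigma> i j))"
    "continuous_on \<sigma> (dirderiv \<sigma> (ES N \<sigma> ! j) (dirderiv \<sigma> (ES N \<sigma> ! i) (coef \<alpha> \<sigma> i j)))"
    "continuous_on \<sigma> \<phi>" "continuous_on \<sigma> (dirderiv \<sigma> (ES N \<sigma> ! j) \<phi>)"
    "continuous_on \<sigma> (dirderiv \<sigma> (ES N \<sigma> ! i) (dirderiv \<sigma> (ES N \<sigma> ! j) \<phi>))"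
proof -
  have \<sigma>D: "\<sigma> \<in> \<D>" by (rule cellsD(1)[OF \<sigma>])
  have e: "ES N \<sigma> ! i \<in> dirs \<sigma>" "ES N \<sigma> ! j \<in> dirs \<sigma>" using ES_nth[OF \<sigma>D] ij length_ES[OF \<sigma>] by auto
  note c = coef_smooth[OF \<alpha> \<sigma>D] and f = smooth[OF \<sigma>D]
  show "continuous_on \<sigma> (coef \<alpha> \<sigma> i j)" "continuous_on \<sigma> (dirderiv \<sigma> (ES N \<sigma> ! i) (coef \<alpha> \<sigma> i j))"
    "continuous_on \<sigma> (dirderiv \<sigma> (ES N \<sigma> ! j) (dirderiv \<sigma> (ES N \<sigma> ! i) (coef \<alpha> \<sigma> i j)))"
    "continuous_on \<sigma> \<phi>" "continuous_on \<sigma> (dirderiv \<sigma> (ES N \<sigma> ! j) \<phi>)"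
    "continuous_on \<sigma> (dirderiv \<sigma> (ES N \<sigma> ! i) (dirderiv \<sigma> (ES N \<sigma> ! j) \<phi>))"
    by (intro smooth_cont smooth_dirderiv c f e)+
qed

definition supported :: "'a superform \<Rightarrow> 'a set \<Rightarrow> bool" where
  "supported \<alpha> K \<longleftrightarrow> (\<forall>\<kappa>\<in>\<D>. \<forall>x\<in>\<kappa> - K. \<forall>v w. set v \<subseteq> dirs \<kappa> \<longrightarrow> set w \<subseteq> dirs \<kappa> \<longrightarrow> \<alpha> x v w = 0)"

lemma supported_exists:
  assumes "\<alpha> \<in> test_forms N \<C> p q"
  shows "\<exists>K. compact K \<and> supported \<alpha> K"
proof -
  obtain K where K: "compact K" "\<And>\<kappa> x v w. \<kappa> \<in> \<D> \<Longrightarrow> x \<in> \<kappa> - K \<Longrightarrow> set v \<subseteq> dirs \<kappa> \<Longrightarrow> set w \<subseteq> dirs \<kappa> \<Longrightarrow> \<alpha> x v w = 0"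
    using form_support[OF assms] by blast
  have "supported \<alpha> K" unfolding supported_def by (intro ballI allI impI K(2))
  thus ?thesis using K(1) by blast
qed

lemma term_zero:
  assumes \<sigma>: "\<sigma> \<in> cells (int k) \<D>" and ij: "i < k" "j < k" and K: "compact K" "supported \<alpha> K"
    and x: "x \<in> \<sigma> - K"
  shows "coef \<alpha> \<sigma> i j x = 0" "dirderiv \<sigma> (ES N \<sigma> ! i) (coef \<alpha> \<sigma> i j) x = 0"
    "dirderiv \<sigma> (ES N \<sigma> ! j) (dirderiv \<sigma> (ES N \<sigma> ! i) (coef \<alpha> \<sigma> i j)) x = 0"
proof -
  have \<sigma>D: "\<sigma> \<in> \<D>" by (rule cellsD(1)[OF \<sigma>])
  have e: "ES N \<sigma> ! i \<in> dirs \<sigma>" "ES N \<sigma> ! j \<in> dirs \<sigma>" using ES_nth[OF \<sigma>D] ij length_ES[OF \<sigma>] by auto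
  note cl = compact_imp_closed[OF K(1)] and cv = D.cell_convex[OF \<sigma>D]
  have z: "coef \<alpha> \<sigma> i j y = 0" if "y \<in> \<sigma> - K" for y
    unfolding coef_def using K(2) \<sigma>D that omit_sub[OF \<sigma>D] unfolding supported_def by blast
  have z1: "dirderiv \<sigma> (ES N \<sigma> ! i) (coef \<alpha> \<sigma> i j) y = 0" if "y \<in> \<sigma> - K" for y
    by (rule dirderiv_zero_off[OF cv _ e(1) cl _ z]) (use that in auto)
  show "coef \<alpha> \<sigma> i j x = 0" by (rule z[OF x])
  show "dirderiv \<sigma> (ES N \<sigma> ! i) (coef \<alpha> \<sigma> i j) x = 0" by (rule z1[OF x])
  show "dirderiv \<sigma> (ES N \<sigma> ! j) (dirderiv \<sigma> (ES N \<sigma> ! i) (coef \<alpha> \<sigma> i j)) x = 0"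
    by (rule dirderiv_zero_off[OF cv _ e(2) cl _ z1]) (use x in auto)
qed

lemma ddcoef_cont:
  assumes \<alpha>: "\<alpha> \<in> superforms N p q" and \<sigma>: "\<sigma> \<in> cells (int k) \<D>"
  shows "continuous_on \<sigma> (ddcoef \<alpha> \<sigma>)" "continuous_on \<sigma> (hesscoef \<alpha> \<sigma>)"
  unfolding ddcoef_def[abs_def] hesscoef_def[abs_def] split_def
  by (intro continuous_on_sum continuous_on_mult continuous_on_const term_cont[OF \<alpha> \<sigma>]; force)+

text \<open>Integrating by parts moves one derivative after the other from \<alpha> to \<phi>. The
  mixed terms, first derivative of \<phi> times first derivative of a coefficient, occur in both
  steps and cancel, leaving the facet terms.\<close>

lemma cell_identity:
  assumes \<alpha>: "\<alpha> \<in> test_forms N \<C> p q" and \<sigma>: "\<sigma> \<in> cells (int k) \<D>"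
  shows "- cint N \<sigma> (\<lambda>x. \<phi> x * d'' (span N) (d' (span N) \<alpha>) x (ES N \<sigma>) (ES N \<sigma>))
      - cint N \<sigma> (\<lambda>x. wedge (d' \<sigma> (d'' \<sigma> (form0 \<phi>))) \<alpha> x (ES N \<sigma>) (ES N \<sigma>)) =
    - ((-1) ^ k) * (\<Sum>\<tau> | \<tau> facet_of \<sigma>. cint N \<tau> (flux \<alpha> \<sigma> \<tau>))"
proof -
  have \<sigma>D: "\<sigma> \<in> \<D>" by (rule cellsD(1)[OF \<sigma>])
  interpret S: cell N \<sigma> by (rule D.cellI[OF \<sigma>D])
  have sf: "\<alpha> \<in> superforms N p q" using \<alpha> unfolding test_forms_def by blast
  obtain K where K: "compact K" "supported \<alpha> K"
    using supported_exists[OF \<alpha>] by blast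
  let ?e = "\<lambda>i. ES N \<sigma> ! i" and ?A = "coef \<alpha> \<sigma>" and ?P = "{..<k} \<times> {..<k}"
  note tc = term_cont[OF sf \<sigma>] and tz = term_zero[OF \<sigma> _ _ K]
  have len: "length (ES N \<sigma>) = k" by (rule length_ES[OF \<sigma>])
  have e: "?e i \<in> dirs \<sigma>" if "i < k" for i using ES_nth[OF \<sigma>D] that len by simp
  \<comment> \<open>\<open>g1\<close> is the derivative of \<open>h1\<close> in the j-th direction
    and \<open>g2\<close> that of \<open>h2\<close> in the i-th. Their difference is the integrand
    of the left-hand side up to sign.\<close>
  define g1 where "g1 p = (\<lambda>x. \<phi> x * dirderiv \<sigma> (?e (snd p)) (dirderiv \<sigma> (?e (fst p)) (?A (fst p) (snd p))) x +
      dirderiv \<sigma> (?e (snd p)) \<phi> x * dirderiv \<sigma> (?e (fst p)) (?A (fst p) (snd p)) x)" for p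
  define g2 where "g2 p = (\<lambda>x. dirderiv \<sigma> (?e (snd p)) \<phi> x * dirderiv \<sigma> (?e (fst p)) (?A (fst p) (snd p)) x +
      dirderiv \<sigma> (?e (fst p)) (dirderiv \<sigma> (?e (snd p)) \<phi>) x * ?A (fst p) (snd p) x)" for p
  define h1 where "h1 p = (\<lambda>x. \<phi> x * dirderiv \<sigma> (?e (fst p)) (?A (fst p) (snd p)) x)" for p
  define h2 where "h2 p = (\<lambda>x. dirderiv \<sigma> (?e (snd p)) \<phi> x * ?A (fst p) (snd p) x)" for p
  define s where "s p = ((-1) ^ (fst p + snd p) :: real)" for p :: "nat \<times> nat"
  have P: "fst p < k" "snd p < k" if "p \<in> ?P" for p using that by auto
  have gc: "continuous_on \<sigma> (g1 p)" "continuous_on \<sigma> (g2 p)" "continuous_on \<sigma> (h1 p)" "continuous_on \<sigma> (h2 p)" if "p \<in> ?P" for p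
    unfolding g1_def g2_def h1_def h2_def by (intro continuous_on_add continuous_on_mult tc[OF P[OF that]])+
  have gz: "g1 p x = 0" "g2 p x = 0" "h1 p x = 0" "h2 p x = 0" if "p \<in> ?P" "x \<in> \<sigma> - K" for p x
    unfolding g1_def g2_def h1_def h2_def using tz[OF P[OF that(1)] that(2)] by auto
  have st1: "cint N \<sigma> (g1 p) = - (\<Sum>\<tau> | \<tau> facet_of \<sigma>. S.lam \<tau> (?e (snd p)) * cint N \<tau> (h1 p))" if "p \<in> ?P" for p
    unfolding g1_def h1_def
    by (rule S.stokes_prod[OF smooth[OF \<sigma>D] smooth_dirderiv[OF coef_smooth[OF sf \<sigma>D] e[OF P(1)[OF that]]] K(1) tz(2)[OF P[OF that]] e[OF P(2)[OF that]]])
  have st2: "cint N \<sigma> (g2 p) = - (\<Sum>\<tau> | \<tau> facet_of \<sigma>. S.lam \<tau> (?e (fst p)) * cint N \<tau> (h2 p))" if "p \<in> ?P" for p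
    unfolding g2_def h2_def
    by (rule S.stokes_prod[OF smooth_dirderiv[OF smooth[OF \<sigma>D] e[OF P(2)[OF that]]] coef_smooth[OF sf \<sigma>D] K(1) tz(1)[OF P[OF that]] e[OF P(1)[OF that]]])
  have fl: "cint N \<tau> (flux \<alpha> \<sigma> \<tau>) = (\<Sum>p\<in>?P. s p * (S.lam \<tau> (?e (fst p)) * cint N \<tau> (h2 p) - S.lam \<tau> (?e (snd p)) * cint N \<tau> (h1 p)))"
    if \<tau>: "\<tau> facet_of \<sigma>" for \<tau>
  proof -
    interpret T: cell N \<tau> by (rule D.cellI[OF D.facet_mem[OF \<sigma>D \<tau>]])
    have sub: "\<tau> \<subseteq> \<sigma>" by (rule facet_of_imp_subset[OF \<tau>])
    have hc: "continuous_on \<tau> (h1 p)" "continuous_on \<tau> (h2 p)" if "p \<in> ?P" for p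
      using gc(3,4)[OF that] sub by (blast intro: continuous_on_subset)+
    have hz: "h1 p x = 0" "h2 p x = 0" if "p \<in> ?P" "x \<in> \<tau> - K" for p x
      using gz(3,4)[OF that(1), of x] that(2) sub by auto
    let ?h = "\<lambda>p x. S.lam \<tau> (?e (fst p)) * h2 p x + (- S.lam \<tau> (?e (snd p))) * h1 p x"
    have "cint N \<tau> (flux \<alpha> \<sigma> \<tau>) = cint N \<tau> (\<lambda>x. \<Sum>p\<in>?P. s p * ?h p x)"
      by (rule cint_cong) (simp add: flux_def len sum.cartesian_product split_def s_def h1_def h2_def)
    also have "\<dots> = (\<Sum>p\<in>?P. s p * cint N \<tau> (?h p))"
      using hz by (intro T.cint_sum[OF _ K(1)] continuous_on_add continuous_on_mult continuous_on_const hc) auto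
    also have "\<dots> = (\<Sum>p\<in>?P. s p * (S.lam \<tau> (?e (fst p)) * cint N \<tau> (h2 p) - S.lam \<tau> (?e (snd p)) * cint N \<tau> (h1 p)))"
    proof (intro sum.cong refl arg_cong2[of _ _ _ _ "(*)"])
      fix p assume p: "p \<in> ?P"
      show "cint N \<tau> (?h p) = S.lam \<tau> (?e (fst p)) * cint N \<tau> (h2 p) - S.lam \<tau> (?e (snd p)) * cint N \<tau> (h1 p)"
        by (subst T.cint_lincomb[OF hc(2)[OF p] hc(1)[OF p] K(1) hz(2)[OF p] hz(1)[OF p]]) simp_all
    qed
    finally show ?thesis .
  qed
  note dc = ddcoef_cont[OF sf \<sigma>]
  have dz: "ddcoef \<alpha> \<sigma> x = 0" "hesscoef \<alpha> \<sigma> x = 0" if "x \<in> \<sigma> - K" for x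
    unfolding ddcoef_def hesscoef_def split_def using tz[OF P that] by (simp_all add: sum.neutral)
  have "- cint N \<sigma> (\<lambda>x. \<phi> x * d'' (span N) (d' (span N) \<alpha>) x (ES N \<sigma>) (ES N \<sigma>))
      - cint N \<sigma> (\<lambda>x. wedge (d' \<sigma> (d'' \<sigma> (form0 \<phi>))) \<alpha> x (ES N \<sigma>) (ES N \<sigma>)) =
      (-1) * cint N \<sigma> (\<lambda>x. \<phi> x * ((-1) ^ k * ddcoef \<alpha> \<sigma> x)) + (-1) * cint N \<sigma> (\<lambda>x. - ((-1) ^ k) * hesscoef \<alpha> \<sigma> x)"
    using cint_cong[of \<sigma> "\<lambda>x. \<phi> x * d'' (span N) (d' (span N) \<alpha>) x (ES N \<sigma>) (ES N \<sigma>)" "\<lambda>x. \<phi> x * ((-1) ^ k * ddcoef \<alpha> \<sigma> x)" N]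
      cint_cong[of \<sigma> "\<lambda>x. wedge (d' \<sigma> (d'' \<sigma> (form0 \<phi>))) \<alpha> x (ES N \<sigma>) (ES N \<sigma>)" "\<lambda>x. - ((-1) ^ k) * hesscoef \<alpha> \<sigma> x" N]
      dd_eq[OF sf \<sigma>] wedge_eq[OF \<sigma>] by simp
  also have "\<dots> = cint N \<sigma> (\<lambda>x. (-1) * (\<phi> x * ((-1) ^ k * ddcoef \<alpha> \<sigma> x)) + (-1) * (- ((-1) ^ k) * hesscoef \<alpha> \<sigma> x))"
    by (rule S.cint_lincomb[symmetric, OF _ _ K(1)])
       (auto intro!: continuous_on_mult continuous_on_const dc smooth_cont[OF smooth[OF \<sigma>D]] continuous_on_minus simp: dz)
  also have "\<dots> = cint N \<sigma> (\<lambda>x. \<Sum>p\<in>?P. (- ((-1) ^ k) * s p) * (1 * g1 p x + (-1) * g2 p x))"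
    by (rule cint_cong)
       (simp add: ddcoef_def hesscoef_def split_def s_def g1_def g2_def sum_distrib_left sum_negf[symmetric] sum.distrib[symmetric] algebra_simps)
  also have "\<dots> = (\<Sum>p\<in>?P. (- ((-1) ^ k) * s p) * cint N \<sigma> (\<lambda>x. 1 * g1 p x + (-1) * g2 p x))"
    using gz by (intro S.cint_sum[OF _ K(1)] continuous_on_add continuous_on_mult continuous_on_const gc) auto
  also have "\<dots> = (\<Sum>p\<in>?P. (- ((-1) ^ k) * s p) *
      (\<Sum>\<tau> | \<tau> facet_of \<sigma>. S.lam \<tau> (?e (fst p)) * cint N \<tau> (h2 p) - S.lam \<tau> (?e (snd p)) * cint N \<tau> (h1 p)))"
  proof (intro sum.cong refl arg_cong2[of _ _ _ _ "(*)"])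
    fix p assume p: "p \<in> ?P"
    have "cint N \<sigma> (\<lambda>x. 1 * g1 p x + (-1) * g2 p x) = 1 * cint N \<sigma> (g1 p) + (-1) * cint N \<sigma> (g2 p)"
      by (rule S.cint_lincomb[OF gc(1)[OF p] gc(2)[OF p] K(1) gz(1)[OF p] gz(2)[OF p]])
    thus "cint N \<sigma> (\<lambda>x. 1 * g1 p x + (-1) * g2 p x) =
      (\<Sum>\<tau> | \<tau> facet_of \<sigma>. S.lam \<tau> (?e (fst p)) * cint N \<tau> (h2 p) - S.lam \<tau> (?e (snd p)) * cint N \<tau> (h1 p))"
      by (simp add: st1[OF p] st2[OF p] sum_subtractf)
  qed
  also have "\<dots> = (\<Sum>\<tau> | \<tau> facet_of \<sigma>. - ((-1) ^ k) * cint N \<tau> (flux \<alpha> \<sigma> \<tau>))"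
    unfolding sum_distrib_left by (subst sum.swap, intro sum.cong refl) (simp add: fl sum_distrib_left mult.assoc sum_negf)
  finally show ?thesis by (simp only: sum_distrib_left)
qed

lemma current_fun_cint:
  assumes "\<And>\<sigma>. \<sigma> \<in> cells (int k) \<D> \<Longrightarrow> continuous_on \<sigma> (\<lambda>x. \<alpha> x (ES N \<sigma>) (ES N \<sigma>))"
  shows "current_fun N (int k) \<D> m \<phi> \<alpha> =
    (\<Sum>\<sigma>\<in>cells (int k) \<D>. (m \<sigma> * (-1) ^ (k * (k - 1) div 2)) * cint N \<sigma> (\<lambda>x. \<phi> x * \<alpha> x (ES N \<sigma>) (ES N \<sigma>)))"
  unfolding current_fun_def
proof (rule sum.cong[OF refl])
  fix \<sigma> assume \<sigma>: "\<sigma> \<in> cells (int k) \<D>"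
  have "continuous_on \<sigma> (\<lambda>x. scale_form \<phi> \<alpha> x (ES N \<sigma>) (ES N \<sigma>))"
    unfolding scale_form_def by (intro continuous_on_mult smooth_cont[OF smooth] assms \<sigma> cellsD(1)[OF \<sigma>])
  from cell.integral_form_cint[OF D.cellI[OF cellsD(1)[OF \<sigma>]], of "scale_form \<phi> \<alpha>", OF this]
  show "m \<sigma> * integral_form N \<sigma> (scale_form \<phi> \<alpha>) =
      m \<sigma> * (-1) ^ (k * (k - 1) div 2) * cint N \<sigma> (\<lambda>x. \<phi> x * \<alpha> x (ES N \<sigma>) (ES N \<sigma>))"
    unfolding length_ES[OF \<sigma>] scale_form_def by simp
qed

lemma current_hess_cint:
  assumes \<alpha>: "\<alpha> \<in> superforms N p q"
  shows "current_piecewise_d'd'' N (int k) \<D> m \<phi> \<alpha> =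
    (\<Sum>\<sigma>\<in>cells (int k) \<D>. (m \<sigma> * (-1) ^ (k * (k - 1) div 2)) *
      cint N \<sigma> (\<lambda>x. wedge (d' \<sigma> (d'' \<sigma> (form0 \<phi>))) \<alpha> x (ES N \<sigma>) (ES N \<sigma>)))"
  unfolding current_piecewise_d'd''_def
proof (rule sum.cong[OF refl])
  fix \<sigma> assume \<sigma>: "\<sigma> \<in> cells (int k) \<D>"
  have "continuous_on \<sigma> (\<lambda>x. - ((-1) ^ k) * hesscoef \<alpha> \<sigma> x)"
    by (intro continuous_on_mult continuous_on_const ddcoef_cont[OF \<alpha> \<sigma>])
  hence "continuous_on \<sigma> (\<lambda>x. wedge (d' \<sigma> (d'' \<sigma> (form0 \<phi>))) \<alpha> x (ES N \<sigma>) (ES N \<sigma>))"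
    by (rule continuous_on_eq) (simp add: wedge_eq[OF \<sigma>])
  from cell.integral_form_cint[OF D.cellI[OF cellsD(1)[OF \<sigma>]], of "wedge (d' \<sigma> (d'' \<sigma> (form0 \<phi>))) \<alpha>", OF this]
  show "m \<sigma> * integral_form N \<sigma> (wedge (d' \<sigma> (d'' \<sigma> (form0 \<phi>))) \<alpha>) =
      m \<sigma> * (-1) ^ (k * (k - 1) div 2) * cint N \<sigma> (\<lambda>x. wedge (d' \<sigma> (d'' \<sigma> (form0 \<phi>))) \<alpha> x (ES N \<sigma>) (ES N \<sigma>))"
    unfolding length_ES[OF \<sigma>] by simp
qed

lemma cells_corner: "cells (int k - 1) (corner_complex (int k) \<D>) = cells (int k - 1) \<D>"
proof -
  have "\<tau> face_of \<tau>" if "\<tau> \<in> \<D>" for \<tau> using D.cell_convex[OF that] by (rule face_of_refl)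
  thus ?thesis unfolding corner_complex_def cells_def by auto
qed

lemma facet_length: "\<tau> \<in> cells (int k - 1) \<D> \<Longrightarrow> k = Suc (length (ES N \<tau>))"
  using cell.ES_length[OF D.cellI[OF cellsD(1)]] cellsD(2) by force

lemma current_delta_cint:
  assumes \<alpha>: "\<alpha> \<in> superforms N p q"
  shows "current_delta N (int k - 1) (corner_complex (int k) \<D>) cw \<alpha> =
    (\<Sum>\<tau>\<in>cells (int k - 1) \<D>. ((-1) ^ (k * (k - 1) div 2) * - ((-1) ^ k)) * cint N \<tau> (\<lambda>x. cw \<tau> x * \<alpha> x (ES N \<tau>) (ES N \<tau>)))"
  unfolding current_delta_def cells_corner
proof (rule sum.cong[OF refl])
  fix \<tau> assume \<tau>: "\<tau> \<in> cells (int k - 1) \<D>"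
  have \<tau>D: "\<tau> \<in> \<D>" by (rule cellsD(1)[OF \<tau>])
  have "continuous_on \<tau> (\<lambda>x. scale_form (cw \<tau>) \<alpha> x (ES N \<tau>) (ES N \<tau>))"
    unfolding scale_form_def by (intro continuous_on_mult cw_cont[OF \<tau>] smooth_cont form_smooth[OF \<alpha> \<tau>D] ES_sub \<tau>D)
  from cell.integral_form_cint[OF D.cellI[OF \<tau>D], of "scale_form (cw \<tau>) \<alpha>", OF this]
  have "integral_form N \<tau> (scale_form (cw \<tau>) \<alpha>) =
      (-1) ^ (length (ES N \<tau>) * (length (ES N \<tau>) - 1) div 2) * cint N \<tau> (\<lambda>x. cw \<tau> x * \<alpha> x (ES N \<tau>) (ES N \<tau>))"
    unfolding scale_form_def .
  also have "(-1) ^ (length (ES N \<tau>) * (length (ES N \<tau>) - 1) div 2) = ((-1) ^ (k * (k - 1) div 2) * - ((-1) ^ k) :: real)"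
    using corner_sign[of "length (ES N \<tau>)"] facet_length[OF \<tau>] by simp
  finally show "integral_form N \<tau> (scale_form (cw \<tau>) \<alpha>) =
    ((-1) ^ (k * (k - 1) div 2) * - ((-1) ^ k)) * cint N \<tau> (\<lambda>x. cw \<tau> x * \<alpha> x (ES N \<tau>) (ES N \<tau>))" .
qed

lemma finite_cells: "finite (cells d \<D>)"
  using D.finite_\<C> unfolding cells_def by simp

text \<open>The facet terms are regrouped by \<tau> in place of \<sigma>, so that each \<tau>
  receives the weighted flux from its whole star.\<close>

lemma corner_identity:
  assumes \<alpha>: "\<alpha> \<in> test_forms N \<C> p q"
  shows "current_d' N 0 1 (current_d'' N 0 0 (current_fun N (int k) \<D> m \<phi>)) \<alpha>
      - current_piecewise_d'd'' N (int k) \<D> m \<phi> \<alpha> =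
    current_delta N (int k - 1) (corner_complex (int k) \<D>) cw \<alpha>"
proof -
  have sf: "\<alpha> \<in> superforms N p q" using \<alpha> unfolding test_forms_def by blast
  obtain K where K: "compact K" "supported \<alpha> K"
    using supported_exists[OF \<alpha>] by blast
  let ?dd = "d'' (span N) (d' (span N) \<alpha>)" and ?e = "(-1) ^ (k * (k - 1) div 2) :: real"
  let ?W = "\<lambda>\<sigma>. wedge (d' \<sigma> (d'' \<sigma> (form0 \<phi>))) \<alpha>"
  have cont: "continuous_on \<sigma> (\<lambda>x. ?dd x (ES N \<sigma>) (ES N \<sigma>))" if \<sigma>: "\<sigma> \<in> cells (int k) \<D>" for \<sigma>
  proof -
    have "continuous_on \<sigma> (\<lambda>x. (-1) ^ k * ddcoef \<alpha> \<sigma> x)"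
      by (intro continuous_on_mult continuous_on_const ddcoef_cont[OF sf \<sigma>])
    thus ?thesis by (rule continuous_on_eq) (simp add: dd_eq[OF sf \<sigma>])
  qed
  have fc: "continuous_on \<tau> (flux \<alpha> \<sigma> \<tau>)" and fz: "\<And>x. x \<in> \<tau> - K \<Longrightarrow> flux \<alpha> \<sigma> \<tau> x = 0"
    if \<sigma>: "\<sigma> \<in> star_cells (int k) \<D> \<tau>" for \<sigma> \<tau>
  proof -
    have \<sigma>c: "\<sigma> \<in> cells (int k) \<D>" and sub: "\<tau> \<subseteq> \<sigma>" by (rule starD[OF \<sigma>])+
    show "continuous_on \<tau> (flux \<alpha> \<sigma> \<tau>)"
      unfolding flux_def[abs_def] length_ES[OF \<sigma>c]
      by (intro continuous_on_sum continuous_on_mult continuous_on_diff continuous_on_const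
          continuous_on_subset[OF _ sub] term_cont[OF sf \<sigma>c]; simp)
    show "flux \<alpha> \<sigma> \<tau> x = 0" if "x \<in> \<tau> - K" for x
    proof -
      have "x \<in> \<sigma> - K" using that sub by blast
      thus ?thesis unfolding flux_def length_ES[OF \<sigma>c] using term_zero[OF \<sigma>c _ _ K] by (simp add: sum.neutral)
    qed
  qed
  \<comment> \<open>The complex contains all non-empty faces, so the facets of an n-cell are exactly
    the cells of dimension n - 1 that are faces of it; this permits the exchange of sums.\<close>
  have facets: "{\<tau>. \<tau> facet_of \<sigma>} = {\<tau> \<in> cells (int k - 1) \<D>. \<tau> face_of \<sigma>}" if "\<sigma> \<in> cells (int k) \<D>" for \<sigma>
  proof -
    have "\<sigma> \<in> \<D>" "aff_dim \<sigma> = int k" using cellsD[OF that] .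
    thus ?thesis using D.facet_mem[of \<sigma>] D.cell_ne unfolding facet_of_def cells_def by auto
  qed
  have star: "{\<sigma> \<in> cells (int k) \<D>. \<tau> face_of \<sigma>} = star_cells (int k) \<D> \<tau>" for \<tau> unfolding star_cells_def ..
  \<comment> \<open>The current has bidegree (0,0) and its d'' has bidegree (0,1), so the signs are
    -1 and +1. On \<alpha> the differentials act in the opposite order, d' first.\<close>
  have "current_d' N 0 1 (current_d'' N 0 0 (current_fun N (int k) \<D> m \<phi>)) \<alpha> = - current_fun N (int k) \<D> m \<phi> ?dd"
    unfolding current_d'_def current_d''_def by simp
  hence "current_d' N 0 1 (current_d'' N 0 0 (current_fun N (int k) \<D> m \<phi>)) \<alpha>
      - current_piecewise_d'd'' N (int k) \<D> m \<phi> \<alpha> =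
    (\<Sum>\<sigma>\<in>cells (int k) \<D>. (m \<sigma> * ?e) * (- cint N \<sigma> (\<lambda>x. \<phi> x * ?dd x (ES N \<sigma>) (ES N \<sigma>)) - cint N \<sigma> (\<lambda>x. ?W \<sigma> x (ES N \<sigma>) (ES N \<sigma>))))"
    by (simp only: current_fun_cint[of ?dd, OF cont] current_hess_cint[OF sf] right_diff_distrib mult_minus_right sum_subtractf sum_negf)
  also have "\<dots> = (\<Sum>\<sigma>\<in>cells (int k) \<D>. \<Sum>\<tau>\<in>{\<tau> \<in> cells (int k - 1) \<D>. \<tau> face_of \<sigma>}. (?e * - ((-1) ^ k)) * (m \<sigma> * cint N \<tau> (flux \<alpha> \<sigma> \<tau>)))"
    by (rule sum.cong[OF refl]) (simp only: cell_identity[OF \<alpha>] facets sum_distrib_left mult_ac)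
  also have "\<dots> = (\<Sum>\<tau>\<in>cells (int k - 1) \<D>. \<Sum>\<sigma>\<in>{\<sigma> \<in> cells (int k) \<D>. \<tau> face_of \<sigma>}. (?e * - ((-1) ^ k)) * (m \<sigma> * cint N \<tau> (flux \<alpha> \<sigma> \<tau>)))"
    by (rule sum.swap_restrict[OF finite_cells finite_cells])
  also have "\<dots> = (\<Sum>\<tau>\<in>cells (int k - 1) \<D>. (?e * - ((-1) ^ k)) * cint N \<tau> (\<lambda>x. cw \<tau> x * \<alpha> x (ES N \<tau>) (ES N \<tau>)))"
  proof (rule sum.cong[OF refl])
    fix \<tau> assume \<tau>: "\<tau> \<in> cells (int k - 1) \<D>"
    have "cint N \<tau> (\<lambda>x. cw \<tau> x * \<alpha> x (ES N \<tau>) (ES N \<tau>)) = cint N \<tau> (\<lambda>x. \<Sum>\<sigma>\<in>star_cells (int k) \<D> \<tau>. m \<sigma> * flux \<alpha> \<sigma> \<tau> x)"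
      by (rule cint_cong) (rule flux_sum[OF sf \<tau>, symmetric])
    also have "\<dots> = (\<Sum>\<sigma>\<in>star_cells (int k) \<D> \<tau>. m \<sigma> * cint N \<tau> (flux \<alpha> \<sigma> \<tau>))"
      by (rule cell.cint_sum[OF D.cellI[OF cellsD(1)[OF \<tau>]] fc K(1) fz])
    finally show "(\<Sum>\<sigma>\<in>{\<sigma> \<in> cells (int k) \<D>. \<tau> face_of \<sigma>}. (?e * - ((-1) ^ k)) * (m \<sigma> * cint N \<tau> (flux \<alpha> \<sigma> \<tau>))) =
      (?e * - ((-1) ^ k)) * cint N \<tau> (\<lambda>x. cw \<tau> x * \<alpha> x (ES N \<tau>) (ES N \<tau>))"
      unfolding star by (simp only: sum_distrib_left)
  qed
  also have "\<dots> = current_delta N (int k - 1) (corner_complex (int k) \<D>) cw \<alpha>" by (rule current_delta_cint[OF sf, symmetric])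
  finally show ?thesis .
qed

lemma current_fun_supercurrent: "current_fun N (int k) \<D> m \<phi> \<in> supercurrents N \<C> p q"
proof (rule supercurrentI[OF finite_cells])
  show "\<sigma> \<in> \<D> \<and> continuous_on \<sigma> \<phi> \<and> set (ES N \<sigma>) \<subseteq> dirs \<sigma> \<and> set (ES N \<sigma>) \<subseteq> dirs \<sigma>" if "\<sigma> \<in> cells (int k) \<D>" for \<sigma>
    using cellsD(1)[OF that] smooth_cont[OF smooth] ES_sub by blast
  fix \<alpha> assume "\<alpha> \<in> test_forms N \<C> p q"
  hence sf: "\<alpha> \<in> superforms N p q" unfolding test_forms_def by blast
  show "current_fun N (int k) \<D> m \<phi> \<alpha> =
    (\<Sum>\<sigma>\<in>cells (int k) \<D>. (m \<sigma> * (-1) ^ (k * (k - 1) div 2)) * cint N \<sigma> (\<lambda>x. \<phi> x * \<alpha> x (ES N \<sigma>) (ES N \<sigma>)))"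
    by (rule current_fun_cint, intro smooth_cont form_smooth[OF sf] ES_sub) (rule cellsD(1), assumption)+
qed

lemma current_delta_supercurrent:
  "current_delta N (int k - 1) (corner_complex (int k) \<D>) cw \<in> supercurrents N \<C> p q"
proof (rule supercurrentI[OF finite_cells])
  show "\<tau> \<in> \<D> \<and> continuous_on \<tau> (cw \<tau>) \<and> set (ES N \<tau>) \<subseteq> dirs \<tau> \<and> set (ES N \<tau>) \<subseteq> dirs \<tau>" if "\<tau> \<in> cells (int k - 1) \<D>" for \<tau>
    using cellsD(1)[OF that] cw_cont[OF that] ES_sub by blast
  fix \<alpha> assume "\<alpha> \<in> test_forms N \<C> p q"
  hence sf: "\<alpha> \<in> superforms N p q" unfolding test_forms_def by blast
  show "current_delta N (int k - 1) (corner_complex (int k) \<D>) cw \<alpha> =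
    (\<Sum>\<tau>\<in>cells (int k - 1) \<D>. ((-1) ^ (k * (k - 1) div 2) * - ((-1) ^ k)) * cint N \<tau> (\<lambda>x. cw \<tau> x * \<alpha> x (ES N \<tau>) (ES N \<tau>)))"
    by (rule current_delta_cint[OF sf])
qed

text \<open>The form is expanded into its coefficients, one term for each cell and each pair of
  omitted indices, to fit the shape of \<open>supercurrentI\<close>.\<close>

lemma current_hess_supercurrent: "current_piecewise_d'd'' N (int k) \<D> m \<phi> \<in> supercurrents N \<C> p q"
proof (rule supercurrentI)
  let ?I = "cells (int k) \<D> \<times> ({..<k} \<times> {..<k})"
  show "finite ?I" using finite_cells by simp
  show "fst p \<in> \<D> \<and> continuous_on (fst p) (dirderiv (fst p) (ES N (fst p) ! fst (snd p)) (dirderiv (fst p) (ES N (fst p) ! snd (snd p)) \<phi>)) \<and>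
      set (omit (fst (snd p)) (ES N (fst p))) \<subseteq> dirs (fst p) \<and> set (omit (snd (snd p)) (ES N (fst p))) \<subseteq> dirs (fst p)" if p: "p \<in> ?I" for p
  proof -
    have c: "fst p \<in> cells (int k) \<D>" "fst (snd p) < k" "snd (snd p) < k" using p by auto
    have D: "fst p \<in> \<D>" by (rule cellsD(1)[OF c(1)])
    have "continuous_on (fst p) (dirderiv (fst p) (ES N (fst p) ! fst (snd p)) (dirderiv (fst p) (ES N (fst p) ! snd (snd p)) \<phi>))"
      by (intro smooth_cont smooth_dirderiv smooth D ES_nth) (use c length_ES[OF c(1)] in simp_all)
    thus ?thesis using D omit_sub[OF D] by blast
  qed
  fix \<alpha> assume \<alpha>: "\<alpha> \<in> test_forms N \<C> p q"
  hence sf: "\<alpha> \<in> superforms N p q" unfolding test_forms_def by blast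
  obtain K where K: "compact K" "supported \<alpha> K"
    using supported_exists[OF \<alpha>] by blast
  let ?c = "\<lambda>p. m (fst p) * (-1) ^ (k * (k - 1) div 2) * (- ((-1) ^ k) * (-1) ^ (fst (snd p) + snd (snd p)))"
  let ?h = "\<lambda>\<sigma> i j x. dirderiv \<sigma> (ES N \<sigma> ! i) (dirderiv \<sigma> (ES N \<sigma> ! j) \<phi>) x * \<alpha> x (omit i (ES N \<sigma>)) (omit j (ES N \<sigma>))"
  have "cint N \<sigma> (\<lambda>x. wedge (d' \<sigma> (d'' \<sigma> (form0 \<phi>))) \<alpha> x (ES N \<sigma>) (ES N \<sigma>)) =
      (\<Sum>p\<in>{..<k} \<times> {..<k}. (- ((-1) ^ k) * (-1) ^ (fst p + snd p)) * cint N \<sigma> (?h \<sigma> (fst p) (snd p)))" if \<sigma>: "\<sigma> \<in> cells (int k) \<D>" for \<sigma>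
  proof -
    have "cint N \<sigma> (\<lambda>x. wedge (d' \<sigma> (d'' \<sigma> (form0 \<phi>))) \<alpha> x (ES N \<sigma>) (ES N \<sigma>)) =
        cint N \<sigma> (\<lambda>x. \<Sum>p\<in>{..<k} \<times> {..<k}. (- ((-1) ^ k) * (-1) ^ (fst p + snd p)) * ?h \<sigma> (fst p) (snd p) x)"
      by (rule cint_cong) (simp only: wedge_eq[OF \<sigma>] hesscoef_def coef_def split_def sum_distrib_left mult.assoc)
    also have "\<dots> = (\<Sum>p\<in>{..<k} \<times> {..<k}. (- ((-1) ^ k) * (-1) ^ (fst p + snd p)) * cint N \<sigma> (?h \<sigma> (fst p) (snd p)))"
    proof (rule cell.cint_sum[OF D.cellI[OF cellsD(1)[OF \<sigma>]] _ K(1)])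
      fix p assume "p \<in> {..<k} \<times> {..<k}"
      hence p: "fst p < k" "snd p < k" by auto
      show "continuous_on \<sigma> (?h \<sigma> (fst p) (snd p))"
        using term_cont(1,6)[OF sf \<sigma> p] unfolding coef_def by (intro continuous_on_mult)
      show "?h \<sigma> (fst p) (snd p) x = 0" if "x \<in> \<sigma> - K" for x
        using term_zero(1)[OF \<sigma> p K that] unfolding coef_def by simp
    qed
    finally show ?thesis .
  qed
  hence "current_piecewise_d'd'' N (int k) \<D> m \<phi> \<alpha> =
     (\<Sum>\<sigma>\<in>cells (int k) \<D>. \<Sum>p\<in>{..<k} \<times> {..<k}. ?c (\<sigma>, p) * cint N \<sigma> (?h \<sigma> (fst p) (snd p)))"
    unfolding current_hess_cint[OF sf] by (intro sum.cong refl) (simp only: sum_distrib_left mult.assoc fst_conv snd_conv)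
  also have "\<dots> = (\<Sum>p\<in>?I. ?c p * cint N (fst p) (?h (fst p) (fst (snd p)) (snd (snd p))))"
    unfolding sum.cartesian_product by (rule sum.cong) auto
  finally show "current_piecewise_d'd'' N (int k) \<D> m \<phi> \<alpha> =
     (\<Sum>p\<in>?I. ?c p * cint N (fst p) (\<lambda>x. dirderiv (fst p) (ES N (fst p) ! fst (snd p)) (dirderiv (fst p) (ES N (fst p) ! snd (snd p)) \<phi>) x *
        \<alpha> x (omit (fst (snd p)) (ES N (fst p))) (omit (snd (snd p)) (ES N (fst p)))))" .
qed

end

theorem theorem0p1:
  fixes N :: "'a::euclidean_space set"
    and n :: nat
    and \<C> :: "'a set set"
    and m :: "'a set \<Rightarrow> real"
    and \<phi> :: "'a \<Rightarrow> real"
  assumes "is_lattice N"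
    and "tropical_cycle N (int n) \<C> (\<lambda>\<sigma> \<omega>. m \<sigma>)"
    and "piecewise_smooth N \<C> \<phi>"
  shows "\<forall>\<C>'. subdivision N \<C>' \<C> \<and> smooth_on_cells \<C>' \<phi> \<longrightarrow>
    (let m' = induced_weights (int n) \<C> m;
         T = current_fun N (int n) \<C>' m' \<phi>;
         R = current_piecewise_d'd'' N (int n) \<C>' m' \<phi>;
         \<Delta> = current_delta N (int n - 1) (corner_complex (int n) \<C>')
                (corner_weight N (int n) \<C>' (\<lambda>\<sigma> \<omega>. m' \<sigma>) \<phi>)
     in T \<in> supercurrents N \<C> (int n) (int n) \<and>
        R \<in> supercurrents N \<C> (int n - 1) (int n - 1) \<and>
        \<Delta> \<in> supercurrents N \<C> (int n - 1) (int n - 1) \<and>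
        (\<forall>\<alpha> \<in> test_forms N \<C> (int n - 1) (int n - 1).
           current_d' N 0 1 (current_d'' N 0 0 T) \<alpha> - R \<alpha> = \<Delta> \<alpha>))"
proof (intro allI impI, goal_cases)
  case as: (1 \<C>')
  have pc: "polyhedral_complex N \<C>" and pure: "pure_dim (int n) \<C>"
    and bal: "\<forall>\<tau>\<in>cells (int n - 1) \<C>. \<forall>\<omega>\<in>\<tau>. (\<Sum>\<sigma>\<in>star_cells (int n) \<C> \<tau>. m \<sigma> *\<^sub>R normal_vector N \<sigma> \<tau>) \<in> dirs \<tau>"
    using assms(2) unfolding tropical_cycle_def by blast+
  have pc': "polyhedral_complex N \<C>'" using as unfolding subdivision_def by blast
  interpret subdiv N \<C> \<C>' "int n"
    using assms(1) pc pc' as pure by unfold_locales blast+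
  \<comment> \<open>The weights are constant, so balancing at one point of the non-empty cell gives
    the condition without a point.\<close>
  have bal': "(\<Sum>\<sigma>\<in>star_cells (int n) \<C> \<tau>. m \<sigma> *\<^sub>R normal_vector N \<sigma> \<tau>) \<in> dirs \<tau>"
    if "\<tau> \<in> cells (int n - 1) \<C>" for \<tau>
    using bal that C.cell_ne[of \<tau>] unfolding cells_def by blast
  have sm: "smooth_open \<sigma> \<phi>" if "\<sigma> \<in> \<C>'" for \<sigma>
    using as that smooth_on_poly_imp[OF D.cell_convex[OF that]] unfolding smooth_on_cells_def by blast
  interpret corner N \<C> \<C>' n \<phi> "induced_weights (int n) \<C> m"
    by unfold_locales (use sm balanced[OF bal'] in blast)+
  show ?case
    unfolding Let_def
    by (intro conjI ballI current_fun_supercurrent current_hess_supercurrent current_delta_supercurrent corner_identity)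
qed

end
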